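(* Let $(A,\bar{\mathfrak{m}})$ be a sequence-regular commutative noetherian local DG-ring with bounded cohomology, and let $\bar{a}_1,\dots,\bar{a}_n \in \bar{\mathfrak{m}}$. Then the Koszul complex $K(A;\bar{a}_1,\dots,\bar{a}_n)$ is a sequence-regular DG-ring if and only if the ideal generated by $\bar{a}_1,\dots,\bar{a}_n$ in $\mathrm{H}^0(A)$ can be generated by a subset of a regular system of parameters of $A$.
   Context: All DG-rings are unital, non-positively graded, $A=\bigoplus_{n\le 0}A^n$ with differential of degree $+1$ satisfying the graded Leibniz rule, and commutative: $ba=(-1)^{\deg(a)\deg(b)}ab$ for homogeneous $a,b$, and $a^2=0$ for $a$ of odd degree. There is a natural surjection $\pi_A^0:A^0\to \mathrm{H}^0(A)$. For a DG-module $M$, $\inf(M)=\inf\{n\mid \mathrm{H}^n(M)\neq 0\}$. $\mathsf{D}(A)$ is the derived category of DG-modules over $A$, and $\mathsf{D}^+(A)$ is its full subcategory of DG-modules with bounded below cohomology. $A$ is noetherian if $\mathrm{H}^0(A)$ is a noetherian ring and each $\mathrm{H}^i(A)$, $i<0$, is a finitely generated $\mathrm{H}^0(A)$-module. $A$ has bounded cohomology if $\mathrm{H}^i(A)=0$ for $i\ll 0$. A noetherian local DG-ring $(A,\bar{\mathfrak{m}})$ is a noetherian DG-ring such that $\mathrm{H}^0(A)$ is a local ring with maximal ideal $\bar{\mathfrak{m}}$. Koszul complex: for $\bar a_1,\dots,\bar a_n\in \mathrm{H}^0(A)$ choose lifts $a_i\in A^0$ and set $K(A;\bar a_1,\dots,\bar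 a_n)=K(A^0;a_1,\dots,a_n)\otimes_{A^0}A$, a commutative non-positive DG-ring independent of the lifts up to isomorphism in the homotopy category of DG-rings, with $\mathrm{H}^0(K(A;\bar a_1,\dots,\bar a_n))=\mathrm{H}^0(A)/(\bar a_1,\dots,\bar a_n)$; for $M\in\mathsf{D}(A)$, $K(M;\bar a_1,\dots,\bar a_n)=K(A;\bar a_1,\dots,\bar a_n)\otimes_A M$. Regular sequences: for a noetherian local DG-ring $(A,\bar{\mathfrak{m}})$ and $M\in\mathsf{D}^+(A)$, an element $\bar x\in\bar{\mathfrak{m}}$ is $M$-regular if multiplication by $\bar x$ on $\mathrm{H}^{\inf(M)}(M)$ is injective. A sequence $\bar a_1,\dots,\bar a_n\in\bar{\mathfrak{m}}$ is $M$-regular if $\bar a_1$ is $M$-regular and $\bar a_2,\dots,\bar a_n$ is $K(M;\bar a_1)$-regular. A noetherian local DG-ring $(A,\bar{\mathfrak{m}})$ with bounded cohomology is sequence-regular if $\bar{\mathfrak{m}}$ can be generated by an $A$-regular sequence. A regular system of parameters of a sequence-regular local DG-ring $(A,\bar{\mathfrak{m}})$ is a minimal generating sequence of $\bar{\mathfrak{m}}$. *)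

theory Defs
  imports "HOL-Algebra.QuotRing" "HOL-Algebra.Module" "HOL-Algebra.Ring_Divisibility"
    "HOL-Library.FuncSet"
begin

section \<open>Graded groups with a differential\<close>

text \<open>
  As for \<^typ>\<open>'a ring\<close> and \<^typ>\<open>('a, 'm) module\<close>, one record serves several structures:
  when an object is only a complex or a DG-module, its fields \<open>mult\<close> and \<open>one\<close> are unused.
  The carrier is the whole direct sum of the homogeneous parts.
\<close>

record 'a dg_ring = "'a ring" +
  homog :: "int \<Rightarrow> 'a set"
  diff :: "'a \<Rightarrow> 'a"

record ('a, 'm) dg_module = "'m dg_ring" +
  act :: "'a \<Rightarrow> 'm \<Rightarrow> 'm"

definition homog_parts :: "('m, 'x) dg_ring_scheme \<Rightarrow> 'm \<Rightarrow> (int \<Rightarrow> 'm) \<Rightarrow> bool"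
  where "homog_parts M x f \<longleftrightarrow>
    (\<forall>n. f n \<in> homog M n) \<and> finite {n. f n \<noteq> \<zero>\<^bsub>M\<^esub>} \<and>
    x = (\<Oplus>\<^bsub>M\<^esub> n \<in> {n. f n \<noteq> \<zero>\<^bsub>M\<^esub>}. f n)"

definition sgn_pow :: "('m, 'x) ring_scheme \<Rightarrow> int \<Rightarrow> 'm \<Rightarrow> 'm"
  where "sgn_pow M k x = (if even k then x else \<ominus>\<^bsub>M\<^esub> x)"

text \<open>
  The Koszul sign for moving an element across a symbol of degree \<open>k\<close> (or \<open>- k\<close>):
  the additive map that multiplies elements of degree \<open>n\<close> by \<open>(- 1) ^ (n * k)\<close>.
\<close>
definition twist :: "('m, 'x) dg_ring_scheme \<Rightarrow> int \<Rightarrow> 'm \<Rightarrow> 'm"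
  where "twist M k x =
    (let f = (THE f. homog_parts M x f)
     in \<Oplus>\<^bsub>M\<^esub> n \<in> {n. f n \<noteq> \<zero>\<^bsub>M\<^esub>}. sgn_pow M (n * k) (f n))"

locale dg_group = abelian_group M for M :: "('m, 'x) dg_ring_scheme" (structure) +
  assumes homog_subgroup: "\<And>n. additive_subgroup (homog M n) M"
    and direct_sum: "\<And>x. x \<in> carrier M \<Longrightarrow> \<exists>!f. homog_parts M x f"
    and diff_homog: "\<And>n x. x \<in> homog M n \<Longrightarrow> diff M x \<in> homog M (n + 1)"
    and diff_add: "\<And>x y. \<lbrakk>x \<in> carrier M; y \<in> carrier M\<rbrakk>
      \<Longrightarrow> diff M (x \<oplus> y) = diff M x \<oplus> diff M y"
    and diff_diff: "\<And>x. x \<in> carrier M \<Longrightarrow> diff M (diff M x) = \<zero>"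

section \<open>Commutative non-positive DG-rings and their DG-modules\<close>

locale dg_ring = dg_group A + ring A for A :: "'a dg_ring" (structure) +
  assumes nonpositive: "\<And>n. 0 < n \<Longrightarrow> homog A n = {\<zero>}"
    and one_homog: "\<one> \<in> homog A 0"
    and mult_homog: "\<And>i j x y. \<lbrakk>x \<in> homog A i; y \<in> homog A j\<rbrakk> \<Longrightarrow> x \<otimes> y \<in> homog A (i + j)"
    and leibniz: "\<And>i x y. \<lbrakk>x \<in> homog A i; y \<in> carrier A\<rbrakk>
      \<Longrightarrow> diff A (x \<otimes> y) = diff A x \<otimes> y \<oplus> sgn_pow A i (x \<otimes> diff A y)"
    and graded_comm: "\<And>i j x y. \<lbrakk>x \<in> homog A i; y \<in> homog A j\<rbrakk>
      \<Longrightarrow> y \<otimes> x = sgn_pow A (i * j) (x \<otimes> y)"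
    and odd_square: "\<And>i x. \<lbrakk>odd i; x \<in> homog A i\<rbrakk> \<Longrightarrow> x \<otimes> x = \<zero>"

locale dg_module = A?: dg_ring A + M?: dg_group M
  for A :: "'a dg_ring" (structure) and M :: "('a, 'm) dg_module" (structure) +
  assumes act_closed: "\<And>a x. \<lbrakk>a \<in> carrier A; x \<in> carrier M\<rbrakk> \<Longrightarrow> act M a x \<in> carrier M"
    and act_l_distr: "\<And>a b x. \<lbrakk>a \<in> carrier A; b \<in> carrier A; x \<in> carrier M\<rbrakk>
      \<Longrightarrow> act M (a \<oplus>\<^bsub>A\<^esub> b) x = act M a x \<oplus>\<^bsub>M\<^esub> act M b x"
    and act_r_distr: "\<And>a x y. \<lbrakk>a \<in> carrier A; x \<in> carrier M; y \<in> carrier M\<rbrakk>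
      \<Longrightarrow> act M a (x \<oplus>\<^bsub>M\<^esub> y) = act M a x \<oplus>\<^bsub>M\<^esub> act M a y"
    and act_assoc: "\<And>a b x. \<lbrakk>a \<in> carrier A; b \<in> carrier A; x \<in> carrier M\<rbrakk>
      \<Longrightarrow> act M (a \<otimes>\<^bsub>A\<^esub> b) x = act M a (act M b x)"
    and act_one: "\<And>x. x \<in> carrier M \<Longrightarrow> act M \<one>\<^bsub>A\<^esub> x = x"
    and act_homog: "\<And>i j a x. \<lbrakk>a \<in> homog A i; x \<in> homog M j\<rbrakk>
      \<Longrightarrow> act M a x \<in> homog M (i + j)"
    and act_leibniz: "\<And>i a x. \<lbrakk>a \<in> homog A i; x \<in> carrier M\<rbrakk>
      \<Longrightarrow> diff M (act M a x) = act M (diff A a) x \<oplus>\<^bsub>M\<^esub> sgn_pow M i (act M a (diff M x))"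

definition self_module :: "'a dg_ring \<Rightarrow> ('a, 'a) dg_module"
  where "self_module A =
    \<lparr>carrier = carrier A, mult = mult A, one = one A, zero = zero A, add = add A,
     homog = homog A, diff = diff A, act = mult A\<rparr>"

section \<open>Cohomology\<close>

definition cocycles :: "('m, 'x) dg_ring_scheme \<Rightarrow> int \<Rightarrow> 'm set"
  where "cocycles M n = {x \<in> homog M n. diff M x = \<zero>\<^bsub>M\<^esub>}"

definition coboundaries :: "('m, 'x) dg_ring_scheme \<Rightarrow> int \<Rightarrow> 'm set"
  where "coboundaries M n = diff M ` homog M (n - 1)"

text \<open>
  Every element of degree \<open>0\<close> of a non-positive DG-ring is a cocycle, so that \<open>H\<^sup>0(A)\<close> is the
  quotient of the ring \<open>A\<^sup>0\<close>. An element of \<open>H\<^sup>0(A)\<close> is a coset, and its lifts to \<open>A\<^sup>0\<close> are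
  the elements of that coset.
\<close>
definition H0 :: "'a dg_ring \<Rightarrow> 'a set ring"
  where "H0 A = (A\<lparr>carrier := homog A 0\<rparr>) Quot coboundaries A 0"

text \<open>The \<open>H\<^sup>0(A)\<close>-module \<open>H\<^sup>n(M)\<close>, in the style of \<^const>\<open>FactRing\<close>.\<close>
definition cohomology :: "('a, 'm) dg_module \<Rightarrow> int \<Rightarrow> ('a set, 'm set) module"
  where "cohomology M n =
    \<lparr>carrier = (\<lambda>z. coboundaries M n +>\<^bsub>M\<^esub> z) ` cocycles M n,
     mult = undefined, one = undefined,
     zero = coboundaries M n, add = set_add M,
     smult = (\<lambda>X Z. \<Union>a\<in>X. \<Union>z\<in>Z. coboundaries M n +>\<^bsub>M\<^esub> act M a z)\<rparr>"

definition cohomology_vanishes :: "('a, 'm) dg_module \<Rightarrow> int \<Rightarrow> bool"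
  where "cohomology_vanishes M n \<longleftrightarrow> carrier (cohomology M n) = {\<zero>\<^bsub>cohomology M n\<^esub>}"

definition bounded_below :: "('a, 'm) dg_module \<Rightarrow> bool"
  where "bounded_below M \<longleftrightarrow> (\<exists>N. \<forall>n<N. cohomology_vanishes M n)"

text \<open>
  The infimum of a bounded below DG-module. For an acyclic one (infimum \<open>\<infinity>\<close>) the value is
  irrelevant, because all cohomology is zero.
\<close>
definition dg_inf :: "('a, 'm) dg_module \<Rightarrow> int"
  where "dg_inf M = Inf {n. \<not> cohomology_vanishes M n}"

section \<open>Noetherian local DG-rings\<close>

definition finitely_generated_module ::
    "('a, 'x) ring_scheme \<Rightarrow> ('a, 'm, 'y) module_scheme \<Rightarrow> bool"
  where "finitely_generated_module R M \<longleftrightarrow>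
    (\<exists>S \<subseteq> carrier M. finite S \<and>
      carrier M = {(\<Oplus>\<^bsub>M\<^esub> s \<in> S. f s \<odot>\<^bsub>M\<^esub> s) | f. f \<in> S \<rightarrow> carrier R})"

definition local_ring :: "('a, 'x) ring_scheme \<Rightarrow> 'a set \<Rightarrow> bool"
  where "local_ring R \<mm> \<longleftrightarrow>
    cring R \<and> maximalideal \<mm> R \<and> (\<forall>J. maximalideal J R \<longrightarrow> J = \<mm>)"

definition noetherian_dg_ring :: "'a dg_ring \<Rightarrow> bool"
  where "noetherian_dg_ring A \<longleftrightarrow>
    dg_ring A \<and> noetherian_ring (H0 A) \<and>
    (\<forall>i<0. finitely_generated_module (H0 A) (cohomology (self_module A) i))"

definition noetherian_local_dg_ring :: "'a dg_ring \<Rightarrow> 'a set set \<Rightarrow> bool"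
  where "noetherian_local_dg_ring A \<mm> \<longleftrightarrow> noetherian_dg_ring A \<and> local_ring (H0 A) \<mm>"

definition bounded_cohomology :: "'a dg_ring \<Rightarrow> bool"
  where "bounded_cohomology A \<longleftrightarrow> bounded_below (self_module A)"

section \<open>Koszul complexes\<close>

text \<open>
  For \<open>a\<^sub>0, \<dots>, a\<^sub>n\<^sub>-\<^sub>1\<close> in \<open>A\<^sup>0\<close>, the complex \<open>K(A\<^sup>0; a)\<close> is the exterior algebra over \<open>A\<^sup>0\<close> on
  \<open>e\<^sub>0, \<dots>, e\<^sub>n\<^sub>-\<^sub>1\<close> of degree \<open>- 1\<close>, with \<open>d e\<^sub>i = a\<^sub>i\<close>. It is free on the \<open>e\<^sub>I\<close> (increasing products)
  for \<open>I \<subseteq> {..<n}\<close>. An element of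
  \<open>K(M; a) = (K(A\<^sup>0; a) \<otimes>\<^bsub>A\<^sup>0\<^esub> A) \<otimes>\<^bsub>A\<^esub> M = K(A\<^sup>0; a) \<otimes>\<^bsub>A\<^sup>0\<^esub> M\<close>
  is a sum of terms \<open>e\<^sub>I \<otimes> x\<^sub>I\<close> and is represented by the extensional function \<open>I \<mapsto> x\<^sub>I\<close>.
  The structure maps are determined by the usual sign rules:
  \<^item> \<open>d e\<^sub>J\<close> is the sum over \<open>i \<in> J\<close> of \<open>(- 1) ^ card {j \<in> J. j < i} a\<^sub>i e\<^bsub>J - {i}\<^esub>\<close>;
  \<^item> \<open>d (e\<^sub>I \<otimes> x) = d e\<^sub>I \<otimes> x + (- 1) ^ card I e\<^sub>I \<otimes> d x\<close>;
  \<^item> \<open>b (e\<^sub>I \<otimes> x) = (- 1) ^ (card I * deg b) e\<^sub>I \<otimes> b x\<close>;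
  \<^item> \<open>(e\<^sub>I \<otimes> x) (e\<^sub>J \<otimes> y) = (- 1) ^ (card J * deg x) e\<^sub>I e\<^sub>J \<otimes> x y\<close>.
\<close>
definition koszul_module ::
    "'a dg_ring \<Rightarrow> ('a, 'm) dg_module \<Rightarrow> 'a list \<Rightarrow> ('a, nat set \<Rightarrow> 'm) dg_module"
  where "koszul_module A M as = (let n = length as; P = Pow {..<n} in
    \<lparr>carrier = P \<rightarrow>\<^sub>E carrier M,
     mult = undefined, one = undefined,
     zero = (\<lambda>I\<in>P. \<zero>\<^bsub>M\<^esub>),
     add = (\<lambda>F G. \<lambda>I\<in>P. F I \<oplus>\<^bsub>M\<^esub> G I),
     homog = (\<lambda>k. {F \<in> P \<rightarrow>\<^sub>E carrier M. \<forall>I\<in>P. F I \<in> homog M (k + int (card I))}),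
     diff = (\<lambda>F. \<lambda>I\<in>P. sgn_pow M (int (card I)) (diff M (F I)) \<oplus>\<^bsub>M\<^esub>
       (\<Oplus>\<^bsub>M\<^esub> i \<in> {..<n} - I.
          sgn_pow M (int (card {j \<in> I. j < i})) (act M (as ! i) (F (insert i I))))),
     act = (\<lambda>b F. \<lambda>I\<in>P. act M (twist A (int (card I)) b) (F I))\<rparr>)"

text \<open>The sign in \<open>e\<^sub>I e\<^sub>J = (- 1) ^ koszul_sgn I J e\<^bsub>I \<union> J\<^esub>\<close> for disjoint \<open>I\<close> and \<open>J\<close>.\<close>
definition koszul_sgn :: "nat set \<Rightarrow> nat set \<Rightarrow> int"
  where "koszul_sgn I J = int (card {(i, j). i \<in> I \<and> j \<in> J \<and> j < i})"

definition koszul_ring :: "'a dg_ring \<Rightarrow> 'a list \<Rightarrow> (nat set \<Rightarrow> 'a) dg_ring"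
  where "koszul_ring A as = (let P = Pow {..<length as}; K = koszul_module A (self_module A) as in
    \<lparr>carrier = carrier K,
     mult = (\<lambda>F G. \<lambda>L\<in>P. \<Oplus>\<^bsub>A\<^esub> I \<in> Pow L.
       sgn_pow A (koszul_sgn I (L - I)) (twist A (int (card (L - I))) (F I) \<otimes>\<^bsub>A\<^esub> G (L - I))),
     one = (\<lambda>I\<in>P. if I = {} then \<one>\<^bsub>A\<^esub> else \<zero>\<^bsub>A\<^esub>),
     zero = zero K, add = add K, homog = homog K, diff = diff K\<rparr>)"

section \<open>Regular sequences\<close>

definition regular_element ::
    "'a set set \<Rightarrow> ('a, 'm) dg_module \<Rightarrow> 'a set \<Rightarrow> bool"
  where "regular_element \<mm> M x \<longleftrightarrow> x \<in> \<mm> \<and>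
    inj_on (\<lambda>z. x \<odot>\<^bsub>cohomology M (dg_inf M)\<^esub> z) (carrier (cohomology M (dg_inf M)))"

text \<open>
  The definition of a regular sequence recurses from \<open>M\<close> to \<open>K(M; a)\<close>, whose elements have another
  type. To make this recursion well-typed, \<open>M\<close> is copied into a type that is closed under the
  formation of Koszul complexes.
\<close>
datatype 'm koszul_iter = Base 'm | Node "nat set \<Rightarrow> 'm koszul_iter"

definition transport :: "('m \<Rightarrow> 'k) \<Rightarrow> ('a, 'm) dg_module \<Rightarrow> ('a, 'k) dg_module"
  where "transport f M = (let g = inv_into UNIV f in
    \<lparr>carrier = f ` carrier M, mult = undefined, one = undefined,
     zero = f \<zero>\<^bsub>M\<^esub>, add = (\<lambda>x y. f (g x \<oplus>\<^bsub>M\<^esub> g y)),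
     homog = (\<lambda>n. f ` homog M n), diff = (\<lambda>x. f (diff M (g x))),
     act = (\<lambda>a x. f (act M a (g x)))\<rparr>)"

definition lift :: "'a set \<Rightarrow> 'a"
  where "lift x = (SOME a. a \<in> x)"

fun regular_sequence_iter ::
    "'a dg_ring \<Rightarrow> 'a set set \<Rightarrow> ('a, 'm koszul_iter) dg_module \<Rightarrow> 'a set list \<Rightarrow> bool"
  where
    "regular_sequence_iter A \<mm> M [] \<longleftrightarrow> True"
  | "regular_sequence_iter A \<mm> M (x # xs) \<longleftrightarrow>
      regular_element \<mm> M x \<and>
      regular_sequence_iter A \<mm> (transport Node (koszul_module A M [lift x])) xs"

definition regular_sequence ::
    "'a dg_ring \<Rightarrow> 'a set set \<Rightarrow> ('a, 'm) dg_module \<Rightarrow> 'a set list \<Rightarrow> bool"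
  where "regular_sequence A \<mm> M xs \<longleftrightarrow>
    noetherian_local_dg_ring A \<mm> \<and> dg_module A M \<and> bounded_below M \<and>
    regular_sequence_iter A \<mm> (transport Base M) xs"

section \<open>Sequence-regular DG-rings\<close>

definition sequence_regular :: "'a dg_ring \<Rightarrow> 'a set set \<Rightarrow> bool"
  where "sequence_regular A \<mm> \<longleftrightarrow>
    noetherian_local_dg_ring A \<mm> \<and> bounded_cohomology A \<and>
    (\<exists>xs. regular_sequence A \<mm> (self_module A) xs \<and> Idl\<^bsub>H0 A\<^esub> (set xs) = \<mm>)"

text \<open>
  A generating sequence is minimal if no term can be omitted. As generated ideals are monotone,
  it is enough to omit one term at a time.
\<close>
definition regular_system_of_parameters :: "'a dg_ring \<Rightarrow> 'a set set \<Rightarrow> 'a set list \<Rightarrow> bool"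
  where "regular_system_of_parameters A \<mm> xs \<longleftrightarrow>
    sequence_regular A \<mm> \<and> set xs \<subseteq> \<mm> \<and> Idl\<^bsub>H0 A\<^esub> (set xs) = \<mm> \<and>
    (\<forall>i<length xs. Idl\<^bsub>H0 A\<^esub> (set (take i xs @ drop (Suc i) xs)) \<noteq> \<mm>)"

end

theory Submission
  imports Defs "HOL-Library.Multiset"
begin

text \<open>
  The Koszul complex on a sequence \<open>as\<close> followed by \<open>a\<close> is the cone of the multiplication by \<open>a\<close> on
  the Koszul complex on \<open>as\<close>. Let \<open>v as\<close> be the infimum of the latter. By Nakayama's lemma, appending
  \<open>a\<close> in the maximal ideal keeps \<open>v as\<close> if \<open>a\<close> is regular and lowers it by \<open>1\<close> otherwise. So \<open>as\<close> is
  regular iff \<open>v as = v []\<close>; moreover \<open>v\<close> is invariant under permutations, and \<open>v as + length as\<close> depends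
  only on the ideal \<open>J as\<close> generated by \<open>as\<close>. The Koszul ring on \<open>as\<close> is sequence-regular iff some \<open>ts\<close>
  satisfies \<open>J (as @ ts) = m\<close> and \<open>v (as @ ts) = v as\<close>.

  All minimal generating sequences of \<open>m\<close> have the same length and are therefore regular. If part of
  one of them generates \<open>J as\<close>, the rest serves as \<open>ts\<close>. Conversely, choose a shortest generating
  sequence \<open>zs @ ts'\<close> of \<open>m\<close> among the terms of \<open>as @ ts\<close>, with \<open>zs\<close> from \<open>as\<close>. As in a regular local
  ring, the quotient by \<open>zs\<close> behaves like a domain, so that a term of \<open>as\<close> outside \<open>J zs\<close> would be
  regular on the Koszul complex on \<open>zs\<close>. Counting with \<open>v\<close> excludes this, hence \<open>J zs = J as\<close>.
\<close>

section \<open>Signs and twists\<close>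

text \<open>The obstacle is that the Koszul constructions involved live in different types: the ring
  K(A; as), the iterated modules in the definition of a regular sequence over \<open>A\<close>, and
  the same iteration over K(A; as). All of them are compared degreewise, as complexes over A^0, with
  \<open>koszul_ring A xs\<close> for a single sequence \<open>xs\<close> in A^0. A regular sequence
  over K(A; as) thereby becomes a continuation \<open>as @ ts\<close>. The price is that A^0 is
  local and noetherian only after division by the ideal of coboundaries, which therefore accompanies
  every ideal. What remains is commutative algebra with one integer. If \<open>xs\<close> and
  \<open>ys\<close> generate the same ideal, every term of the second sequence in
  \<open>xs @ ys\<close> or \<open>ys @ xs\<close> is wasted, and comparing the two orders yields
  the invariance of \<open>v xs + length xs\<close>. The comparison of lengths of minimal generating
  sequences is a Steinitz exchange modulo the square of \<open>m\<close>, and regularity of single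
  elements rests on a special case of Krull's intersection theorem.\<close>

lemma (in abelian_monoid) finsum_mono_neutral:
  assumes "finite B" "A \<subseteq> B" "\<And>i. i \<in> B - A \<Longrightarrow> f i = \<zero>" "f \<in> A \<rightarrow> carrier G"
  shows "finsum G f A = finsum G f B"
proof -
  have "f \<in> B \<rightarrow> carrier G"
    using assms(3,4) by (force simp: Pi_iff)
  then show ?thesis
    using add.finprod_mono_neutral_cong_left[of B A f f] assms by auto
qed

text \<open>A plain additive map between carriers is enough, so the component maps of later
  constructions, which are not declared as group homomorphisms, commute with finite sums.\<close>

lemma additive_finsum:
  assumes M: "abelian_group M" and N: "abelian_group N"
    and closed: "\<And>x. x \<in> carrier M \<Longrightarrow> \<phi> x \<in> carrier N"
    and add: "\<And>x y. \<lbrakk>x \<in> carrier M; y \<in> carrier M\<rbrakk> \<Longrightarrow> \<phi> (x \<oplus>\<^bsub>M\<^esub> y) = \<phi> x \<oplus>\<^bsub>N\<^esub> \<phi> y"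
    and fin: "finite F" and f: "f \<in> F \<rightarrow> carrier M"
  shows "\<phi> (finsum M f F) = finsum N (\<lambda>i. \<phi> (f i)) F"
proof -
  interpret h: abelian_group_hom M N \<phi>
    by (rule abelian_group_homI[OF M N]) (auto intro!: group_hom.intro group_hom_axioms.intro
        abelian_group.a_group M N simp: hom_def closed add)
  show ?thesis
    using fin f by induct (auto simp: closed add Pi_iff)
qed

context abelian_group
begin

lemma sgn_pow_closed [simp, intro]: "x \<in> carrier G \<Longrightarrow> sgn_pow G k x \<in> carrier G"
  by (simp add: sgn_pow_def)

lemma sgn_pow_zero [simp]: "sgn_pow G k \<zero> = \<zero>"
  by (simp add: sgn_pow_def)

lemma sgn_pow_add:
  "\<lbrakk>x \<in> carrier G; y \<in> carrier G\<rbrakk> \<Longrightarrow> sgn_pow G k (x \<oplus> y) = sgn_pow G k x \<oplus> sgn_pow G k y"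
  by (simp add: sgn_pow_def minus_add)

lemma sgn_pow_sgn_pow:
  "x \<in> carrier G \<Longrightarrow> sgn_pow G k (sgn_pow G l x) = sgn_pow G (k + l) x"
  by (simp add: sgn_pow_def)

lemma sgn_pow_minus: "x \<in> carrier G \<Longrightarrow> \<ominus> (sgn_pow G k x) = sgn_pow G (k + 1) x"
  by (simp add: sgn_pow_def)

lemma sgn_pow_cong: "even (k - l) \<Longrightarrow> sgn_pow G k x = sgn_pow G l x"
  by (simp add: sgn_pow_def)

lemma sgn_pow_finsum:
  assumes "finite F" "f \<in> F \<rightarrow> carrier G"
  shows "sgn_pow G k (finsum G f F) = finsum G (\<lambda>i. sgn_pow G k (f i)) F"
  by (rule additive_finsum) (use assms in \<open>auto simp: sgn_pow_add abelian_group_axioms\<close>)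

end

lemma sgn_pow_0 [simp]: "sgn_pow M 0 x = x"
  by (simp add: sgn_pow_def)

context ring
begin

lemma sgn_pow_l_mult:
  "\<lbrakk>x \<in> carrier R; y \<in> carrier R\<rbrakk> \<Longrightarrow> sgn_pow R k x \<otimes> y = sgn_pow R k (x \<otimes> y)"
  by (simp add: sgn_pow_def l_minus)

lemma sgn_pow_r_mult:
  "\<lbrakk>x \<in> carrier R; y \<in> carrier R\<rbrakk> \<Longrightarrow> x \<otimes> sgn_pow R k y = sgn_pow R k (x \<otimes> y)"
  by (simp add: sgn_pow_def r_minus)

end

section \<open>Homogeneous decompositions, the twist and the differential\<close>

context dg_group
begin

lemma homog_carrier [simp, intro]: "x \<in> homog M n \<Longrightarrow> x \<in> carrier M"
  using additive_subgroup.a_subset[OF homog_subgroup] by blast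

lemma homog_zero [simp]: "\<zero> \<in> homog M n"
  by (rule additive_subgroup.zero_closed[OF homog_subgroup])

lemma homog_add [simp]: "\<lbrakk>x \<in> homog M n; y \<in> homog M n\<rbrakk> \<Longrightarrow> x \<oplus> y \<in> homog M n"
  by (rule additive_subgroup.a_closed[OF homog_subgroup])

lemma homog_minus [simp]: "x \<in> homog M n \<Longrightarrow> \<ominus> x \<in> homog M n"
  by (rule additive_subgroup.a_inv_closed[OF homog_subgroup])

lemma homog_sgn_pow [simp]: "x \<in> homog M n \<Longrightarrow> sgn_pow M k x \<in> homog M n"
  by (simp add: sgn_pow_def)

lemma homog_partsI:
  assumes "\<And>n. f n \<in> homog M n" "finite F" "\<And>n. n \<notin> F \<Longrightarrow> f n = \<zero>" "x = finsum M f F"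
  shows "homog_parts M x f"
proof -
  have sub: "{n. f n \<noteq> \<zero>} \<subseteq> F" using assms(3) by auto
  have "finsum M f {n. f n \<noteq> \<zero>} = finsum M f F"
    by (rule finsum_mono_neutral) (use assms sub in auto)
  then show ?thesis
    using assms sub finite_subset by (auto simp: homog_parts_def)
qed

lemma homog_partsE:
  assumes "x \<in> carrier M"
  obtains f F where "\<And>n. f n \<in> homog M n" "finite F" "\<And>n. n \<notin> F \<Longrightarrow> f n = \<zero>"
    "x = finsum M f F" "homog_parts M x f"
proof -
  obtain f where f: "homog_parts M x f" using direct_sum[OF assms] by blast
  show ?thesis
    by (rule that[of f "{n. f n \<noteq> \<zero>}"]) (use f in \<open>auto simp: homog_parts_def\<close>)
qed

text \<open>Every element is a finite sum of homogeneous ones. An identity between additive maps can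
  thus be checked in one degree at a time, where a twist is a mere sign.\<close>

lemma homog_sum_eqI:
  assumes N: "abelian_group N"
    and closed: "\<And>x. x \<in> carrier M \<Longrightarrow> \<phi> x \<in> carrier N" "\<And>x. x \<in> carrier M \<Longrightarrow> \<psi> x \<in> carrier N"
    and "\<And>x y. \<lbrakk>x \<in> carrier M; y \<in> carrier M\<rbrakk> \<Longrightarrow> \<phi> (x \<oplus> y) = \<phi> x \<oplus>\<^bsub>N\<^esub> \<phi> y"
    and "\<And>x y. \<lbrakk>x \<in> carrier M; y \<in> carrier M\<rbrakk> \<Longrightarrow> \<psi> (x \<oplus> y) = \<psi> x \<oplus>\<^bsub>N\<^esub> \<psi> y"
    and eq: "\<And>n x. x \<in> homog M n \<Longrightarrow> \<phi> x = \<psi> x"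
    and x: "x \<in> carrier M"
  shows "\<phi> x = \<psi> x"
proof -
  obtain f F where f: "\<And>n. f n \<in> homog M n" "finite F" "x = finsum M f F"
    using homog_partsE[OF x] by metis
  interpret N: abelian_group N by (rule N)
  have fc: "f n \<in> carrier M" for n using f(1) by blast
  have "\<phi> x = finsum N (\<lambda>i. \<phi> (f i)) F" "\<psi> x = finsum N (\<lambda>i. \<psi> (f i)) F"
    unfolding f(3) by (rule additive_finsum; use assms f(2) fc in \<open>auto simp: abelian_group_axioms Pi_iff\<close>)+
  then show ?thesis
    by (simp add: eq[OF f(1)])
qed

text \<open>The uniqueness of the decomposition resolves the \<open>THE\<close> in
  \<open>twist\<close>. Admitting any finite \<open>F\<close> that contains the support gives two
  elements a common index set, as additivity requires.\<close>

lemma twist_eq: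
  assumes f: "homog_parts M x f" and x: "x \<in> carrier M" and "finite F" "\<And>n. n \<notin> F \<Longrightarrow> f n = \<zero>"
  shows "twist M k x = finsum M (\<lambda>n. sgn_pow M (n * k) (f n)) F"
proof -
  have the: "(THE f. homog_parts M x f) = f"
    using direct_sum[OF x] f by (intro the_equality) auto
  have "f n \<in> homog M n" for n using f by (simp add: homog_parts_def)
  then show ?thesis
    unfolding twist_def the Let_def
    by (intro finsum_mono_neutral) (use assms in auto)
qed

lemma twist_homog:
  assumes "x \<in> homog M n"
  shows "twist M k x = sgn_pow M (n * k) x"
proof -
  define f where "f = (\<lambda>m. if m = n then x else \<zero>)"
  have parts: "homog_parts M x f"
    by (rule homog_partsI[of _ "{n}"]) (use assms in \<open>auto simp: f_def\<close>)
  show ?thesis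
    by (subst twist_eq[OF parts, of "{n}"]) (use assms in \<open>auto simp: f_def\<close>)
qed

lemma twist_closed [simp, intro]:
  assumes "x \<in> carrier M"
  shows "twist M k x \<in> carrier M"
proof -
  obtain f F where f: "\<And>n. f n \<in> homog M n" "finite F" "\<And>n. n \<notin> F \<Longrightarrow> f n = \<zero>" "homog_parts M x f"
    using homog_partsE[OF assms] by metis
  show ?thesis
    by (subst twist_eq[OF f(4) assms f(2,3)]) (use f in \<open>auto intro!: finsum_closed\<close>)
qed

lemma twist_add:
  assumes x: "x \<in> carrier M" and y: "y \<in> carrier M"
  shows "twist M k (x \<oplus> y) = twist M k x \<oplus> twist M k y"
proof -
  obtain f F where f: "\<And>n. f n \<in> homog M n" "finite F" "\<And>n. n \<notin> F \<Longrightarrow> f n = \<zero>"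
    "x = finsum M f F" "homog_parts M x f"
    using homog_partsE[OF x] by metis
  obtain g G where g: "\<And>n. g n \<in> homog M n" "finite G" "\<And>n. n \<notin> G \<Longrightarrow> g n = \<zero>"
    "y = finsum M g G" "homog_parts M y g"
    using homog_partsE[OF y] by metis
  let ?H = "F \<union> G"
  have c: "f n \<in> carrier M" "g n \<in> carrier M" for n using f(1) g(1) by blast+
  have "finsum M f F = finsum M f ?H" "finsum M g G = finsum M g ?H"
    by (rule finsum_mono_neutral; use f(1-3) g(1-3) in auto)+
  then have "x \<oplus> y = finsum M (\<lambda>n. f n \<oplus> g n) ?H"
    using f(1) g(1) unfolding f(4) g(4) by (subst finsum_addf) auto
  then have h: "homog_parts M (x \<oplus> y) (\<lambda>n. f n \<oplus> g n)"
    by (intro homog_partsI[of _ ?H]) (use f g in auto)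
  have "twist M k (x \<oplus> y) = finsum M (\<lambda>n. sgn_pow M (n * k) (f n \<oplus> g n)) ?H"
    by (rule twist_eq[OF h]) (use x y f g in auto)
  also have "\<dots> = finsum M (\<lambda>n. sgn_pow M (n * k) (f n) \<oplus> sgn_pow M (n * k) (g n)) ?H"
    using c by (intro finsum_cong') (auto simp: sgn_pow_add)
  also have "\<dots> = finsum M (\<lambda>n. sgn_pow M (n * k) (f n)) ?H \<oplus> finsum M (\<lambda>n. sgn_pow M (n * k) (g n)) ?H"
    using c by (subst finsum_addf) auto
  also have "\<dots> = twist M k x \<oplus> twist M k y"
    by (subst (1 2) twist_eq[of _ _ ?H]) (use x y f g in auto)
  finally show ?thesis .
qed

text \<open>With this characterization the decomposition need not be unfolded again: composed twists
  and the twist of a Koszul ring are recognized by their values in each degree.\<close>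

lemma twist_unique:
  assumes "\<And>x. x \<in> carrier M \<Longrightarrow> \<phi> x \<in> carrier M"
    and "\<And>x y. \<lbrakk>x \<in> carrier M; y \<in> carrier M\<rbrakk> \<Longrightarrow> \<phi> (x \<oplus> y) = \<phi> x \<oplus> \<phi> y"
    and "\<And>n x. x \<in> homog M n \<Longrightarrow> \<phi> x = sgn_pow M (n * k) x"
    and "x \<in> carrier M"
  shows "twist M k x = \<phi> x"
  by (rule homog_sum_eqI[of M]) (use assms in \<open>auto simp: twist_add twist_homog abelian_group_axioms\<close>)

lemma twist_zero [simp]: "twist M k \<zero> = \<zero>"
  using twist_homog[of \<zero> 0 k] by simp

lemma twist_0 [simp]: "x \<in> carrier M \<Longrightarrow> twist M 0 x = x"
  by (rule twist_unique) auto

lemma twist_mem_homog [simp]: "x \<in> homog M n \<Longrightarrow> twist M k x \<in> homog M n"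
  by (simp add: twist_homog)

lemma twist_minus:
  assumes "x \<in> carrier M" shows "twist M k (\<ominus> x) = \<ominus> twist M k x"
proof (rule sym, rule minus_equality)
  show "twist M k (\<ominus> x) \<oplus> twist M k x = \<zero>"
    using assms by (simp flip: twist_add add: l_neg)
qed (use assms in auto)

lemma twist_sgn_pow: "x \<in> carrier M \<Longrightarrow> twist M k (sgn_pow M l x) = sgn_pow M l (twist M k x)"
  by (simp add: sgn_pow_def twist_minus)

lemma twist_twist:
  assumes "x \<in> carrier M" shows "twist M k (twist M l x) = twist M (k + l) x"
  by (rule twist_unique[symmetric])
    (use assms in \<open>auto simp: twist_add twist_homog twist_homog[OF homog_sgn_pow] sgn_pow_sgn_pow
      algebra_simps\<close>)

lemma diff_mem_homog: "\<lbrakk>x \<in> homog M n; m = n + 1\<rbrakk> \<Longrightarrow> diff M x \<in> homog M m"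
  by (simp add: diff_homog)

lemma diff_zero [simp]: "diff M \<zero> = \<zero>"
proof -
  have "diff M \<zero> \<in> carrier M" using diff_homog[of \<zero> 0] by simp
  moreover have "diff M \<zero> \<oplus> diff M \<zero> = diff M \<zero>" using diff_add[of \<zero> \<zero>] by simp
  ultimately show ?thesis by (metis add.l_cancel_one')
qed

lemma diff_finsum:
  assumes "finite F" "\<And>i. i \<in> F \<Longrightarrow> f i \<in> homog M (d i)"
  shows "diff M (finsum M f F) = finsum M (\<lambda>i. diff M (f i)) F"
  using assms
proof (induct)
  case (insert i F)
  have "diff M (f i) \<in> carrier M" "\<And>j. j \<in> F \<Longrightarrow> diff M (f j) \<in> carrier M"
    using insert diff_homog by (meson homog_carrier insertCI)+
  moreover have "f i \<in> carrier M" "finsum M f F \<in> carrier M"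
    using insert(4) by (auto intro!: finsum_closed intro: homog_carrier)
  moreover have "f \<in> F \<rightarrow> carrier M" using insert by auto
  ultimately show ?case
    using insert by (auto simp: Pi_iff diff_add)
qed simp

text \<open>The assumptions give closure only on homogeneous elements; the general case goes through
  the decomposition and \<open>diff_finsum\<close>.\<close>

lemma diff_closed [simp, intro]:
  assumes "x \<in> carrier M" shows "diff M x \<in> carrier M"
proof -
  obtain f F where f: "\<And>n. f n \<in> homog M n" "finite F" "x = finsum M f F"
    using homog_partsE[OF assms] by metis
  have "diff M (f n) \<in> carrier M" for n using f(1) diff_homog homog_carrier by blast
  then show ?thesis unfolding f(3) by (subst diff_finsum) (use f in auto)
qed

lemma diff_minus: "x \<in> carrier M \<Longrightarrow> diff M (\<ominus> x) = \<ominus> diff M x"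
  by (rule minus_equality[symmetric]) (auto simp: l_neg simp flip: diff_add)

lemma diff_sgn_pow: "x \<in> carrier M \<Longrightarrow> diff M (sgn_pow M k x) = sgn_pow M k (diff M x)"
  by (simp add: sgn_pow_def diff_minus)

end

context dg_ring
begin

text \<open>Signs multiply because degrees add. The reduction to homogeneous factors is made twice,
  once in each variable.\<close>

lemma twist_mult:
  assumes "x \<in> carrier A" "y \<in> carrier A"
  shows "twist A k (x \<otimes> y) = twist A k x \<otimes> twist A k y"
proof -
  have hom: "twist A k (x \<otimes> y) = twist A k x \<otimes> twist A k y" if x: "x \<in> homog A i" and y: "y \<in> carrier A" for i x y
  proof (rule homog_sum_eqI[of A, OF _ _ _ _ _ _ y])
    fix j y assume "y \<in> homog A j"
    with x show "twist A k (x \<otimes> y) = twist A k x \<otimes> twist A k y"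
      by (simp add: twist_homog[OF x] twist_homog[of y j] twist_homog[OF mult_homog[OF x]]
          homog_carrier[OF x] homog_carrier[of y j] sgn_pow_l_mult sgn_pow_r_mult sgn_pow_sgn_pow distrib_right add.commute)
  qed (use x in \<open>auto simp: twist_add r_distr abelian_group_axioms\<close>)
  show ?thesis
    by (rule homog_sum_eqI[of A, OF _ _ _ _ _ _ assms(1)])
      (use assms hom in \<open>auto simp: twist_add l_distr abelian_group_axioms\<close>)
qed

lemma twist_one [simp]: "twist A k \<one> = \<one>"
  using one_homog by (simp add: twist_homog)

lemma degree_zero_central:
  assumes "a \<in> homog A 0" "x \<in> carrier A"
  shows "a \<otimes> x = x \<otimes> a"
proof (rule homog_sum_eqI[of A, OF _ _ _ _ _ _ assms(2)])
  fix n x assume "x \<in> homog A n"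
  then show "a \<otimes> x = x \<otimes> a" using graded_comm[of x n a 0] assms(1) by simp
qed (use assms in \<open>auto simp: l_distr r_distr abelian_group_axioms\<close>)

lemma diff_degree_zero: "a \<in> homog A 0 \<Longrightarrow> diff A a = \<zero>"
  using diff_homog[of a 0] nonpositive[of 1] by simp

lemma diff_one [simp]: "diff A \<one> = \<zero>"
  by (simp add: diff_degree_zero one_homog)

lemma diff_act_degree_zero:
  assumes "a \<in> homog A 0" "x \<in> carrier A"
  shows "diff A (a \<otimes> x) = a \<otimes> diff A x"
  using assms by (simp add: leibniz diff_degree_zero)

lemma mult_mem_homog: "\<lbrakk>x \<in> homog A i; y \<in> homog A j; k = i + j\<rbrakk> \<Longrightarrow> x \<otimes> y \<in> homog A k"
  by (simp add: mult_homog)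

end

section \<open>Adjoining one exterior variable\<close>

text \<open>\<open>C\<close> is a direct sum of two copies of \<open>B\<close> with projections
  \<open>p\<close>, \<open>q\<close> and pairing \<open>j\<close>. Only the additive structure is
  fixed here, so that the locale serves both the extension of a DG-ring and the cone of a complex;
  the group laws of \<open>C\<close> are inherited componentwise.\<close>

locale pair_group = B: abelian_group B for B :: "('b, 'x) ring_scheme" +
  fixes C :: "('c, 'y) ring_scheme" and p q :: "'c \<Rightarrow> 'b" and j :: "'b \<Rightarrow> 'b \<Rightarrow> 'c"
  assumes p_closed [simp]: "z \<in> carrier C \<Longrightarrow> p z \<in> carrier B"
    and q_closed [simp]: "z \<in> carrier C \<Longrightarrow> q z \<in> carrier B"
    and j_closed [simp]: "\<lbrakk>u \<in> carrier B; v \<in> carrier B\<rbrakk> \<Longrightarrow> j u v \<in> carrier C"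
    and p_j [simp]: "\<lbrakk>u \<in> carrier B; v \<in> carrier B\<rbrakk> \<Longrightarrow> p (j u v) = u"
    and q_j [simp]: "\<lbrakk>u \<in> carrier B; v \<in> carrier B\<rbrakk> \<Longrightarrow> q (j u v) = v"
    and j_p_q: "z \<in> carrier C \<Longrightarrow> j (p z) (q z) = z"
    and add_closed [simp]: "\<lbrakk>z \<in> carrier C; w \<in> carrier C\<rbrakk> \<Longrightarrow> z \<oplus>\<^bsub>C\<^esub> w \<in> carrier C"
    and p_add [simp]: "\<lbrakk>z \<in> carrier C; w \<in> carrier C\<rbrakk> \<Longrightarrow> p (z \<oplus>\<^bsub>C\<^esub> w) = p z \<oplus>\<^bsub>B\<^esub> p w"
    and q_add [simp]: "\<lbrakk>z \<in> carrier C; w \<in> carrier C\<rbrakk> \<Longrightarrow> q (z \<oplus>\<^bsub>C\<^esub> w) = q z \<oplus>\<^bsub>B\<^esub> q w"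
    and zero_closed [simp]: "\<zero>\<^bsub>C\<^esub> \<in> carrier C"
    and p_zero [simp]: "p \<zero>\<^bsub>C\<^esub> = \<zero>\<^bsub>B\<^esub>" and q_zero [simp]: "q \<zero>\<^bsub>C\<^esub> = \<zero>\<^bsub>B\<^esub>"
begin

lemma eqI: "\<lbrakk>z \<in> carrier C; w \<in> carrier C; p z = p w; q z = q w\<rbrakk> \<Longrightarrow> z = w"
  by (metis j_p_q)

sublocale C: abelian_group C
proof (rule abelian_groupI)
  fix z assume z: "z \<in> carrier C"
  show "\<exists>w\<in>carrier C. w \<oplus>\<^bsub>C\<^esub> z = \<zero>\<^bsub>C\<^esub>"
    by (rule bexI[of _ "j (\<ominus>\<^bsub>B\<^esub> p z) (\<ominus>\<^bsub>B\<^esub> q z)"]) (use z in \<open>auto intro!: eqI simp: B.l_neg\<close>)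
qed (auto intro!: eqI simp: B.a_ac)

lemma p_minus [simp]: "z \<in> carrier C \<Longrightarrow> p (\<ominus>\<^bsub>C\<^esub> z) = \<ominus>\<^bsub>B\<^esub> p z"
  by (rule B.minus_equality[symmetric]) (auto simp: C.l_neg simp flip: p_add)

lemma q_minus [simp]: "z \<in> carrier C \<Longrightarrow> q (\<ominus>\<^bsub>C\<^esub> z) = \<ominus>\<^bsub>B\<^esub> q z"
  by (rule B.minus_equality[symmetric]) (auto simp: C.l_neg simp flip: q_add)

lemma p_sgn_pow [simp]: "z \<in> carrier C \<Longrightarrow> p (sgn_pow C k z) = sgn_pow B k (p z)"
  by (simp add: sgn_pow_def)

lemma q_sgn_pow [simp]: "z \<in> carrier C \<Longrightarrow> q (sgn_pow C k z) = sgn_pow B k (q z)"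
  by (simp add: sgn_pow_def)

end

text \<open>An element \<open>z\<close> stands for \<open>p z + e q z\<close> with a new variable
  \<open>e\<close> of degree - 1 and \<open>d e = a\<close>. Moving \<open>e\<close> to the left
  past \<open>p z\<close> produces \<open>twist B 1\<close>, a product of two terms with
  \<open>e\<close> vanishes since \<open>e\<close> squares to 0, and
  \<open>d (e u) = a u - e (d u)\<close> explains the components of \<open>diff C\<close>.\<close>

locale exterior_extension = B: dg_ring B + pair_group B C p q j
  for B :: "'b dg_ring" and C :: "'c dg_ring" and p q :: "'c \<Rightarrow> 'b" and j :: "'b \<Rightarrow> 'b \<Rightarrow> 'c" +
  fixes a :: 'b
  assumes a: "a \<in> homog B 0"
    and one_closed [simp]: "\<one>\<^bsub>C\<^esub> \<in> carrier C"
    and p_one [simp]: "p \<one>\<^bsub>C\<^esub> = \<one>\<^bsub>B\<^esub>" and q_one [simp]: "q \<one>\<^bsub>C\<^esub> = \<zero>\<^bsub>B\<^esub>"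
    and mult_closed [simp]: "\<lbrakk>z \<in> carrier C; w \<in> carrier C\<rbrakk> \<Longrightarrow> z \<otimes>\<^bsub>C\<^esub> w \<in> carrier C"
    and p_mult [simp]: "\<lbrakk>z \<in> carrier C; w \<in> carrier C\<rbrakk> \<Longrightarrow> p (z \<otimes>\<^bsub>C\<^esub> w) = p z \<otimes>\<^bsub>B\<^esub> p w"
    and q_mult [simp]: "\<lbrakk>z \<in> carrier C; w \<in> carrier C\<rbrakk>
      \<Longrightarrow> q (z \<otimes>\<^bsub>C\<^esub> w) = q z \<otimes>\<^bsub>B\<^esub> p w \<oplus>\<^bsub>B\<^esub> twist B 1 (p z) \<otimes>\<^bsub>B\<^esub> q w"
    and homog_eq: "homog C n = {z \<in> carrier C. p z \<in> homog B n \<and> q z \<in> homog B (n + 1)}"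
    and d_closed [simp]: "z \<in> carrier C \<Longrightarrow> diff C z \<in> carrier C"
    and p_diff [simp]: "z \<in> carrier C \<Longrightarrow> p (diff C z) = diff B (p z) \<oplus>\<^bsub>B\<^esub> a \<otimes>\<^bsub>B\<^esub> q z"
    and q_diff [simp]: "z \<in> carrier C \<Longrightarrow> q (diff C z) = \<ominus>\<^bsub>B\<^esub> diff B (q z)"
begin

lemma a_carrier [simp]: "a \<in> carrier B" using a by simp

lemma ring_C: "ring C"
proof (rule ringI)
  show "monoid C"
    by (rule monoidI)
      (auto intro!: eqI simp: B.m_assoc B.l_distr B.r_distr B.twist_mult B.a_assoc)
qed (auto intro!: eqI C.abelian_group_axioms simp: B.l_distr B.r_distr B.twist_add B.a_ac)

sublocale C: ring C by (rule ring_C)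

text \<open>Since \<open>e\<close> has degree - 1, the part of \<open>z\<close> in degree
  \<open>n\<close> contributes to \<open>q z\<close> in degree \<open>n + 1\<close>; hence the shift
  of the index.\<close>

lemma homog_parts_components:
  assumes "homog_parts C z h"
  shows "homog_parts B (p z) (\<lambda>n. p (h n))" "homog_parts B (q z) (\<lambda>n. q (h (n - 1)))"
proof -
  let ?F = "{n. h n \<noteq> \<zero>\<^bsub>C\<^esub>}"
  have fin: "finite ?F" and z: "z = finsum C h ?F" and h: "h n \<in> homog C n" for n
    using assms by (auto simp: homog_parts_def)
  have hc: "h n \<in> carrier C" "p (h n) \<in> homog B n" "q (h n) \<in> homog B (n + 1)" for n
    using h[of n] by (auto simp: homog_eq)
  have qh: "q (h (n - 1)) \<in> homog B n" for n using hc(3)[of "n - 1"] by simp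
  show "homog_parts B (p z) (\<lambda>n. p (h n))"
  proof (rule B.homog_partsI[OF _ fin])
    show "p z = finsum B (\<lambda>n. p (h n)) ?F"
      unfolding z by (rule additive_finsum)
        (use fin hc in \<open>auto simp: C.abelian_group_axioms B.abelian_group_axioms\<close>)
  qed (use hc in auto)
  have "q z = finsum B (\<lambda>n. q (h n)) ?F"
    unfolding z by (rule additive_finsum)
      (use fin hc in \<open>auto simp: C.abelian_group_axioms B.abelian_group_axioms\<close>)
  also have "\<dots> = finsum B (\<lambda>n. q (h (n - 1))) ((\<lambda>n. n + 1) ` ?F)"
    by (subst B.finsum_reindex) (use hc(1) in \<open>auto simp: inj_on_def\<close>)
  finally show "homog_parts B (q z) (\<lambda>n. q (h (n - 1)))"
    by (intro B.homog_partsI[of _ "(\<lambda>n. n + 1) ` ?F"]) (use fin qh in \<open>auto simp: image_iff\<close>,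
        metis diff_add_cancel q_zero)
qed

text \<open>Existence pairs the part of \<open>p z\<close> in degree \<open>n\<close> with that of
  \<open>q z\<close> in degree \<open>n + 1\<close>; uniqueness holds in each component by
  \<open>homog_parts_components\<close>.\<close>

lemma ex1_homog_parts:
  assumes z: "z \<in> carrier C"
  shows "\<exists>!h. homog_parts C z h"
proof -
  obtain f F where f: "\<And>n. f n \<in> homog B n" "finite F" "\<And>n. n \<notin> F \<Longrightarrow> f n = \<zero>\<^bsub>B\<^esub>" "p z = finsum B f F"
    using B.homog_partsE[OF p_closed[OF z]] by metis
  obtain g G where g: "\<And>n. g n \<in> homog B n" "finite G" "\<And>n. n \<notin> G \<Longrightarrow> g n = \<zero>\<^bsub>B\<^esub>" "q z = finsum B g G"
    using B.homog_partsE[OF q_closed[OF z]] by metis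
  have c [simp]: "f n \<in> carrier B" "g n \<in> carrier B" for n using f(1) g(1) by blast+
  define h where "h n = j (f n) (g (n + 1))" for n
  have h [simp]: "h n \<in> carrier C" "p (h n) = f n" "q (h n) = g (n + 1)" for n
    by (auto simp: h_def)
  let ?H = "F \<union> (\<lambda>n. n - 1) ` G"
  have H: "finite ?H" using f g by auto
  have h0: "n \<notin> ?H \<Longrightarrow> h n = \<zero>\<^bsub>C\<^esub>" for n
    using f(3)[of n] g(3)[of "n + 1"] by (intro eqI) (force simp: image_iff)+
  have zh: "z = finsum C h ?H"
  proof (rule eqI[OF z])
    have "p (finsum C h ?H) = finsum B f ?H"
      by (subst additive_finsum[of C B p]) (use H in \<open>auto simp: C.abelian_group_axioms B.abelian_group_axioms\<close>)
    also have "\<dots> = finsum B f F"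
      by (rule B.finsum_mono_neutral[symmetric]) (use f(3) H in auto)
    finally show "p z = p (finsum C h ?H)" using f by simp
    have "q (finsum C h ?H) = finsum B (\<lambda>n. g (n + 1)) ?H"
      by (subst additive_finsum[of C B q]) (use H in \<open>auto simp: C.abelian_group_axioms B.abelian_group_axioms\<close>)
    also have "\<dots> = finsum B g ((\<lambda>n. n + 1) ` ?H)"
      by (rule B.finsum_reindex[symmetric]) (auto simp: inj_on_def)
    also have "\<dots> = finsum B g G"
      by (rule B.finsum_mono_neutral[symmetric]) (use g(2,3) f(2) in \<open>auto simp: image_Un image_image\<close>)
    finally show "q z = q (finsum C h ?H)" using g by simp
  qed (auto intro!: C.finsum_closed)
  have hh: "h n \<in> homog C n" for n using f(1) g(1) by (simp add: homog_eq)
  have nz: "finite {n. h n \<noteq> \<zero>\<^bsub>C\<^esub>}" "{n. h n \<noteq> \<zero>\<^bsub>C\<^esub>} \<subseteq> ?H"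
    using H h0 by (auto intro: finite_subset[OF _ H])
  have "finsum C h {n. h n \<noteq> \<zero>\<^bsub>C\<^esub>} = finsum C h ?H"
    by (rule C.finsum_mono_neutral) (use nz H in auto)
  then have ex: "homog_parts C z h"
    using nz hh zh by (simp add: homog_parts_def)
  show ?thesis
  proof (rule ex1I[of _ h])
    show "homog_parts C z h" by (rule ex)
    fix h' assume h': "homog_parts C z h'"
    then have hc: "h' n \<in> carrier C" for n by (auto simp: homog_parts_def homog_eq)
    have "(\<lambda>n. p (h' n)) = (\<lambda>n. p (h n))"
      using B.direct_sum[OF p_closed[OF z]] homog_parts_components(1)[OF h']
        homog_parts_components(1)[OF ex] by blast
    moreover have "(\<lambda>n. q (h' (n - 1))) = (\<lambda>n. q (h (n - 1)))"
      using B.direct_sum[OF q_closed[OF z]] homog_parts_components(2)[OF h']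
        homog_parts_components(2)[OF ex] by blast
    then have "q (h' n) = q (h n)" for n by (metis add_diff_cancel_right')
    ultimately show "h' = h"
      by (intro ext eqI hc) (auto dest: fun_cong)
  qed
qed

text \<open>The twists become the signs of the degrees \<open>i\<close> of \<open>p z\<close> and
  \<open>i + 1\<close> of \<open>p (diff C z)\<close>. As \<open>a\<close> is central, the two terms
  containing \<open>a\<close> in the \<open>q\<close>-component then carry opposite signs and
  cancel.\<close>

lemma homog_leibniz:
  assumes z: "z \<in> homog C i" and w: "w \<in> carrier C"
  shows "diff C (z \<otimes>\<^bsub>C\<^esub> w) = diff C z \<otimes>\<^bsub>C\<^esub> w \<oplus>\<^bsub>C\<^esub> sgn_pow C i (z \<otimes>\<^bsub>C\<^esub> diff C w)"
proof -
  note [simp] = w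
  have zc [simp]: "z \<in> carrier C" and pz: "p z \<in> homog B i" and qz: "q z \<in> homog B (i + 1)"
    using z by (auto simp: homog_eq)
  have pdz: "p (diff C z) \<in> homog B (i + 1)"
    using pz qz a by (auto simp: B.diff_mem_homog intro!: B.homog_add B.mult_mem_homog)
  have tw: "twist B 1 (p z) = sgn_pow B i (p z)" using B.twist_homog[OF pz] by simp
  have tw': "twist B 1 (p (diff C z)) = sgn_pow B (i + 1) (p (diff C z))"
    using B.twist_homog[OF pdz] by simp
  have comm: "p z \<otimes>\<^bsub>B\<^esub> (a \<otimes>\<^bsub>B\<^esub> q w) = a \<otimes>\<^bsub>B\<^esub> (p z \<otimes>\<^bsub>B\<^esub> q w)"
    using B.degree_zero_central[OF a, of "p z"] by (simp flip: B.m_assoc)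
  have comm': "q z \<otimes>\<^bsub>B\<^esub> (a \<otimes>\<^bsub>B\<^esub> q w) = a \<otimes>\<^bsub>B\<^esub> (q z \<otimes>\<^bsub>B\<^esub> q w)"
    using B.degree_zero_central[OF a, of "q z"] by (simp flip: B.m_assoc)
  show ?thesis
  proof (rule eqI)
    show "p (diff C (z \<otimes>\<^bsub>C\<^esub> w)) = p (diff C z \<otimes>\<^bsub>C\<^esub> w \<oplus>\<^bsub>C\<^esub> sgn_pow C i (z \<otimes>\<^bsub>C\<^esub> diff C w))"
      by (simp add: tw B.leibniz[OF pz] B.l_distr B.r_distr B.sgn_pow_l_mult B.sgn_pow_r_mult
          B.sgn_pow_add comm B.m_assoc B.a_ac)
    show "q (diff C (z \<otimes>\<^bsub>C\<^esub> w)) = q (diff C z \<otimes>\<^bsub>C\<^esub> w \<oplus>\<^bsub>C\<^esub> sgn_pow C i (z \<otimes>\<^bsub>C\<^esub> diff C w))"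
      unfolding q_diff[OF mult_closed[OF zc w]] q_mult[OF zc w] q_add[OF mult_closed[OF d_closed[OF zc] w] C.sgn_pow_closed[OF mult_closed[OF zc d_closed[OF w]]]]
        q_sgn_pow[OF mult_closed[OF zc d_closed[OF w]]] q_mult[OF d_closed[OF zc] w] q_mult[OF zc d_closed[OF w]] tw tw'
      by (simp add: B.leibniz[OF pz] B.leibniz[OF qz] B.diff_add B.diff_sgn_pow B.l_distr B.r_distr
          B.sgn_pow_l_mult B.sgn_pow_r_mult B.sgn_pow_add B.m_assoc B.minus_add comm'
          B.sgn_pow_minus B.sgn_pow_sgn_pow B.l_minus B.r_minus)
        (auto simp: sgn_pow_def B.minus_add B.r_minus B.l_minus B.a_ac B.r_neg1 B.r_neg2 B.r_neg)
  qed auto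
qed

theorem dg_ring_C: "dg_ring C"
proof (intro dg_ring.intro dg_group.intro ring_C dg_group_axioms.intro dg_ring_axioms.intro)
  show "abelian_group C" by (rule C.abelian_group_axioms)
  show "additive_subgroup (homog C n) C" for n
  proof (rule additive_subgroupI, rule C.add.subgroupI)
    show "homog C n \<noteq> {}" by (auto simp: homog_eq intro!: exI[of _ "\<zero>\<^bsub>C\<^esub>"])
  qed (auto simp: homog_eq simp flip: a_inv_def)
  show "\<exists>!f. homog_parts C x f" if "x \<in> carrier C" for x by (rule ex1_homog_parts[OF that])
  show "diff C x \<in> homog C (n + 1)" if "x \<in> homog C n" for n x
    using that a by (auto simp: homog_eq B.diff_mem_homog intro!: B.homog_add B.homog_minus B.mult_mem_homog)
  show "diff C (x \<oplus>\<^bsub>C\<^esub> y) = diff C x \<oplus>\<^bsub>C\<^esub> diff C y" if "x \<in> carrier C" "y \<in> carrier C" for x y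
    using that by (intro eqI) (auto simp: B.diff_add B.r_distr B.minus_add B.a_ac)
  show "diff C (diff C x) = \<zero>\<^bsub>C\<^esub>" if "x \<in> carrier C" for x
    using that a by (intro eqI)
      (auto simp: B.diff_add B.diff_diff B.diff_minus B.diff_act_degree_zero B.r_minus B.r_neg)
  show "homog C n = {\<zero>\<^bsub>C\<^esub>}" if "0 < n" for n
    using that by (auto simp: homog_eq B.nonpositive intro: eqI)
  show "\<one>\<^bsub>C\<^esub> \<in> homog C 0" by (simp add: homog_eq B.one_homog)
  show "x \<otimes>\<^bsub>C\<^esub> y \<in> homog C (i + k)" if "x \<in> homog C i" "y \<in> homog C k" for i k x y
    using that by (auto simp: homog_eq intro!: B.homog_add B.mult_mem_homog)
  show "diff C (x \<otimes>\<^bsub>C\<^esub> y) = diff C x \<otimes>\<^bsub>C\<^esub> y \<oplus>\<^bsub>C\<^esub> sgn_pow C i (x \<otimes>\<^bsub>C\<^esub> diff C y)"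
    if "x \<in> homog C i" "y \<in> carrier C" for i x y
    using that by (rule homog_leibniz)
  show "y \<otimes>\<^bsub>C\<^esub> x = sgn_pow C (i * k) (x \<otimes>\<^bsub>C\<^esub> y)" if "x \<in> homog C i" "y \<in> homog C k" for i k x y
  proof -
    have c [simp]: "x \<in> carrier C" "y \<in> carrier C" and px: "p x \<in> homog B i" "q x \<in> homog B (i + 1)"
      and py: "p y \<in> homog B k" "q y \<in> homog B (k + 1)"
      using that by (auto simp: homog_eq)
    show ?thesis
    proof (rule eqI)
      show "p (y \<otimes>\<^bsub>C\<^esub> x) = p (sgn_pow C (i * k) (x \<otimes>\<^bsub>C\<^esub> y))"
        using B.graded_comm[OF px(1) py(1)] by simp
      show "q (y \<otimes>\<^bsub>C\<^esub> x) = q (sgn_pow C (i * k) (x \<otimes>\<^bsub>C\<^esub> y))"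
        by (simp add: B.twist_homog[OF px(1)] B.twist_homog[OF py(1)] B.graded_comm[OF px(1) py(2)]
            B.graded_comm[OF px(2) py(1)] B.sgn_pow_l_mult B.sgn_pow_add B.sgn_pow_sgn_pow)
          (auto simp: sgn_pow_def B.a_ac)
    qed auto
  qed
  show "x \<otimes>\<^bsub>C\<^esub> x = \<zero>\<^bsub>C\<^esub>" if "odd i" "x \<in> homog C i" for i x
  proof -
    have c [simp]: "x \<in> carrier C" and px: "p x \<in> homog B i" "q x \<in> homog B (i + 1)"
      using that by (auto simp: homog_eq)
    show ?thesis
      \<comment> \<open>In the \<open>q\<close>-component, \<open>p x\<close> and \<open>q x\<close>
        commute because \<open>i * (i + 1)\<close> is even, while the twist of \<open>p x\<close>
        has an odd sign; the two products cancel.\<close>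
      by (rule eqI) (use that(1) px in \<open>auto simp: B.odd_square B.twist_homog[OF px(1)] B.sgn_pow_l_mult
         B.graded_comm[OF px] sgn_pow_def B.r_neg B.l_minus\<close>)
  qed
qed

end

section \<open>Koszul rings\<close>

lemma a_inv_self_module: "\<ominus>\<^bsub>self_module A\<^esub> x = \<ominus>\<^bsub>A\<^esub> x"
  by (simp add: a_inv_def m_inv_def self_module_def)

lemma sgn_pow_self_module: "sgn_pow (self_module A) k x = sgn_pow A k x"
  by (simp add: sgn_pow_def a_inv_self_module)

lemma finsum_self_module: "finsum (self_module A) f S = finsum A f S"
  by (simp add: finsum_def finprod_def self_module_def)

lemma self_module_simps [simp]:
  "carrier (self_module A) = carrier A" "zero (self_module A) = zero A" "add (self_module A) = add A"
  "homog (self_module A) = homog A" "diff (self_module A) = diff A" "act (self_module A) = mult A"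
  by (simp_all add: self_module_def)

lemma koszul_ring_carrier: "carrier (koszul_ring A as) = Pow {..<length as} \<rightarrow>\<^sub>E carrier A"
  by (simp add: koszul_ring_def koszul_module_def Let_def)

lemma koszul_ring_zero: "\<zero>\<^bsub>koszul_ring A as\<^esub> = (\<lambda>I\<in>Pow {..<length as}. \<zero>\<^bsub>A\<^esub>)"
  by (simp add: koszul_ring_def koszul_module_def Let_def)

lemma koszul_ring_one:
  "\<one>\<^bsub>koszul_ring A as\<^esub> = (\<lambda>I\<in>Pow {..<length as}. if I = {} then \<one>\<^bsub>A\<^esub> else \<zero>\<^bsub>A\<^esub>)"
  by (simp add: koszul_ring_def Let_def)

lemma koszul_ring_add:
  "F \<oplus>\<^bsub>koszul_ring A as\<^esub> G = (\<lambda>I\<in>Pow {..<length as}. F I \<oplus>\<^bsub>A\<^esub> G I)"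
  by (simp add: koszul_ring_def koszul_module_def Let_def)

lemma koszul_ring_mult:
  "F \<otimes>\<^bsub>koszul_ring A as\<^esub> G = (\<lambda>L\<in>Pow {..<length as}. \<Oplus>\<^bsub>A\<^esub> I \<in> Pow L.
     sgn_pow A (koszul_sgn I (L - I)) (twist A (int (card (L - I))) (F I) \<otimes>\<^bsub>A\<^esub> G (L - I)))"
  by (simp add: koszul_ring_def Let_def)

lemma koszul_ring_homog:
  "homog (koszul_ring A as) k = {F \<in> Pow {..<length as} \<rightarrow>\<^sub>E carrier A.
     \<forall>I\<in>Pow {..<length as}. F I \<in> homog A (k + int (card I))}"
  by (simp add: koszul_ring_def koszul_module_def Let_def)

lemma koszul_ring_diff:
  "diff (koszul_ring A as) F = (\<lambda>I\<in>Pow {..<length as}. sgn_pow A (int (card I)) (diff A (F I)) \<oplus>\<^bsub>A\<^esub>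
     (\<Oplus>\<^bsub>A\<^esub> i \<in> {..<length as} - I.
        sgn_pow A (int (card {j \<in> I. j < i})) (as ! i \<otimes>\<^bsub>A\<^esub> F (insert i I))))"
  by (simp add: koszul_ring_def koszul_module_def Let_def sgn_pow_self_module finsum_self_module)

section \<open>Signs and sums over subsets with one additional index\<close>

lemma koszul_sgn_insert_right:
  assumes "I \<subseteq> {..<n}"
  shows "koszul_sgn I (insert n J) = koszul_sgn I J"
  using assms unfolding koszul_sgn_def by (intro arg_cong[of _ _ "\<lambda>X. int (card X)"]) auto

text \<open>The new index \<open>n\<close> exceeds all others. On the left it is inverted with every
  element of \<open>J\<close>; on the right it is inverted with none.\<close>

lemma koszul_sgn_insert_left:
  assumes "I \<subseteq> {..<n}" "J \<subseteq> {..<n}"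
  shows "koszul_sgn (insert n I) J = koszul_sgn I J + int (card J)"
proof -
  have fin: "finite I" "finite J" using assms finite_subset by blast+
  have "{(i, j). i \<in> insert n I \<and> j \<in> J \<and> j < i} = {(i, j). i \<in> I \<and> j \<in> J \<and> j < i} \<union> Pair n ` J"
    using assms by auto
  moreover have "finite {(i, j). i \<in> I \<and> j \<in> J \<and> j < i}"
    by (rule finite_subset[of _ "I \<times> J"]) (use fin in auto)
  moreover have "{(i, j). i \<in> I \<and> j \<in> J \<and> j < i} \<inter> Pair n ` J = {}"
    using assms by auto
  ultimately show ?thesis
    unfolding koszul_sgn_def by (simp add: card_Un_disjoint fin card_image inj_on_def)
qed

lemma koszul_sgn_empty [simp]: "koszul_sgn {} J = 0"
  by (simp add: koszul_sgn_def)

lemma (in abelian_monoid) finsum_Pow_insert: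
  assumes "finite L" "n \<notin> L" and T: "\<And>I. I \<subseteq> insert n L \<Longrightarrow> T I \<in> carrier G"
  shows "finsum G T (Pow (insert n L)) = finsum G T (Pow L) \<oplus> finsum G (\<lambda>I. T (insert n I)) (Pow L)"
proof -
  have "finsum G T (Pow (insert n L)) = finsum G T (Pow L) \<oplus> finsum G T (insert n ` Pow L)"
    unfolding Pow_insert by (rule finsum_Un_disjoint) (use assms in \<open>auto simp: subset_insertI2\<close>)
  also have "finsum G T (insert n ` Pow L) = finsum G (\<lambda>I. T (insert n I)) (Pow L)"
  proof (rule finsum_reindex)
    show "T \<in> insert n ` Pow L \<rightarrow> carrier G" by (auto intro!: T)
    show "inj_on (insert n) (Pow L)" using assms(2) by (auto simp: inj_on_def insert_ident subset_iff)
  qed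
  finally show ?thesis .
qed

text \<open>The shape of the product formula for the coefficient at \<open>insert n L\<close>:
  \<open>U\<close> collects the subsets containing \<open>n\<close>, where the last variable comes
  from the left factor, and \<open>V\<close> those without it. The sign \<open>k\<close> is the one
  that \<open>koszul_snd\<close> puts in front of this coefficient.\<close>

lemma (in abelian_group) sgn_pow_finsum_Pow_insert:
  assumes L: "finite L" "n \<notin> L" and T: "\<And>I. I \<subseteq> insert n L \<Longrightarrow> T I \<in> carrier G"
    and U: "\<And>I. I \<subseteq> L \<Longrightarrow> sgn_pow G k (T (insert n I)) = U I"
    and V: "\<And>I. I \<subseteq> L \<Longrightarrow> sgn_pow G k (T I) = V I"
  shows "sgn_pow G k (finsum G T (Pow (insert n L))) = finsum G U (Pow L) \<oplus> finsum G V (Pow L)"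
proof -
  have c: "T I \<in> carrier G" "T (insert n I) \<in> carrier G" if "I \<subseteq> L" for I
    using that T[of I] T[of "insert n I"] by auto
  have "finsum G V (Pow L) = sgn_pow G k (finsum G T (Pow L))"
    using c by (subst sgn_pow_finsum) (auto simp: L V[symmetric] intro!: finsum_cong')
  moreover have "finsum G U (Pow L) = sgn_pow G k (finsum G (\<lambda>I. T (insert n I)) (Pow L))"
    using c by (subst sgn_pow_finsum) (auto simp: L U[symmetric] intro!: finsum_cong')
  moreover have "finsum G T (Pow L) \<in> carrier G" "finsum G (\<lambda>I. T (insert n I)) (Pow L) \<in> carrier G"
    using c by (auto intro!: finsum_closed)
  ultimately show ?thesis
    by (simp add: finsum_Pow_insert[OF L T] sgn_pow_add a_comm)
qed

section \<open>Coordinates on a Koszul ring\<close>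

definition koszul_const :: "'a dg_ring \<Rightarrow> nat \<Rightarrow> 'a \<Rightarrow> nat set \<Rightarrow> 'a"
  where "koszul_const A n s = (\<lambda>I\<in>Pow {..<n}. if I = {} then s else \<zero>\<^bsub>A\<^esub>)"

definition koszul_fst :: "nat \<Rightarrow> (nat set \<Rightarrow> 'm) \<Rightarrow> nat set \<Rightarrow> 'm"
  where "koszul_fst n F = restrict F (Pow {..<n})"

text \<open>As \<open>e_I e_n = (- 1) ^ card I e_n e_I\<close>, this sign rewrites an element as
  \<open>p + e_n q\<close> with the new variable in front, the normal form expected by
  \<open>exterior_extension\<close>.\<close>

definition koszul_snd :: "'a dg_ring \<Rightarrow> nat \<Rightarrow> (nat set \<Rightarrow> 'a) \<Rightarrow> nat set \<Rightarrow> 'a"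
  where "koszul_snd A n F = (\<lambda>I\<in>Pow {..<n}. sgn_pow A (int (card I)) (F (insert n I)))"

definition koszul_pair :: "'a dg_ring \<Rightarrow> nat \<Rightarrow> (nat set \<Rightarrow> 'a) \<Rightarrow> (nat set \<Rightarrow> 'a) \<Rightarrow> nat set \<Rightarrow> 'a"
  where "koszul_pair A n u v = (\<lambda>I\<in>Pow {..<Suc n}.
    if n \<in> I then sgn_pow A (int (card (I - {n}))) (v (I - {n})) else u I)"

lemma subset_lessThan_Suc_cases:
  assumes "I \<subseteq> {..<Suc n}"
  obtains "I \<subseteq> {..<n}" "n \<notin> I" | J where "J \<subseteq> {..<n}" "I = insert n J" "n \<notin> J"
proof (cases "n \<in> I")
  case True
  show ?thesis
    by (rule that(2)[of "I - {n}"]) (use True assms in \<open>auto simp: less_Suc_eq\<close>)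
next
  case False
  then show ?thesis
    using assms less_Suc_eq by (intro that(1)) auto
qed

context dg_ring
begin

lemma koszul_closed [simp]: "\<lbrakk>F \<in> Pow {..<n} \<rightarrow>\<^sub>E carrier A; I \<subseteq> {..<n}\<rbrakk> \<Longrightarrow> F I \<in> carrier A"
  by auto

lemma koszul_minus:
  assumes K: "abelian_group (koszul_ring A as)" and F: "F \<in> carrier (koszul_ring A as)"
  shows "\<ominus>\<^bsub>koszul_ring A as\<^esub> F = (\<lambda>I\<in>Pow {..<length as}. \<ominus> F I)"
proof (rule abelian_group.minus_equality[OF K])
  show "(\<lambda>I\<in>Pow {..<length as}. \<ominus> F I) \<oplus>\<^bsub>koszul_ring A as\<^esub> F = \<zero>\<^bsub>koszul_ring A as\<^esub>"
    using F by (auto simp: koszul_ring_add koszul_ring_zero koszul_ring_carrier l_neg)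
qed (use F in \<open>auto simp: koszul_ring_carrier\<close>)

lemma koszul_sgn_pow:
  assumes K: "abelian_group (koszul_ring A as)" and F: "F \<in> carrier (koszul_ring A as)"
  shows "sgn_pow (koszul_ring A as) k F = (\<lambda>I\<in>Pow {..<length as}. sgn_pow A k (F I))"
proof (cases "even k")
  case True
  then show ?thesis
    using F by (simp add: sgn_pow_def koszul_ring_carrier extensional_restrict PiE_def)
qed (simp add: sgn_pow_def koszul_minus[OF assms])

text \<open>The coefficient at \<open>I\<close> of an element of degree \<open>m\<close> has degree
  \<open>m + card I\<close> in \<open>A\<close>; the outer sign removes the surplus
  \<open>k * card I\<close>.\<close>

lemma koszul_twist:
  assumes K: "dg_ring (koszul_ring A as)" and F: "F \<in> carrier (koszul_ring A as)"
  shows "twist (koszul_ring A as) k F =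
    (\<lambda>I\<in>Pow {..<length as}. sgn_pow A (k * int (card I)) (twist A k (F I)))"
proof -
  interpret K: dg_ring "koszul_ring A as" by (rule K)
  show ?thesis
  proof (rule K.twist_unique[OF _ _ _ F])
    fix m G assume "G \<in> homog (koszul_ring A as) m"
    then have G: "G \<in> carrier (koszul_ring A as)"
      and h: "\<And>I. I \<subseteq> {..<length as} \<Longrightarrow> G I \<in> homog A (m + int (card I))"
      by (auto simp: koszul_ring_homog koszul_ring_carrier)
    have "sgn_pow A (k * int (card I)) (twist A k (G I)) = sgn_pow A (m * k) (G I)" if "I \<subseteq> {..<length as}" for I
      using h[OF that] by (simp add: twist_homog[OF h[OF that]] homog_carrier[OF h[OF that]] sgn_pow_sgn_pow)
        (rule sgn_pow_cong, simp add: algebra_simps)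
    then show "(\<lambda>I\<in>Pow {..<length as}. sgn_pow A (k * int (card I)) (twist A k (G I))) =
        sgn_pow (koszul_ring A as) (m * k) G"
      by (auto simp: koszul_sgn_pow[OF K.abelian_group_axioms G] intro!: restrict_ext)
  qed (auto simp: koszul_ring_carrier koszul_ring_add twist_add sgn_pow_add PiE_iff
      extensional_def intro!: restrict_ext split: if_splits)
qed

lemma koszul_const_closed: "s \<in> carrier A \<Longrightarrow> koszul_const A (length as) s \<in> carrier (koszul_ring A as)"
  by (auto simp: koszul_const_def koszul_ring_carrier)

lemma koszul_const_homog: "s \<in> homog A n \<Longrightarrow> koszul_const A (length as) s \<in> homog (koszul_ring A as) n"
  by (auto simp: koszul_const_def koszul_ring_homog)

text \<open>The constant is supported at \<open>I = {}\<close>, where no sign arises, so the sum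
  over subsets collapses to one term.\<close>

lemma koszul_const_mult:
  assumes s: "s \<in> homog A 0" and G: "G \<in> carrier (koszul_ring A as)"
  shows "koszul_const A (length as) s \<otimes>\<^bsub>koszul_ring A as\<^esub> G = (\<lambda>L\<in>Pow {..<length as}. s \<otimes> G L)"
proof -
  have "(\<Oplus> I \<in> Pow L. sgn_pow A (koszul_sgn I (L - I))
      (twist A (int (card (L - I))) (koszul_const A (length as) s I) \<otimes> G (L - I))) = s \<otimes> G L"
    if L: "L \<subseteq> {..<length as}" for L
  proof -
    have GI: "G (L - I) \<in> carrier A" for I using G L by (auto simp: koszul_ring_carrier)
    have fin: "finite (Pow L)" using L finite_subset by blast
    have "(\<Oplus> I \<in> Pow L. sgn_pow A (koszul_sgn I (L - I))
      (twist A (int (card (L - I))) (koszul_const A (length as) s I) \<otimes> G (L - I)))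
      = (\<Oplus> I \<in> {{}}. sgn_pow A (koszul_sgn I (L - I))
      (twist A (int (card (L - I))) (koszul_const A (length as) s I) \<otimes> G (L - I)))"
      by (rule finsum_mono_neutral[symmetric]) (use fin s L GI GI[of "{}"] in \<open>auto simp: koszul_const_def twist_homog\<close>)
    also have "\<dots> = s \<otimes> G L"
      using s GI[of "{}"] by (simp add: koszul_const_def twist_homog[OF s])
    finally show ?thesis .
  qed
  then show ?thesis by (auto simp: koszul_ring_mult)
qed

text \<open>The subsets \<open>I\<close> of \<open>insert n L\<close> are split by whether they
  contain \<open>n\<close>, that is, whether \<open>e_n\<close> is taken from \<open>F\<close> or
  from \<open>G\<close>. In the second case \<open>e_n\<close> has to pass the term of
  \<open>F\<close>, which produces the twist.\<close>

lemma koszul_snd_mult: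
  assumes K: "dg_ring (koszul_ring A as)" and n: "n = length as"
    and F: "F \<in> carrier (koszul_ring A (as @ [a]))" and G: "G \<in> carrier (koszul_ring A (as @ [a]))"
  shows "koszul_snd A n (F \<otimes>\<^bsub>koszul_ring A (as @ [a])\<^esub> G) =
    koszul_snd A n F \<otimes>\<^bsub>koszul_ring A as\<^esub> koszul_fst n G \<oplus>\<^bsub>koszul_ring A as\<^esub>
    twist (koszul_ring A as) 1 (koszul_fst n F) \<otimes>\<^bsub>koszul_ring A as\<^esub> koszul_snd A n G"
proof -
  have Fc: "F I \<in> carrier A" and Gc: "G I \<in> carrier A" if "I \<subseteq> {..<Suc n}" for I
    using F G that unfolding koszul_ring_carrier n by auto
  have pF: "koszul_fst n F \<in> carrier (koszul_ring A as)"
    unfolding koszul_fst_def koszul_ring_carrier n[symmetric]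
    by (rule PiE_I) (auto intro!: Fc simp: subset_iff less_SucI)
  have "sgn_pow A (int (card L)) (\<Oplus> I \<in> Pow (insert n L). sgn_pow A (koszul_sgn I (insert n L - I))
        (twist A (int (card (insert n L - I))) (F I) \<otimes> G (insert n L - I))) =
     (\<Oplus> I \<in> Pow L. sgn_pow A (koszul_sgn I (L - I)) (twist A (int (card (L - I))) (koszul_snd A n F I) \<otimes> koszul_fst n G (L - I)))
   \<oplus> (\<Oplus> I \<in> Pow L. sgn_pow A (koszul_sgn I (L - I)) (twist A (int (card (L - I)))
        (twist (koszul_ring A as) 1 (koszul_fst n F) I) \<otimes> koszul_snd A n G (L - I)))"
    (is "sgn_pow A _ (\<Oplus> I \<in> _. ?T I) = finsum A ?U _ \<oplus> finsum A ?V _") if L: "L \<subseteq> {..<n}" for L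
  proof -
    have fin: "finite L" "finite (Pow L)" using L finite_subset by blast+
    have nL: "n \<notin> L" using L by auto
    have sub: "I \<subseteq> {..<Suc n}" "insert n L - I \<subseteq> {..<Suc n}" if "I \<subseteq> insert n L" for I
      using that L by auto
    have sub': "I \<subseteq> {..<Suc n}" "L - I \<subseteq> {..<Suc n}" "insert n (L - I) \<subseteq> {..<Suc n}"
      "insert n I \<subseteq> {..<Suc n}" if "I \<subseteq> L" for I
      using that L by auto
    have T: "?T I \<in> carrier A" if "I \<subseteq> insert n L" for I
      using sub[OF that] by (intro sgn_pow_closed m_closed twist_closed Fc Gc)
    \<comment> \<open>Here \<open>n\<close> belongs to the left factor. It forms
      \<open>card (L - I)\<close> inversions with the right one, and
      \<open>card L = card I + card (L - I)\<close> turns the outer sign into that of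
      \<open>koszul_snd\<close> at \<open>I\<close>.\<close>
    have U: "sgn_pow A (int (card L)) (?T (insert n I)) = ?U I" if I: "I \<subseteq> L" for I
    proof -
      have eq: "insert n L - insert n I = L - I" using nL by auto
      have fI: "finite I" using I fin finite_subset by blast
      have c: "card L = card I + card (L - I)"
        using I fin by (metis card_Diff_subset card_mono fI le_add_diff_inverse)
      have k: "koszul_sgn (insert n I) (L - I) = koszul_sgn I (L - I) + int (card (L - I))"
        by (rule koszul_sgn_insert_left) (use I L in auto)
      have IL: "I \<subseteq> {..<n}" "L - I \<subseteq> {..<n}" using I L by auto
      show ?thesis
        unfolding eq k c using IL sub'[OF I] Fc Gc
        by (simp add: koszul_snd_def koszul_fst_def twist_sgn_pow sgn_pow_l_mult sgn_pow_sgn_pow)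
           (rule sgn_pow_cong, simp)
    qed
    \<comment> \<open>Here \<open>n\<close> belongs to the right factor and forms no inversion. The
      twist of \<open>F I\<close> has exponent \<open>card (L - I) + 1\<close>, and the additional 1
      is the twist of the Koszul ring on the first component.\<close>
    have V: "sgn_pow A (int (card L)) (?T I) = ?V I" if I: "I \<subseteq> L" for I
    proof -
      have eq: "insert n L - I = insert n (L - I)" using nL I by auto
      have fI: "finite I" "finite (L - I)" using I fin finite_subset by blast+
      have c: "card L = card I + card (L - I)"
        using I fin by (metis card_Diff_subset card_mono fI(1) le_add_diff_inverse)
      have k: "koszul_sgn I (insert n (L - I)) = koszul_sgn I (L - I)"
        by (rule koszul_sgn_insert_right) (use I L in auto)
      have IL: "I \<subseteq> {..<n}" "L - I \<subseteq> {..<n}" using I L by auto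
      have c': "card (insert n (L - I)) = card (L - I) + 1" using fI nL by simp
      show ?thesis
        unfolding eq k c' koszul_twist[OF K pF] using IL sub'[OF I] Fc Gc
        by (simp add: c koszul_snd_def koszul_fst_def n[symmetric] twist_sgn_pow sgn_pow_l_mult sgn_pow_r_mult
            sgn_pow_sgn_pow twist_twist add.commute)
    qed
    show ?thesis
      by (rule sgn_pow_finsum_Pow_insert) (use fin nL T U V in \<open>blast+\<close>)
  qed
  then show ?thesis
    unfolding koszul_ring_add koszul_ring_mult koszul_snd_def[of _ _ "restrict _ _"]
    by (auto simp: n[symmetric] less_SucI subset_iff intro!: restrict_ext)
qed

lemma koszul_fst_mult:
  assumes F: "F \<in> carrier (koszul_ring A (as @ [a]))" and G: "G \<in> carrier (koszul_ring A (as @ [a]))"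
  shows "koszul_fst (length as) (F \<otimes>\<^bsub>koszul_ring A (as @ [a])\<^esub> G) =
    koszul_fst (length as) F \<otimes>\<^bsub>koszul_ring A as\<^esub> koszul_fst (length as) G"
proof -
  let ?n = "length as"
  have Fc: "F I \<in> carrier A" and Gc: "G I \<in> carrier A" if "I \<subseteq> {..<?n}" for I
  proof -
    have "I \<in> Pow {..<length (as @ [a])}" using that by (auto simp: less_SucI)
    then show "F I \<in> carrier A" "G I \<in> carrier A"
      using F G unfolding koszul_ring_carrier by blast+
  qed
  have "(\<Oplus> I \<in> Pow L. sgn_pow A (koszul_sgn I (L - I)) (twist A (int (card (L - I))) (F I) \<otimes> G (L - I))) =
    (\<Oplus> I \<in> Pow L. sgn_pow A (koszul_sgn I (L - I))
      (twist A (int (card (L - I))) (koszul_fst ?n F I) \<otimes> koszul_fst ?n G (L - I)))"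
    if L: "L \<subseteq> {..<?n}" for L
  proof (rule finsum_cong'[OF refl])
    fix I assume "I \<in> Pow L"
    then have "I \<subseteq> {..<?n}" "L - I \<subseteq> {..<?n}" using L by auto
    then show "sgn_pow A (koszul_sgn I (L - I)) (twist A (int (card (L - I))) (F I) \<otimes> G (L - I)) =
      sgn_pow A (koszul_sgn I (L - I)) (twist A (int (card (L - I))) (koszul_fst ?n F I) \<otimes> koszul_fst ?n G (L - I))"
      by (simp add: koszul_fst_def)
  next
    show "(\<lambda>I. sgn_pow A (koszul_sgn I (L - I)) (twist A (int (card (L - I))) (koszul_fst ?n F I) \<otimes> koszul_fst ?n G (L - I)))
      \<in> Pow L \<rightarrow> carrier A"
    proof
      fix I assume "I \<in> Pow L"
      then have "I \<subseteq> {..<?n}" "L - I \<subseteq> {..<?n}" using L by auto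
      then show "sgn_pow A (koszul_sgn I (L - I)) (twist A (int (card (L - I))) (koszul_fst ?n F I) \<otimes> koszul_fst ?n G (L - I))
        \<in> carrier A"
        by (auto simp: koszul_fst_def intro!: Fc Gc sgn_pow_closed m_closed twist_closed)
    qed
  qed
  then show ?thesis
    unfolding koszul_ring_mult koszul_fst_def[of _ "restrict _ _"]
    by (auto simp: restrict_def fun_eq_iff less_SucI subset_iff)
qed

text \<open>For \<open>L\<close> not containing \<open>n\<close>, the only index beyond those of
  \<open>as\<close> is \<open>i = n\<close>. All elements of \<open>L\<close> lie below it, so its
  sign has exponent \<open>card L\<close>, as in \<open>koszul_snd\<close>.\<close>

lemma koszul_fst_diff:
  assumes as: "set (as @ [a]) \<subseteq> homog A 0" and F: "F \<in> carrier (koszul_ring A (as @ [a]))"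
  shows "koszul_fst (length as) (diff (koszul_ring A (as @ [a])) F) =
    diff (koszul_ring A as) (koszul_fst (length as) F) \<oplus>\<^bsub>koszul_ring A as\<^esub>
    koszul_const A (length as) a \<otimes>\<^bsub>koszul_ring A as\<^esub> koszul_snd A (length as) F"
proof -
  define n where n: "n = length as"
  have Fc: "F I \<in> carrier A" if "I \<subseteq> {..<Suc n}" for I
    using F that unfolding koszul_ring_carrier n by auto
  have ac: "a \<in> carrier A" "i < n \<Longrightarrow> as ! i \<in> carrier A" for i
    using as nth_mem[of i as] by (auto simp: n subset_iff simp del: nth_mem)
  have q: "koszul_snd A n F \<in> carrier (koszul_ring A as)"
    unfolding koszul_ring_carrier n[symmetric] koszul_snd_def
    by (rule PiE_I) (auto intro!: Fc sgn_pow_closed simp: subset_iff less_SucI)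
  have "sgn_pow A (int (card L)) (diff A (F L)) \<oplus>
     (\<Oplus> i \<in> {..<Suc n} - L. sgn_pow A (int (card {j \<in> L. j < i})) ((as @ [a]) ! i \<otimes> F (insert i L))) =
     (sgn_pow A (int (card L)) (diff A (koszul_fst n F L)) \<oplus>
     (\<Oplus> i \<in> {..<n} - L. sgn_pow A (int (card {j \<in> L. j < i})) (as ! i \<otimes> koszul_fst n F (insert i L)))) \<oplus>
     a \<otimes> koszul_snd A n F L" if L: "L \<subseteq> {..<n}" for L
  proof -
    have set: "{..<Suc n} - L = insert n ({..<n} - L)" "n \<notin> {..<n} - L" "{j \<in> L. j < n} = L"
      "L \<subseteq> {..<Suc n}" "insert n L \<subseteq> {..<Suc n}"
      using L by (auto simp: less_Suc_eq)
    have ins: "insert i L \<subseteq> {..<n}" if "i \<in> {..<n} - L" for i using that L by auto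
    have ins': "insert i L \<subseteq> {..<Suc n}" if "i \<in> {..<n} - L" for i using that L by auto
    have "(\<Oplus> i \<in> {..<n} - L. sgn_pow A (int (card {j \<in> L. j < i})) ((as @ [a]) ! i \<otimes> F (insert i L)))
      = (\<Oplus> i \<in> {..<n} - L. sgn_pow A (int (card {j \<in> L. j < i})) (as ! i \<otimes> koszul_fst n F (insert i L)))"
      (is "?S = ?S'")
      by (rule finsum_cong') (use ins ins' ac Fc in \<open>auto simp: nth_append n koszul_fst_def\<close>)
    moreover have "(\<Oplus> i \<in> insert n ({..<n} - L). sgn_pow A (int (card {j \<in> L. j < i})) ((as @ [a]) ! i \<otimes> F (insert i L)))
      = sgn_pow A (int (card {j \<in> L. j < n})) ((as @ [a]) ! n \<otimes> F (insert n L)) \<oplus> ?S"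
      by (rule finsum_insert) (use set ins' ac Fc in \<open>auto simp: nth_append n[symmetric]\<close>)
    moreover have "?S' \<in> carrier A"
      by (rule finsum_closed) (use ins ins' ac Fc in \<open>auto simp: koszul_fst_def\<close>)
    ultimately show ?thesis
      using L set Fc ac unfolding set(1)
      by (simp add: koszul_fst_def koszul_snd_def n[symmetric] nth_append sgn_pow_r_mult a_ac)
  qed
  then show ?thesis
    unfolding n[symmetric] koszul_ring_add koszul_ring_diff koszul_fst_def[of _ "restrict _ _"]
      koszul_const_mult[OF as[THEN subsetD, of a, simplified] q, folded n]
    by (auto simp: restrict_def fun_eq_iff less_SucI subset_iff n[symmetric])
qed

text \<open>No summand with \<open>a\<close> occurs, since \<open>n\<close> already lies in
  \<open>insert n L\<close>. The remaining terms each acquire one odd sign, because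
  \<open>card (insert n L)\<close> and \<open>card (insert i L)\<close> exceed \<open>card L\<close>
  by 1.\<close>

lemma koszul_snd_diff:
  assumes K: "abelian_group (koszul_ring A as)"
    and as: "set (as @ [a]) \<subseteq> homog A 0" and F: "F \<in> carrier (koszul_ring A (as @ [a]))"
  shows "koszul_snd A (length as) (diff (koszul_ring A (as @ [a])) F) =
    \<ominus>\<^bsub>koszul_ring A as\<^esub> diff (koszul_ring A as) (koszul_snd A (length as) F)"
proof -
  define n where n: "n = length as"
  have Fc: "F I \<in> carrier A" if "I \<subseteq> {..<Suc n}" for I
    using F that unfolding koszul_ring_carrier n by auto
  have ac: "i < n \<Longrightarrow> as ! i \<in> carrier A" for i
    using as nth_mem[of i as] by (auto simp: n subset_iff simp del: nth_mem)
  have q: "koszul_snd A n F L \<in> carrier A" if "L \<subseteq> {..<n}" for L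
    using that unfolding koszul_snd_def by (auto intro!: Fc sgn_pow_closed simp: subset_iff less_SucI)
  have main: "sgn_pow A (int (card L)) (sgn_pow A (int (card (insert n L))) (diff A (F (insert n L))) \<oplus>
     (\<Oplus> i \<in> {..<Suc n} - insert n L. sgn_pow A (int (card {j \<in> insert n L. j < i})) ((as @ [a]) ! i \<otimes> F (insert i (insert n L))))) =
     \<ominus> (sgn_pow A (int (card L)) (diff A (koszul_snd A n F L)) \<oplus>
     (\<Oplus> i \<in> {..<n} - L. sgn_pow A (int (card {j \<in> L. j < i})) (as ! i \<otimes> koszul_snd A n F (insert i L))))"
    (is "sgn_pow A _ (_ \<oplus> finsum A ?T _) = \<ominus> (_ \<oplus> finsum A ?U _)")
    if L: "L \<subseteq> {..<n}" for L
  proof -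
    have set: "{..<Suc n} - insert n L = {..<n} - L" "n \<notin> L" "insert n L \<subseteq> {..<Suc n}" "finite L"
      using L finite_subset by (auto simp: less_Suc_eq)
    have T: "?T i \<in> carrier A" "?U i \<in> carrier A" "sgn_pow A (int (card L)) (?T i) = \<ominus> ?U i" if i: "i \<in> {..<n} - L" for i
    proof -
      have ins: "insert i L \<subseteq> {..<n}" "insert i (insert n L) \<subseteq> {..<Suc n}" "insert n (insert i L) = insert i (insert n L)"
        "{j \<in> insert n L. j < i} = {j \<in> L. j < i}" "i \<notin> L" "i < n"
        using i L by (auto simp: less_SucI)
      have c: "F (insert i (insert n L)) \<in> carrier A" "as ! i \<in> carrier A" "koszul_snd A n F (insert i L) \<in> carrier A"
        using ins Fc ac q by auto
      then show "?T i \<in> carrier A" "?U i \<in> carrier A" using ins(6) by (auto simp: nth_append n)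
      have "koszul_snd A n F (insert i L) = sgn_pow A (int (card L) + 1) (F (insert i (insert n L)))"
        using ins(1,3,5) set by (simp add: koszul_snd_def add.commute)
      then show "sgn_pow A (int (card L)) (?T i) = \<ominus> ?U i"
        using c ins(4,6) by (simp add: nth_append n[symmetric] sgn_pow_r_mult sgn_pow_sgn_pow sgn_pow_minus)
          (rule sgn_pow_cong, simp)
    qed
    have "sgn_pow A (int (card L)) (finsum A ?T ({..<n} - L)) = finsum A (\<lambda>i. \<ominus> ?U i) ({..<n} - L)"
      by (subst sgn_pow_finsum) (use T in \<open>auto intro!: finsum_cong'\<close>)
    also have "\<dots> = \<ominus> finsum A ?U ({..<n} - L)"
      by (rule additive_finsum[symmetric]) (use T in \<open>auto simp: abelian_group_axioms minus_add\<close>)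
    finally have *: "sgn_pow A (int (card L)) (finsum A ?T ({..<n} - L)) = \<ominus> finsum A ?U ({..<n} - L)" .
    have "finsum A ?T ({..<n} - L) \<in> carrier A" "finsum A ?U ({..<n} - L) \<in> carrier A"
      using T by (auto intro!: finsum_closed)
    with * set Fc[OF set(3)] L show ?thesis
      unfolding set(1)
      by (simp add: sgn_pow_add minus_add koszul_snd_def sgn_pow_sgn_pow diff_sgn_pow sgn_pow_minus)
  qed
  have dq: "diff (koszul_ring A as) (koszul_snd A n F) \<in> carrier (koszul_ring A as)"
    unfolding koszul_ring_diff koszul_ring_carrier n[symmetric]
    by (rule PiE_I) (auto intro!: a_closed sgn_pow_closed finsum_closed diff_closed m_closed q ac)
  show ?thesis
    unfolding n[symmetric] koszul_minus[OF K dq]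
    unfolding koszul_ring_diff koszul_snd_def[of _ _ "restrict _ _"]
    using main by (auto simp: restrict_def fun_eq_iff less_SucI subset_iff n[symmetric])
qed

lemma koszul_mult_closed:
  assumes F: "F \<in> carrier (koszul_ring A as)" and G: "G \<in> carrier (koszul_ring A as)"
  shows "F \<otimes>\<^bsub>koszul_ring A as\<^esub> G \<in> carrier (koszul_ring A as)"
proof -
  have "sgn_pow A (koszul_sgn I (L - I)) (twist A (int (card (L - I))) (F I) \<otimes> G (L - I)) \<in> carrier A"
    if "L \<subseteq> {..<length as}" "I \<subseteq> L" for I L
  proof -
    have "I \<in> Pow {..<length as}" "L - I \<in> Pow {..<length as}" using that by auto
    then have "F I \<in> carrier A" "G (L - I) \<in> carrier A"
      using F G unfolding koszul_ring_carrier by blast+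
    then show ?thesis by auto
  qed
  then show ?thesis
    unfolding koszul_ring_mult koszul_ring_carrier
    by (intro PiE_I) (auto intro!: finsum_closed)
qed

lemma koszul_diff_closed:
  assumes as: "set as \<subseteq> homog A 0" and F: "F \<in> carrier (koszul_ring A as)"
  shows "diff (koszul_ring A as) F \<in> carrier (koszul_ring A as)"
proof -
  have Fc: "F I \<in> carrier A" if "I \<subseteq> {..<length as}" for I
    using F that unfolding koszul_ring_carrier by auto
  have "as ! i \<in> carrier A" if "i < length as" for i
    using as nth_mem[OF that] by auto
  then show ?thesis
    unfolding koszul_ring_diff koszul_ring_carrier
    by (intro PiE_I) (auto intro!: a_closed sgn_pow_closed finsum_closed diff_closed m_closed Fc)
qed

text \<open>This brings the explicit sums over subsets into the abstract form
  \<open>p + e q\<close>; the ring axioms as well as the cones of complexes are later obtained from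
  this decomposition at the last index.\<close>

lemma koszul_exterior_extension:
  assumes K: "dg_ring (koszul_ring A as)" and as: "set (as @ [a]) \<subseteq> homog A 0"
  shows "exterior_extension (koszul_ring A as) (koszul_ring A (as @ [a]))
    (koszul_fst (length as)) (koszul_snd A (length as)) (koszul_pair A (length as))
    (koszul_const A (length as) a)"
proof -
  interpret K: dg_ring "koszul_ring A as" by (rule K)
  let ?C = "koszul_ring A (as @ [a])"
  define n where n: "n = length as"
  note c = koszul_ring_carrier n[symmetric]
  have Fc: "F I \<in> carrier A" if "F \<in> carrier ?C" "I \<subseteq> {..<Suc n}" for F I
    using that unfolding c by (auto simp: n)
  have sub: "I \<subseteq> {..<Suc n}" "insert n I \<subseteq> {..<Suc n}" if "I \<subseteq> {..<n}" for I
    using that by (auto simp: less_SucI)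
  have p_cl: "koszul_fst n F \<in> carrier (koszul_ring A as)" if "F \<in> carrier ?C" for F
    unfolding c koszul_fst_def by (rule PiE_I) (use that sub in \<open>auto intro!: Fc\<close>)
  have q_cl: "koszul_snd A n F \<in> carrier (koszul_ring A as)" if "F \<in> carrier ?C" for F
    unfolding c koszul_snd_def by (rule PiE_I) (use that sub in \<open>auto intro!: Fc sgn_pow_closed\<close>)
  have j_cl: "koszul_pair A n u v \<in> carrier ?C"
    if "u \<in> carrier (koszul_ring A as)" "v \<in> carrier (koszul_ring A as)" for u v
  proof -
    have uv: "u I \<in> carrier A" "v I \<in> carrier A" if "I \<subseteq> {..<n}" for I
      using that \<open>u \<in> _\<close> \<open>v \<in> _\<close> unfolding c by auto
    have "koszul_pair A n u v I \<in> carrier A" if "I \<subseteq> {..<Suc n}" for I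
      using that
    proof (cases rule: subset_lessThan_Suc_cases)
      case 1
      then show ?thesis using that uv by (simp add: koszul_pair_def)
    next
      case (2 J)
      then have "I - {n} = J" by auto
      then show ?thesis using that 2 uv by (simp add: koszul_pair_def)
    qed
    then show ?thesis unfolding koszul_ring_carrier
      by (intro PiE_I) (auto simp: n koszul_pair_def)
  qed
  have p_j: "koszul_fst n (koszul_pair A n u v) = u" if "u \<in> carrier (koszul_ring A as)" for u v
    using that sub unfolding c koszul_fst_def koszul_pair_def
    by (auto simp: fun_eq_iff PiE_iff extensional_def restrict_def)
  have q_j: "koszul_snd A n (koszul_pair A n u v) = v" if v: "v \<in> carrier (koszul_ring A as)" for u v
  proof -
    have "sgn_pow A (int (card I)) (koszul_pair A n u v (insert n I)) = v I" if "I \<subseteq> {..<n}" for I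
    proof -
      have "insert n I - {n} = I" "v I \<in> carrier A" using that v unfolding c by auto
      then show ?thesis
        using sub[OF that] by (simp add: koszul_pair_def sgn_pow_sgn_pow) (simp add: sgn_pow_def)
    qed
    then show ?thesis
      using v unfolding c koszul_snd_def by (auto simp: fun_eq_iff PiE_iff extensional_def restrict_def)
  qed
  have j_pq: "koszul_pair A n (koszul_fst n F) (koszul_snd A n F) = F" if F: "F \<in> carrier ?C" for F
  proof
    fix I
    consider "\<not> I \<subseteq> {..<Suc n}" | "I \<subseteq> {..<n}" "n \<notin> I" | J where "J \<subseteq> {..<n}" "I = insert n J" "n \<notin> J"
      using subset_lessThan_Suc_cases by metis
    then show "koszul_pair A n (koszul_fst n F) (koszul_snd A n F) I = F I"
    proof cases
      case 1
      then show ?thesis using F by (auto simp: koszul_pair_def koszul_ring_carrier n PiE_iff extensional_def)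
    next
      case 2
      then show ?thesis using sub by (simp add: koszul_pair_def koszul_fst_def)
    next
      case 3
      then show ?thesis
        using sub[OF 3(1)] Fc[OF F sub(2)[OF 3(1)]]
        by (simp add: koszul_pair_def koszul_snd_def sgn_pow_sgn_pow) (simp add: sgn_pow_def)
    qed
  qed
  have homog: "homog ?C k = {F \<in> carrier ?C. koszul_fst n F \<in> homog (koszul_ring A as) k \<and>
      koszul_snd A n F \<in> homog (koszul_ring A as) (k + 1)}" for k
  proof (rule Set.set_eqI)
    fix F
    show "F \<in> homog ?C k \<longleftrightarrow> F \<in> {F \<in> carrier ?C. koszul_fst n F \<in> homog (koszul_ring A as) k \<and>
      koszul_snd A n F \<in> homog (koszul_ring A as) (k + 1)}" (is "_ \<longleftrightarrow> F \<in> ?R")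
    proof (cases "F \<in> carrier ?C")
      case True
      have "(\<forall>I\<in>Pow {..<Suc n}. F I \<in> homog A (k + int (card I))) \<longleftrightarrow>
        (\<forall>I\<in>Pow {..<n}. F I \<in> homog A (k + int (card I)) \<and> F (insert n I) \<in> homog A (k + 1 + int (card I)))"
        (is "?l \<longleftrightarrow> ?r")
      proof
        assume l: ?l
        show ?r
        proof
          fix I assume "I \<in> Pow {..<n}"
          then have I: "I \<subseteq> {..<n}" by simp
          then have "card (insert n I) = Suc (card I)" by (auto intro!: card_insert_disjoint finite_subset[OF I])
          then show "F I \<in> homog A (k + int (card I)) \<and> F (insert n I) \<in> homog A (k + 1 + int (card I))"
            using l[rule_format, of I] l[rule_format, of "insert n I"] sub[OF I] by (auto simp: algebra_simps)
        qed
      next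
        assume r: ?r
        show ?l
        proof
          fix I assume "I \<in> Pow {..<Suc n}"
          then have "I \<subseteq> {..<Suc n}" by simp
          then show "F I \<in> homog A (k + int (card I))"
          proof (cases rule: subset_lessThan_Suc_cases)
            case (2 J)
            then have "card I = Suc (card J)" by (auto intro!: card_insert_disjoint finite_subset[OF 2(1)])
            then show ?thesis using r[rule_format, of J] 2 by (auto simp: algebra_simps)
          qed (use r in auto)
        qed
      qed
      moreover have "F (insert n I) \<in> carrier A" if "I \<subseteq> {..<n}" for I using Fc[OF True] sub[OF that] by blast
      moreover have "F I \<in> homog A m" if "sgn_pow A l (F I) \<in> homog A m" "F I \<in> carrier A" for l m I
        using that(1) homog_minus[of "\<ominus> F I"] that(2) by (auto simp: sgn_pow_def split: if_splits)
      then have "sgn_pow A l (F I) \<in> homog A m \<longleftrightarrow> F I \<in> homog A m" if "F I \<in> carrier A" for l m I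
        using that homog_sgn_pow by blast
      ultimately show ?thesis
        using True p_cl[OF True] q_cl[OF True]
        by (auto simp: koszul_ring_homog c koszul_fst_def koszul_snd_def)
    next
      case False
      then show ?thesis by (auto simp: koszul_ring_homog koszul_ring_carrier)
    qed
  qed
  have ac: "(as @ [a]) ! i \<in> carrier A" if "i < Suc n" for i
    using as nth_mem[of i "as @ [a]"] that by (auto simp: n simp del: nth_mem set_append)
  show ?thesis
    unfolding n[symmetric]
  proof (intro exterior_extension.intro exterior_extension_axioms.intro K)
    show "pair_group (koszul_ring A as) ?C (koszul_fst n) (koszul_snd A n) (koszul_pair A n)"
    proof (unfold_locales, goal_cases)
      case (7 z w)
      then show ?case by (auto simp: koszul_ring_add koszul_ring_carrier)
    next
      case (8 z w)
      then show ?case using sub by (auto simp: koszul_ring_add koszul_fst_def c n[symmetric] intro!: restrict_ext)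
    next
      case (9 z w)
      then show ?case using sub Fc
        by (auto simp: koszul_ring_add koszul_snd_def n[symmetric] sgn_pow_add intro!: restrict_ext)
    next
      case 11
      show ?case using sub by (auto simp: koszul_ring_zero koszul_fst_def n[symmetric] restrict_def fun_eq_iff)
    next
      case 12
      show ?case using sub by (auto simp: koszul_ring_zero koszul_snd_def n[symmetric] restrict_def fun_eq_iff)
    qed (use p_cl q_cl j_cl p_j q_j j_pq in \<open>auto simp: koszul_ring_zero koszul_ring_carrier\<close>)
  next
    show "koszul_const A n a \<in> homog (koszul_ring A as) 0"
      using koszul_const_homog[of a 0 as] as by (simp add: n)
    show "koszul_fst n \<one>\<^bsub>?C\<^esub> = \<one>\<^bsub>koszul_ring A as\<^esub>"
      using sub by (auto simp: koszul_ring_one koszul_fst_def n[symmetric] restrict_def fun_eq_iff)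
    show "koszul_snd A n \<one>\<^bsub>?C\<^esub> = \<zero>\<^bsub>koszul_ring A as\<^esub>"
      using sub by (auto simp: koszul_ring_one koszul_ring_zero koszul_snd_def n[symmetric] restrict_def fun_eq_iff)
    fix z assume z: "z \<in> carrier ?C"
    show "diff ?C z \<in> carrier ?C"
      using as z by (intro koszul_diff_closed) auto
    show "koszul_fst n (diff ?C z) = diff (koszul_ring A as) (koszul_fst n z) \<oplus>\<^bsub>koszul_ring A as\<^esub>
        koszul_const A n a \<otimes>\<^bsub>koszul_ring A as\<^esub> koszul_snd A n z"
      unfolding n by (rule koszul_fst_diff[OF as z])
    show "koszul_snd A n (diff ?C z) = \<ominus>\<^bsub>koszul_ring A as\<^esub> diff (koszul_ring A as) (koszul_snd A n z)"
      unfolding n by (rule koszul_snd_diff[OF K.abelian_group_axioms as z])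
    fix w assume w: "w \<in> carrier ?C"
    show "z \<otimes>\<^bsub>?C\<^esub> w \<in> carrier ?C"
      by (rule koszul_mult_closed[OF z w])
    show "koszul_fst n (z \<otimes>\<^bsub>?C\<^esub> w) = koszul_fst n z \<otimes>\<^bsub>koszul_ring A as\<^esub> koszul_fst n w"
      unfolding n by (rule koszul_fst_mult[OF z w])
    show "koszul_snd A n (z \<otimes>\<^bsub>?C\<^esub> w) = koszul_snd A n z \<otimes>\<^bsub>koszul_ring A as\<^esub> koszul_fst n w \<oplus>\<^bsub>koszul_ring A as\<^esub>
        twist (koszul_ring A as) 1 (koszul_fst n z) \<otimes>\<^bsub>koszul_ring A as\<^esub> koszul_snd A n w"
      by (rule koszul_snd_mult[OF K n z w])
  qed (use homog in \<open>auto simp: koszul_ring_one koszul_ring_carrier\<close>)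
qed

end

text \<open>Transport of structure along a bijection. It treats the empty sequence, whose Koszul
  ring is \<open>A\<close> rewritten as functions on the single set \<open>{}\<close>.\<close>

locale dg_ring_copy = B: dg_ring B for B :: "'b dg_ring" +
  fixes C :: "'c dg_ring" and p :: "'c \<Rightarrow> 'b" and j :: "'b \<Rightarrow> 'c"
  assumes p_closed [simp]: "z \<in> carrier C \<Longrightarrow> p z \<in> carrier B"
    and j_closed [simp]: "u \<in> carrier B \<Longrightarrow> j u \<in> carrier C"
    and p_j [simp]: "u \<in> carrier B \<Longrightarrow> p (j u) = u"
    and j_p: "z \<in> carrier C \<Longrightarrow> j (p z) = z"
    and add_closed [simp]: "\<lbrakk>z \<in> carrier C; w \<in> carrier C\<rbrakk> \<Longrightarrow> z \<oplus>\<^bsub>C\<^esub> w \<in> carrier C"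
    and p_add [simp]: "\<lbrakk>z \<in> carrier C; w \<in> carrier C\<rbrakk> \<Longrightarrow> p (z \<oplus>\<^bsub>C\<^esub> w) = p z \<oplus>\<^bsub>B\<^esub> p w"
    and zero_closed [simp]: "\<zero>\<^bsub>C\<^esub> \<in> carrier C" and p_zero [simp]: "p \<zero>\<^bsub>C\<^esub> = \<zero>\<^bsub>B\<^esub>"
    and one_closed [simp]: "\<one>\<^bsub>C\<^esub> \<in> carrier C" and p_one [simp]: "p \<one>\<^bsub>C\<^esub> = \<one>\<^bsub>B\<^esub>"
    and mult_closed [simp]: "\<lbrakk>z \<in> carrier C; w \<in> carrier C\<rbrakk> \<Longrightarrow> z \<otimes>\<^bsub>C\<^esub> w \<in> carrier C"
    and p_mult [simp]: "\<lbrakk>z \<in> carrier C; w \<in> carrier C\<rbrakk> \<Longrightarrow> p (z \<otimes>\<^bsub>C\<^esub> w) = p z \<otimes>\<^bsub>B\<^esub> p w"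
    and homog_eq: "homog C n = {z \<in> carrier C. p z \<in> homog B n}"
    and d_closed [simp]: "z \<in> carrier C \<Longrightarrow> diff C z \<in> carrier C"
    and p_diff [simp]: "z \<in> carrier C \<Longrightarrow> p (diff C z) = diff B (p z)"
begin

lemma eqI: "\<lbrakk>z \<in> carrier C; w \<in> carrier C; p z = p w\<rbrakk> \<Longrightarrow> z = w"
  by (metis j_p)

lemma ring_C: "ring C"
proof (rule ringI)
  show "abelian_group C"
  proof (rule abelian_groupI)
    fix z assume z: "z \<in> carrier C"
    show "\<exists>w\<in>carrier C. w \<oplus>\<^bsub>C\<^esub> z = \<zero>\<^bsub>C\<^esub>"
      by (rule bexI[of _ "j (\<ominus>\<^bsub>B\<^esub> p z)"]) (use z in \<open>auto intro!: eqI simp: B.l_neg\<close>)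
  qed (auto intro!: eqI simp: B.a_ac)
  show "monoid C"
    by (rule monoidI) (auto intro!: eqI simp: B.m_assoc)
qed (auto intro!: eqI simp: B.l_distr B.r_distr)

sublocale C: ring C by (rule ring_C)

lemma p_minus [simp]: "z \<in> carrier C \<Longrightarrow> p (\<ominus>\<^bsub>C\<^esub> z) = \<ominus>\<^bsub>B\<^esub> p z"
  by (rule B.minus_equality[symmetric]) (auto simp: C.l_neg simp flip: p_add)

lemma p_sgn_pow [simp]: "z \<in> carrier C \<Longrightarrow> p (sgn_pow C k z) = sgn_pow B k (p z)"
  by (simp add: sgn_pow_def)

lemma homog_parts_iff:
  assumes z: "z \<in> carrier C" and h: "\<And>n. h n \<in> carrier C"
  shows "homog_parts C z h \<longleftrightarrow> homog_parts B (p z) (\<lambda>n. p (h n))"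
proof -
  have "p w = \<zero>\<^bsub>B\<^esub> \<longleftrightarrow> w = \<zero>\<^bsub>C\<^esub>" if "w \<in> carrier C" for w
    using eqI[OF that zero_closed] by auto
  moreover have "z = finsum C h X \<longleftrightarrow> p z = finsum B (\<lambda>n. p (h n)) X" if "finite X" for X
  proof -
    have "p (finsum C h X) = finsum B (\<lambda>n. p (h n)) X"
      by (rule additive_finsum) (use that h in \<open>auto simp: C.abelian_group_axioms B.abelian_group_axioms\<close>)
    moreover have "finsum C h X \<in> carrier C" using h by (auto intro!: C.finsum_closed)
    ultimately show ?thesis using eqI[OF z] by metis
  qed
  ultimately show ?thesis using h by (auto simp: homog_parts_def homog_eq)
qed

lemma ex1_homog_parts:
  assumes z: "z \<in> carrier C"
  shows "\<exists>!h. homog_parts C z h"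
proof -
  obtain f where f: "homog_parts B (p z) f" "\<And>g. homog_parts B (p z) g \<Longrightarrow> g = f"
    using B.direct_sum[OF p_closed[OF z]] by metis
  then have fc: "f n \<in> carrier B" for n by (auto simp: homog_parts_def)
  show ?thesis
  proof (rule ex1I[of _ "\<lambda>n. j (f n)"])
    show "homog_parts C z (\<lambda>n. j (f n))"
      using f(1) fc by (subst homog_parts_iff[OF z]) auto
    fix g assume g: "homog_parts C z g"
    then have gc: "g n \<in> carrier C" for n by (auto simp: homog_parts_def homog_eq)
    then have "(\<lambda>n. p (g n)) = f" using f(2) g homog_parts_iff[OF z] by blast
    then show "g = (\<lambda>n. j (f n))" using gc j_p by auto
  qed
qed

theorem dg_ring_C: "dg_ring C"
proof (intro dg_ring.intro dg_group.intro ring_C dg_group_axioms.intro dg_ring_axioms.intro C.abelian_group_axioms)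
  show "additive_subgroup (homog C n) C" for n
  proof (rule additive_subgroupI, rule C.add.subgroupI)
    show "homog C n \<noteq> {}" by (auto simp: homog_eq intro!: exI[of _ "\<zero>\<^bsub>C\<^esub>"])
  qed (auto simp: homog_eq simp flip: a_inv_def)
  show "\<exists>!f. homog_parts C x f" if "x \<in> carrier C" for x by (rule ex1_homog_parts[OF that])
  show "diff C x \<in> homog C (n + 1)" if "x \<in> homog C n" for n x
    using that by (auto simp: homog_eq B.diff_homog)
  show "diff C (x \<oplus>\<^bsub>C\<^esub> y) = diff C x \<oplus>\<^bsub>C\<^esub> diff C y" if "x \<in> carrier C" "y \<in> carrier C" for x y
    using that by (intro eqI) (auto simp: B.diff_add)
  show "diff C (diff C x) = \<zero>\<^bsub>C\<^esub>" if "x \<in> carrier C" for x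
    using that by (intro eqI) (auto simp: B.diff_diff)
  show "homog C n = {\<zero>\<^bsub>C\<^esub>}" if "0 < n" for n
    using that by (auto simp: homog_eq B.nonpositive intro: eqI)
  show "\<one>\<^bsub>C\<^esub> \<in> homog C 0" by (simp add: homog_eq B.one_homog)
  show "x \<otimes>\<^bsub>C\<^esub> y \<in> homog C (i + k)" if "x \<in> homog C i" "y \<in> homog C k" for i k x y
    using that by (auto simp: homog_eq B.mult_homog)
  show "diff C (x \<otimes>\<^bsub>C\<^esub> y) = diff C x \<otimes>\<^bsub>C\<^esub> y \<oplus>\<^bsub>C\<^esub> sgn_pow C i (x \<otimes>\<^bsub>C\<^esub> diff C y)"
    if "x \<in> homog C i" "y \<in> carrier C" for i x y
    using that B.leibniz[of "p x" i "p y"] by (intro eqI) (auto simp: homog_eq)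
  show "y \<otimes>\<^bsub>C\<^esub> x = sgn_pow C (i * k) (x \<otimes>\<^bsub>C\<^esub> y)" if "x \<in> homog C i" "y \<in> homog C k" for i k x y
    using that B.graded_comm[of "p x" i "p y" k] by (intro eqI) (auto simp: homog_eq)
  show "x \<otimes>\<^bsub>C\<^esub> x = \<zero>\<^bsub>C\<^esub>" if "odd i" "x \<in> homog C i" for i x
    using that B.odd_square[of i "p x"] by (intro eqI) (auto simp: homog_eq)
qed

end

context dg_ring
begin

lemma koszul_Nil_simps:
  shows "carrier (koszul_ring A []) = {{}} \<rightarrow>\<^sub>E carrier A"
    and "homog (koszul_ring A []) k = {F \<in> {{}} \<rightarrow>\<^sub>E carrier A. F {} \<in> homog A k}"
    and "\<zero>\<^bsub>koszul_ring A []\<^esub> = (\<lambda>I\<in>{{}}. \<zero>)" "\<one>\<^bsub>koszul_ring A []\<^esub> = (\<lambda>I\<in>{{}}. \<one>)"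
    and "F \<oplus>\<^bsub>koszul_ring A []\<^esub> G = (\<lambda>I\<in>{{}}. F I \<oplus> G I)"
    and "\<lbrakk>F \<in> {{}} \<rightarrow>\<^sub>E carrier A; G \<in> {{}} \<rightarrow>\<^sub>E carrier A\<rbrakk> \<Longrightarrow> F \<otimes>\<^bsub>koszul_ring A []\<^esub> G = (\<lambda>I\<in>{{}}. F I \<otimes> G I)"
    and "F \<in> {{}} \<rightarrow>\<^sub>E carrier A \<Longrightarrow> diff (koszul_ring A []) F = (\<lambda>I\<in>{{}}. diff A (F I))"
proof -
  show "carrier (koszul_ring A []) = {{}} \<rightarrow>\<^sub>E carrier A" by (simp add: koszul_ring_carrier)
  show "homog (koszul_ring A []) k = {F \<in> {{}} \<rightarrow>\<^sub>E carrier A. F {} \<in> homog A k}"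
    by (simp add: koszul_ring_homog)
  show "\<zero>\<^bsub>koszul_ring A []\<^esub> = (\<lambda>I\<in>{{}}. \<zero>)" by (simp add: koszul_ring_zero)
  show "\<one>\<^bsub>koszul_ring A []\<^esub> = (\<lambda>I\<in>{{}}. \<one>)"
    unfolding koszul_ring_one by (rule restrict_cong) auto
  show "F \<oplus>\<^bsub>koszul_ring A []\<^esub> G = (\<lambda>I\<in>{{}}. F I \<oplus> G I)" by (simp add: koszul_ring_add)
  assume F: "F \<in> {{}} \<rightarrow>\<^sub>E carrier A"
  then have Fc: "F {} \<in> carrier A" by (rule PiE_mem) simp
  show "diff (koszul_ring A []) F = (\<lambda>I\<in>{{}}. diff A (F I))"
    unfolding koszul_ring_diff using Fc by (intro restrict_cong) auto
  assume G: "G \<in> {{}} \<rightarrow>\<^sub>E carrier A"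
  then have "G {} \<in> carrier A" by (rule PiE_mem) simp
  with Fc show "F \<otimes>\<^bsub>koszul_ring A []\<^esub> G = (\<lambda>I\<in>{{}}. F I \<otimes> G I)"
    unfolding koszul_ring_mult by (intro restrict_cong) auto
qed

lemma dg_ring_koszul_Nil: "dg_ring (koszul_ring A [])"
proof -
  let ?C = "koszul_ring A []"
  interpret dg_ring_copy A ?C "\<lambda>F. F {}" "\<lambda>u. \<lambda>I\<in>{{}}. u"
  proof (unfold_locales, goal_cases)
    case (4 z)
    show ?case
    proof
      fix I show "(\<lambda>I\<in>{{}}. z {}) I = z I"
        using 4 by (cases "I = {}") (auto simp: koszul_Nil_simps PiE_iff extensional_def)
    qed
  qed (simp_all add: koszul_Nil_simps PiE_iff extensional_def)
  show ?thesis by (rule dg_ring_C)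
qed

text \<open>The induction runs from the right end: the index of the last term is the largest, so
  adjoining it is an exterior extension of the ring on the initial segment.\<close>

theorem dg_ring_koszul:
  assumes "set as \<subseteq> homog A 0"
  shows "dg_ring (koszul_ring A as)"
  using assms
proof (induction as rule: rev_induct)
  case Nil
  show ?case by (rule dg_ring_koszul_Nil)
next
  case (snoc a as)
  interpret exterior_extension "koszul_ring A as" "koszul_ring A (as @ [a])"
    "koszul_fst (length as)" "koszul_snd A (length as)" "koszul_pair A (length as)" "koszul_const A (length as) a"
    by (rule koszul_exterior_extension) (use snoc in auto)
  show ?case by (rule dg_ring_C)
qed

end

lemma (in abelian_group) minus_eq_zeroD: "\<lbrakk>\<ominus> x = \<zero>; x \<in> carrier G\<rbrakk> \<Longrightarrow> x = \<zero>"
  using r_neg[of x] by simp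

section \<open>Complexes over a commutative ring\<close>

text \<open>Cohomology only sees homogeneous elements, so the laws are restricted to them. The
  action \<alpha> is a parameter and not a field of \<open>M\<close>, because the same ring A^0 has
  to act on DG-rings and on DG-modules over different rings.\<close>

locale scalar_complex = S: cring S + M: abelian_group M
  for S :: "('s, 'y) ring_scheme" and M :: "('m, 'x) dg_ring_scheme" +
  fixes \<alpha> :: "'s \<Rightarrow> 'm \<Rightarrow> 'm"
  assumes homog_subgroup: "additive_subgroup (homog M n) M"
    and diff_homog: "x \<in> homog M n \<Longrightarrow> diff M x \<in> homog M (n + 1)"
    and diff_add: "\<lbrakk>x \<in> homog M n; y \<in> homog M n\<rbrakk> \<Longrightarrow> diff M (x \<oplus>\<^bsub>M\<^esub> y) = diff M x \<oplus>\<^bsub>M\<^esub> diff M y"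
    and diff_diff: "x \<in> homog M n \<Longrightarrow> diff M (diff M x) = \<zero>\<^bsub>M\<^esub>"
    and act_homog: "\<lbrakk>s \<in> carrier S; x \<in> homog M n\<rbrakk> \<Longrightarrow> \<alpha> s x \<in> homog M n"
    and act_add: "\<lbrakk>s \<in> carrier S; x \<in> homog M n; y \<in> homog M n\<rbrakk> \<Longrightarrow> \<alpha> s (x \<oplus>\<^bsub>M\<^esub> y) = \<alpha> s x \<oplus>\<^bsub>M\<^esub> \<alpha> s y"
    and add_act: "\<lbrakk>s \<in> carrier S; t \<in> carrier S; x \<in> homog M n\<rbrakk> \<Longrightarrow> \<alpha> (s \<oplus>\<^bsub>S\<^esub> t) x = \<alpha> s x \<oplus>\<^bsub>M\<^esub> \<alpha> t x"
    and mult_act: "\<lbrakk>s \<in> carrier S; t \<in> carrier S; x \<in> homog M n\<rbrakk> \<Longrightarrow> \<alpha> (s \<otimes>\<^bsub>S\<^esub> t) x = \<alpha> s (\<alpha> t x)"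
    and one_act: "x \<in> homog M n \<Longrightarrow> \<alpha> \<one>\<^bsub>S\<^esub> x = x"
    and diff_act: "\<lbrakk>s \<in> carrier S; x \<in> homog M n\<rbrakk> \<Longrightarrow> diff M (\<alpha> s x) = \<alpha> s (diff M x)"
begin

lemma homog_carrier: "x \<in> homog M n \<Longrightarrow> x \<in> carrier M"
  using additive_subgroup.a_subset[OF homog_subgroup] by blast

lemma homog_zero [simp]: "\<zero>\<^bsub>M\<^esub> \<in> homog M n"
  by (rule additive_subgroup.zero_closed[OF homog_subgroup])

lemma homog_add [simp]: "\<lbrakk>x \<in> homog M n; y \<in> homog M n\<rbrakk> \<Longrightarrow> x \<oplus>\<^bsub>M\<^esub> y \<in> homog M n"
  by (rule additive_subgroup.a_closed[OF homog_subgroup])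

lemma homog_minus [simp]: "x \<in> homog M n \<Longrightarrow> \<ominus>\<^bsub>M\<^esub> x \<in> homog M n"
  by (rule additive_subgroup.a_inv_closed[OF homog_subgroup])

lemma diff_zero [simp]: "diff M \<zero>\<^bsub>M\<^esub> = \<zero>\<^bsub>M\<^esub>"
proof -
  have "diff M \<zero>\<^bsub>M\<^esub> \<in> carrier M" using diff_homog[of "\<zero>\<^bsub>M\<^esub>" 0] homog_carrier by auto
  moreover have "diff M \<zero>\<^bsub>M\<^esub> \<oplus>\<^bsub>M\<^esub> diff M \<zero>\<^bsub>M\<^esub> = diff M \<zero>\<^bsub>M\<^esub>"
    using diff_add[of "\<zero>\<^bsub>M\<^esub>" 0 "\<zero>\<^bsub>M\<^esub>"] by simp
  ultimately show ?thesis by (metis M.add.l_cancel_one')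
qed

lemma diff_minus: "x \<in> homog M n \<Longrightarrow> diff M (\<ominus>\<^bsub>M\<^esub> x) = \<ominus>\<^bsub>M\<^esub> diff M x"
  by (rule M.minus_equality[symmetric])
    (auto simp: M.l_neg homog_carrier intro!: homog_carrier[OF diff_homog, of _ n] simp flip: diff_add[of _ n])

lemma act_zero [simp]: "s \<in> carrier S \<Longrightarrow> \<alpha> s \<zero>\<^bsub>M\<^esub> = \<zero>\<^bsub>M\<^esub>"
proof -
  assume s: "s \<in> carrier S"
  then have "\<alpha> s \<zero>\<^bsub>M\<^esub> \<in> carrier M" using act_homog[of s "\<zero>\<^bsub>M\<^esub>" 0] homog_carrier by auto
  moreover have "\<alpha> s \<zero>\<^bsub>M\<^esub> \<oplus>\<^bsub>M\<^esub> \<alpha> s \<zero>\<^bsub>M\<^esub> = \<alpha> s \<zero>\<^bsub>M\<^esub>"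
    using act_add[of s "\<zero>\<^bsub>M\<^esub>" 0 "\<zero>\<^bsub>M\<^esub>"] s by simp
  ultimately show ?thesis by (metis M.add.l_cancel_one')
qed

lemma act_minus: "\<lbrakk>s \<in> carrier S; x \<in> homog M n\<rbrakk> \<Longrightarrow> \<alpha> s (\<ominus>\<^bsub>M\<^esub> x) = \<ominus>\<^bsub>M\<^esub> \<alpha> s x"
  by (rule M.minus_equality[symmetric])
    (auto simp: M.l_neg homog_carrier intro!: homog_carrier[OF act_homog, of _ _ n] simp flip: act_add[of _ _ n])

lemma zero_act: "x \<in> homog M n \<Longrightarrow> \<alpha> \<zero>\<^bsub>S\<^esub> x = \<zero>\<^bsub>M\<^esub>"
proof -
  assume x: "x \<in> homog M n"
  then have "\<alpha> \<zero>\<^bsub>S\<^esub> x \<in> carrier M" using act_homog homog_carrier by blast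
  moreover have "\<alpha> \<zero>\<^bsub>S\<^esub> x \<oplus>\<^bsub>M\<^esub> \<alpha> \<zero>\<^bsub>S\<^esub> x = \<alpha> \<zero>\<^bsub>S\<^esub> x"
    using add_act[of "\<zero>\<^bsub>S\<^esub>" "\<zero>\<^bsub>S\<^esub>" x n] x by simp
  ultimately show ?thesis by (metis M.add.l_cancel_one')
qed

lemma minus_act: "\<lbrakk>s \<in> carrier S; x \<in> homog M n\<rbrakk> \<Longrightarrow> \<alpha> (\<ominus>\<^bsub>S\<^esub> s) x = \<ominus>\<^bsub>M\<^esub> \<alpha> s x"
  by (rule M.minus_equality[symmetric])
    (auto simp: S.l_neg zero_act intro!: homog_carrier[OF act_homog, of _ _ n] simp flip: add_act[of _ _ _ n])

lemma act_commute:
  "\<lbrakk>s \<in> carrier S; t \<in> carrier S; x \<in> homog M n\<rbrakk> \<Longrightarrow> \<alpha> s (\<alpha> t x) = \<alpha> t (\<alpha> s x)"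
  by (metis S.m_comm mult_act)

lemma cocycles_homog: "z \<in> cocycles M n \<Longrightarrow> z \<in> homog M n"
  by (simp add: cocycles_def)

lemma coboundariesI: "w \<in> homog M (n - 1) \<Longrightarrow> diff M w \<in> coboundaries M n"
  by (simp add: coboundaries_def)

lemma coboundaries_cocycles: "coboundaries M n \<subseteq> cocycles M n"
  using diff_homog[of _ "n - 1"] diff_diff by (auto simp: coboundaries_def cocycles_def)

lemma coboundaries_zero [simp]: "\<zero>\<^bsub>M\<^esub> \<in> coboundaries M n"
  using coboundariesI[of "\<zero>\<^bsub>M\<^esub>" n] by simp

lemma coboundaries_add:
  "\<lbrakk>x \<in> coboundaries M n; y \<in> coboundaries M n\<rbrakk> \<Longrightarrow> x \<oplus>\<^bsub>M\<^esub> y \<in> coboundaries M n"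
  unfolding coboundaries_def by (auto simp flip: diff_add)

lemma coboundaries_act:
  "\<lbrakk>s \<in> carrier S; x \<in> coboundaries M n\<rbrakk> \<Longrightarrow> \<alpha> s x \<in> coboundaries M n"
  unfolding coboundaries_def by (auto simp: act_homog simp flip: diff_act)

lemma coboundaries_minus: "x \<in> coboundaries M n \<Longrightarrow> \<ominus>\<^bsub>M\<^esub> x \<in> coboundaries M n"
  unfolding coboundaries_def by (auto simp flip: diff_minus)

lemma cocycles_add: "\<lbrakk>x \<in> cocycles M n; y \<in> cocycles M n\<rbrakk> \<Longrightarrow> x \<oplus>\<^bsub>M\<^esub> y \<in> cocycles M n"
  by (auto simp: cocycles_def diff_add)

lemma cocycles_act: "\<lbrakk>s \<in> carrier S; x \<in> cocycles M n\<rbrakk> \<Longrightarrow> \<alpha> s x \<in> cocycles M n"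
  by (auto simp: cocycles_def diff_act act_homog)

lemma cocycles_minus: "x \<in> cocycles M n \<Longrightarrow> \<ominus>\<^bsub>M\<^esub> x \<in> cocycles M n"
  by (auto simp: cocycles_def diff_minus)

lemma add_eq_coboundaries:
  assumes "x \<oplus>\<^bsub>M\<^esub> y \<in> coboundaries M n" "y \<in> coboundaries M n" "x \<in> homog M n"
  shows "x \<in> coboundaries M n"
proof -
  have "y \<in> homog M n" using assms(2) coboundaries_cocycles cocycles_homog by blast
  then have "x = (x \<oplus>\<^bsub>M\<^esub> y) \<oplus>\<^bsub>M\<^esub> \<ominus>\<^bsub>M\<^esub> y"
    using assms(3) by (simp add: M.a_assoc homog_carrier M.r_neg)
  then show ?thesis using coboundaries_add[OF assms(1) coboundaries_minus[OF assms(2)]] by simp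
qed

text \<open>A submodule of \<open>H^n(M)\<close>, given by its preimage in the cocycles. Chains of
  such preimages express the noetherian condition without forming quotients.\<close>

definition between :: "int \<Rightarrow> 'm set \<Rightarrow> bool" where
  "between n X \<longleftrightarrow> coboundaries M n \<subseteq> X \<and> X \<subseteq> cocycles M n \<and>
    (\<forall>x\<in>X. \<forall>y\<in>X. x \<oplus>\<^bsub>M\<^esub> y \<in> X) \<and> (\<forall>s\<in>carrier S. \<forall>x\<in>X. \<alpha> s x \<in> X)"

definition noetherian_cohomology :: "int \<Rightarrow> bool" where
  "noetherian_cohomology n \<longleftrightarrow> (\<forall>X :: nat \<Rightarrow> 'm set.
    (\<forall>k. between n (X k) \<and> X k \<subseteq> X (Suc k)) \<longrightarrow> (\<exists>k. \<forall>l\<ge>k. X l = X k))"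

definition acyclic_at :: "int \<Rightarrow> bool" where
  "acyclic_at n \<longleftrightarrow> cocycles M n \<subseteq> coboundaries M n"

text \<open>Injectivity of \<open>x\<close> on \<open>H^n(M)\<close>, expressed on
  representatives.\<close>

definition regular_at :: "'s \<Rightarrow> int \<Rightarrow> bool" where
  "regular_at x n \<longleftrightarrow> (\<forall>z\<in>cocycles M n. \<alpha> x z \<in> coboundaries M n \<longrightarrow> z \<in> coboundaries M n)"

text \<open>Scalars with this property act as zero on all of cohomology and can be neglected in
  questions of regularity; they make it possible to compute with scalars modulo an ideal.\<close>

definition annihilates :: "'s \<Rightarrow> bool" where
  "annihilates x \<longleftrightarrow> (\<forall>n. \<forall>z\<in>cocycles M n. \<alpha> x z \<in> coboundaries M n)"

lemma between_minus:
  assumes "between n X" "x \<in> X" shows "\<ominus>\<^bsub>M\<^esub> x \<in> X"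
proof -
  have "x \<in> homog M n" using assms cocycles_homog by (auto simp: between_def)
  then have "\<ominus>\<^bsub>M\<^esub> x = \<alpha> (\<ominus>\<^bsub>S\<^esub> \<one>\<^bsub>S\<^esub>) x" by (simp add: minus_act one_act)
  then show ?thesis using assms by (simp add: between_def)
qed

lemma acyclic_imp_regular: "acyclic_at n \<Longrightarrow> regular_at x n"
  by (auto simp: acyclic_at_def regular_at_def)

lemma regular_annihilates_imp_acyclic: "\<lbrakk>regular_at x n; annihilates x\<rbrakk> \<Longrightarrow> acyclic_at n"
  by (auto simp: acyclic_at_def regular_at_def annihilates_def)

lemma regular_mult:
  "\<lbrakk>x \<in> carrier S; y \<in> carrier S; regular_at x n; regular_at y n\<rbrakk> \<Longrightarrow> regular_at (x \<otimes>\<^bsub>S\<^esub> y) n"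
  unfolding regular_at_def by (metis cocycles_act cocycles_homog mult_act)

lemma regular_cong:
  assumes s: "x \<in> carrier S" "y \<in> carrier S" and ann: "annihilates (x \<ominus>\<^bsub>S\<^esub> y)" and reg: "regular_at x n"
  shows "regular_at y n"
  unfolding regular_at_def
proof (intro ballI impI)
  fix z assume z: "z \<in> cocycles M n" "\<alpha> y z \<in> coboundaries M n"
  have "x = (x \<ominus>\<^bsub>S\<^esub> y) \<oplus>\<^bsub>S\<^esub> y" using s by (simp add: S.minus_eq S.a_assoc S.l_neg)
  then have "\<alpha> x z = \<alpha> (x \<ominus>\<^bsub>S\<^esub> y) z \<oplus>\<^bsub>M\<^esub> \<alpha> y z"
    using s z(1) by (metis S.minus_closed add_act cocycles_homog)
  then have "\<alpha> x z \<in> coboundaries M n"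
    using coboundaries_add z ann by (auto simp: annihilates_def)
  then show "z \<in> coboundaries M n" using reg z(1) by (auto simp: regular_at_def)
qed

text \<open>Up to a scalar acting as zero, \<open>e\<close> is an inverse of \<open>x\<close> on
  cohomology.\<close>

lemma regular_unit:
  assumes s: "e \<in> carrier S" "x \<in> carrier S" and ann: "annihilates (e \<otimes>\<^bsub>S\<^esub> x \<ominus>\<^bsub>S\<^esub> \<one>\<^bsub>S\<^esub>)"
  shows "regular_at x n"
  unfolding regular_at_def
proof (intro ballI impI)
  fix z assume z: "z \<in> cocycles M n" "\<alpha> x z \<in> coboundaries M n"
  let ?a = "e \<otimes>\<^bsub>S\<^esub> x \<ominus>\<^bsub>S\<^esub> \<one>\<^bsub>S\<^esub>"
  have zh: "z \<in> homog M n" using z cocycles_homog by blast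
  have "\<one>\<^bsub>S\<^esub> \<oplus>\<^bsub>S\<^esub> ?a = e \<otimes>\<^bsub>S\<^esub> x" using s by (simp add: S.minus_eq S.a_comm[of "e \<otimes>\<^bsub>S\<^esub> x"] S.r_neg2)
  then have "z \<oplus>\<^bsub>M\<^esub> \<alpha> ?a z = \<alpha> e (\<alpha> x z)"
    using s zh by (metis S.minus_closed S.m_closed S.one_closed add_act mult_act one_act)
  moreover have "\<alpha> e (\<alpha> x z) \<in> coboundaries M n" using coboundaries_act s z by blast
  ultimately show "z \<in> coboundaries M n"
    using add_eq_coboundaries zh ann z by (metis annihilates_def)
qed

text \<open>If \<open>x\<close> acted surjectively on a nonzero cohomology group, then a sequence with
  \<open>z k = x z (k + 1)\<close> would generate an increasing chain of submodules; where it becomes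
  stationary, \<open>z (k + 1)\<close> is a multiple \<open>c z k = c x z (k + 1)\<close>, so that it vanishes.\<close>

lemma nakayama:
  assumes noeth: "noetherian_cohomology n" and na: "\<not> acyclic_at n" and x: "x \<in> carrier S"
    and unit: "\<And>c. c \<in> carrier S \<Longrightarrow> \<exists>e\<in>carrier S. annihilates (e \<otimes>\<^bsub>S\<^esub> (\<one>\<^bsub>S\<^esub> \<ominus>\<^bsub>S\<^esub> c \<otimes>\<^bsub>S\<^esub> x) \<ominus>\<^bsub>S\<^esub> \<one>\<^bsub>S\<^esub>)"
  shows "\<exists>z\<in>cocycles M n. \<forall>w\<in>cocycles M n. \<forall>b\<in>coboundaries M n. z \<noteq> \<alpha> x w \<oplus>\<^bsub>M\<^esub> b"
proof (rule ccontr)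
  assume "\<not> ?thesis"
  then have "\<forall>z. \<exists>w. z \<in> cocycles M n \<longrightarrow> w \<in> cocycles M n \<and> (\<exists>b\<in>coboundaries M n. z = \<alpha> x w \<oplus>\<^bsub>M\<^esub> b)"
    by blast
  then obtain g where g: "\<And>z. z \<in> cocycles M n \<Longrightarrow> g z \<in> cocycles M n"
    "\<And>z. z \<in> cocycles M n \<Longrightarrow> \<exists>b\<in>coboundaries M n. z = \<alpha> x (g z) \<oplus>\<^bsub>M\<^esub> b"
    by metis
  obtain z0 where z0: "z0 \<in> cocycles M n" "z0 \<notin> coboundaries M n" using na by (auto simp: acyclic_at_def)
  define z where "z k = (g ^^ k) z0" for k
  have zc: "z k \<in> cocycles M n" for k by (induct k) (auto simp: z_def z0 g)
  then have zh: "z k \<in> homog M n" for k using cocycles_homog by blast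
  have step: "\<exists>b\<in>coboundaries M n. z k = \<alpha> x (z (Suc k)) \<oplus>\<^bsub>M\<^esub> b" for k
    using g(2)[OF zc[of k]] by (simp add: z_def)
  have zn: "z k \<notin> coboundaries M n" for k
  proof (induct k)
    case (Suc k)
    then show ?case using step[of k] coboundaries_act[OF x] coboundaries_add by metis
  qed (simp add: z_def z0)
  define X where "X k = {\<alpha> c (z k) \<oplus>\<^bsub>M\<^esub> b |c b. c \<in> carrier S \<and> b \<in> coboundaries M n}" for k
  have bh: "b \<in> homog M n" if "b \<in> coboundaries M n" for b using that coboundaries_cocycles cocycles_homog by blast
  have betw: "between n (X k)" for k
    unfolding between_def
  proof (intro conjI subsetI ballI)
    fix b assume b: "b \<in> coboundaries M n"
    then have "b = \<alpha> \<zero>\<^bsub>S\<^esub> (z k) \<oplus>\<^bsub>M\<^esub> b" using bh[OF b] homog_carrier zh by (simp add: zero_act[of _ n])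
    then show "b \<in> X k" using b unfolding X_def by blast
  next
    fix u assume "u \<in> X k"
    then show "u \<in> cocycles M n"
      using cocycles_add cocycles_act zc coboundaries_cocycles unfolding X_def by blast
  next
    fix u v assume "u \<in> X k" "v \<in> X k"
    then obtain c b c' b' where u: "u = \<alpha> c (z k) \<oplus>\<^bsub>M\<^esub> b" "c \<in> carrier S" "b \<in> coboundaries M n"
      and v: "v = \<alpha> c' (z k) \<oplus>\<^bsub>M\<^esub> b'" "c' \<in> carrier S" "b' \<in> coboundaries M n" unfolding X_def by blast
    have "\<alpha> c (z k) \<in> carrier M" "\<alpha> c' (z k) \<in> carrier M" "b \<in> carrier M" "b' \<in> carrier M"
      using u v act_homog zh bh homog_carrier by blast+
    then have "u \<oplus>\<^bsub>M\<^esub> v = \<alpha> (c \<oplus>\<^bsub>S\<^esub> c') (z k) \<oplus>\<^bsub>M\<^esub> (b \<oplus>\<^bsub>M\<^esub> b')"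
      using u v zh by (simp add: add_act[of _ _ _ n] M.a_ac)
    then show "u \<oplus>\<^bsub>M\<^esub> v \<in> X k" using u v coboundaries_add unfolding X_def by blast
  next
    fix s u assume s: "s \<in> carrier S" and "u \<in> X k"
    then obtain c b where u: "u = \<alpha> c (z k) \<oplus>\<^bsub>M\<^esub> b" "c \<in> carrier S" "b \<in> coboundaries M n"
      unfolding X_def by blast
    then have "\<alpha> s u = \<alpha> (s \<otimes>\<^bsub>S\<^esub> c) (z k) \<oplus>\<^bsub>M\<^esub> \<alpha> s b"
      using s zh bh act_homog by (simp add: act_add[of _ _ n] mult_act[of _ _ _ n])
    then show "\<alpha> s u \<in> X k" using s u coboundaries_act unfolding X_def by blast
  qed
  have mono: "X k \<subseteq> X (Suc k)" for k
  proof
    fix u assume "u \<in> X k"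
    then obtain c b where u: "u = \<alpha> c (z k) \<oplus>\<^bsub>M\<^esub> b" "c \<in> carrier S" "b \<in> coboundaries M n"
      unfolding X_def by blast
    obtain b' where b': "b' \<in> coboundaries M n" "z k = \<alpha> x (z (Suc k)) \<oplus>\<^bsub>M\<^esub> b'" using step by blast
    have h: "\<alpha> x (z (Suc k)) \<in> homog M n" using act_homog x zh by blast
    have "u = \<alpha> (c \<otimes>\<^bsub>S\<^esub> x) (z (Suc k)) \<oplus>\<^bsub>M\<^esub> (\<alpha> c b' \<oplus>\<^bsub>M\<^esub> b)"
      unfolding u(1) b'(2) using u(2) x h bh[OF b'(1)] bh[OF u(3)] zh[of "Suc k"]
      by (simp add: act_add[of _ _ n] mult_act[of _ _ _ n] M.a_assoc homog_carrier homog_carrier[OF act_homog])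
    then show "u \<in> X (Suc k)"
      using u b' x coboundaries_add coboundaries_act S.m_closed unfolding X_def by blast
  qed
  obtain k where "X (Suc k) = X k"
    using noeth betw mono unfolding noetherian_cohomology_def by (metis le_SucI order_refl)
  moreover have "z (Suc k) = \<alpha> \<one>\<^bsub>S\<^esub> (z (Suc k)) \<oplus>\<^bsub>M\<^esub> \<zero>\<^bsub>M\<^esub>" using zh[of "Suc k"] homog_carrier[OF zh] by (simp add: one_act[of _ n])
  then have "z (Suc k) \<in> X (Suc k)" using coboundaries_zero unfolding X_def by blast
  ultimately obtain c b where c: "z (Suc k) = \<alpha> c (z k) \<oplus>\<^bsub>M\<^esub> b" "c \<in> carrier S" "b \<in> coboundaries M n"
    unfolding X_def by blast
  obtain b' where b': "b' \<in> coboundaries M n" "z k = \<alpha> x (z (Suc k)) \<oplus>\<^bsub>M\<^esub> b'" using step by blast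
  let ?w = "z (Suc k)"
  have cx: "\<alpha> (c \<otimes>\<^bsub>S\<^esub> x) ?w \<in> homog M n" "\<alpha> c b' \<in> homog M n" "\<alpha> x ?w \<in> homog M n"
    using c x act_homog zh bh b' by auto
  have eq: "?w = \<alpha> (c \<otimes>\<^bsub>S\<^esub> x) ?w \<oplus>\<^bsub>M\<^esub> (\<alpha> c b' \<oplus>\<^bsub>M\<^esub> b)"
  proof -
    have "?w = \<alpha> c (\<alpha> x ?w \<oplus>\<^bsub>M\<^esub> b') \<oplus>\<^bsub>M\<^esub> b" using c(1) b'(2) by simp
    also have "\<dots> = \<alpha> (c \<otimes>\<^bsub>S\<^esub> x) ?w \<oplus>\<^bsub>M\<^esub> (\<alpha> c b' \<oplus>\<^bsub>M\<^esub> b)"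
      using c(2) x cx b'(1) bh[OF c(3)] bh[OF b'(1)] zh[of "Suc k"]
      by (simp add: act_add[of _ _ n] mult_act[of _ _ _ n] M.a_assoc homog_carrier homog_carrier[OF act_homog])
    finally show ?thesis .
  qed
  have "\<alpha> (\<one>\<^bsub>S\<^esub> \<ominus>\<^bsub>S\<^esub> c \<otimes>\<^bsub>S\<^esub> x) ?w = ?w \<oplus>\<^bsub>M\<^esub> \<ominus>\<^bsub>M\<^esub> \<alpha> (c \<otimes>\<^bsub>S\<^esub> x) ?w"
    using c x zh[of "Suc k"] by (simp add: S.minus_eq add_act[of _ _ _ n] minus_act[of _ _ n] one_act[of _ n])
  also have "\<dots> = \<alpha> c b' \<oplus>\<^bsub>M\<^esub> b"
    using eq cx c(3) bh homog_carrier by (metis M.add.m_comm M.r_neg2 homog_add homog_minus M.a_inv_closed M.a_assoc M.r_neg1)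
  also have "\<dots> \<in> coboundaries M n" using c b' coboundaries_add coboundaries_act by blast
  finally have *: "\<alpha> (\<one>\<^bsub>S\<^esub> \<ominus>\<^bsub>S\<^esub> c \<otimes>\<^bsub>S\<^esub> x) ?w \<in> coboundaries M n" .
  \<comment> \<open>The scalar \<open>1 - c x\<close> is invertible on cohomology and sends the
    class of \<open>?w\<close> to 0, although \<open>?w\<close> is not a coboundary.\<close>
  obtain e where "e \<in> carrier S" "annihilates (e \<otimes>\<^bsub>S\<^esub> (\<one>\<^bsub>S\<^esub> \<ominus>\<^bsub>S\<^esub> c \<otimes>\<^bsub>S\<^esub> x) \<ominus>\<^bsub>S\<^esub> \<one>\<^bsub>S\<^esub>)" using unit c by blast
  then have "regular_at (\<one>\<^bsub>S\<^esub> \<ominus>\<^bsub>S\<^esub> c \<otimes>\<^bsub>S\<^esub> x) n" using regular_unit c x by simp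
  with * zc zn show False by (auto simp: regular_at_def)
qed

end

text \<open>The mapping cone of \<open>x\<close>: \<open>N\<close> consists of \<open>M\<close> and
  a shifted copy of \<open>M\<close>, in the coordinates \<open>p + e q\<close> of
  \<open>exterior_extension\<close>. Its long exact sequence contains
  \<open>H^n(M) -> H^n(N) -> H^(n+1)(M) -> H^(n+1)(M)\<close> with \<open>x\<close> as the last map;
  the lemmas on acyclicity extract the portions of it that are used.\<close>

locale complex_cone = M: scalar_complex S M \<alpha> + pair_group M N p q j
  for S :: "('s, 'y) ring_scheme" and M :: "('m, 'x) dg_ring_scheme" and \<alpha>
    and N :: "('n, 'w) dg_ring_scheme" and p q j +
  fixes \<beta> :: "'s \<Rightarrow> 'n \<Rightarrow> 'n" and x :: 's
  assumes x [simp]: "x \<in> carrier S"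
    and homog_eq: "homog N n = {z \<in> carrier N. p z \<in> homog M n \<and> q z \<in> homog M (n + 1)}"
    and d_closed: "z \<in> homog N n \<Longrightarrow> diff N z \<in> carrier N"
    and p_diff: "z \<in> homog N n \<Longrightarrow> p (diff N z) = diff M (p z) \<oplus>\<^bsub>M\<^esub> \<alpha> x (q z)"
    and q_diff: "z \<in> homog N n \<Longrightarrow> q (diff N z) = \<ominus>\<^bsub>M\<^esub> diff M (q z)"
    and act_closed: "\<lbrakk>s \<in> carrier S; z \<in> homog N n\<rbrakk> \<Longrightarrow> \<beta> s z \<in> carrier N"
    and p_act: "\<lbrakk>s \<in> carrier S; z \<in> homog N n\<rbrakk> \<Longrightarrow> p (\<beta> s z) = \<alpha> s (p z)"
    and q_act: "\<lbrakk>s \<in> carrier S; z \<in> homog N n\<rbrakk> \<Longrightarrow> q (\<beta> s z) = \<alpha> s (q z)"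
begin

lemma homogD:
  assumes "z \<in> homog N n"
  shows "z \<in> carrier N" "p z \<in> homog M n" "q z \<in> homog M (n + 1)"
  using assms by (auto simp: homog_eq)

lemma homog_j: "\<lbrakk>u \<in> homog M n; v \<in> homog M (n + 1)\<rbrakk> \<Longrightarrow> j u v \<in> homog N n"
  by (auto simp: homog_eq M.homog_carrier)

lemma homog_p_j: "\<lbrakk>u \<in> homog M n; v \<in> homog M k\<rbrakk> \<Longrightarrow> p (j u v) = u"
  and homog_q_j: "\<lbrakk>u \<in> homog M n; v \<in> homog M k\<rbrakk> \<Longrightarrow> q (j u v) = v"
  by (auto simp: M.homog_carrier)

lemma homogI: "\<lbrakk>z \<in> carrier N; p z \<in> homog M n; q z \<in> homog M (n + 1)\<rbrakk> \<Longrightarrow> z \<in> homog N n"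
  by (simp add: homog_eq)

lemma homog_diff:
  assumes z: "z \<in> homog N n" shows "diff N z \<in> homog N (n + 1)"
proof (rule homogI)
  note zD = homogD[OF z]
  show "diff N z \<in> carrier N" by (rule d_closed[OF z])
  show "p (diff N z) \<in> homog M (n + 1)"
    unfolding p_diff[OF z] by (intro M.homog_add M.diff_homog M.act_homog x zD)
  show "q (diff N z) \<in> homog M (n + 1 + 1)"
    unfolding q_diff[OF z] by (intro M.homog_minus M.diff_homog zD)
qed

lemma homog_act:
  assumes s: "s \<in> carrier S" and z: "z \<in> homog N n" shows "\<beta> s z \<in> homog N n"
proof (rule homogI)
  show "\<beta> s z \<in> carrier N" by (rule act_closed[OF s z])
  show "p (\<beta> s z) \<in> homog M n" "q (\<beta> s z) \<in> homog M (n + 1)"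
    unfolding p_act[OF s z] q_act[OF s z] by (intro M.act_homog s homogD[OF z])+
qed

lemma homog_add: "\<lbrakk>z \<in> homog N n; w \<in> homog N n\<rbrakk> \<Longrightarrow> z \<oplus>\<^bsub>N\<^esub> w \<in> homog N n"
  by (auto simp: homog_eq)

lemma homog_eqI: "\<lbrakk>z \<in> homog N n; w \<in> homog N n; p z = p w; q z = q w\<rbrakk> \<Longrightarrow> z = w"
  by (rule eqI) (auto simp: homog_eq)

lemma homog_p_add: "\<lbrakk>z \<in> homog N n; w \<in> homog N n\<rbrakk> \<Longrightarrow> p (z \<oplus>\<^bsub>N\<^esub> w) = p z \<oplus>\<^bsub>M\<^esub> p w"
  and homog_q_add: "\<lbrakk>z \<in> homog N n; w \<in> homog N n\<rbrakk> \<Longrightarrow> q (z \<oplus>\<^bsub>N\<^esub> w) = q z \<oplus>\<^bsub>M\<^esub> q w"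
  by (auto simp: homog_eq)

lemma homog_diff_diff: assumes z: "z \<in> homog N n" shows "diff N (diff N z) = \<zero>\<^bsub>N\<^esub>"
proof (rule eqI)
  note zD = homogD[OF z] homog_diff[OF z]
  show "diff N (diff N z) \<in> carrier N" by (rule d_closed[OF zD(4)])
  have c: "diff M (p z) \<in> homog M (n+1)" "\<alpha> x (q z) \<in> homog M (n+1)" "diff M (q z) \<in> homog M (n+1+1)"
    using M.diff_homog M.act_homog zD x by blast+
  have d: "\<alpha> x (diff M (q z)) \<in> carrier M"
    using c M.act_homog M.homog_carrier x by blast
  show "p (diff N (diff N z)) = p \<zero>\<^bsub>N\<^esub>"
    unfolding p_diff[OF zD(4)] unfolding p_diff[OF z] q_diff[OF z] M.diff_add[OF c(1,2)]
      M.act_minus[OF x c(3)] M.diff_act[OF x zD(3)] M.diff_diff[OF zD(2)]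
    using d by (simp add: M.M.r_neg)
  show "q (diff N (diff N z)) = q \<zero>\<^bsub>N\<^esub>"
    unfolding q_diff[OF zD(4)] unfolding q_diff[OF z] M.diff_minus[OF c(3)] M.diff_diff[OF zD(3)] by simp
qed simp

lemma homog_diff_add:
  assumes z: "z \<in> homog N n" and w: "w \<in> homog N n"
  shows "diff N (z \<oplus>\<^bsub>N\<^esub> w) = diff N z \<oplus>\<^bsub>N\<^esub> diff N w"
proof (rule homog_eqI[of _ "n + 1"])
  note zD = homogD[OF z] homog_diff[OF z] and wD = homogD[OF w] homog_diff[OF w]
  have zw: "z \<oplus>\<^bsub>N\<^esub> w \<in> homog N n" by (rule homog_add[OF z w])
  show "diff N (z \<oplus>\<^bsub>N\<^esub> w) \<in> homog N (n + 1)" "diff N z \<oplus>\<^bsub>N\<^esub> diff N w \<in> homog N (n + 1)"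
    by (rule homog_diff[OF zw], rule homog_add[OF zD(4) wD(4)])
  have c: "diff M (p z) \<in> carrier M" "diff M (p w) \<in> carrier M" "\<alpha> x (q z) \<in> carrier M" "\<alpha> x (q w) \<in> carrier M"
    "diff M (q z) \<in> carrier M" "diff M (q w) \<in> carrier M"
    using M.diff_homog M.act_homog M.homog_carrier zD wD x by blast+
  show "p (diff N (z \<oplus>\<^bsub>N\<^esub> w)) = p (diff N z \<oplus>\<^bsub>N\<^esub> diff N w)"
    unfolding homog_p_add[OF zD(4) wD(4)] p_diff[OF zw] p_diff[OF z] p_diff[OF w] homog_p_add[OF z w] homog_q_add[OF z w]
      M.diff_add[OF zD(2) wD(2)] M.act_add[OF x zD(3) wD(3)]
    using c by (simp add: M.M.a_ac)
  show "q (diff N (z \<oplus>\<^bsub>N\<^esub> w)) = q (diff N z \<oplus>\<^bsub>N\<^esub> diff N w)"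
    unfolding homog_q_add[OF zD(4) wD(4)] q_diff[OF zw] q_diff[OF z] q_diff[OF w] homog_q_add[OF z w]
      M.diff_add[OF zD(3) wD(3)]
    using c by (simp add: M.M.minus_add)
qed

lemma homog_diff_act:
  assumes s: "s \<in> carrier S" and z: "z \<in> homog N n"
  shows "diff N (\<beta> s z) = \<beta> s (diff N z)"
proof (rule homog_eqI[of _ "n + 1"])
  note zD = homogD[OF z] homog_diff[OF z]
  have b: "\<beta> s z \<in> homog N n" by (rule homog_act[OF s z])
  show "diff N (\<beta> s z) \<in> homog N (n + 1)" "\<beta> s (diff N z) \<in> homog N (n + 1)"
    by (rule homog_diff[OF b], rule homog_act[OF s zD(4)])
  have c: "diff M (p z) \<in> homog M (n+1)" "\<alpha> x (q z) \<in> homog M (n+1)" "diff M (q z) \<in> homog M (n+1+1)"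
    using M.diff_homog M.act_homog zD x by blast+
  show "p (diff N (\<beta> s z)) = p (\<beta> s (diff N z))"
    unfolding p_diff[OF b] p_act[OF s zD(4)] p_diff[OF z] M.act_add[OF s c(1,2)] p_act[OF s z] q_act[OF s z]
      M.diff_act[OF s zD(2)] M.act_commute[OF x s zD(3)] ..
  show "q (diff N (\<beta> s z)) = q (\<beta> s (diff N z))"
    unfolding q_diff[OF b] q_act[OF s zD(4)] q_diff[OF z] M.act_minus[OF s c(3)] q_act[OF s z] M.diff_act[OF s zD(3)] ..
qed

lemma homog_act_add:
  assumes s: "s \<in> carrier S" and z: "z \<in> homog N n" and w: "w \<in> homog N n"
  shows "\<beta> s (z \<oplus>\<^bsub>N\<^esub> w) = \<beta> s z \<oplus>\<^bsub>N\<^esub> \<beta> s w"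
proof (rule homog_eqI[of _ n])
  have zw: "z \<oplus>\<^bsub>N\<^esub> w \<in> homog N n" by (rule homog_add[OF z w])
  have b: "\<beta> s z \<in> homog N n" "\<beta> s w \<in> homog N n" by (rule homog_act[OF s z], rule homog_act[OF s w])
  show "\<beta> s (z \<oplus>\<^bsub>N\<^esub> w) \<in> homog N n" "\<beta> s z \<oplus>\<^bsub>N\<^esub> \<beta> s w \<in> homog N n"
    by (rule homog_act[OF s zw], rule homog_add[OF b])
  show "p (\<beta> s (z \<oplus>\<^bsub>N\<^esub> w)) = p (\<beta> s z \<oplus>\<^bsub>N\<^esub> \<beta> s w)"
    unfolding p_act[OF s zw] homog_p_add[OF z w] homog_p_add[OF b] p_act[OF s z] p_act[OF s w]
    by (rule M.act_add[OF s homogD(2)[OF z] homogD(2)[OF w]])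
  show "q (\<beta> s (z \<oplus>\<^bsub>N\<^esub> w)) = q (\<beta> s z \<oplus>\<^bsub>N\<^esub> \<beta> s w)"
    unfolding q_act[OF s zw] homog_q_add[OF z w] homog_q_add[OF b] q_act[OF s z] q_act[OF s w]
    by (rule M.act_add[OF s homogD(3)[OF z] homogD(3)[OF w]])
qed

lemma homog_add_act:
  assumes s: "s \<in> carrier S" and t: "t \<in> carrier S" and z: "z \<in> homog N n"
  shows "\<beta> (s \<oplus>\<^bsub>S\<^esub> t) z = \<beta> s z \<oplus>\<^bsub>N\<^esub> \<beta> t z"
proof (rule homog_eqI[of _ n])
  have st: "s \<oplus>\<^bsub>S\<^esub> t \<in> carrier S" using s t by simp
  have b: "\<beta> s z \<in> homog N n" "\<beta> t z \<in> homog N n" by (rule homog_act[OF s z], rule homog_act[OF t z])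
  show "\<beta> (s \<oplus>\<^bsub>S\<^esub> t) z \<in> homog N n" "\<beta> s z \<oplus>\<^bsub>N\<^esub> \<beta> t z \<in> homog N n"
    by (rule homog_act[OF st z], rule homog_add[OF b])
  show "p (\<beta> (s \<oplus>\<^bsub>S\<^esub> t) z) = p (\<beta> s z \<oplus>\<^bsub>N\<^esub> \<beta> t z)"
    unfolding p_act[OF st z] homog_p_add[OF b] p_act[OF s z] p_act[OF t z]
    by (rule M.add_act[OF s t homogD(2)[OF z]])
  show "q (\<beta> (s \<oplus>\<^bsub>S\<^esub> t) z) = q (\<beta> s z \<oplus>\<^bsub>N\<^esub> \<beta> t z)"
    unfolding q_act[OF st z] homog_q_add[OF b] q_act[OF s z] q_act[OF t z]
    by (rule M.add_act[OF s t homogD(3)[OF z]])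
qed

lemma homog_mult_act:
  assumes s: "s \<in> carrier S" and t: "t \<in> carrier S" and z: "z \<in> homog N n"
  shows "\<beta> (s \<otimes>\<^bsub>S\<^esub> t) z = \<beta> s (\<beta> t z)"
proof (rule homog_eqI[of _ n])
  have st: "s \<otimes>\<^bsub>S\<^esub> t \<in> carrier S" using s t by simp
  have b: "\<beta> t z \<in> homog N n" by (rule homog_act[OF t z])
  show "\<beta> (s \<otimes>\<^bsub>S\<^esub> t) z \<in> homog N n" "\<beta> s (\<beta> t z) \<in> homog N n"
    by (rule homog_act[OF st z], rule homog_act[OF s b])
  show "p (\<beta> (s \<otimes>\<^bsub>S\<^esub> t) z) = p (\<beta> s (\<beta> t z))"
    unfolding p_act[OF st z] p_act[OF s b] p_act[OF t z] by (rule M.mult_act[OF s t homogD(2)[OF z]])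
  show "q (\<beta> (s \<otimes>\<^bsub>S\<^esub> t) z) = q (\<beta> s (\<beta> t z))"
    unfolding q_act[OF st z] q_act[OF s b] q_act[OF t z] by (rule M.mult_act[OF s t homogD(3)[OF z]])
qed

lemma homog_one_act: assumes z: "z \<in> homog N n" shows "\<beta> \<one>\<^bsub>S\<^esub> z = z"
proof (rule homog_eqI[OF _ z])
  show "p (\<beta> \<one>\<^bsub>S\<^esub> z) = p z" "q (\<beta> \<one>\<^bsub>S\<^esub> z) = q z"
    using homogD[OF z] by (simp_all add: p_act[OF _ z] q_act[OF _ z] M.one_act[of _ n] M.one_act[of _ "n + 1"])
qed (rule homog_act[OF _ z], simp)

sublocale N: scalar_complex S N \<beta>
proof (intro scalar_complex.intro scalar_complex_axioms.intro M.S.is_cring C.abelian_group_axioms)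
  show "additive_subgroup (homog N n) N" for n
  proof (rule additive_subgroupI, rule C.add.subgroupI)
    show "homog N n \<noteq> {}" by (auto simp: homog_eq intro!: exI[of _ "\<zero>\<^bsub>N\<^esub>"])
  qed (auto simp: homog_eq simp flip: a_inv_def)
  fix n z assume z: "z \<in> homog N n"
  show "diff N z \<in> homog N (n + 1)" by (rule homog_diff[OF z])
  show "diff N (diff N z) = \<zero>\<^bsub>N\<^esub>" by (rule homog_diff_diff[OF z])
  show "\<beta> \<one>\<^bsub>S\<^esub> z = z" by (rule homog_one_act[OF z])
  show "diff N (z \<oplus>\<^bsub>N\<^esub> w) = diff N z \<oplus>\<^bsub>N\<^esub> diff N w" if "w \<in> homog N n" for w
    by (rule homog_diff_add[OF z that])
  fix s assume s: "s \<in> carrier S"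
  show "\<beta> s z \<in> homog N n" by (rule homog_act[OF s z])
  show "diff N (\<beta> s z) = \<beta> s (diff N z)" by (rule homog_diff_act[OF s z])
  show "\<beta> s (z \<oplus>\<^bsub>N\<^esub> w) = \<beta> s z \<oplus>\<^bsub>N\<^esub> \<beta> s w" if "w \<in> homog N n" for w
    by (rule homog_act_add[OF s z that])
  fix t assume t: "t \<in> carrier S"
  show "\<beta> (s \<oplus>\<^bsub>S\<^esub> t) z = \<beta> s z \<oplus>\<^bsub>N\<^esub> \<beta> t z" by (rule homog_add_act[OF s t z])
  show "\<beta> (s \<otimes>\<^bsub>S\<^esub> t) z = \<beta> s (\<beta> t z)" by (rule homog_mult_act[OF s t z])
qed

text \<open>In the long exact sequence, \<open>H^n(N)\<close> lies between \<open>H^n(M)\<close> and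
  the kernel of \<open>x\<close> on \<open>H^(n+1)(M)\<close>, and both vanish.\<close>

lemma regular_imp_acyclic:
  assumes M: "M.acyclic_at n" and reg: "M.regular_at x (n + 1)"
  shows "N.acyclic_at n"
  unfolding N.acyclic_at_def
proof
  fix z assume "z \<in> cocycles N n"
  then have z: "z \<in> homog N n" "diff N z = \<zero>\<^bsub>N\<^esub>" by (auto simp: cocycles_def)
  note zD = homogD[OF z(1)]
  have c: "diff M (p z) \<in> carrier M" "\<alpha> x (q z) \<in> carrier M" "diff M (q z) \<in> carrier M"
    using M.diff_homog M.act_homog M.homog_carrier zD x by blast+
  have dp: "diff M (p z) \<oplus>\<^bsub>M\<^esub> \<alpha> x (q z) = \<zero>\<^bsub>M\<^esub>" using p_diff[OF z(1)] z(2) by simp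
  have "\<ominus>\<^bsub>M\<^esub> diff M (q z) = \<zero>\<^bsub>M\<^esub>" using q_diff[OF z(1)] z(2) by simp
  then have dq: "diff M (q z) = \<zero>\<^bsub>M\<^esub>" using c(3) by (rule M.M.minus_eq_zeroD)
  have "\<alpha> x (q z) = \<ominus>\<^bsub>M\<^esub> diff M (p z)" using dp c by (intro M.M.minus_equality[symmetric]) (simp_all add: M.M.a_comm)
  also have "\<dots> = diff M (\<ominus>\<^bsub>M\<^esub> p z)" using M.diff_minus[OF zD(2)] by simp
  finally have "\<alpha> x (q z) \<in> coboundaries M (n + 1)" using zD(2) by (auto simp: coboundaries_def)
  then have "q z \<in> coboundaries M (n + 1)"
    using reg dq zD(3) by (auto simp: M.regular_at_def cocycles_def)
  then obtain w where w: "w \<in> homog M n" "q z = diff M w" by (auto simp: coboundaries_def)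
  have wx: "\<alpha> x w \<in> homog M n" by (rule M.act_homog[OF x w(1)])
  have "diff M (p z \<oplus>\<^bsub>M\<^esub> \<alpha> x w) = \<zero>\<^bsub>M\<^esub>"
    using M.diff_add[OF zD(2) wx] dp w M.diff_act[OF x w(1)] by simp
  then have "p z \<oplus>\<^bsub>M\<^esub> \<alpha> x w \<in> cocycles M n" using zD(2) wx by (simp add: cocycles_def)
  then obtain u where u: "u \<in> homog M (n - 1)" "p z \<oplus>\<^bsub>M\<^esub> \<alpha> x w = diff M u"
    using M by (auto simp: M.acyclic_at_def coboundaries_def)
  \<comment> \<open>With \<open>q z = d w\<close>, subtracting the boundary of \<open>- e w\<close>
    from \<open>z\<close> leaves \<open>p z + x w\<close>, a cocycle of \<open>M\<close>; its
    primitive \<open>u\<close> completes a primitive of \<open>z\<close>.\<close>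
  let ?y = "j u (\<ominus>\<^bsub>M\<^esub> w)"
  have y: "?y \<in> homog N (n - 1)" by (rule homog_j) (use u w in auto)
  have "diff N ?y = z"
  proof (rule homog_eqI[OF _ z(1)])
    show "diff N ?y \<in> homog N n" using homog_diff[OF y] by simp
    have "\<alpha> x (\<ominus>\<^bsub>M\<^esub> w) = \<ominus>\<^bsub>M\<^esub> \<alpha> x w" by (rule M.act_minus[OF x w(1)])
    then show "p (diff N ?y) = p z"
      using p_diff[OF y] u(1) w(1) M.homog_carrier[OF wx] M.homog_carrier[OF zD(2)]
      by (simp add: homog_p_j[of _ "n - 1" _ n] homog_q_j[of _ "n - 1" _ n] M.M.a_assoc M.M.r_neg flip: u(2))
    show "q (diff N ?y) = q z"
      using q_diff[OF y] u(1) w M.diff_minus[OF w(1)] M.homog_carrier[OF M.diff_homog[OF w(1)]]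
      by (simp add: homog_q_j[of _ "n - 1" _ n])
  qed
  then show "z \<in> coboundaries N n" using y by (auto simp: coboundaries_def)
qed

text \<open>Exactness at \<open>H^(n+1)(M)\<close>: a class killed by \<open>x\<close> lifts to a
  cocycle of \<open>N\<close> whose first component is a primitive of \<open>- x v\<close>. A
  primitive of this lift contains one of \<open>v\<close>, up to sign.\<close>

lemma acyclic_imp_regular_above:
  assumes "N.acyclic_at n"
  shows "M.regular_at x (n + 1)"
  unfolding M.regular_at_def
proof (intro ballI impI)
  fix v assume v: "v \<in> cocycles M (n + 1)" "\<alpha> x v \<in> coboundaries M (n + 1)"
  then obtain u where u: "u \<in> homog M n" "\<alpha> x v = diff M u" by (auto simp: coboundaries_def)
  have vh: "v \<in> homog M (n + 1)" "diff M v = \<zero>\<^bsub>M\<^esub>" using v by (auto simp: cocycles_def)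
  let ?z = "j (\<ominus>\<^bsub>M\<^esub> u) v"
  have z: "?z \<in> homog N n" by (rule homog_j) (use u vh in auto)
  have pq: "p ?z = \<ominus>\<^bsub>M\<^esub> u" "q ?z = v" using u vh by (auto simp: homog_p_j[of _ n _ "n+1"] homog_q_j[of _ n _ "n+1"])
  have "diff M u \<in> carrier M" using M.diff_homog[OF u(1)] M.homog_carrier by blast
  then have "diff N ?z = \<zero>\<^bsub>N\<^esub>"
    using M.diff_minus[OF u(1)]
    by (intro eqI) (auto simp: d_closed[OF z] p_diff[OF z] q_diff[OF z] pq u(2) vh M.M.l_neg)
  then have "?z \<in> coboundaries N n" using assms z by (auto simp: N.acyclic_at_def cocycles_def)
  then obtain y where y: "y \<in> homog N (n - 1)" "?z = diff N y" by (auto simp: coboundaries_def)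
  have qy: "q y \<in> homog M n" using homogD(3)[OF y(1)] by simp
  have "v = \<ominus>\<^bsub>M\<^esub> diff M (q y)" using q_diff[OF y(1)] y(2) pq by simp
  also have "\<dots> = diff M (\<ominus>\<^bsub>M\<^esub> q y)" using M.diff_minus[OF qy] by simp
  finally show "v \<in> coboundaries M (n + 1)" using qy by (auto simp: coboundaries_def)
qed

text \<open>The quotient of \<open>H^n(M)\<close> by the image of \<open>x\<close> embeds into
  \<open>H^n(N)\<close>, and Nakayama's lemma makes this quotient nonzero.\<close>

lemma not_acyclic_cone:
  assumes "M.noetherian_cohomology n" "\<not> M.acyclic_at n"
    and unit: "\<And>c. c \<in> carrier S \<Longrightarrow> \<exists>e\<in>carrier S. M.annihilates (e \<otimes>\<^bsub>S\<^esub> (\<one>\<^bsub>S\<^esub> \<ominus>\<^bsub>S\<^esub> c \<otimes>\<^bsub>S\<^esub> x) \<ominus>\<^bsub>S\<^esub> \<one>\<^bsub>S\<^esub>)"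
  shows "\<not> N.acyclic_at n"
proof
  assume ac: "N.acyclic_at n"
  obtain u where u: "u \<in> cocycles M n" "\<And>w b. \<lbrakk>w \<in> cocycles M n; b \<in> coboundaries M n\<rbrakk> \<Longrightarrow> u \<noteq> \<alpha> x w \<oplus>\<^bsub>M\<^esub> b"
    using M.nakayama[OF assms(1,2) x unit] by blast
  let ?z = "j u \<zero>\<^bsub>M\<^esub>"
  have uh: "u \<in> homog M n" "diff M u = \<zero>\<^bsub>M\<^esub>" using u by (auto simp: cocycles_def)
  have z: "?z \<in> homog N n" by (rule homog_j) (use uh in auto)
  have pq: "p ?z = u" "q ?z = \<zero>\<^bsub>M\<^esub>" using uh M.homog_carrier by auto
  have "diff N ?z = \<zero>\<^bsub>N\<^esub>"
    by (intro eqI) (auto simp: d_closed[OF z] p_diff[OF z] q_diff[OF z] pq uh)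
  then have "?z \<in> coboundaries N n" using ac z by (auto simp: N.acyclic_at_def cocycles_def)
  then obtain y where y: "y \<in> homog N (n - 1)" "?z = diff N y" by (auto simp: coboundaries_def)
  note yD = homogD[OF y(1)]
  have qy: "q y \<in> homog M n" using yD(3) by simp
  have c: "diff M (q y) \<in> carrier M" "diff M (p y) \<in> carrier M" "\<alpha> x (q y) \<in> carrier M"
    using M.diff_homog M.act_homog M.homog_carrier yD x by blast+
  have "\<ominus>\<^bsub>M\<^esub> diff M (q y) = \<zero>\<^bsub>M\<^esub>" using q_diff[OF y(1)] y(2) pq by simp
  then have "diff M (q y) = \<zero>\<^bsub>M\<^esub>" using c(1) by (rule M.M.minus_eq_zeroD)
  then have "q y \<in> cocycles M n" using qy by (simp add: cocycles_def)
  moreover have "u = \<alpha> x (q y) \<oplus>\<^bsub>M\<^esub> diff M (p y)"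
    using p_diff[OF y(1)] y(2) pq c by (simp add: M.M.a_comm)
  ultimately show False using u(2) yD(2) by (metis M.coboundariesI)
qed

text \<open>The extension \<open>0 \<rightarrow> M \<rightarrow> N \<rightarrow> M[1] \<rightarrow> 0\<close> splits an increasing chain of submodules of
  \<open>H\<^sup>n(N)\<close> into a chain in \<open>H\<^sup>n(M)\<close> and a chain in \<open>H\<^sup>n\<^sup>+\<^sup>1(M)\<close>.\<close>

lemma noetherian_cone:
  assumes "M.noetherian_cohomology n" "M.noetherian_cohomology (n + 1)"
  shows "N.noetherian_cohomology n"
  unfolding N.noetherian_cohomology_def
proof (intro allI impI)
  fix X :: "nat \<Rightarrow> _" assume X: "\<forall>k. N.between n (X k) \<and> X k \<subseteq> X (Suc k)"
  then have Xk: "N.between n (X k)" "X k \<subseteq> X (Suc k)" for k by simp_all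
  have Xc: "z \<in> homog N n" "diff N z = \<zero>\<^bsub>N\<^esub>" if "z \<in> X k" for z k
    using Xk(1)[of k] that by (auto simp: N.between_def cocycles_def)
  have Xb: "coboundaries N n \<subseteq> X k" for k using Xk(1)[of k] by (simp add: N.between_def)
  have Xadd: "z \<oplus>\<^bsub>N\<^esub> w \<in> X k" if "z \<in> X k" "w \<in> X k" for z w k
    using Xk(1)[of k] that by (simp add: N.between_def)
  have Xact: "\<beta> s z \<in> X k" if "s \<in> carrier S" "z \<in> X k" for s z k
    using Xk(1)[of k] that by (simp add: N.between_def)
  have Xminus: "\<ominus>\<^bsub>N\<^esub> z \<in> X k" if "z \<in> X k" for z k
    by (rule N.between_minus[OF Xk(1) that])
  have mono: "X k \<subseteq> X l" if "k \<le> l" for k l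
    by (rule lift_Suc_mono_le[of X, OF _ that]) (rule Xk(2))
  \<comment> \<open>\<open>P k\<close> is the trace of the submodule on the subcomplex
    \<open>M\<close>, and \<open>Q k\<close> is its image in the shifted quotient.\<close>
  define P where "P k = {u \<in> homog M n. j u \<zero>\<^bsub>M\<^esub> \<in> X k}" for k
  define Q where "Q k = q ` X k" for k
  have j0: "j u \<zero>\<^bsub>M\<^esub> \<in> homog N n" "p (j u \<zero>\<^bsub>M\<^esub>) = u" "q (j u \<zero>\<^bsub>M\<^esub>) = \<zero>\<^bsub>M\<^esub>" if "u \<in> homog M m" "m = n" for u m
    using that M.homog_carrier by (auto intro!: homog_j)
  have PM: "M.between n (P k)" for k
    unfolding M.between_def
  proof (intro conjI subsetI ballI)
    fix b assume "b \<in> coboundaries M n"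
    then obtain w where w: "w \<in> homog M (n - 1)" "b = diff M w" by (auto simp: coboundaries_def)
    have b: "b \<in> homog M n" using M.diff_homog[OF w(1)] w(2) by simp
    have jw: "j w \<zero>\<^bsub>M\<^esub> \<in> homog N (n - 1)" by (rule homog_j) (use w in auto)
    have "diff N (j w \<zero>\<^bsub>M\<^esub>) = j b \<zero>\<^bsub>M\<^esub>"
      using w b j0(2,3)[OF b] M.homog_carrier[OF w(1)] M.homog_carrier[OF b]
      by (intro eqI) (auto simp: d_closed[OF jw] p_diff[OF jw] q_diff[OF jw] M.homog_carrier)
    then show "b \<in> P k" using b jw Xb[of k] by (auto simp: P_def coboundaries_def)
  next
    fix u assume "u \<in> P k"
    then have u: "u \<in> homog M n" "j u \<zero>\<^bsub>M\<^esub> \<in> X k" by (auto simp: P_def)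
    have "diff M u = \<zero>\<^bsub>M\<^esub>"
      using p_diff[OF j0(1)[OF u(1)]] Xc(2)[OF u(2)] j0(2,3)[OF u(1)] M.diff_homog[OF u(1)] M.homog_carrier by auto
    then show "u \<in> cocycles M n" using u by (simp add: cocycles_def)
  next
    fix u v assume "u \<in> P k" "v \<in> P k"
    then have u: "u \<in> homog M n" "j u \<zero>\<^bsub>M\<^esub> \<in> X k" and v: "v \<in> homog M n" "j v \<zero>\<^bsub>M\<^esub> \<in> X k"
      by (auto simp: P_def)
    have uv: "u \<oplus>\<^bsub>M\<^esub> v \<in> homog M n" using u v by simp
    have "j (u \<oplus>\<^bsub>M\<^esub> v) \<zero>\<^bsub>M\<^esub> = j u \<zero>\<^bsub>M\<^esub> \<oplus>\<^bsub>N\<^esub> j v \<zero>\<^bsub>M\<^esub>"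
      using j0[OF u(1)] j0[OF v(1)] j0[OF uv] homogD(1) by (intro eqI) auto
    then show "u \<oplus>\<^bsub>M\<^esub> v \<in> P k" using uv Xadd u v by (simp add: P_def)
  next
    fix s u assume s: "s \<in> carrier S" and "u \<in> P k"
    then have u: "u \<in> homog M n" "j u \<zero>\<^bsub>M\<^esub> \<in> X k" by (auto simp: P_def)
    have su: "\<alpha> s u \<in> homog M n" by (rule M.act_homog[OF s u(1)])
    have "j (\<alpha> s u) \<zero>\<^bsub>M\<^esub> = \<beta> s (j u \<zero>\<^bsub>M\<^esub>)"
      using j0[OF u(1)] j0[OF su] s
      by (intro homog_eqI[of _ n]) (auto simp: homog_act p_act[of _ _ n] q_act[of _ _ n])
    then show "\<alpha> s u \<in> P k" using su Xact[OF s u(2)] by (simp add: P_def)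
  qed
  have QM: "M.between (n + 1) (Q k)" for k
    unfolding M.between_def
  proof (intro conjI subsetI ballI)
    fix b assume "b \<in> coboundaries M (n + 1)"
    then obtain w where w: "w \<in> homog M n" "b = diff M w" by (auto simp: coboundaries_def)
    have jw: "j \<zero>\<^bsub>M\<^esub> (\<ominus>\<^bsub>M\<^esub> w) \<in> homog N (n - 1)" by (rule homog_j) (use w in auto)
    have "q (diff N (j \<zero>\<^bsub>M\<^esub> (\<ominus>\<^bsub>M\<^esub> w))) = b"
      using w M.homog_carrier[OF w(1)] M.diff_minus[OF w(1)] M.homog_carrier[OF M.diff_homog[OF w(1)]]
      by (auto simp: q_diff[OF jw])
    moreover have "diff N (j \<zero>\<^bsub>M\<^esub> (\<ominus>\<^bsub>M\<^esub> w)) \<in> X k" using Xb jw by (auto simp: coboundaries_def)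
    ultimately show "b \<in> Q k" by (auto simp: Q_def)
  next
    fix v assume "v \<in> Q k"
    then obtain z where z: "z \<in> X k" "v = q z" by (auto simp: Q_def)
    note zD = homogD[OF Xc(1)[OF z(1)]]
    have "\<ominus>\<^bsub>M\<^esub> diff M (q z) = \<zero>\<^bsub>M\<^esub>" using q_diff[OF Xc(1)[OF z(1)]] Xc(2)[OF z(1)] by simp
    then have "diff M (q z) = \<zero>\<^bsub>M\<^esub>" using M.homog_carrier[OF M.diff_homog[OF zD(3)]]
      by (rule M.M.minus_eq_zeroD)
    then show "v \<in> cocycles M (n + 1)" using z zD by (simp add: cocycles_def)
  next
    fix u v assume "u \<in> Q k" "v \<in> Q k"
    then obtain z w where z: "z \<in> X k" "u = q z" and w: "w \<in> X k" "v = q w" by (auto simp: Q_def)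
    then have "u \<oplus>\<^bsub>M\<^esub> v = q (z \<oplus>\<^bsub>N\<^esub> w)" using homog_q_add[OF Xc(1) Xc(1)] by simp
    then show "u \<oplus>\<^bsub>M\<^esub> v \<in> Q k" using Xadd z w by (auto simp: Q_def)
  next
    fix s v assume s: "s \<in> carrier S" and "v \<in> Q k"
    then obtain z where z: "z \<in> X k" "v = q z" by (auto simp: Q_def)
    then have "\<alpha> s v = q (\<beta> s z)" using q_act[OF s Xc(1)] by simp
    then show "\<alpha> s v \<in> Q k" using Xact[OF s] z by (auto simp: Q_def)
  qed
  have "P k \<subseteq> P (Suc k)" "Q k \<subseteq> Q (Suc k)" for k using Xk(2)[of k] by (auto simp: P_def Q_def)
  then obtain k1 k2 where k: "\<And>l. l \<ge> k1 \<Longrightarrow> P l = P k1" "\<And>l. l \<ge> k2 \<Longrightarrow> Q l = Q k2"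
    using assms PM QM unfolding M.noetherian_cohomology_def by (metis (no_types, lifting))
  show "\<exists>k. \<forall>l\<ge>k. X l = X k"
  proof (intro exI allI impI)
    fix l assume l: "max k1 k2 \<le> l"
    let ?k = "max k1 k2"
    have PQ: "P l = P ?k" "Q l = Q ?k" using k l by (metis max.bounded_iff order_refl max.cobounded1 max.cobounded2)+
    show "X l = X ?k"
    proof
      show "X l \<subseteq> X ?k"
      proof
        fix z assume z: "z \<in> X l"
        then have "q z \<in> Q ?k" using PQ by (auto simp: Q_def)
        then obtain w where w: "w \<in> X ?k" "q z = q w" by (auto simp: Q_def)
        have w': "w \<in> X l" using mono[OF l] w by blast
        \<comment> \<open>The second components agree by the choice of \<open>w\<close>, so the
          difference lies in the subcomplex \<open>M\<close> and is controlled by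
          \<open>P\<close>.\<close>
        let ?y = "z \<oplus>\<^bsub>N\<^esub> \<ominus>\<^bsub>N\<^esub> w"
        have y: "?y \<in> X l" using Xadd[OF z Xminus[OF w']] .
        note c = homogD[OF Xc(1)[OF z]] homogD[OF Xc(1)[OF w']] homogD[OF Xc(1)[OF y]]
        have "q ?y = \<zero>\<^bsub>M\<^esub>" using c w by (simp add: M.M.r_neg)
        then have jy: "j (p ?y) \<zero>\<^bsub>M\<^esub> = ?y" using j_p_q[OF c(7)] by simp
        then have "p ?y \<in> P l" using y c(8) by (simp add: P_def)
        then have "p ?y \<in> P ?k" using PQ by simp
        then have "?y \<in> X ?k" using jy by (simp add: P_def)
        then have "?y \<oplus>\<^bsub>N\<^esub> w \<in> X ?k" using Xadd w by blast
        moreover have "?y \<oplus>\<^bsub>N\<^esub> w = z" using c by (simp add: C.a_assoc C.l_neg)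
        ultimately show "z \<in> X ?k" by simp
      qed
    qed (rule mono[OF l])
  qed
qed

end

section \<open>Isomorphisms of complexes\<close>

text \<open>Bijectivity is demanded in each degree, not on carriers, in keeping with laws that hold
  for homogeneous elements. This also matches cones, whose degree \<open>n\<close> combines the
  degrees \<open>n\<close> and \<open>n + 1\<close>.\<close>

locale complex_iso = M: scalar_complex S M \<alpha> + N: scalar_complex S N \<beta>
  for S :: "('s, 'y) ring_scheme" and M :: "('m, 'x) dg_ring_scheme" and \<alpha>
    and N :: "('n, 'w) dg_ring_scheme" and \<beta> +
  fixes f :: "'m \<Rightarrow> 'n"
  assumes bij: "bij_betw f (homog M n) (homog N n)"
    and f_add: "\<lbrakk>x \<in> homog M n; y \<in> homog M n\<rbrakk> \<Longrightarrow> f (x \<oplus>\<^bsub>M\<^esub> y) = f x \<oplus>\<^bsub>N\<^esub> f y"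
    and f_diff: "x \<in> homog M n \<Longrightarrow> f (diff M x) = diff N (f x)"
    and f_act: "\<lbrakk>s \<in> carrier S; x \<in> homog M n\<rbrakk> \<Longrightarrow> f (\<alpha> s x) = \<beta> s (f x)"
begin

lemma f_homog: "x \<in> homog M n \<Longrightarrow> f x \<in> homog N n"
  using bij by (rule bij_betw_apply)

lemma f_eq_iff: "\<lbrakk>x \<in> homog M n; y \<in> homog M n\<rbrakk> \<Longrightarrow> f x = f y \<longleftrightarrow> x = y"
  using bij_betw_imp_inj_on[OF bij, of n] by (auto simp: inj_on_eq_iff)

lemma f_surj: assumes "y \<in> homog N n" obtains x where "x \<in> homog M n" "y = f x"
  using bij_betw_imp_surj_on[OF bij, of n] assms by blast

lemma f_zero: "f \<zero>\<^bsub>M\<^esub> = \<zero>\<^bsub>N\<^esub>"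
proof -
  have "f \<zero>\<^bsub>M\<^esub> \<in> carrier N" using N.homog_carrier[OF f_homog[OF M.homog_zero]] .
  moreover have "f \<zero>\<^bsub>M\<^esub> \<oplus>\<^bsub>N\<^esub> f \<zero>\<^bsub>M\<^esub> = f \<zero>\<^bsub>M\<^esub>"
    using f_add[of "\<zero>\<^bsub>M\<^esub>" 0 "\<zero>\<^bsub>M\<^esub>"] by simp
  ultimately show ?thesis by (metis N.M.add.l_cancel_one')
qed

lemma f_minus:
  assumes x: "x \<in> homog M n" shows "f (\<ominus>\<^bsub>M\<^esub> x) = \<ominus>\<^bsub>N\<^esub> f x"
proof (rule N.M.minus_equality[symmetric])
  show "f (\<ominus>\<^bsub>M\<^esub> x) \<oplus>\<^bsub>N\<^esub> f x = \<zero>\<^bsub>N\<^esub>"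
    using f_add[OF M.homog_minus[OF x] x] M.homog_carrier[OF x] f_zero by (simp add: M.M.l_neg)
qed (use N.homog_carrier f_homog M.homog_minus x in blast)+

lemma cocycles_iff:
  assumes x: "x \<in> homog M n"
  shows "f x \<in> cocycles N n \<longleftrightarrow> x \<in> cocycles M n"
  using f_eq_iff[OF M.diff_homog[OF x] M.homog_zero] f_zero f_diff[OF x] x f_homog[OF x]
  by (simp add: cocycles_def)

lemma coboundaries_iff:
  assumes x: "x \<in> homog M n"
  shows "f x \<in> coboundaries N n \<longleftrightarrow> x \<in> coboundaries M n"
proof
  assume "f x \<in> coboundaries N n"
  then obtain y where y: "y \<in> homog N (n - 1)" "f x = diff N y" by (auto simp: coboundaries_def)
  then obtain w where w: "w \<in> homog M (n - 1)" "y = f w" using f_surj by blast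
  then have "f x = f (diff M w)" using y f_diff by simp
  then have "x = diff M w" using f_eq_iff[OF x, of "diff M w"] M.diff_homog[OF w(1)] by simp
  then show "x \<in> coboundaries M n" using w by (simp add: coboundaries_def)
next
  assume "x \<in> coboundaries M n"
  then obtain w where w: "w \<in> homog M (n - 1)" "x = diff M w" by (auto simp: coboundaries_def)
  then have "f x = diff N (f w)" using f_diff by simp
  then show "f x \<in> coboundaries N n" using f_homog[OF w(1)] by (simp add: coboundaries_def)
qed

lemma acyclic_at_iff: "M.acyclic_at n \<longleftrightarrow> N.acyclic_at n"
proof
  assume M: "M.acyclic_at n"
  show "N.acyclic_at n"
    unfolding N.acyclic_at_def
  proof
    fix y assume y: "y \<in> cocycles N n"
    obtain x where x: "x \<in> homog M n" "y = f x" using f_surj[OF N.cocycles_homog[OF y]] .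
    then show "y \<in> coboundaries N n"
      using M y cocycles_iff coboundaries_iff by (auto simp: M.acyclic_at_def)
  qed
next
  assume N: "N.acyclic_at n"
  show "M.acyclic_at n"
    unfolding M.acyclic_at_def
  proof
    fix x assume x: "x \<in> cocycles M n"
    then show "x \<in> coboundaries M n"
      using N cocycles_iff[OF M.cocycles_homog[OF x]] coboundaries_iff[OF M.cocycles_homog[OF x]]
      by (auto simp: N.acyclic_at_def)
  qed
qed

lemma regular_at_iff:
  assumes s: "s \<in> carrier S"
  shows "M.regular_at s n \<longleftrightarrow> N.regular_at s n"
proof
  assume M: "M.regular_at s n"
  show "N.regular_at s n"
    unfolding N.regular_at_def
  proof (intro ballI impI)
    fix y assume y: "y \<in> cocycles N n" "\<beta> s y \<in> coboundaries N n"
    obtain x where x: "x \<in> homog M n" "y = f x" using f_surj[OF N.cocycles_homog[OF y(1)]] .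
    then show "y \<in> coboundaries N n"
      using M y cocycles_iff coboundaries_iff f_act[OF s] M.act_homog[OF s] by (metis M.regular_at_def)
  qed
next
  assume N: "N.regular_at s n"
  show "M.regular_at s n"
    unfolding M.regular_at_def
  proof (intro ballI impI)
    fix x assume x: "x \<in> cocycles M n" "\<alpha> s x \<in> coboundaries M n"
    note xh = M.cocycles_homog[OF x(1)]
    show "x \<in> coboundaries M n"
      using N x cocycles_iff[OF xh] coboundaries_iff[OF xh] coboundaries_iff[OF M.act_homog[OF s xh]] f_act[OF s xh]
      by (metis N.regular_at_def)
  qed
qed

end

text \<open>Functoriality of the cone: the isomorphism is applied to both components. A comparison
  of two complexes thereby passes to their Koszul complexes on one further element.\<close>

lemma complex_iso_cone:
  assumes "complex_iso S M \<alpha> N \<beta> f" "complex_cone S M \<alpha> M' p q j \<alpha>' x" "complex_cone S N \<beta> N' p' q' j' \<beta>' x"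
  shows "complex_iso S M' \<alpha>' N' \<beta>' (\<lambda>z. j' (f (p z)) (f (q z)))"
proof -
  interpret f: complex_iso S M \<alpha> N \<beta> f by (rule assms)
  interpret M: complex_cone S M \<alpha> M' p q j \<alpha>' x by (rule assms)
  interpret N: complex_cone S N \<beta> N' p' q' j' \<beta>' x by (rule assms)
  let ?f = "\<lambda>z. j' (f (p z)) (f (q z))"
  have F: "?f z \<in> homog N' n" "p' (?f z) = f (p z)" "q' (?f z) = f (q z)" if z: "z \<in> homog M' n" for z n
  proof -
    note c = f.f_homog[OF M.homogD(2)[OF z]] f.f_homog[OF M.homogD(3)[OF z]]
    show "?f z \<in> homog N' n" by (rule N.homog_j[OF c])
    show "p' (?f z) = f (p z)" "q' (?f z) = f (q z)" by (rule N.homog_p_j[OF c], rule N.homog_q_j[OF c])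
  qed
  show ?thesis
  proof (intro complex_iso.intro complex_iso_axioms.intro M.N.scalar_complex_axioms N.N.scalar_complex_axioms)
    fix n
    show "bij_betw ?f (homog M' n) (homog N' n)"
    proof (rule bij_betwI')
      fix z w assume z: "z \<in> homog M' n" and w: "w \<in> homog M' n"
      show "?f z = ?f w \<longleftrightarrow> z = w"
        using F[OF z] F[OF w] f.f_eq_iff[OF M.homogD(2)[OF z] M.homogD(2)[OF w]]
          f.f_eq_iff[OF M.homogD(3)[OF z] M.homogD(3)[OF w]] M.homog_eqI[OF z w] by metis
    next
      fix z assume "z \<in> homog M' n" then show "?f z \<in> homog N' n" by (rule F)
    next
      fix y assume y: "y \<in> homog N' n"
      obtain u where u: "u \<in> homog M n" "p' y = f u" using f.f_surj[OF N.homogD(2)[OF y]] .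
      obtain v where v: "v \<in> homog M (n + 1)" "q' y = f v" using f.f_surj[OF N.homogD(3)[OF y]] .
      have "y = ?f (j u v)"
        using u v N.j_p_q[OF N.homogD(1)[OF y]] by (simp add: M.homog_p_j[OF u(1) v(1)] M.homog_q_j[OF u(1) v(1)])
      then show "\<exists>x\<in>homog M' n. y = ?f x" using M.homog_j[OF u(1) v(1)] by blast
    qed
    fix z assume z: "z \<in> homog M' n"
    note dz = M.homog_diff[OF z]
    have c: "diff M (p z) \<in> homog M (n+1)" "\<alpha> x (q z) \<in> homog M (n+1)" "diff M (q z) \<in> homog M (n+1+1)"
      using f.M.diff_homog f.M.act_homog M.homogD[OF z] M.x by blast+
    show "?f (diff M' z) = diff N' (?f z)"
    proof (rule N.homog_eqI[OF F(1)[OF dz] N.homog_diff[OF F(1)[OF z]]])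
      show "p' (?f (diff M' z)) = p' (diff N' (?f z))"
        unfolding F(2)[OF dz] N.p_diff[OF F(1)[OF z]] unfolding F(2,3)[OF z] M.p_diff[OF z]
          f.f_add[OF c(1,2)] f.f_diff[OF M.homogD(2)[OF z]] f.f_act[OF M.x M.homogD(3)[OF z]] ..
      show "q' (?f (diff M' z)) = q' (diff N' (?f z))"
        unfolding F(3)[OF dz] N.q_diff[OF F(1)[OF z]] unfolding F(2,3)[OF z] M.q_diff[OF z]
          f.f_minus[OF c(3)] f.f_diff[OF M.homogD(3)[OF z]] ..
    qed
    show "?f (z \<oplus>\<^bsub>M'\<^esub> w) = ?f z \<oplus>\<^bsub>N'\<^esub> ?f w" if w: "w \<in> homog M' n" for w
    proof -
      note zw = M.homog_add[OF z w]
      show ?thesis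
      proof (rule N.homog_eqI[OF F(1)[OF zw] N.homog_add[OF F(1)[OF z] F(1)[OF w]]])
        show "p' (?f (z \<oplus>\<^bsub>M'\<^esub> w)) = p' (?f z \<oplus>\<^bsub>N'\<^esub> ?f w)"
          unfolding F(2)[OF zw] N.homog_p_add[OF F(1)[OF z] F(1)[OF w]] F(2)[OF z] F(2)[OF w]
          unfolding M.homog_p_add[OF z w]
          by (rule f.f_add[OF M.homogD(2)[OF z] M.homogD(2)[OF w]])
        show "q' (?f (z \<oplus>\<^bsub>M'\<^esub> w)) = q' (?f z \<oplus>\<^bsub>N'\<^esub> ?f w)"
          unfolding F(3)[OF zw] N.homog_q_add[OF F(1)[OF z] F(1)[OF w]] F(3)[OF z] F(3)[OF w]
          unfolding M.homog_q_add[OF z w]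
          by (rule f.f_add[OF M.homogD(3)[OF z] M.homogD(3)[OF w]])
      qed
    qed
    fix s assume s: "s \<in> carrier S"
    note sz = M.homog_act[OF s z]
    show "?f (\<alpha>' s z) = \<beta>' s (?f z)"
    proof (rule N.homog_eqI[OF F(1)[OF sz] N.homog_act[OF s F(1)[OF z]]])
      show "p' (?f (\<alpha>' s z)) = p' (\<beta>' s (?f z))"
        unfolding F(2)[OF sz] N.p_act[OF s F(1)[OF z]] F(2)[OF z]
        unfolding M.p_act[OF s z]
        by (rule f.f_act[OF s M.homogD(2)[OF z]])
      show "q' (?f (\<alpha>' s z)) = q' (\<beta>' s (?f z))"
        unfolding F(3)[OF sz] N.q_act[OF s F(1)[OF z]] F(3)[OF z]
        unfolding M.q_act[OF s z]
        by (rule f.f_act[OF s M.homogD(3)[OF z]])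
    qed
  qed
qed

text \<open>The signs: the swap of two exterior variables negates the component of their product.\<close>

lemma complex_iso_swap:
  assumes "complex_cone S M \<alpha> M1 p1 q1 j1 \<alpha>1 a" "complex_cone S M1 \<alpha>1 M2 p2 q2 j2 \<alpha>2 b"
    and "complex_cone S M \<alpha> N1 r1 s1 k1 \<beta>1 b" "complex_cone S N1 \<beta>1 N2 r2 s2 k2 \<beta>2 a"
  shows "complex_iso S M2 \<alpha>2 N2 \<beta>2
    (\<lambda>z. k2 (k1 (p1 (p2 z)) (p1 (q2 z))) (k1 (q1 (p2 z)) (\<ominus>\<^bsub>M\<^esub> q1 (q2 z))))"
proof -
  interpret M1: complex_cone S M \<alpha> M1 p1 q1 j1 \<alpha>1 a by (rule assms)
  interpret M2: complex_cone S M1 \<alpha>1 M2 p2 q2 j2 \<alpha>2 b by (rule assms)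
  interpret N1: complex_cone S M \<alpha> N1 r1 s1 k1 \<beta>1 b by (rule assms)
  interpret N2: complex_cone S N1 \<beta>1 N2 r2 s2 k2 \<beta>2 a by (rule assms)
  let ?f = "\<lambda>z. k2 (k1 (p1 (p2 z)) (p1 (q2 z))) (k1 (q1 (p2 z)) (\<ominus>\<^bsub>M\<^esub> q1 (q2 z)))"
  have zD: "p1 (p2 z) \<in> homog M n" "q1 (p2 z) \<in> homog M (n + 1)" "p1 (q2 z) \<in> homog M (n + 1)"
    "q1 (q2 z) \<in> homog M (n + 1 + 1)" if z: "z \<in> homog M2 n" for z n
    using M1.homogD[OF M2.homogD(2)[OF z]] M1.homogD[OF M2.homogD(3)[OF z]] by auto
  have F: "?f z \<in> homog N2 n" "r1 (r2 (?f z)) = p1 (p2 z)" "s1 (r2 (?f z)) = p1 (q2 z)"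
     "r1 (s2 (?f z)) = q1 (p2 z)" "s1 (s2 (?f z)) = \<ominus>\<^bsub>M\<^esub> q1 (q2 z)" if z: "z \<in> homog M2 n" for z n
  proof -
    note D = zD[OF z]
    note k = N1.homog_j[OF D(1,3)] N1.homog_j[OF D(2) M1.M.homog_minus[OF D(4)]]
    show "?f z \<in> homog N2 n" by (rule N2.homog_j[OF k])
    show "r1 (r2 (?f z)) = p1 (p2 z)" "s1 (r2 (?f z)) = p1 (q2 z)"
      unfolding N2.homog_p_j[OF k] by (rule N1.homog_p_j[OF D(1,3)], rule N1.homog_q_j[OF D(1,3)])
    show "r1 (s2 (?f z)) = q1 (p2 z)" "s1 (s2 (?f z)) = \<ominus>\<^bsub>M\<^esub> q1 (q2 z)"
      unfolding N2.homog_q_j[OF k]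
      by (rule N1.homog_p_j[OF D(2) M1.M.homog_minus[OF D(4)]], rule N1.homog_q_j[OF D(2) M1.M.homog_minus[OF D(4)]])
  qed
  \<comment> \<open>Elements of a double cone are determined by four components in \<open>M\<close>,
    to which every identity below is reduced.\<close>
  have Neq: "y = y'" if "y \<in> homog N2 n" "y' \<in> homog N2 n" "r1 (r2 y) = r1 (r2 y')" "s1 (r2 y) = s1 (r2 y')"
    "r1 (s2 y) = r1 (s2 y')" "s1 (s2 y) = s1 (s2 y')" for y y' n
    by (rule N2.homog_eqI[OF that(1,2)]; rule N1.homog_eqI) (use that N2.homogD in blast)+
  have Meq: "y = y'" if "y \<in> homog M2 n" "y' \<in> homog M2 n" "p1 (p2 y) = p1 (p2 y')" "q1 (p2 y) = q1 (p2 y')"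
    "p1 (q2 y) = p1 (q2 y')" "q1 (q2 y) = q1 (q2 y')" for y y' n
    by (rule M2.homog_eqI[OF that(1,2)]; rule M1.homog_eqI) (use that M2.homogD in blast)+
  show ?thesis
  proof (intro complex_iso.intro complex_iso_axioms.intro M2.N.scalar_complex_axioms N2.N.scalar_complex_axioms)
    fix n
    show "bij_betw ?f (homog M2 n) (homog N2 n)"
    proof (rule bij_betwI')
      fix z w assume z: "z \<in> homog M2 n" and w: "w \<in> homog M2 n"
      show "?f z = ?f w \<longleftrightarrow> z = w"
      proof
        assume eq: "?f z = ?f w"
        show "z = w"
        proof (rule Meq[OF z w])
          show "p1 (p2 z) = p1 (p2 w)" "q1 (p2 z) = q1 (p2 w)" "p1 (q2 z) = p1 (q2 w)"
            using F[OF z] F[OF w] eq by metis+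
          have "\<ominus>\<^bsub>M\<^esub> q1 (q2 z) = \<ominus>\<^bsub>M\<^esub> q1 (q2 w)" using F(5)[OF z] F(5)[OF w] eq by metis
          then show "q1 (q2 z) = q1 (q2 w)"
            using M1.M.homog_carrier[OF zD(4)[OF z]] M1.M.homog_carrier[OF zD(4)[OF w]] by (metis M1.M.M.minus_minus)
        qed
      qed simp
    next
      fix z assume "z \<in> homog M2 n" then show "?f z \<in> homog N2 n" by (rule F)
    next
      fix y assume y: "y \<in> homog N2 n"
      note D = N1.homogD[OF N2.homogD(2)[OF y]] N1.homogD[OF N2.homogD(3)[OF y]]
      \<comment> \<open>The inverse has the same shape and the same sign, since exchanging the
        variables twice is the identity.\<close>
      define g where "g = j2 (j1 (r1 (r2 y)) (r1 (s2 y))) (j1 (s1 (r2 y)) (\<ominus>\<^bsub>M\<^esub> s1 (s2 y)))"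
      note j = M1.homog_j[OF D(2,5)] M1.homog_j[OF D(3) M1.M.homog_minus[OF D(6)]]
      have g: "g \<in> homog M2 n" unfolding g_def by (rule M2.homog_j[OF j])
      have c: "p1 (p2 g) = r1 (r2 y)" "q1 (p2 g) = r1 (s2 y)" "p1 (q2 g) = s1 (r2 y)" "q1 (q2 g) = \<ominus>\<^bsub>M\<^esub> s1 (s2 y)"
        unfolding g_def M2.homog_p_j[OF j] M2.homog_q_j[OF j]
        by (rule M1.homog_p_j[OF D(2,5)], rule M1.homog_q_j[OF D(2,5)],
            rule M1.homog_p_j[OF D(3) M1.M.homog_minus[OF D(6)]], rule M1.homog_q_j[OF D(3) M1.M.homog_minus[OF D(6)]])
      have "y = ?f g"
        by (rule Neq[OF y F(1)[OF g]]; unfold F[OF g]; unfold c) (use M1.M.homog_carrier[OF D(6)] in simp_all)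
      then show "\<exists>x\<in>homog M2 n. y = ?f x" using g by blast
    qed
    fix z assume z: "z \<in> homog M2 n"
    note D = zD[OF z] and z2 = M2.homogD[OF z] and dz = M2.homog_diff[OF z] and fz = F(1)[OF z]
    note fD = N2.homogD[OF fz]
    show "?f (z \<oplus>\<^bsub>M2\<^esub> w) = ?f z \<oplus>\<^bsub>N2\<^esub> ?f w" if w: "w \<in> homog M2 n" for w
    proof -
      note zw = M2.homog_add[OF z w] and w2 = M2.homogD[OF w] and fw = F(1)[OF w]
      note fwD = N2.homogD[OF fw]
      note e = M2.homog_p_add[OF z w] M2.homog_q_add[OF z w] M1.homog_p_add[OF z2(2) w2(2)] M1.homog_q_add[OF z2(2) w2(2)]
        M1.homog_p_add[OF z2(3) w2(3)] M1.homog_q_add[OF z2(3) w2(3)]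
      show ?thesis
        by (rule Neq[OF F(1)[OF zw] N2.homog_add[OF fz fw]];
            unfold F[OF zw] N2.homog_p_add[OF fz fw] N2.homog_q_add[OF fz fw] N1.homog_p_add[OF fD(2) fwD(2)]
              N1.homog_q_add[OF fD(2) fwD(2)] N1.homog_p_add[OF fD(3) fwD(3)] N1.homog_q_add[OF fD(3) fwD(3)]
              F[OF z] F[OF w];
            unfold e)
          (use M1.M.homog_carrier[OF D(4)] M1.M.homog_carrier[OF zD(4)[OF w]] in \<open>simp_all add: M1.M.M.minus_add\<close>)
    qed
    show "?f (\<alpha>2 s z) = \<beta>2 s (?f z)" if s: "s \<in> carrier S" for s
    proof -
      note sz = M2.homog_act[OF s z]
      show ?thesis
        by (rule Neq[OF F(1)[OF sz] N2.homog_act[OF s fz]];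
            unfold F[OF sz] N2.p_act[OF s fz] N2.q_act[OF s fz] N1.p_act[OF s fD(2)] N1.q_act[OF s fD(2)]
              N1.p_act[OF s fD(3)] N1.q_act[OF s fD(3)] F[OF z];
            unfold M2.p_act[OF s z] M2.q_act[OF s z]
              M1.p_act[OF s z2(2)] M1.q_act[OF s z2(2)] M1.p_act[OF s z2(3)] M1.q_act[OF s z2(3)]
              M1.M.act_minus[OF s D(4)]; rule refl)
    qed
    have ab: "a \<in> carrier S" "b \<in> carrier S" by simp_all
    note M1d = M1.homog_diff[OF z2(2)] M1.homog_act[OF ab(2) z2(3)] M1.homog_diff[OF z2(3)]
    note N1d = N1.homog_diff[OF fD(2)] N1.homog_act[OF ab(1) fD(3)] N1.homog_diff[OF fD(3)]
    have m: "p1 (\<ominus>\<^bsub>M1\<^esub> diff M1 (q2 z)) = \<ominus>\<^bsub>M\<^esub> p1 (diff M1 (q2 z))" "q1 (\<ominus>\<^bsub>M1\<^esub> diff M1 (q2 z)) = \<ominus>\<^bsub>M\<^esub> q1 (diff M1 (q2 z))"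
      by (rule M1.p_minus[OF M1.homogD(1)[OF M1d(3)]], rule M1.q_minus[OF M1.homogD(1)[OF M1d(3)]])
    have m': "r1 (\<ominus>\<^bsub>N1\<^esub> diff N1 (s2 (?f z))) = \<ominus>\<^bsub>M\<^esub> r1 (diff N1 (s2 (?f z)))"
      "s1 (\<ominus>\<^bsub>N1\<^esub> diff N1 (s2 (?f z))) = \<ominus>\<^bsub>M\<^esub> s1 (diff N1 (s2 (?f z)))"
      by (rule N1.p_minus[OF N1.homogD(1)[OF N1d(3)]], rule N1.q_minus[OF N1.homogD(1)[OF N1d(3)]])
    have c: "diff M (p1 (p2 z)) \<in> carrier M" "\<alpha> a (q1 (p2 z)) \<in> carrier M" "\<alpha> b (p1 (q2 z)) \<in> carrier M"
      "diff M (q1 (p2 z)) \<in> carrier M" "\<alpha> b (q1 (q2 z)) \<in> carrier M" "diff M (p1 (q2 z)) \<in> carrier M"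
      "\<alpha> a (q1 (q2 z)) \<in> carrier M" "diff M (q1 (q2 z)) \<in> carrier M"
      using M1.M.homog_carrier M1.M.diff_homog M1.M.act_homog ab D by blast+
    show "?f (diff M2 z) = diff N2 (?f z)"
      by (rule Neq[OF F(1)[OF dz] N2.homog_diff[OF fz]];
          unfold F[OF dz] N2.p_diff[OF fz] N2.q_diff[OF fz] m' N1.homog_p_add[OF N1d(1,2)] N1.homog_q_add[OF N1d(1,2)]
            N1.p_diff[OF fD(2)] N1.q_diff[OF fD(2)] N1.p_act[OF ab(1) fD(3)] N1.q_act[OF ab(1) fD(3)]
            N1.p_diff[OF fD(3)] N1.q_diff[OF fD(3)] F[OF z];
          unfold M2.p_diff[OF z] M2.q_diff[OF z] m M1.homog_p_add[OF M1d(1,2)] M1.homog_q_add[OF M1d(1,2)]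
            M1.p_diff[OF z2(2)] M1.q_diff[OF z2(2)] M1.p_act[OF ab(2) z2(3)] M1.q_act[OF ab(2) z2(3)]
            M1.p_diff[OF z2(3)] M1.q_diff[OF z2(3)] M1.M.act_minus[OF ab(1) D(4)] M1.M.act_minus[OF ab(2) D(4)]
            M1.M.diff_minus[OF D(4)])
        (use c in \<open>simp_all add: M1.M.M.minus_add M1.M.M.a_ac\<close>)
  qed
qed

section \<open>Depth along sequences in a local ring\<close>

text \<open>Here \<open>v xs\<close> stands for the infimum of the Koszul complex on \<open>xs\<close>, and \<open>reg xs x\<close> says that \<open>x\<close>
  is regular on it. The ring is only local and noetherian modulo the ideal \<open>N\<close>.\<close>

locale depth_function = cring R for R (structure) +
  fixes N m :: "'a set" and v :: "'a list \<Rightarrow> int" and reg :: "'a list \<Rightarrow> 'a \<Rightarrow> bool"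
  assumes N_carrier: "N \<subseteq> carrier R"
    and m_ideal: "ideal m R" and N_m: "N \<subseteq> m"
    and unit: "\<lbrakk>s \<in> carrier R; s \<notin> m\<rbrakk> \<Longrightarrow> \<exists>e\<in>carrier R. e \<otimes> s \<ominus> \<one> \<in> N"
    and one_m: "\<one> \<notin> m"
    and acc: "\<lbrakk>\<And>k::nat. ideal (X k) R; \<And>k. N \<subseteq> X k; \<And>k. X k \<subseteq> X (Suc k)\<rbrakk> \<Longrightarrow> \<exists>k. X (Suc k) = X k"
    and v_snoc: "\<lbrakk>set xs \<subseteq> m; x \<in> m\<rbrakk> \<Longrightarrow> v (xs @ [x]) = (if reg xs x then v xs else v xs - 1)"
    and v_perm: "\<lbrakk>set xs \<subseteq> m; mset xs = mset ys\<rbrakk> \<Longrightarrow> v xs = v ys"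
    and not_reg: "\<lbrakk>set xs \<subseteq> m; x \<in> Idl (N \<union> set xs)\<rbrakk> \<Longrightarrow> \<not> reg xs x"
    and reg_mult: "\<lbrakk>set xs \<subseteq> m; x \<in> carrier R; y \<in> carrier R; reg xs x; reg xs y\<rbrakk> \<Longrightarrow> reg xs (x \<otimes> y)"
    and reg_unit: "\<lbrakk>set xs \<subseteq> m; x \<in> carrier R; x \<notin> m\<rbrakk> \<Longrightarrow> reg xs x"
    and reg_cong: "\<lbrakk>set xs \<subseteq> m; x \<in> carrier R; y \<in> carrier R; x \<ominus> y \<in> Idl (N \<union> set xs); reg xs x\<rbrakk> \<Longrightarrow> reg xs y"
begin

section \<open>Ideals containing \<open>N\<close>\<close>

definition J :: "'a list \<Rightarrow> 'a set" where "J xs = Idl (N \<union> set xs)"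

lemmas ring_normalize = minus_eq l_distr r_distr minus_add m_ac a_ac r_minus l_minus r_neg2 r_neg1 r_neg

lemma m_carrier: "m \<subseteq> carrier R"
  using m_ideal by (simp add: ideal.Icarr subsetI)

lemma m_carrierD: "x \<in> m \<Longrightarrow> x \<in> carrier R"
  using m_carrier by blast

lemma J_ideal: "set xs \<subseteq> carrier R \<Longrightarrow> ideal (J xs) R"
  unfolding J_def using N_carrier by (intro genideal_ideal) auto

lemma J_N: "set xs \<subseteq> carrier R \<Longrightarrow> N \<subseteq> J xs"
  and J_set: "set xs \<subseteq> carrier R \<Longrightarrow> set xs \<subseteq> J xs"
  unfolding J_def using N_carrier genideal_self[of "N \<union> set xs"] by auto

lemma J_leI: "\<lbrakk>ideal I R; N \<subseteq> I; set xs \<subseteq> I\<rbrakk> \<Longrightarrow> J xs \<subseteq> I"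
  unfolding J_def by (intro genideal_minimal) auto

lemma J_le_J: "\<lbrakk>set ys \<subseteq> carrier R; set xs \<subseteq> J ys\<rbrakk> \<Longrightarrow> J xs \<subseteq> J ys"
  by (rule J_leI[OF J_ideal J_N])

lemma J_mono: "\<lbrakk>set ys \<subseteq> carrier R; set xs \<subseteq> set ys\<rbrakk> \<Longrightarrow> J xs \<subseteq> J ys"
  using J_le_J J_set by blast

lemma J_m: "set xs \<subseteq> m \<Longrightarrow> J xs \<subseteq> m"
  by (rule J_leI[OF m_ideal N_m])

lemma minus_diff_cancel: "\<lbrakk>x \<in> carrier R; y \<in> carrier R\<rbrakk> \<Longrightarrow> x \<ominus> y \<oplus> y = x"
  by (simp add: minus_eq a_assoc l_neg)

lemma ideal_minus: "\<lbrakk>ideal I R; x \<in> I; y \<in> I\<rbrakk> \<Longrightarrow> x \<ominus> y \<in> I"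
  by (metis additive_subgroup.a_closed additive_subgroup.a_inv_closed ideal_def minus_eq)

lemma ideal_add: "\<lbrakk>ideal I R; x \<in> I; y \<in> I\<rbrakk> \<Longrightarrow> x \<oplus> y \<in> I"
  by (simp add: additive_subgroup.a_closed ideal_def)

lemma ideal_mult: "\<lbrakk>ideal I R; c \<in> carrier R; x \<in> I\<rbrakk> \<Longrightarrow> c \<otimes> x \<in> I"
  by (rule ideal.I_l_closed)

lemma ideal_minus_add:
  assumes "ideal I R" "x \<ominus> y \<in> I" "y \<in> I" "x \<in> carrier R" shows "x \<in> I"
  using ideal_add[OF assms(1-3)] ideal.Icarr[OF assms(1,3)] assms(4) by (simp add: minus_diff_cancel)

text \<open>This is the ideal \<open>I y + L\<close>, described by the form in which membership is
  used. It is applied with the whole ring as \<open>I\<close> in \<open>J_snoc\<close> and with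
  \<open>m\<close> as \<open>I\<close> in the Nakayama argument of
  \<open>redundant_of_square\<close>.\<close>

lemma multiples_ideal:
  assumes I: "ideal I R" and L: "ideal L R" and y: "y \<in> carrier R"
  shows "ideal {w \<in> carrier R. \<exists>c\<in>I. w \<ominus> c \<otimes> y \<in> L} R"
proof -
  interpret I: ideal I R by (rule I)
  interpret L: ideal L R by (rule L)
  define T where "T = {w \<in> carrier R. \<exists>c\<in>I. w \<ominus> c \<otimes> y \<in> L}"
  have TI: "w \<in> T" if "w \<in> carrier R" "c \<in> I" "w \<ominus> c \<otimes> y \<in> L" for w c
    using that unfolding T_def by blast
  have Tc: "w \<in> carrier R" if "w \<in> T" for w using that unfolding T_def by simp
  \<comment> \<open>Closure under two-term linear combinations yields negatives, sums and multiples
    at once.\<close>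
  have lin: "a \<otimes> w \<oplus> b \<otimes> w' \<in> T"
    if ab: "a \<in> carrier R" "b \<in> carrier R" and w: "w \<in> T" "w' \<in> T" for a b w w'
  proof -
    obtain d where d: "d \<in> I" "w \<ominus> d \<otimes> y \<in> L" using w(1) unfolding T_def by blast
    obtain d' where d': "d' \<in> I" "w' \<ominus> d' \<otimes> y \<in> L" using w(2) unfolding T_def by blast
    note wc = Tc[OF w(1)] Tc[OF w(2)] I.Icarr[OF d(1)] I.Icarr[OF d'(1)]
    have "a \<otimes> (w \<ominus> d \<otimes> y) \<oplus> b \<otimes> (w' \<ominus> d' \<otimes> y) \<in> L"
      by (intro L.a_closed L.I_l_closed d d' ab)
    also have "a \<otimes> (w \<ominus> d \<otimes> y) \<oplus> b \<otimes> (w' \<ominus> d' \<otimes> y) = (a \<otimes> w \<oplus> b \<otimes> w') \<ominus> (a \<otimes> d \<oplus> b \<otimes> d') \<otimes> y"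
      using wc ab y by (simp add: ring_normalize)
    finally show ?thesis
      by (rule TI[rotated 2]) (use wc ab d d' in \<open>simp_all add: I.I_l_closed\<close>)
  qed
  have zero: "\<zero> \<in> T" by (rule TI[of _ \<zero>]) (use y in \<open>simp_all add: minus_eq\<close>)
  have "ideal T R"
  proof (rule idealI[OF ring_axioms])
    show "subgroup T (add_monoid R)"
    proof (rule add.subgroupI)
      show "T \<subseteq> carrier R" using Tc by blast
      show "T \<noteq> {}" using zero by blast
      show "\<ominus> w \<in> T" if w: "w \<in> T" for w
        using lin[of "\<ominus> \<one>" \<zero> w w] w Tc[OF w] by (simp add: l_minus)
      show "w \<oplus> w' \<in> T" if w: "w \<in> T" "w' \<in> T" for w w'
        using lin[of \<one> \<one> w w'] w Tc[OF w(1)] Tc[OF w(2)] by simp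
    qed
    fix a w assume w: "a \<in> T" "w \<in> carrier R"
    show "w \<otimes> a \<in> T" using lin[of w \<zero> a a] w Tc[OF w(1)] by simp
    then show "a \<otimes> w \<in> T" using m_comm[OF Tc[OF w(1)] w(2)] by simp
  qed
  then show ?thesis unfolding T_def .
qed

lemma J_snoc:
  assumes xs: "set xs \<subseteq> carrier R" and x: "x \<in> carrier R"
  shows "y \<in> J (xs @ [x]) \<longleftrightarrow> y \<in> carrier R \<and> (\<exists>c\<in>carrier R. y \<ominus> c \<otimes> x \<in> J xs)"
proof
  let ?T = "{w \<in> carrier R. \<exists>c\<in>carrier R. w \<ominus> c \<otimes> x \<in> J xs}"
  have I: "ideal ?T R" by (rule multiples_ideal[OF oneideal J_ideal[OF xs] x])
  interpret L: ideal "J xs" R by (rule J_ideal[OF xs])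
  have le: "w \<in> ?T" if "w \<in> J xs" for w
    using that L.Icarr x by (auto intro!: bexI[of _ \<zero>] simp: minus_eq)
  have "x \<in> ?T" using x L.zero_closed by (auto intro!: bexI[of _ \<one>] simp: minus_eq r_neg)
  then have "J (xs @ [x]) \<subseteq> ?T"
    using le J_N[OF xs] J_set[OF xs] by (intro J_leI[OF I]) auto
  then show "y \<in> J (xs @ [x]) \<Longrightarrow> y \<in> carrier R \<and> (\<exists>c\<in>carrier R. y \<ominus> c \<otimes> x \<in> J xs)" by blast
next
  assume "y \<in> carrier R \<and> (\<exists>c\<in>carrier R. y \<ominus> c \<otimes> x \<in> J xs)"
  then obtain c where c: "y \<in> carrier R" "c \<in> carrier R" "y \<ominus> c \<otimes> x \<in> J xs" by blast
  have xx: "set (xs @ [x]) \<subseteq> carrier R" using xs x by simp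
  have "c \<otimes> x \<in> J (xs @ [x])" "y \<ominus> c \<otimes> x \<in> J (xs @ [x])"
    using c J_set[OF xx] J_mono[OF xx, of xs] by (auto intro: ideal_mult[OF J_ideal[OF xx]])
  then show "y \<in> J (xs @ [x])" using ideal_minus_add[OF J_ideal[OF xx]] c by blast
qed

text \<open>An inverse of \<open>s\<close> modulo \<open>N\<close> recovers \<open>w\<close> from
  \<open>s w\<close>, since \<open>L\<close> absorbs the error.\<close>

lemma unit_cancel:
  assumes L: "ideal L R" "N \<subseteq> L" and s: "s \<in> carrier R" "s \<notin> m" and w: "w \<in> carrier R" "s \<otimes> w \<in> L"
  shows "w \<in> L"
proof -
  obtain e where e: "e \<in> carrier R" "e \<otimes> s \<ominus> \<one> \<in> N" using unit[OF s] by blast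
  have "e \<otimes> (s \<otimes> w) \<in> L" "w \<otimes> (e \<otimes> s \<ominus> \<one>) \<in> L"
    using e w L by (auto intro: ideal_mult)
  then have "e \<otimes> (s \<otimes> w) \<ominus> w \<otimes> (e \<otimes> s \<ominus> \<one>) \<in> L" using ideal_minus[OF L(1)] by blast
  also have "e \<otimes> (s \<otimes> w) \<ominus> w \<otimes> (e \<otimes> s \<ominus> \<one>) = w" using e(1) s(1) w(1) by (simp add: ring_normalize)
  finally show ?thesis .
qed

lemma one_minus_unit: "x \<in> m \<Longrightarrow> \<one> \<ominus> x \<notin> m"
  using ideal_add[OF m_ideal, of "\<one> \<ominus> x" x] one_m minus_diff_cancel[of \<one> x] m_carrierD by auto

section \<open>The arithmetic of \<open>v\<close> when sequences are continued, permuted or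
  replaced\<close>

lemma v_append:
  "set (xs @ ys) \<subseteq> m \<Longrightarrow> v (xs @ ys) \<le> v xs \<and> v xs \<le> v (xs @ ys) + int (length ys)"
proof (induction ys rule: rev_induct)
  case (snoc y ys)
  then show ?case using v_snoc[of "xs @ ys" y] by (auto split: if_splits)
qed simp

lemma v_append_le: "set (xs @ ys) \<subseteq> m \<Longrightarrow> v (xs @ ys) \<le> v xs"
  using v_append by blast

lemma v_append_ge: "set (xs @ ys) \<subseteq> m \<Longrightarrow> v xs \<le> v (xs @ ys) + int (length ys)"
  using v_append by blast

text \<open>A term that already lies in the ideal of its predecessors is not regular, so each of
  them lowers \<open>v\<close> by exactly 1.\<close>

lemma v_append_gen:
  assumes "set xs \<subseteq> m" "set ys \<subseteq> J xs"
  shows "v (xs @ ys) = v xs - int (length ys)"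
  using assms(2)
proof (induction ys rule: rev_induct)
  case (snoc y ys)
  have m: "set (xs @ ys) \<subseteq> m" "y \<in> m" using snoc assms J_m[OF assms(1)] by auto
  then have c: "set (xs @ ys) \<subseteq> carrier R" using m_carrier by blast
  have "y \<in> J (xs @ ys)" using snoc J_mono[OF c, of xs] by auto
  then have "\<not> reg (xs @ ys) y" using not_reg[OF m(1)] by (simp add: J_def)
  then show ?case using v_snoc[OF m] snoc by simp
qed simp

text \<open>Both orders of concatenation have the same \<open>v\<close>, and in either order the
  second sequence consists of terms in the ideal of the first.\<close>

lemma v_ideal:
  assumes "set xs \<subseteq> m" "set ys \<subseteq> m" "J xs = J ys"
  shows "v xs + int (length xs) = v ys + int (length ys)"
proof -
  have "set ys \<subseteq> J xs" "set xs \<subseteq> J ys" using assms J_set m_carrier by blast+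
  then have "v (xs @ ys) = v xs - int (length ys)" "v (ys @ xs) = v ys - int (length xs)"
    using v_append_gen assms by auto
  moreover have "v (xs @ ys) = v (ys @ xs)" using assms by (intro v_perm) auto
  ultimately show ?thesis by simp
qed

lemma reg_iff: "\<lbrakk>set xs \<subseteq> m; x \<in> m\<rbrakk> \<Longrightarrow> reg xs x \<longleftrightarrow> v (xs @ [x]) = v xs"
  using v_snoc by auto

text \<open>When \<open>x\<close> is moved in front of \<open>ys\<close>, the value
  \<open>v (xs @ [x])\<close> is squeezed between \<open>v xs\<close> and the value of the full
  sequence, which is again \<open>v xs\<close>.\<close>

lemma reg_prefix:
  assumes "set (xs @ ys) \<subseteq> m" "x \<in> m" "reg (xs @ ys) x" "v (xs @ ys) = v xs"
  shows "reg xs x"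
proof -
  have "v (xs @ ys @ [x]) = v xs" using v_snoc[of "xs @ ys" x] assms by simp
  moreover have "v (xs @ ys @ [x]) = v ((xs @ [x]) @ ys)" using assms by (intro v_perm) auto
  moreover have "v ((xs @ [x]) @ ys) \<le> v (xs @ [x])" "v (xs @ [x]) \<le> v xs"
    using v_append_le[of "xs @ [x]" ys] v_append_le[of xs "[x]"] assms by auto
  ultimately show ?thesis using reg_iff assms by simp
qed

text \<open>A special case of Krull's intersection theorem. If \<open>y\<close> could be divided by \<open>t\<close> infinitely often
  modulo \<open>J zs\<close>, the quotients \<open>u k\<close> would generate an increasing chain of ideals.\<close>

lemma divide_out:
  assumes zs: "set zs \<subseteq> m" and t: "t \<in> m" and y: "y \<in> carrier R" "y \<notin> J zs"
  shows "\<exists>(k::nat) u. u \<in> carrier R \<and> u \<notin> J (zs @ [t]) \<and> y \<ominus> t [^] k \<otimes> u \<in> J zs"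
proof (rule ccontr)
  assume neg: "\<not> ?thesis"
  have zc: "set zs \<subseteq> carrier R" and tc: "t \<in> carrier R" using zs t m_carrier by auto
  note I = J_ideal[OF zc]
  \<comment> \<open>Contrary to the claim, every quotient obtained so far is again divisible by
    \<open>t\<close> modulo \<open>J zs\<close>; \<open>g\<close> chooses the next one.\<close>
  define g where "g u = (SOME c. c \<in> carrier R \<and> u \<ominus> c \<otimes> t \<in> J zs)" for u
  define u where "u k = (g ^^ k) y" for k
  have inv: "u k \<in> carrier R \<and> y \<ominus> t [^] k \<otimes> u k \<in> J zs \<and>
      (u (Suc k) \<in> carrier R \<and> u k \<ominus> u (Suc k) \<otimes> t \<in> J zs)" for k
  proof (induction k)
    case 0
    have 1: "u 0 \<in> carrier R" "y \<ominus> t [^] (0::nat) \<otimes> u 0 \<in> J zs"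
      using y additive_subgroup.zero_closed[OF ideal.axioms(1)[OF I]] by (auto simp: u_def minus_eq r_neg)
    then have "u 0 \<in> J (zs @ [t])" using neg by blast
    then have "g (u 0) \<in> carrier R \<and> u 0 \<ominus> g (u 0) \<otimes> t \<in> J zs"
      unfolding g_def by (intro someI_ex[of "\<lambda>c. c \<in> carrier R \<and> u 0 \<ominus> c \<otimes> t \<in> J zs"]) (auto simp: J_snoc[OF zc tc])
    then show ?case using 1 by (simp add: u_def)
  next
    case (Suc k)
    have c: "u k \<in> carrier R" "u (Suc k) \<in> carrier R" using Suc by auto
    have "y \<ominus> t [^] k \<otimes> u k \<oplus> t [^] k \<otimes> (u k \<ominus> u (Suc k) \<otimes> t) \<in> J zs"
      using Suc c tc by (intro ideal_add[OF I] ideal_mult[OF I]) auto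
    also have "y \<ominus> t [^] k \<otimes> u k \<oplus> t [^] k \<otimes> (u k \<ominus> u (Suc k) \<otimes> t) = y \<ominus> t [^] Suc k \<otimes> u (Suc k)"
      using c tc y(1) by (simp add: ring_normalize)
    finally have 1: "u (Suc k) \<in> carrier R" "y \<ominus> t [^] Suc k \<otimes> u (Suc k) \<in> J zs" using c by auto
    then have "u (Suc k) \<in> J (zs @ [t])" using neg by blast
    then have "g (u (Suc k)) \<in> carrier R \<and> u (Suc k) \<ominus> g (u (Suc k)) \<otimes> t \<in> J zs"
      unfolding g_def by (intro someI_ex[of "\<lambda>c. c \<in> carrier R \<and> u (Suc k) \<ominus> c \<otimes> t \<in> J zs"]) (auto simp: J_snoc[OF zc tc])
    then show ?case using 1 by (simp add: u_def)
  qed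
  have uc: "u k \<in> carrier R" for k using inv by blast
  have zuc: "set (zs @ [u k]) \<subseteq> carrier R" for k using zc uc by simp
  have "\<exists>k. J (zs @ [u (Suc k)]) = J (zs @ [u k])"
  proof (rule acc[of "\<lambda>k. J (zs @ [u k])"])
    fix k
    show "ideal (J (zs @ [u k])) R" "N \<subseteq> J (zs @ [u k])" using zuc J_ideal J_N by blast+
    have "u k \<ominus> t \<otimes> u (Suc k) \<in> J zs" using inv uc tc by (metis m_comm)
    then have "u k \<in> J (zs @ [u (Suc k)])" using J_snoc[OF zc uc] uc tc by blast
    then show "J (zs @ [u k]) \<subseteq> J (zs @ [u (Suc k)])"
      using J_set[OF zuc] by (intro J_le_J[OF zuc]) auto
  qed
  then obtain k where "J (zs @ [u (Suc k)]) = J (zs @ [u k])" by blast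
  then have "u (Suc k) \<in> J (zs @ [u k])" using J_set[OF zuc[of "Suc k"]] by auto
  then obtain c where c: "c \<in> carrier R" "u (Suc k) \<ominus> c \<otimes> u k \<in> J zs" using J_snoc[OF zc uc] by blast
  \<comment> \<open>Stationarity makes \<open>u (k + 1)\<close> a multiple of \<open>u k\<close>,
    which is itself \<open>u (k + 1) t\<close> modulo \<open>J zs\<close>. So \<open>1 - c t\<close>
    kills \<open>u (k + 1)\<close> modulo \<open>J zs\<close>.\<close>
  have "u (Suc k) \<ominus> c \<otimes> u k \<oplus> c \<otimes> (u k \<ominus> u (Suc k) \<otimes> t) \<in> J zs"
    using inv c uc tc by (intro ideal_add[OF I] ideal_mult[OF I]) auto
  also have "u (Suc k) \<ominus> c \<otimes> u k \<oplus> c \<otimes> (u k \<ominus> u (Suc k) \<otimes> t) = (\<one> \<ominus> c \<otimes> t) \<otimes> u (Suc k)"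
    using uc[of k] uc[of "Suc k"] c(1) tc by (simp add: ring_normalize)
  finally have "u (Suc k) \<in> J zs"
    using unit_cancel[OF I J_N[OF zc]] one_minus_unit ideal_mult[OF m_ideal c(1) t] c tc uc
    by (meson m_closed minus_closed one_closed)
  then have "t [^] Suc k \<otimes> u (Suc k) \<in> J zs" using ideal_mult[OF I] tc by blast
  then show False using inv[of "Suc k"] y ideal_minus_add[OF I] by blast
qed

text \<open>The analogue of the fact that a regular local ring is a domain: dividing out a regular
  element \<open>t\<close> as often as possible reduces to the quotient by \<open>t\<close>.\<close>

lemma nonzero_regular:
  "\<lbrakk>set (zs @ ts) \<subseteq> m; J (zs @ ts) = m; v (zs @ ts) = v zs; y \<in> m; y \<notin> J zs\<rbrakk> \<Longrightarrow> reg zs y"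
proof (induction ts arbitrary: zs y)
  case Nil
  then show ?case by simp
next
  case (Cons t ts)
  have zs: "set zs \<subseteq> m" and t: "t \<in> m" and ts: "set ts \<subseteq> m" using Cons by auto
  have tc: "t \<in> carrier R" and yc: "y \<in> carrier R" using t Cons m_carrier by auto
  have v: "v (zs @ [t]) = v zs" "v ((zs @ [t]) @ ts) = v (zs @ [t])"
    using v_append_le[of "zs @ [t]" ts] v_append_le[of zs "[t]"] Cons zs t by auto
  have regt: "reg zs t" using reg_iff[OF zs t] v by simp
  obtain k :: nat and u where u: "u \<in> carrier R" "u \<notin> J (zs @ [t])" "y \<ominus> t [^] k \<otimes> u \<in> J zs"
    using divide_out[OF zs t yc] Cons by blast
  \<comment> \<open>If \<open>u\<close> lies in \<open>m\<close>, the induction applies to it over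
    \<open>zs @ [t]\<close>, whose ideal does not contain \<open>u\<close>; regularity then descends
    to \<open>zs\<close> because appending \<open>t\<close> leaves \<open>v\<close>
    unchanged.\<close>
  have regu: "reg zs u"
  proof (cases "u \<in> m")
    case True
    then have "reg (zs @ [t]) u" using Cons.IH[of "zs @ [t]" u] Cons.prems v u by simp
    then show ?thesis using reg_prefix[of zs "[t]" u] zs t True v by simp
  qed (use reg_unit zs u in blast)
  have "reg zs (t [^] i \<otimes> u)" for i :: nat
  proof (induction i)
    case (Suc i)
    have "t [^] Suc i \<otimes> u = t \<otimes> (t [^] i \<otimes> u)" using tc u(1) by (simp add: m_ac)
    then show ?case using reg_mult[OF zs tc _ regt Suc] tc u by simp
  qed (use regu u in simp)
  moreover have "t [^] k \<otimes> u \<ominus> y \<in> J zs"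
  proof -
    have "\<ominus> (y \<ominus> t [^] k \<otimes> u) \<in> J zs"
      using u(3) J_ideal[of zs] zs m_carrier by (meson additive_subgroup.a_inv_closed ideal_def order_trans)
    also have "\<ominus> (y \<ominus> t [^] k \<otimes> u) = t [^] k \<otimes> u \<ominus> y" using tc u(1) yc by (simp add: minus_eq minus_add a_comm)
    finally show ?thesis .
  qed
  ultimately show ?case using reg_cong[OF zs, of "t [^] k \<otimes> u" y] tc u yc by (simp add: J_def)
qed

section \<open>Minimal generating sequences of \<open>m\<close>\<close>

definition irredundant :: "'a list \<Rightarrow> bool" where
  "irredundant ys \<longleftrightarrow> (\<forall>i<length ys. J (take i ys @ drop (Suc i) ys) \<noteq> m)"

text \<open>Modulo \<open>J ws\<close>, the element \<open>y\<close> is a combination of the terms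
  of \<open>zs\<close>. A coefficient outside \<open>m\<close> is a unit modulo \<open>N\<close> and
  lets \<open>y\<close> replace its term; if all coefficients lie in \<open>m\<close>, then all
  summands are products of two elements of \<open>m\<close>. This is the exchange lemma for the
  vector space of \<open>m\<close> modulo its square, phrased without forming it.\<close>

lemma exchange_or_square:
  "\<lbrakk>set ws \<subseteq> m; set zs \<subseteq> m; y \<in> J (ws @ zs)\<rbrakk> \<Longrightarrow>
    (\<exists>zs1 z zs2. zs = zs1 @ z # zs2 \<and> z \<in> J (ws @ y # zs1 @ zs2)) \<or>
    y \<in> Idl (J ws \<union> {a \<otimes> b |a b. a \<in> m \<and> b \<in> m})"
proof (induction zs arbitrary: y)
  case Nil
  have "J ws \<union> {a \<otimes> b |a b. a \<in> m \<and> b \<in> m} \<subseteq> carrier R" using J_m[OF Nil(1)] m_carrier by auto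
  from genideal_self[OF this] show ?case using Nil by auto
next
  case (Cons z zs)
  let ?P = "J ws \<union> {a \<otimes> b |a b. a \<in> m \<and> b \<in> m}"
  have sub: "?P \<subseteq> carrier R" using J_m[OF Cons(2)] m_carrier by auto
  have c: "set (ws @ zs) \<subseteq> carrier R" "z \<in> carrier R" "z \<in> m" using Cons m_carrier by auto
  have "J (ws @ z # zs) = J ((ws @ zs) @ [z])" by (simp add: J_def)
  then obtain b where b: "y \<in> carrier R" "b \<in> carrier R" "y \<ominus> b \<otimes> z \<in> J (ws @ zs)"
    using Cons J_snoc[OF c(1,2)] by auto
  have yz: "set (ws @ y # z # zs) \<subseteq> carrier R" using c b by simp
  note I = J_ideal[OF yz]
  show ?case
  proof (cases "b \<in> m")
    case False
    have yzs: "set (ws @ y # zs) \<subseteq> carrier R" using c b by simp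
    have "y \<ominus> b \<otimes> z \<in> J (ws @ y # zs)" "y \<in> J (ws @ y # zs)"
      using b J_mono[OF yzs, of "ws @ zs"] J_set[OF yzs] by auto
    then have "y \<ominus> (y \<ominus> b \<otimes> z) \<in> J (ws @ y # zs)" using ideal_minus[OF J_ideal[OF yzs]] by blast
    also have "y \<ominus> (y \<ominus> b \<otimes> z) = b \<otimes> z" using b(1,2) c(2) by (simp add: ring_normalize)
    finally have "z \<in> J (ws @ y # zs)"
      using unit_cancel[OF J_ideal[OF yzs] J_N[OF yzs] b(2) False c(2)] by blast
    then have "z # zs = [] @ z # zs" "z \<in> J (ws @ y # [] @ zs)" by simp_all
    then show ?thesis by blast
  next
    case True
    \<comment> \<open>A summand with coefficient in \<open>m\<close> is harmless for the second
      alternative, so it is subtracted and the induction goes on with the remainder.\<close>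
    let ?y = "y \<ominus> b \<otimes> z"
    have yc: "?y \<in> carrier R" using b c by simp
    consider zs1 z' zs2 where "zs = zs1 @ z' # zs2" "z' \<in> J (ws @ ?y # zs1 @ zs2)" | "?y \<in> Idl ?P"
      using Cons.IH[of ?y] b Cons.prems by auto
    then show ?thesis
    proof cases
      case 1
      have s: "set (ws @ y # (z # zs1) @ zs2) \<subseteq> carrier R" using 1 c b by simp
      have "?y \<in> J (ws @ y # (z # zs1) @ zs2)"
        using J_set[OF s] b c by (intro ideal_minus[OF J_ideal[OF s]] ideal_mult[OF J_ideal[OF s]]) auto
      then have "J (ws @ ?y # zs1 @ zs2) \<subseteq> J (ws @ y # (z # zs1) @ zs2)"
        using J_set[OF s] by (intro J_le_J[OF s]) auto
      then have "z' \<in> J (ws @ y # (z # zs1) @ zs2)" using 1 by blast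
      moreover have "z # zs = (z # zs1) @ z' # zs2" using 1 by simp
      ultimately show ?thesis by blast
    next
      case 2
      have "b \<otimes> z \<in> Idl ?P" using genideal_self[OF sub] True c by auto
      then have "y \<in> Idl ?P" using ideal_minus_add[OF genideal_ideal[OF sub] 2] b by blast
      then show ?thesis by blast
    qed
  qed
qed

text \<open>Nakayama's lemma for a single generator. As \<open>m\<close> is the sum of
  \<open>J (ws @ rs)\<close> and the multiples of \<open>y\<close>, a product of two elements of
  \<open>m\<close> lies in \<open>J (ws @ rs) + m y\<close>. Hence so does \<open>y\<close>, and the
  factor \<open>1 - c\<close> with \<open>c\<close> in \<open>m\<close> can be cancelled.\<close>

lemma redundant_of_square:
  assumes ys: "set (ws @ y # rs) \<subseteq> m" "J (ws @ y # rs) = m"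
    and y: "y \<in> Idl (J ws \<union> {a \<otimes> b |a b. a \<in> m \<and> b \<in> m})"
  shows "J (ws @ rs) = m"
proof -
  let ?r = "ws @ rs"
  have r: "set ?r \<subseteq> m" and ym: "y \<in> m" using ys(1) by auto
  have rc: "set ?r \<subseteq> carrier R" by (rule order_trans[OF r m_carrier])
  have yc: "y \<in> carrier R" by (rule m_carrierD[OF ym])
  have "set (?r @ [y]) = set (ws @ y # rs)" by auto
  then have Jr: "J (?r @ [y]) = m" using ys(2) by (simp only: J_def)
  note I = J_ideal[OF rc]
  let ?T = "{w \<in> carrier R. \<exists>c\<in>m. w \<ominus> c \<otimes> y \<in> J ?r}"
  have T: "ideal ?T R" by (rule multiples_ideal[OF m_ideal I yc])
  have "w \<in> ?T" if "w \<in> J ws" for w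
  proof -
    have w: "w \<in> J ?r" using that J_mono[OF rc, of ws] by auto
    then have wc: "w \<in> carrier R" by (rule ideal.Icarr[OF I])
    have "w \<ominus> \<zero> \<otimes> y = w" using wc yc by (simp add: minus_eq)
    moreover have "\<zero> \<in> m" by (rule additive_subgroup.zero_closed[OF ideal.axioms(1)[OF m_ideal]])
    ultimately show ?thesis using w wc by (metis (mono_tags, lifting) mem_Collect_eq)
  qed
  moreover have "a \<otimes> b \<in> ?T" if "a \<in> m" "b \<in> m" for a b
  proof -
    have "b \<in> J (?r @ [y])" using that(2) by (simp only: Jr)
    then obtain c where c: "c \<in> carrier R" "b \<ominus> c \<otimes> y \<in> J ?r" using J_snoc[OF rc yc] by blast
    have ab: "a \<in> carrier R" "b \<in> carrier R" using that m_carrierD by auto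
    have "a \<otimes> (b \<ominus> c \<otimes> y) \<in> J ?r" by (rule ideal_mult[OF I ab(1) c(2)])
    also have "a \<otimes> (b \<ominus> c \<otimes> y) = a \<otimes> b \<ominus> (c \<otimes> a) \<otimes> y" using ab c(1) yc by (simp add: ring_normalize)
    finally have "a \<otimes> b \<ominus> (c \<otimes> a) \<otimes> y \<in> J ?r" .
    moreover have "c \<otimes> a \<in> m" by (rule ideal_mult[OF m_ideal c(1) that(1)])
    ultimately show ?thesis using m_closed[OF ab] by blast
  qed
  ultimately have "J ws \<union> {a \<otimes> b |a b. a \<in> m \<and> b \<in> m} \<subseteq> ?T" by blast
  from genideal_minimal[OF T this] y have "y \<in> ?T" by (rule subsetD)
  then obtain c where c: "c \<in> m" "y \<ominus> c \<otimes> y \<in> J ?r" by blast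
  have cc: "c \<in> carrier R" by (rule m_carrierD[OF c(1)])
  have "y \<ominus> c \<otimes> y = (\<one> \<ominus> c) \<otimes> y" using cc yc by (simp add: minus_eq l_distr l_minus)
  then have "(\<one> \<ominus> c) \<otimes> y \<in> J ?r" using c(2) by simp
  then have "y \<in> J ?r"
    using unit_cancel[OF I J_N[OF rc] _ one_minus_unit[OF c(1)] yc] cc by simp
  then have "J (?r @ [y]) \<subseteq> J ?r"
    using J_set[OF rc] by (intro J_le_J[OF rc]) simp
  then show ?thesis using Jr J_m[OF r] by simp
qed

text \<open>Steinitz exchange: the terms of \<open>ys\<close> successively replace terms of
  \<open>xs\<close> while the sequence keeps generating \<open>m\<close>. The other alternative of
  \<open>exchange_or_square\<close> would make a term of \<open>ys\<close> redundant.\<close>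

lemma irredundant_length_le:
  assumes xs: "set xs \<subseteq> m" "J xs = m" and ys: "set ys \<subseteq> m" "J ys = m" "irredundant ys"
  shows "length ys \<le> length xs"
proof -
  have "\<exists>zs. set zs \<subseteq> m \<and> J (take k ys @ zs) = m \<and> length zs + k \<le> length xs" if "k \<le> length ys" for k
    using that
  proof (induction k)
    case 0
    show ?case using xs by (intro exI[of _ xs]) simp
  next
    case (Suc k)
    then obtain zs where zs: "set zs \<subseteq> m" "J (take k ys @ zs) = m" "length zs + k \<le> length xs" by auto
    have k: "k < length ys" using Suc by simp
    have tk: "set (take k ys) \<subseteq> m" by (rule order_trans[OF set_take_subset ys(1)])
    have y: "ys ! k \<in> m" by (rule subsetD[OF ys(1) nth_mem[OF k]])
    have split: "take k ys @ ys ! k # drop (Suc k) ys = ys" by (rule id_take_nth_drop[OF k, symmetric])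
    have "J (take k ys @ drop (Suc k) ys) \<noteq> m" using ys(3) k unfolding irredundant_def by blast
    then have "ys ! k \<notin> Idl (J (take k ys) \<union> {a \<otimes> b |a b. a \<in> m \<and> b \<in> m})"
      using redundant_of_square[of "take k ys" "ys ! k" "drop (Suc k) ys", unfolded split, OF ys(1,2)] by blast
    then obtain zs1 z zs2 where z: "zs = zs1 @ z # zs2" "z \<in> J (take k ys @ ys ! k # zs1 @ zs2)"
      using exchange_or_square[OF tk zs(1), of "ys ! k"] y unfolding zs(2) by auto
    let ?ws = "take (Suc k) ys @ zs1 @ zs2"
    have eq: "take k ys @ ys ! k # zs1 @ zs2 = ?ws" using k by (simp add: take_Suc_conv_app_nth)
    have w: "set ?ws \<subseteq> m" using z(1) zs(1) tk y unfolding eq[symmetric] by auto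
    then have wc: "set ?ws \<subseteq> carrier R" using m_carrier by (rule order_trans)
    have "set (take k ys @ ys ! k # zs1 @ zs2) \<subseteq> J ?ws" "z \<in> J ?ws"
      using J_set[OF wc] z(2) by (simp_all only: eq)
    then have "set (take k ys @ zs) \<subseteq> J ?ws" using z(1) by auto
    from J_le_J[OF wc this] have "J ?ws = m" using zs(2) J_m[OF w] by simp
    moreover have "set (zs1 @ zs2) \<subseteq> m" "length (zs1 @ zs2) + Suc k \<le> length xs"
      using zs(1,3) unfolding z(1) by auto
    ultimately show ?case by blast
  qed
  from this[OF order_refl] show ?thesis by auto
qed

text \<open>The sums of \<open>v\<close> and length agree for \<open>xs\<close> and
  \<open>ys\<close>, and \<open>ys\<close> is no longer than \<open>xs\<close>; so
  \<open>v ys\<close> is at least \<open>v []\<close>. The opposite bound is automatic.\<close>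

lemma irredundant_regular:
  assumes xs: "set xs \<subseteq> m" "J xs = m" "v xs = v []" and ys: "set ys \<subseteq> m" "J ys = m" "irredundant ys"
  shows "v ys = v []"
proof -
  have "v xs + int (length xs) = v ys + int (length ys)"
    by (rule v_ideal[OF xs(1) ys(1)]) (simp only: xs ys)
  moreover have "v ys \<le> v []" using v_append_le[of "[]" ys] ys(1) by simp
  ultimately show ?thesis using irredundant_length_le[OF xs(1,2) ys] xs(3) by linarith
qed

section \<open>Regularity of the quotient and parts of minimal generating sequences\<close>

theorem regular_quotient_imp:
  assumes xs: "set xs \<subseteq> m" "J xs = m" "v xs = v []"
    and as: "set as \<subseteq> m" and ts: "set ts \<subseteq> m" "J (as @ ts) = m" "v (as @ ts) = v as"
  shows "\<exists>ys zs. set ys \<subseteq> m \<and> J ys = m \<and> irredundant ys \<and> set zs \<subseteq> set ys \<and> J zs = J as"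
proof -
  \<comment> \<open>The bound of \<open>length ts'\<close> by \<open>length ts\<close> is what later
    forces \<open>ts'\<close> to be regular on the Koszul complex on \<open>as\<close>.\<close>
  define P where "P l \<longleftrightarrow> (\<exists>zs ts'. set zs \<subseteq> set as \<and> set ts' \<subseteq> set ts \<and> length ts' \<le> length ts \<and>
    J (zs @ ts') = m \<and> l = length (zs @ ts'))" for l
  have "P (length (as @ ts))" unfolding P_def using ts by (intro exI[of _ as] exI[of _ ts]) auto
  then obtain l where l: "P l" "\<And>i. i < l \<Longrightarrow> \<not> P i" by (metis exists_least_iff)
  obtain zs ts' where z: "set zs \<subseteq> set as" "set ts' \<subseteq> set ts" "length ts' \<le> length ts" "J (zs @ ts') = m"
    "l = length (zs @ ts')" using l(1) unfolding P_def by blast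
  let ?ys = "zs @ ts'"
  have ysm: "set ?ys \<subseteq> m" using z as ts by auto
  \<comment> \<open>Omitting a term from either half would give a shorter sequence of the kind
    described by \<open>P\<close>.\<close>
  have irr: "irredundant ?ys"
    unfolding irredundant_def
  proof (intro allI impI notI)
    fix i assume i: "i < length ?ys" and J: "J (take i ?ys @ drop (Suc i) ?ys) = m"
    show False
    proof (cases "i < length zs")
      case True
      let ?zs = "take i zs @ drop (Suc i) zs"
      have e: "take i ?ys @ drop (Suc i) ?ys = ?zs @ ts'" using True by simp
      have "set ?zs \<subseteq> set as" using z(1) set_take_subset[of i zs] set_drop_subset[of "Suc i" zs] by auto
      then have "P (length (?zs @ ts'))" unfolding P_def using J z unfolding e by blast
      moreover have "length (?zs @ ts') < l" using z(5) True by simp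
      ultimately show False using l(2) by blast
    next
      case False
      let ?i = "i - length zs"
      let ?ts = "take ?i ts' @ drop (Suc ?i) ts'"
      have e: "take i ?ys @ drop (Suc i) ?ys = zs @ ?ts" using False by (simp add: Suc_diff_le)
      have "set ?ts \<subseteq> set ts" using z(2) set_take_subset[of ?i ts'] set_drop_subset[of "Suc ?i" ts'] by auto
      moreover have "length ?ts < length ts'" using i False by simp
      ultimately have "P (length (zs @ ?ts))" unfolding P_def using J z(1,3) unfolding e
        by (intro exI[of _ zs] exI[of _ ?ts]) auto
      moreover have "length (zs @ ?ts) < l" using z(5) \<open>length ?ts < length ts'\<close> by simp
      ultimately show False using l(2) by blast
    qed
  qed
  have vys: "v ?ys = v []" by (rule irredundant_regular[OF xs ysm z(4) irr])
  have atm: "set (as @ ts') \<subseteq> m" "set (as @ ts) \<subseteq> m" using as z ts by auto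
  have ac: "set (as @ ts') \<subseteq> carrier R" "set as \<subseteq> carrier R" "set zs \<subseteq> carrier R" using atm as z m_carrier by auto
  have Jat: "J (as @ ts') = m"
    using J_m[OF atm(1)] J_mono[OF ac(1), of ?ys] z by auto
  \<comment> \<open>Both sequences generate \<open>m\<close>, so fewer terms would mean a larger
    \<open>v\<close>. But \<open>ts\<close> already attains the upper bound \<open>v as\<close>;
    hence the lengths agree and \<open>ts'\<close> attains it too.\<close>
  have "v (as @ ts') + int (length ts') = v (as @ ts) + int (length ts)"
    using v_ideal[OF atm] Jat ts by simp
  then have at: "v (as @ ts') = v as" "length ts' = length ts"
    using v_append_le[OF atm(1)] z(3) ts(3) by auto
  \<comment> \<open>Cancelling the common tail \<open>ts'\<close> from two generating sequences of
    \<open>m\<close> compares \<open>as\<close> with \<open>zs\<close>, although their ideals are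
    not yet known to agree.\<close>
  have vas: "v as + int (length as) = v [] + int (length zs)"
    using v_ideal[OF atm(1) ysm] Jat z(4) vys at by simp
  have vzs: "v zs = v []" using v_append_le[OF ysm] v_append_le[of "[]" zs] ysm vys by simp
  have "y \<in> J zs" if y: "y \<in> set as" for y
  proof (rule ccontr)
    assume "y \<notin> J zs"
    then have "reg zs y" using nonzero_regular[OF ysm z(4)] vys vzs y as by auto
    then have vy: "v (zs @ [y]) = v []" using v_snoc[of zs y] ysm y as vzs by auto
    \<comment> \<open>The terms of \<open>zs @ [y]\<close> lie in \<open>J as\<close> and lower
      \<open>v\<close> by \<open>length zs + 1\<close>. In the other order the value starts from
      \<open>v []\<close> and the terms of \<open>as\<close> lower it by at most
      \<open>length as\<close>. The two bounds contradict the balance \<open>vas\<close> by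
      1.\<close>
    have "v (as @ zs @ [y]) = v as - int (length (zs @ [y]))"
      by (rule v_append_gen[OF as]) (use z y J_set[OF ac(2)] in auto)
    moreover have "v (as @ zs @ [y]) = v ((zs @ [y]) @ as)" using as ysm y by (intro v_perm) auto
    moreover have "v (zs @ [y]) \<le> v ((zs @ [y]) @ as) + int (length as)"
      using as ysm y by (intro v_append_ge) auto
    ultimately show False using vy vas by simp
  qed
  then have "J as = J zs"
    using J_le_J[OF ac(3), of as] J_mono[OF ac(2) z(1)] by blast
  then show ?thesis using ysm z(4) irr by (intro exI[of _ ?ys] exI[of _ zs]) auto
qed

text \<open>The terms of \<open>ys\<close> outside \<open>zs\<close> complete \<open>as\<close>. Two
  uses of \<open>v_ideal\<close>, for sequences generating \<open>m\<close> and for sequences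
  generating \<open>J as\<close>, show that these terms do not lower \<open>v\<close> after
  \<open>as\<close>, because they do not lower it after the terms of \<open>zs\<close>.\<close>

theorem regular_quotient_if:
  assumes xs: "set xs \<subseteq> m" "J xs = m" "v xs = v []" and as: "set as \<subseteq> m"
    and ys: "set ys \<subseteq> m" "J ys = m" "irredundant ys" and zs: "set zs \<subseteq> set ys" "J zs = J as"
  shows "\<exists>ts. set ts \<subseteq> m \<and> J (as @ ts) = m \<and> v (as @ ts) = v as"
proof -
  have vys: "v ys = v []" by (rule irredundant_regular[OF xs ys])
  \<comment> \<open>\<open>zs\<close> may repeat or reorder terms, so it is replaced by a sublist of
    \<open>ys\<close> with the same elements; \<open>?ss @ ?ts\<close> is then a permutation of
    \<open>ys\<close>.\<close>
  let ?ss = "filter (\<lambda>y. y \<in> set zs) ys" and ?ts = "filter (\<lambda>y. y \<notin> set zs) ys"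
  have ms: "mset ys = mset (?ss @ ?ts)" by simp
  have ssts: "set (?ss @ ?ts) \<subseteq> m" using ys by auto
  have ss: "set ?ss = set zs" using zs(1) by auto
  have vst: "v (?ss @ ?ts) = v []" using v_perm[OF ys(1) ms] vys by simp
  then have vss: "v ?ss = v []" using v_append_le[OF ssts] v_append_le[of "[]" ?ss] ssts by auto
  have Jss: "J ?ss = J as" using zs(2) ss by (simp only: J_def)
  have atm: "set (as @ ?ts) \<subseteq> m" using as ys by auto
  then have ac: "set (as @ ?ts) \<subseteq> carrier R" "set as \<subseteq> carrier R" using m_carrier by auto
  have "set ys \<subseteq> J (as @ ?ts)"
  proof
    fix y assume y: "y \<in> set ys"
    show "y \<in> J (as @ ?ts)"
    proof (cases "y \<in> set zs")
      case True
      have "set ?ss \<subseteq> J ?ss" using ssts m_carrier by (intro J_set) auto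
      then have "y \<in> J as" using True ss Jss by blast
      then show ?thesis using J_mono[OF ac(1), of as] by auto
    qed (use y J_set[OF ac(1)] in auto)
  qed
  then have Jat: "J (as @ ?ts) = m" using J_le_J[OF ac(1), of ys] J_m[OF atm] ys(2) by blast
  have "v (as @ ?ts) + int (length (as @ ?ts)) = v (?ss @ ?ts) + int (length (?ss @ ?ts))"
  proof (rule v_ideal[OF atm ssts])
    have "set (?ss @ ?ts) = set ys" by auto
    then show "J (as @ ?ts) = J (?ss @ ?ts)" using Jat ys(2) by (simp only: J_def)
  qed
  moreover have "v as + int (length as) = v ?ss + int (length ?ss)"
    using Jss ssts by (intro v_ideal[OF as]) auto
  ultimately have "v (as @ ?ts) = v as" using vst vss by simp
  then show ?thesis using Jat ys by (intro exI[of _ ?ts]) auto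
qed

end

section \<open>Koszul rings as complexes over the degree zero part\<close>

definition degree_zero :: "'a dg_ring \<Rightarrow> 'a dg_ring"
  where "degree_zero A = A\<lparr>carrier := homog A 0\<rparr>"

lemma degree_zero_simps [simp]:
  "carrier (degree_zero A) = homog A 0" "add (degree_zero A) = add A" "mult (degree_zero A) = mult A"
  "zero (degree_zero A) = zero A" "one (degree_zero A) = one A"
  by (simp_all add: degree_zero_def)

context dg_ring
begin

lemma cring_degree_zero: "cring (degree_zero A)"
proof (rule cringI)
  show "abelian_group (degree_zero A)"
  proof (rule abelian_groupI)
    fix x assume "x \<in> carrier (degree_zero A)"
    then show "\<exists>y\<in>carrier (degree_zero A). y \<oplus>\<^bsub>degree_zero A\<^esub> x = \<zero>\<^bsub>degree_zero A\<^esub>"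
      by (intro bexI[of _ "\<ominus> x"]) (auto simp: l_neg)
  qed (auto simp: a_ac)
  show "comm_monoid (degree_zero A)"
    by (rule comm_monoidI) (auto simp: one_homog m_assoc mult_mem_homog intro: degree_zero_central)
qed (auto simp: l_distr)

sublocale Z: cring "degree_zero A"
  by (rule cring_degree_zero)

lemma degree_zero_minus [simp]:
  assumes "x \<in> homog A 0" shows "\<ominus>\<^bsub>degree_zero A\<^esub> x = \<ominus> x"
  by (rule Z.minus_equality) (use assms in \<open>auto simp: l_neg\<close>)

lemma degree_zero_diff [simp]:
  "\<lbrakk>x \<in> homog A 0; y \<in> homog A 0\<rbrakk> \<Longrightarrow> x \<ominus>\<^bsub>degree_zero A\<^esub> y = x \<ominus> y"
  by (simp add: Z.minus_eq minus_eq)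

text \<open>If \<open>b = d c\<close> and \<open>z\<close> is a cocycle, then
  \<open>b z = d (c z)\<close>. So A^0 acts on cohomology through \<open>H^0(A)\<close>.\<close>

lemma coboundaries_annihilate:
  assumes b: "b \<in> coboundaries A 0" and z: "z \<in> cocycles A n"
  shows "b \<otimes> z \<in> coboundaries A n"
proof -
  obtain c where c: "c \<in> homog A (-1)" "b = diff A c" using b by (auto simp: coboundaries_def)
  have zh: "z \<in> homog A n" "diff A z = \<zero>" using z by (auto simp: cocycles_def)
  have "diff A (c \<otimes> z) = b \<otimes> z"
    using leibniz[OF c(1) homog_carrier[OF zh(1)]] zh c homog_carrier[OF diff_homog[OF c(1)]] homog_carrier[OF zh(1)]
      homog_carrier[OF c(1)] by simp
  moreover have "c \<otimes> z \<in> homog A (n - 1)" by (rule mult_mem_homog[OF c(1) zh(1)]) simp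
  ultimately show ?thesis by (metis coboundaries_def imageI)
qed

lemma degree_zero_cocycle: "x \<in> homog A 0 \<Longrightarrow> x \<in> cocycles A 0"
  by (simp add: cocycles_def diff_degree_zero)

text \<open>Scalars act through a homomorphism to the degree zero part: the identity for
  \<open>A\<close> itself, and \<open>koszul_const\<close> for Koszul rings.\<close>

lemma scalar_complexI:
  assumes S: "cring S" and hom: "\<And>s. s \<in> carrier S \<Longrightarrow> \<sigma> s \<in> homog A 0"
    and add: "\<And>s t. \<lbrakk>s \<in> carrier S; t \<in> carrier S\<rbrakk> \<Longrightarrow> \<sigma> (s \<oplus>\<^bsub>S\<^esub> t) = \<sigma> s \<oplus> \<sigma> t"
    and mult: "\<And>s t. \<lbrakk>s \<in> carrier S; t \<in> carrier S\<rbrakk> \<Longrightarrow> \<sigma> (s \<otimes>\<^bsub>S\<^esub> t) = \<sigma> s \<otimes> \<sigma> t"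
    and one: "\<sigma> \<one>\<^bsub>S\<^esub> = \<one>"
  shows "scalar_complex S A (\<lambda>s x. \<sigma> s \<otimes> x)"
proof (intro scalar_complex.intro scalar_complex_axioms.intro S abelian_group_axioms homog_subgroup)
  fix n x assume x: "x \<in> homog A n"
  note xc = homog_carrier[OF x]
  show "diff A x \<in> homog A (n + 1)" by (rule diff_homog[OF x])
  show "diff A (diff A x) = \<zero>" by (rule diff_diff[OF xc])
  show "\<sigma> \<one>\<^bsub>S\<^esub> \<otimes> x = x" using xc by (simp add: one)
  show "diff A (x \<oplus> y) = diff A x \<oplus> diff A y" if "y \<in> homog A n" for y
    using that xc by (intro diff_add) auto
  fix s assume s: "s \<in> carrier S"
  note sc = homog_carrier[OF hom[OF s]]
  show "\<sigma> s \<otimes> x \<in> homog A n" by (rule mult_mem_homog[OF hom[OF s] x]) simp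
  show "\<sigma> s \<otimes> (x \<oplus> y) = \<sigma> s \<otimes> x \<oplus> \<sigma> s \<otimes> y" if "y \<in> homog A n" for y
    using xc sc homog_carrier[OF that] by (simp add: r_distr)
  show "diff A (\<sigma> s \<otimes> x) = \<sigma> s \<otimes> diff A x" by (rule diff_act_degree_zero[OF hom[OF s] xc])
  fix t assume t: "t \<in> carrier S"
  note tc = homog_carrier[OF hom[OF t]]
  show "\<sigma> (s \<oplus>\<^bsub>S\<^esub> t) \<otimes> x = \<sigma> s \<otimes> x \<oplus> \<sigma> t \<otimes> x" using xc sc tc by (simp add: add s t l_distr)
  show "\<sigma> (s \<otimes>\<^bsub>S\<^esub> t) \<otimes> x = \<sigma> s \<otimes> (\<sigma> t \<otimes> x)" using xc sc tc by (simp add: mult s t m_assoc)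
qed

lemma coboundaries_ideal: "ideal (coboundaries A 0) (degree_zero A)"
proof -
  interpret C: scalar_complex "degree_zero A" A "\<lambda>s x. s \<otimes> x"
    by (rule scalar_complexI[OF cring_degree_zero]) auto
  have sub: "coboundaries A 0 \<subseteq> homog A 0"
    using C.coboundaries_cocycles C.cocycles_homog by blast
  show ?thesis
  proof (rule idealI[OF Z.ring_axioms])
    show "subgroup (coboundaries A 0) (add_monoid (degree_zero A))"
    proof (rule Z.add.subgroupI)
      show "coboundaries A 0 \<subseteq> carrier (degree_zero A)" using sub by simp
      show "coboundaries A 0 \<noteq> {}" using C.coboundaries_zero by blast
      show "\<ominus>\<^bsub>degree_zero A\<^esub> x \<in> coboundaries A 0" if "x \<in> coboundaries A 0" for x
        using C.coboundaries_minus[OF that] sub that by auto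
      show "x \<oplus>\<^bsub>degree_zero A\<^esub> y \<in> coboundaries A 0" if "x \<in> coboundaries A 0" "y \<in> coboundaries A 0" for x y
        using C.coboundaries_add[OF that] by simp
    qed
    fix a x assume a: "a \<in> coboundaries A 0" and x: "x \<in> carrier (degree_zero A)"
    show "x \<otimes>\<^bsub>degree_zero A\<^esub> a \<in> coboundaries A 0" using C.coboundaries_act[OF x a] by simp
    moreover have "x \<otimes> a = a \<otimes> x" using a x sub by (intro degree_zero_central) auto
    ultimately show "a \<otimes>\<^bsub>degree_zero A\<^esub> x \<in> coboundaries A 0" by simp
  qed
qed

lemma koszul_const_empty [simp]: "koszul_const A n s {} = s"
  by (simp add: koszul_const_def)

lemma koszul_const_add:
  "koszul_const A (length as) (s \<oplus> t) = koszul_const A (length as) s \<oplus>\<^bsub>koszul_ring A as\<^esub> koszul_const A (length as) t"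
  if "s \<in> homog A 0" "t \<in> homog A 0"
  using that by (auto simp: koszul_const_def koszul_ring_add intro!: restrict_ext)

lemma koszul_const_times:
  "koszul_const A (length as) (s \<otimes> t) = koszul_const A (length as) s \<otimes>\<^bsub>koszul_ring A as\<^esub> koszul_const A (length as) t"
  if "s \<in> homog A 0" "t \<in> homog A 0"
  unfolding koszul_const_mult[OF that(1) koszul_const_closed[OF homog_carrier[OF that(2)]]]
  using that by (auto simp: koszul_const_def intro!: restrict_ext)

lemma koszul_const_one: "koszul_const A (length as) \<one> = \<one>\<^bsub>koszul_ring A as\<^esub>"
  by (simp add: koszul_const_def koszul_ring_one)

text \<open>The coefficient at \<open>I\<close> of an element of degree 0 has degree
  \<open>card I\<close>, which is positive unless \<open>I\<close> is empty. So A^0 is also the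
  degree zero part of every Koszul ring.\<close>

lemma koszul_degree_zero_eq:
  assumes F: "F \<in> homog (koszul_ring A as) 0"
  shows "F = koszul_const A (length as) (F {})" "F {} \<in> homog A 0"
proof -
  have F': "F \<in> extensional (Pow {..<length as})" "\<And>I. I \<subseteq> {..<length as} \<Longrightarrow> F I \<in> homog A (int (card I))"
    using F by (auto simp: koszul_ring_homog PiE_def)
  show "F {} \<in> homog A 0" using F'(2)[of "{}"] by simp
  show "F = koszul_const A (length as) (F {})"
  proof
    fix I
    consider "\<not> I \<subseteq> {..<length as}" | "I = {}" | "I \<subseteq> {..<length as}" "I \<noteq> {}" by blast
    then show "F I = koszul_const A (length as) (F {}) I"
    proof cases
      case 1
      then show ?thesis using F'(1) by (simp add: koszul_const_def extensional_def)
    next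
      case 3
      then have "0 < int (card I)" using finite_subset[OF 3(1)] by (simp add: card_gt_0_iff)
      then show ?thesis using F'(2)[OF 3(1)] 3 nonpositive by (simp add: koszul_const_def)
    qed simp
  qed
qed

definition koszul_act :: "'a list \<Rightarrow> 'a \<Rightarrow> (nat set \<Rightarrow> 'a) \<Rightarrow> nat set \<Rightarrow> 'a"
  where "koszul_act as s F = koszul_const A (length as) s \<otimes>\<^bsub>koszul_ring A as\<^esub> F"

lemma koszul_complex:
  assumes as: "set as \<subseteq> homog A 0"
  shows "scalar_complex (degree_zero A) (koszul_ring A as) (koszul_act as)"
proof -
  interpret K: dg_ring "koszul_ring A as" by (rule dg_ring_koszul[OF as])
  have "scalar_complex (degree_zero A) (koszul_ring A as)
      (\<lambda>s F. koszul_const A (length as) s \<otimes>\<^bsub>koszul_ring A as\<^esub> F)"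
    by (rule K.scalar_complexI[OF cring_degree_zero])
      (auto simp: koszul_const_homog koszul_const_add koszul_const_times koszul_const_one)
  then show ?thesis by (simp add: koszul_act_def[abs_def])
qed

lemma koszul_cone:
  assumes as: "set (as @ [a]) \<subseteq> homog A 0"
  shows "complex_cone (degree_zero A) (koszul_ring A as) (koszul_act as) (koszul_ring A (as @ [a]))
    (koszul_fst (length as)) (koszul_snd A (length as)) (koszul_pair A (length as)) (koszul_act (as @ [a])) a"
proof -
  have as': "set as \<subseteq> homog A 0" "a \<in> homog A 0" using as by auto
  interpret E: exterior_extension "koszul_ring A as" "koszul_ring A (as @ [a])"
    "koszul_fst (length as)" "koszul_snd A (length as)" "koszul_pair A (length as)" "koszul_const A (length as) a"
    by (rule koszul_exterior_extension[OF dg_ring_koszul[OF as'(1)] as])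
  interpret M: scalar_complex "degree_zero A" "koszul_ring A as" "koszul_act as"
    by (rule koszul_complex[OF as'(1)])
  interpret N: scalar_complex "degree_zero A" "koszul_ring A (as @ [a])" "koszul_act (as @ [a])"
    by (rule koszul_complex[OF as])
  have hc: "z \<in> carrier (koszul_ring A (as @ [a]))" if "z \<in> homog (koszul_ring A (as @ [a])) n" for z n
    using that by (rule N.homog_carrier)
  have sub: "I \<subseteq> {..<Suc (length as)}" "insert (length as) I \<subseteq> {..<Suc (length as)}" if "I \<subseteq> {..<length as}" for I
    using that by auto
  have zI: "z I \<in> carrier A" if "z \<in> carrier (koszul_ring A (as @ [a]))" "I \<subseteq> {..<Suc (length as)}" for z I
    using that unfolding koszul_ring_carrier by auto
  have act: "koszul_act (as @ [a]) s z = (\<lambda>L\<in>Pow {..<Suc (length as)}. s \<otimes> z L)"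
    if "s \<in> homog A 0" "z \<in> carrier (koszul_ring A (as @ [a]))" for s z
    using koszul_const_mult[OF that] by (simp add: koszul_act_def)
  show ?thesis
  proof (intro complex_cone.intro complex_cone_axioms.intro M.scalar_complex_axioms E.pair_group_axioms)
    show "a \<in> carrier (degree_zero A)" using as' by simp
    show "homog (koszul_ring A (as @ [a])) n = {z \<in> carrier (koszul_ring A (as @ [a])).
      koszul_fst (length as) z \<in> homog (koszul_ring A as) n \<and>
      koszul_snd A (length as) z \<in> homog (koszul_ring A as) (n + 1)}" for n
      by (rule E.homog_eq)
    fix n z assume z: "z \<in> homog (koszul_ring A (as @ [a])) n"
    note zc = hc[OF z]
    show "diff (koszul_ring A (as @ [a])) z \<in> carrier (koszul_ring A (as @ [a]))" by (rule E.d_closed[OF zc])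
    show "koszul_fst (length as) (diff (koszul_ring A (as @ [a])) z) =
        diff (koszul_ring A as) (koszul_fst (length as) z) \<oplus>\<^bsub>koszul_ring A as\<^esub>
        koszul_act as a (koszul_snd A (length as) z)"
      unfolding koszul_act_def by (rule E.p_diff[OF zc])
    show "koszul_snd A (length as) (diff (koszul_ring A (as @ [a])) z) =
        \<ominus>\<^bsub>koszul_ring A as\<^esub> diff (koszul_ring A as) (koszul_snd A (length as) z)"
      by (rule E.q_diff[OF zc])
    fix s assume s: "s \<in> carrier (degree_zero A)"
    then have sh: "s \<in> homog A 0" by simp
    show "koszul_act (as @ [a]) s z \<in> carrier (koszul_ring A (as @ [a]))"
      by (rule hc[OF N.act_homog[OF s z]])
    show "koszul_fst (length as) (koszul_act (as @ [a]) s z) = koszul_act as s (koszul_fst (length as) z)"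
      unfolding act[OF sh zc] unfolding koszul_act_def koszul_const_mult[OF sh E.p_closed[OF zc]]
      using sub by (auto simp: koszul_fst_def restrict_def fun_eq_iff)
    have "sgn_pow A k (s \<otimes> z I) = s \<otimes> sgn_pow A k (z I)" if "I \<subseteq> {..<Suc (length as)}" for k I
      using zI[OF zc that] sh by (simp add: sgn_pow_r_mult)
    then show "koszul_snd A (length as) (koszul_act (as @ [a]) s z) = koszul_act as s (koszul_snd A (length as) z)"
      unfolding act[OF sh zc] unfolding koszul_act_def koszul_const_mult[OF sh E.q_closed[OF zc]]
      using sub by (auto simp: koszul_snd_def intro!: restrict_ext)
  qed
qed

text \<open>The kernel of the map from A^0 to \<open>H^0\<close> of the Koszul ring.\<close>

definition koszul_ideal :: "'a list \<Rightarrow> 'a set"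
  where "koszul_ideal as = {s \<in> homog A 0. koszul_const A (length as) s \<in> coboundaries (koszul_ring A as) 0}"

text \<open>Such a scalar acts as multiplication by a coboundary of degree 0 in the Koszul
  ring.\<close>

lemma koszul_ideal_annihilates:
  assumes as: "set as \<subseteq> homog A 0" and s: "s \<in> koszul_ideal as"
  shows "scalar_complex.annihilates (koszul_ring A as) (koszul_act as) s"
proof -
  interpret K: dg_ring "koszul_ring A as" by (rule dg_ring_koszul[OF as])
  interpret M: scalar_complex "degree_zero A" "koszul_ring A as" "koszul_act as"
    by (rule koszul_complex[OF as])
  show ?thesis
    unfolding M.annihilates_def using s K.coboundaries_annihilate
    by (simp add: koszul_act_def koszul_ideal_def)
qed

lemma koszul_ideal_is_ideal:
  assumes as: "set as \<subseteq> homog A 0"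
  shows "ideal (koszul_ideal as) (degree_zero A)"
proof -
  interpret K: dg_ring "koszul_ring A as" by (rule dg_ring_koszul[OF as])
  interpret h: ring_hom_ring "degree_zero A" "degree_zero (koszul_ring A as)" "koszul_const A (length as)"
    by (rule ring_hom_ringI2[OF Z.ring_axioms K.Z.ring_axioms])
      (auto intro!: ring_hom_memI simp: koszul_const_homog koszul_const_add koszul_const_times koszul_const_one)
  have "ideal {r \<in> carrier (degree_zero A). koszul_const A (length as) r \<in> coboundaries (koszul_ring A as) 0} (degree_zero A)"
    by (rule h.ideal_vimage[OF K.coboundaries_ideal])
  then show ?thesis by (simp add: koszul_ideal_def)
qed

lemma koszul_diff_empty:
  assumes as: "set as \<subseteq> homog A 0" and F: "F \<in> carrier (koszul_ring A as)"
  shows "diff (koszul_ring A as) F {} = diff A (F {}) \<oplus> (\<Oplus> i \<in> {..<length as}. as ! i \<otimes> F {i})"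
  by (simp add: koszul_ring_diff)

lemma degree_zero_finsum_mem:
  assumes I: "ideal I (degree_zero A)" and "finite F" "\<And>i. i \<in> F \<Longrightarrow> f i \<in> I"
  shows "finsum A f F \<in> I"
  using assms(2,3)
proof (induction F)
  case empty
  then show ?case using additive_subgroup.zero_closed[OF ideal.axioms(1)[OF I]] by simp
next
  case (insert i F)
  have c: "f j \<in> carrier A" if "j \<in> insert i F" for j
    using ideal.Icarr[OF I insert(4)[OF that]] by auto
  show ?case
    using insert c additive_subgroup.a_closed[OF ideal.axioms(1)[OF I], of "f i" "finsum A f F"] by (auto simp: Pi_iff)
qed

text \<open>An element \<open>F\<close> of degree - 1 has coefficients \<open>F {}\<close> of degree
  - 1 and \<open>F {i}\<close> of degree 0, and the coefficient of its differential at
  \<open>{}\<close> is \<open>d (F {})\<close> plus the sum of the \<open>a_i F {i}\<close>. Hence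
  the kernel is generated by the coboundaries of \<open>A\<close> and the terms of
  \<open>as\<close>.\<close>

lemma koszul_ideal_eq:
  assumes as: "set as \<subseteq> homog A 0"
  shows "koszul_ideal as = Idl\<^bsub>degree_zero A\<^esub> (coboundaries A 0 \<union> set as)"
proof -
  interpret K: dg_ring "koszul_ring A as" by (rule dg_ring_koszul[OF as])
  let ?I = "Idl\<^bsub>degree_zero A\<^esub> (coboundaries A 0 \<union> set as)"
  have sub: "coboundaries A 0 \<union> set as \<subseteq> carrier (degree_zero A)"
    using as ideal.Icarr[OF coboundaries_ideal] by auto
  note I = Z.genideal_ideal[OF sub] and gen = Z.genideal_self[OF sub]
  show ?thesis
  proof
    show "koszul_ideal as \<subseteq> ?I"
    proof
      fix s assume s: "s \<in> koszul_ideal as"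
      then obtain F where F: "F \<in> homog (koszul_ring A as) (-1)" "koszul_const A (length as) s = diff (koszul_ring A as) F"
        by (auto simp: koszul_ideal_def coboundaries_def)
      have h: "F {} \<in> homog A (-1)" "\<And>i. i < length as \<Longrightarrow> F {i} \<in> homog A 0"
        using F(1) by (force simp: koszul_ring_homog)+
      have "s = diff A (F {}) \<oplus> (\<Oplus> i \<in> {..<length as}. as ! i \<otimes> F {i})"
        using koszul_diff_empty[OF as K.homog_carrier[OF F(1)]] F(2) koszul_const_empty by metis
      moreover have "diff A (F {}) \<in> ?I" using gen h(1) by (auto simp: coboundaries_def)
      moreover have "(\<Oplus> i \<in> {..<length as}. as ! i \<otimes> F {i}) \<in> ?I"
      proof (rule degree_zero_finsum_mem[OF I])
        fix i assume "i \<in> {..<length as}"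
        then have i: "i < length as" by simp
        have "as ! i \<in> ?I" using gen nth_mem[OF i] by blast
        then show "as ! i \<otimes> F {i} \<in> ?I" using ideal.I_r_closed[OF I, of "as ! i" "F {i}"] h(2)[OF i] by simp
      qed simp
      ultimately show "s \<in> ?I" using additive_subgroup.a_closed[OF ideal.axioms(1)[OF I]] by simp
    qed
    have "coboundaries A 0 \<subseteq> koszul_ideal as"
    proof
      fix s assume "s \<in> coboundaries A 0"
      then obtain b where b: "b \<in> homog A (-1)" "s = diff A b" by (auto simp: coboundaries_def)
      let ?b = "koszul_const A (length as) b"
      have bh: "?b \<in> homog (koszul_ring A as) (-1)" by (rule koszul_const_homog[OF b(1)])
      have dh: "diff (koszul_ring A as) ?b \<in> homog (koszul_ring A as) 0" using K.diff_homog[OF bh] by simp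
      have "(\<Oplus> i \<in> {..<length as}. as ! i \<otimes> ?b {i}) = (\<Oplus> i \<in> {..<length as}. \<zero>)"
        using homog_carrier[OF subsetD[OF as nth_mem]] by (intro finsum_cong') (auto simp: koszul_const_def)
      then have "diff (koszul_ring A as) ?b {} = s"
        using koszul_diff_empty[OF as K.homog_carrier[OF bh]] b homog_carrier[OF diff_homog[OF b(1)]] by simp
      then have "koszul_const A (length as) s = diff (koszul_ring A as) ?b"
        using koszul_degree_zero_eq(1)[OF dh] by simp
      then show "s \<in> koszul_ideal as"
        using bh b diff_homog[OF b(1)] by (simp add: koszul_ideal_def coboundaries_def)
    qed
    moreover have "a \<in> koszul_ideal as" if a: "a \<in> set as" for a
    proof -
      obtain k where k: "k < length as" "a = as ! k" using a by (metis in_set_conv_nth)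
      have nth: "as ! i \<in> homog A 0" if "i < length as" for i using as nth_mem[OF that] by blast
      \<comment> \<open>The exterior variable with index \<open>k\<close>, whose differential is the
        term \<open>as ! k\<close>.\<close>
      define e where "e = (\<lambda>I\<in>Pow {..<length as}. if I = {k} then \<one> else \<zero>)"
      have eh: "e \<in> homog (koszul_ring A as) (-1)" by (auto simp: koszul_ring_homog e_def one_homog)
      have dh: "diff (koszul_ring A as) e \<in> homog (koszul_ring A as) 0" using K.diff_homog[OF eh] by simp
      have "(\<Oplus> i \<in> {..<length as}. as ! i \<otimes> e {i}) = (\<Oplus> i \<in> {k}. as ! i \<otimes> e {i})"
        by (rule finsum_mono_neutral[symmetric]) (use k homog_carrier[OF nth] in \<open>auto simp: e_def\<close>)
      also have "\<dots> = a" using k nth[OF k(1)] by (simp add: e_def)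
      finally have "diff (koszul_ring A as) e {} = a"
        using koszul_diff_empty[OF as K.homog_carrier[OF eh]] k nth[OF k(1)] by (simp add: e_def)
      then have "koszul_const A (length as) a = diff (koszul_ring A as) e"
        using koszul_degree_zero_eq(1)[OF dh] by simp
      then show ?thesis using eh k nth by (simp add: koszul_ideal_def coboundaries_def)
    qed
    ultimately show "?I \<subseteq> koszul_ideal as"
      by (intro Z.genideal_minimal[OF koszul_ideal_is_ideal[OF as]]) auto
  qed
qed

text \<open>The exchange takes place at the end of the sequence; the common tail \<open>ys\<close>
  is then adjoined by cones.\<close>

lemma koszul_swap:
  assumes "set (xs @ [a, b] @ ys) \<subseteq> homog A 0"
  shows "\<exists>f. complex_iso (degree_zero A) (koszul_ring A (xs @ [a, b] @ ys)) (koszul_act (xs @ [a, b] @ ys))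
    (koszul_ring A (xs @ [b, a] @ ys)) (koszul_act (xs @ [b, a] @ ys)) f"
  using assms
proof (induction ys rule: rev_induct)
  case Nil
  have 1: "set (xs @ [a]) \<subseteq> homog A 0" "set ((xs @ [a]) @ [b]) \<subseteq> homog A 0"
    "set (xs @ [b]) \<subseteq> homog A 0" "set ((xs @ [b]) @ [a]) \<subseteq> homog A 0" using Nil by auto
  show ?case
    using complex_iso_swap[OF koszul_cone[OF 1(1)] koszul_cone[OF 1(2)] koszul_cone[OF 1(3)] koszul_cone[OF 1(4)]]
    by auto
next
  case (snoc y ys)
  then have 1: "set ((xs @ [a, b] @ ys) @ [y]) \<subseteq> homog A 0" "set ((xs @ [b, a] @ ys) @ [y]) \<subseteq> homog A 0" by auto
  obtain f where f: "complex_iso (degree_zero A) (koszul_ring A (xs @ [a, b] @ ys)) (koszul_act (xs @ [a, b] @ ys))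
    (koszul_ring A (xs @ [b, a] @ ys)) (koszul_act (xs @ [b, a] @ ys)) f" using snoc by auto
  show ?case using complex_iso_cone[OF f koszul_cone[OF 1(1)] koszul_cone[OF 1(2)]] by auto
qed

end

section \<open>The infimum of Koszul complexes over a local DG-ring\<close>

definition complex_inf :: "('m, 'x) dg_ring_scheme \<Rightarrow> int"
  where "complex_inf M = Inf {n. \<not> cocycles M n \<subseteq> coboundaries M n}"

lemma complex_inf_eqI:
  assumes "\<not> cocycles M n \<subseteq> coboundaries M n" "\<And>k. k < n \<Longrightarrow> cocycles M k \<subseteq> coboundaries M k"
  shows "complex_inf M = n"
  unfolding complex_inf_def
  by (rule cInf_eq_minimum) (use assms in \<open>auto simp: not_less[symmetric]\<close>)

text \<open>Here \<open>m\<close> is meant as the preimage in A^0 of the maximal ideal of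
  \<open>H^0(A)\<close>, so inverses and chains of ideals are controlled modulo coboundaries. The
  last two conditions are put on \<open>koszul_ring A []\<close> rather than on \<open>A\<close>,
  because the inductions over sequences begin there.\<close>

locale local_dg_ring = dg_ring A for A :: "'a dg_ring" (structure) +
  fixes m :: "'a set"
  assumes m_ideal: "ideal m (degree_zero A)" and coboundaries_m: "coboundaries A 0 \<subseteq> m" and one_m: "\<one> \<notin> m"
    and unit: "\<lbrakk>s \<in> homog A 0; s \<notin> m\<rbrakk> \<Longrightarrow> \<exists>e\<in>homog A 0. e \<otimes> s \<ominus> \<one> \<in> coboundaries A 0"
    and acc: "\<lbrakk>\<And>k::nat. ideal (X k) (degree_zero A); \<And>k. coboundaries A 0 \<subseteq> X k; \<And>k. X k \<subseteq> X (Suc k)\<rbrakk>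
      \<Longrightarrow> \<exists>k. X (Suc k) = X k"
    and noetherian_Nil: "scalar_complex.noetherian_cohomology (degree_zero A) (koszul_ring A []) (koszul_act []) n"
    and bounded_Nil: "\<exists>b. \<forall>n<b. cocycles (koszul_ring A []) n \<subseteq> coboundaries (koszul_ring A []) n"
begin

abbreviation S where "S \<equiv> degree_zero A"

lemma m_homog: "x \<in> m \<Longrightarrow> x \<in> homog A 0"
  using ideal.Icarr[OF m_ideal] by simp

lemma m_homog_list: "set as \<subseteq> m \<Longrightarrow> set as \<subseteq> homog A 0"
  using m_homog by blast

text \<open>The cone in degree \<open>n\<close> requires its predecessor in the degrees
  \<open>n\<close> and \<open>n + 1\<close>, so the degree varies in the induction.\<close>

lemma noetherian_koszul:
  "set as \<subseteq> m \<Longrightarrow> scalar_complex.noetherian_cohomology S (koszul_ring A as) (koszul_act as) n"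
proof (induction as arbitrary: n rule: rev_induct)
  case (snoc a as)
  interpret C: complex_cone S "koszul_ring A as" "koszul_act as" "koszul_ring A (as @ [a])"
    "koszul_fst (length as)" "koszul_snd A (length as)" "koszul_pair A (length as)" "koszul_act (as @ [a])" a
    by (rule koszul_cone[OF m_homog_list[OF snoc.prems]])
  show ?case by (rule C.noetherian_cone) (use snoc in auto)
qed (rule noetherian_Nil)

lemma one_minus_unit:
  assumes x: "x \<in> m" and c: "c \<in> homog A 0"
  shows "\<exists>e\<in>homog A 0. e \<otimes> (\<one> \<ominus> c \<otimes> x) \<ominus> \<one> \<in> coboundaries A 0"
proof (rule unit)
  have cx: "c \<otimes> x \<in> m" using ideal.I_l_closed[OF m_ideal x, of c] c by simp
  note h = m_homog[OF cx] one_homog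
  show "\<one> \<ominus> c \<otimes> x \<in> homog A 0" using h by (simp add: minus_eq)
  show "\<one> \<ominus> c \<otimes> x \<notin> m"
  proof
    assume "\<one> \<ominus> c \<otimes> x \<in> m"
    then have "\<one> \<ominus> c \<otimes> x \<oplus> c \<otimes> x \<in> m"
      using additive_subgroup.a_closed[OF ideal.axioms(1)[OF m_ideal] _ cx] by simp
    moreover have "\<one> \<ominus> c \<otimes> x \<oplus> c \<otimes> x = \<one>" using homog_carrier[OF h(1)] by (simp add: minus_eq a_assoc l_neg)
    ultimately show False using one_m by simp
  qed
qed

lemma coboundaries_koszul_ideal: "set as \<subseteq> homog A 0 \<Longrightarrow> coboundaries A 0 \<subseteq> koszul_ideal as"
  using Z.genideal_self[of "coboundaries A 0 \<union> set as"] ideal.Icarr[OF coboundaries_ideal]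
  by (auto simp: koszul_ideal_eq)

definition v :: "'a list \<Rightarrow> int" where "v as = complex_inf (koszul_ring A as)"

definition reg :: "'a list \<Rightarrow> 'a \<Rightarrow> bool"
  where "reg as x \<longleftrightarrow> scalar_complex.regular_at (koszul_ring A as) (koszul_act as) x (v as)"

text \<open>\<open>Inf\<close> on the integers is meaningful only for nonempty sets that are bounded
  below. This predicate guarantees that \<open>v as\<close> really is the lowest degree with nonzero
  cohomology.\<close>

definition has_inf :: "'a list \<Rightarrow> bool"
  where "has_inf as \<longleftrightarrow> \<not> cocycles (koszul_ring A as) (v as) \<subseteq> coboundaries (koszul_ring A as) (v as) \<and>
    (\<forall>n<v as. cocycles (koszul_ring A as) n \<subseteq> coboundaries (koszul_ring A as) n)"

text \<open>Cohomology in degree 0 is nonzero, since a primitive of the unit would put 1 into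
  \<open>koszul_ideal []\<close> and so into \<open>m\<close>. By boundedness only finitely many
  lower degrees remain.\<close>

lemma has_inf_Nil: "has_inf []"
proof -
  interpret K: dg_ring "koszul_ring A []" by (rule dg_ring_koszul) simp
  let ?P = "\<lambda>n. \<not> cocycles (koszul_ring A []) n \<subseteq> coboundaries (koszul_ring A []) n"
  have "koszul_const A 0 \<one> \<in> cocycles (koszul_ring A []) 0"
    using koszul_const_homog[OF one_homog, of "[]"] by (simp add: K.degree_zero_cocycle)
  moreover have "koszul_const A 0 \<one> \<notin> coboundaries (koszul_ring A []) 0"
  proof
    assume "koszul_const A 0 \<one> \<in> coboundaries (koszul_ring A []) 0"
    then have "\<one> \<in> koszul_ideal []" by (simp add: koszul_ideal_def one_homog)
    also have "koszul_ideal [] \<subseteq> m"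
      using Z.genideal_minimal[OF m_ideal coboundaries_m] by (simp add: koszul_ideal_eq)
    finally show False using one_m by simp
  qed
  ultimately have P0: "?P 0" by blast
  obtain b where b: "\<And>n. n < b \<Longrightarrow> \<not> ?P n" using bounded_Nil by blast
  then have "\<not> 0 < b" using P0 by blast
  \<comment> \<open>Counting upwards from the bound \<open>b\<close> makes the lowest degree
    accessible to the well-ordering of the naturals.\<close>
  define i where "i = (LEAST i::nat. ?P (b + int i))"
  have "?P (b + int (nat (- b)))" using P0 \<open>\<not> 0 < b\<close> by simp
  then have Pi: "?P (b + int i)" unfolding i_def by (rule LeastI)
  have least: "\<not> ?P n" if n: "n < b + int i" for n
  proof (cases "n < b")
    case False
    then have "n = b + int (nat (n - b))" "nat (n - b) < i" using n by auto
    then show ?thesis using not_less_Least[of "nat (n - b)" "\<lambda>i. ?P (b + int i)"] unfolding i_def by metis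
  qed (use b in blast)
  have "v [] = b + int i" unfolding v_def by (rule complex_inf_eqI) (use Pi least in auto)
  then show ?thesis using Pi least by (simp add: has_inf_def)
qed

text \<open>Below \<open>v as - 1\<close> the cone is acyclic. In degree \<open>v as - 1\<close> it
  is acyclic exactly if \<open>a\<close> is injective on the bottom cohomology for
  \<open>as\<close>, and in degree \<open>v as\<close> Nakayama's lemma keeps it nonzero. So
  regularity decides between the two degrees.\<close>

lemma inf_snoc:
  assumes m: "set as \<subseteq> m" "a \<in> m" and inf: "has_inf as"
  shows "has_inf (as @ [a]) \<and> v (as @ [a]) = (if reg as a then v as else v as - 1)"
proof -
  have aa: "set (as @ [a]) \<subseteq> homog A 0" using m m_homog by auto
  interpret C: complex_cone S "koszul_ring A as" "koszul_act as" "koszul_ring A (as @ [a])"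
    "koszul_fst (length as)" "koszul_snd A (length as)" "koszul_pair A (length as)" "koszul_act (as @ [a])" a
    by (rule koszul_cone[OF aa])
  have i: "\<not> C.M.acyclic_at (v as)" "\<And>n. n < v as \<Longrightarrow> C.M.acyclic_at n"
    using inf by (auto simp: has_inf_def C.M.acyclic_at_def)
  have low: "C.N.acyclic_at n" if "n + 1 < v as" for n
    using that i(2) by (intro C.regular_imp_acyclic C.M.acyclic_imp_regular) auto
  have top: "\<not> C.N.acyclic_at (v as)"
  \<comment> \<open>The inverse of \<open>1 - c a\<close> modulo coboundaries of \<open>A\<close>
    becomes an inverse on cohomology, because these coboundaries lie in
    \<open>koszul_ideal as\<close>.\<close>
  proof (rule C.not_acyclic_cone[OF noetherian_koszul[OF m(1)] i(1)])
    fix c assume c: "c \<in> carrier S"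
    then obtain e where e: "e \<in> homog A 0" "e \<otimes> (\<one> \<ominus> c \<otimes> a) \<ominus> \<one> \<in> coboundaries A 0"
      using one_minus_unit[OF m(2)] by auto
    have h: "c \<otimes> a \<in> homog A 0" using c m(2) m_homog by (intro mult_mem_homog) auto
    then have h': "\<one> \<ominus> c \<otimes> a \<in> homog A 0" using one_homog by (simp add: minus_eq)
    have "e \<otimes> (\<one> \<ominus> c \<otimes> a) \<in> homog A 0" using e(1) h' by (intro mult_mem_homog) auto
    then have "e \<otimes>\<^bsub>S\<^esub> (\<one>\<^bsub>S\<^esub> \<ominus>\<^bsub>S\<^esub> c \<otimes>\<^bsub>S\<^esub> a) \<ominus>\<^bsub>S\<^esub> \<one>\<^bsub>S\<^esub> \<in> koszul_ideal as"
      using e h one_homog coboundaries_koszul_ideal[OF m_homog_list[OF m(1)]] by auto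
    then have "C.M.annihilates (e \<otimes>\<^bsub>S\<^esub> (\<one>\<^bsub>S\<^esub> \<ominus>\<^bsub>S\<^esub> c \<otimes>\<^bsub>S\<^esub> a) \<ominus>\<^bsub>S\<^esub> \<one>\<^bsub>S\<^esub>)"
      by (rule koszul_ideal_annihilates[OF m_homog_list[OF m(1)]])
    then show "\<exists>e\<in>carrier S. C.M.annihilates (e \<otimes>\<^bsub>S\<^esub> (\<one>\<^bsub>S\<^esub> \<ominus>\<^bsub>S\<^esub> c \<otimes>\<^bsub>S\<^esub> a) \<ominus>\<^bsub>S\<^esub> \<one>\<^bsub>S\<^esub>)"
      using e(1) by auto
  qed
  have reg: "reg as a \<longleftrightarrow> C.M.regular_at a (v as)" by (simp add: reg_def)
  show ?thesis
  proof (cases "reg as a")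
    case True
    then have "C.N.acyclic_at (v as - 1)"
      using C.regular_imp_acyclic[of "v as - 1"] i(2) reg by simp
    then have lo: "C.N.acyclic_at n" if "n < v as" for n
      using that low[of n] by (cases "n = v as - 1") auto
    have "v (as @ [a]) = v as"
      unfolding v_def[of "as @ [a]"]
      by (rule complex_inf_eqI) (use top lo in \<open>auto simp: C.N.acyclic_at_def\<close>)
    then show ?thesis using True top lo by (auto simp: has_inf_def C.N.acyclic_at_def)
  next
    case False
    then have n1: "\<not> C.N.acyclic_at (v as - 1)"
      using C.acyclic_imp_regular_above[of "v as - 1"] reg by auto
    have lo: "C.N.acyclic_at n" if "n < v as - 1" for n using that low by auto
    have "v (as @ [a]) = v as - 1"
      unfolding v_def[of "as @ [a]"]
      by (rule complex_inf_eqI) (use n1 lo in \<open>auto simp: C.N.acyclic_at_def\<close>)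
    then show ?thesis using False n1 lo by (auto simp: has_inf_def C.N.acyclic_at_def)
  qed
qed

lemma has_inf: "set as \<subseteq> m \<Longrightarrow> has_inf as"
  by (induction as rule: rev_induct) (use has_inf_Nil inf_snoc in auto)

lemma v_swap:
  assumes "set (xs @ [a, b] @ ys) \<subseteq> m"
  shows "v (xs @ [a, b] @ ys) = v (xs @ [b, a] @ ys)"
proof -
  obtain f where f: "complex_iso S (koszul_ring A (xs @ [a, b] @ ys)) (koszul_act (xs @ [a, b] @ ys))
    (koszul_ring A (xs @ [b, a] @ ys)) (koszul_act (xs @ [b, a] @ ys)) f"
    using koszul_swap[OF m_homog_list[OF assms]] by blast
  interpret f: complex_iso S "koszul_ring A (xs @ [a, b] @ ys)" "koszul_act (xs @ [a, b] @ ys)"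
    "koszul_ring A (xs @ [b, a] @ ys)" "koszul_act (xs @ [b, a] @ ys)" f by (rule f)
  show ?thesis
    using f.acyclic_at_iff[unfolded f.M.acyclic_at_def f.N.acyclic_at_def]
    by (simp add: v_def complex_inf_def)
qed

lemma v_move:
  "set (pre @ x # ys1 @ ys2) \<subseteq> m \<Longrightarrow> v (pre @ x # ys1 @ ys2) = v (pre @ ys1 @ x # ys2)"
proof (induction ys1 arbitrary: pre)
  case (Cons y ys1)
  have "v (pre @ [x, y] @ ys1 @ ys2) = v (pre @ [y, x] @ ys1 @ ys2)"
    by (rule v_swap) (use Cons in auto)
  then show ?case using Cons.IH[of "pre @ [y]"] Cons.prems by auto
qed simp

text \<open>The prefix \<open>pre\<close> absorbs the first term \<open>x\<close> in the induction;
  \<open>v_move\<close> then carries \<open>x\<close> to its place in \<open>ys\<close> by adjacent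
  exchanges.\<close>

lemma v_perm: "\<lbrakk>set (pre @ xs) \<subseteq> m; mset xs = mset ys\<rbrakk> \<Longrightarrow> v (pre @ xs) = v (pre @ ys)"
proof (induction xs arbitrary: pre ys)
  case (Cons x xs)
  have "x \<in> set ys" using Cons.prems(2) by (metis list.set_intros(1) mset_eq_setD)
  then obtain ys1 ys2 where ys: "ys = ys1 @ x # ys2" by (auto simp: in_set_conv_decomp)
  have ms: "mset xs = mset (ys1 @ ys2)" using Cons.prems(2) ys by simp
  have sx: "set xs = set (ys1 @ ys2)" using mset_eq_setD[OF ms] .
  have "v (pre @ x # xs) = v ((pre @ [x]) @ ys1 @ ys2)"
    using Cons.IH[of "pre @ [x]" "ys1 @ ys2"] ms Cons.prems(1) by simp
  also have "\<dots> = v (pre @ ys1 @ x # ys2)"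
    using v_move[of pre x ys1 ys2] Cons.prems(1) sx by simp
  finally show ?case using ys by simp
qed simp

text \<open>The ideal \<open>N\<close> becomes the ideal of coboundaries. The laws of regularity
  modulo the ideal of \<open>xs\<close> reduce to the fact that this ideal annihilates the
  cohomology of the Koszul complex on \<open>xs\<close>.\<close>

sublocale depth: depth_function S "coboundaries A 0" m v reg
proof (intro depth_function.intro depth_function_axioms.intro Z.is_cring)
  show "coboundaries A 0 \<subseteq> carrier S" using ideal.Icarr[OF coboundaries_ideal] by auto
  show "ideal m S" "coboundaries A 0 \<subseteq> m" "\<one>\<^bsub>S\<^esub> \<notin> m" using m_ideal coboundaries_m one_m by auto
  show "\<exists>e\<in>carrier S. e \<otimes>\<^bsub>S\<^esub> s \<ominus>\<^bsub>S\<^esub> \<one>\<^bsub>S\<^esub> \<in> coboundaries A 0" if s: "s \<in> carrier S" "s \<notin> m" for s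
  proof -
    obtain e where e: "e \<in> homog A 0" "e \<otimes> s \<ominus> \<one> \<in> coboundaries A 0" using unit s by auto
    have "e \<otimes> s \<in> homog A 0" using e s by (intro mult_mem_homog) auto
    then show ?thesis using e one_homog by (intro bexI[of _ e]) auto
  qed
  show "\<exists>k. X (Suc k) = X k" if "\<And>k::nat. ideal (X k) S" "\<And>k. coboundaries A 0 \<subseteq> X k" "\<And>k. X k \<subseteq> X (Suc k)" for X
    using that by (rule acc)
  show "v xs = v ys" if "set xs \<subseteq> m" "mset xs = mset ys" for xs ys
    using v_perm[of "[]" xs ys] that by simp
  fix xs assume xs: "set xs \<subseteq> m"
  note xh = m_homog_list[OF xs]
  interpret K: scalar_complex S "koszul_ring A xs" "koszul_act xs" by (rule koszul_complex[OF xh])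
  note J = koszul_ideal_eq[OF xh, symmetric] and ann = koszul_ideal_annihilates[OF xh]
  show "v (xs @ [x]) = (if reg xs x then v xs else v xs - 1)" if "x \<in> m" for x
    using inf_snoc[OF xs that has_inf[OF xs]] by blast
  show "\<not> reg xs x" if "x \<in> Idl\<^bsub>S\<^esub> (coboundaries A 0 \<union> set xs)" for x
  proof
    assume "reg xs x"
    then have "K.acyclic_at (v xs)"
      using K.regular_annihilates_imp_acyclic ann that unfolding J reg_def by blast
    then show False using has_inf[OF xs] by (simp add: has_inf_def K.acyclic_at_def)
  qed
  fix x assume x: "x \<in> carrier S"
  show "reg xs (x \<otimes>\<^bsub>S\<^esub> y)" if "y \<in> carrier S" "reg xs x" "reg xs y" for y
    using K.regular_mult[OF x that(1)] that unfolding reg_def by blast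
  show "reg xs y" if "y \<in> carrier S" "x \<ominus>\<^bsub>S\<^esub> y \<in> Idl\<^bsub>S\<^esub> (coboundaries A 0 \<union> set xs)" "reg xs x" for y
    using K.regular_cong[OF x that(1)] ann that unfolding J reg_def by blast
  show "reg xs x" if xm: "x \<notin> m"
  proof -
    obtain e where e: "e \<in> homog A 0" "e \<otimes> x \<ominus> \<one> \<in> coboundaries A 0" using unit x xm by auto
    have "e \<otimes> x \<in> homog A 0" using e x by (intro mult_mem_homog) auto
    then have "e \<otimes>\<^bsub>S\<^esub> x \<ominus>\<^bsub>S\<^esub> \<one>\<^bsub>S\<^esub> \<in> koszul_ideal xs"
      using e one_homog coboundaries_koszul_ideal[OF xh] by auto
    then show ?thesis unfolding reg_def using K.regular_unit[of e x] e x ann by simp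
  qed
qed

end

section \<open>Noetherian rings and modules\<close>

text \<open>A finite set whose closure is too small can be enlarged by a missing element, which
  gives a strictly growing chain. The closure operator is left abstract to cover generated ideals as
  well as spans in modules.\<close>

lemma finitely_generated_of_acc:
  fixes cl :: "'a set \<Rightarrow> 'a set"
  assumes self: "\<And>X. \<lbrakk>finite X; X \<subseteq> I\<rbrakk> \<Longrightarrow> X \<subseteq> cl X \<and> cl X \<subseteq> I"
    and acc: "\<And>X :: nat \<Rightarrow> 'a set. (\<And>k. finite (X k) \<and> X k \<subseteq> I \<and> X k \<subseteq> X (Suc k)) \<Longrightarrow> \<exists>k. cl (X (Suc k)) = cl (X k)"
  shows "\<exists>X. finite X \<and> X \<subseteq> I \<and> cl X = I"
proof (rule ccontr)
  assume neg: "\<not> ?thesis"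
  define g where "g X = (SOME x. x \<in> I - cl X)" for X
  have g: "g X \<in> I - cl X" if "finite X" "X \<subseteq> I" for X
  proof -
    have "cl X \<noteq> I" "cl X \<subseteq> I" using neg self that by blast+
    then have "\<exists>x. x \<in> I - cl X" by blast
    then show ?thesis unfolding g_def by (rule someI_ex)
  qed
  define X where "X k = ((\<lambda>Y. insert (g Y) Y) ^^ k) {}" for k
  have Suc: "X (Suc k) = insert (g (X k)) (X k)" for k by (simp add: X_def)
  have X: "finite (X k) \<and> X k \<subseteq> I" for k
  proof (induction k)
    case (Suc k)
    then show ?case using g[of "X k"] by (simp add: \<open>X (Suc k) = insert (g (X k)) (X k)\<close>)
  qed (simp add: X_def)
  then obtain k where k: "cl (X (Suc k)) = cl (X k)"
    using acc[of X] Suc by blast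
  have "g (X k) \<in> cl (X (Suc k))" using self[of "X (Suc k)"] X[of "Suc k"] Suc[of k] by blast
  then show False using g[of "X k"] X[of k] k by simp
qed

text \<open>In a noetherian ring the union of a nonempty chain of ideals belongs to the chain; for
  the range of \<open>X\<close> this is stationarity.\<close>

lemma (in noetherian_ring) ascending_chain:
  assumes I: "\<And>k::nat. ideal (X k) R" and mono: "\<And>k. X k \<subseteq> X (Suc k)"
  shows "\<exists>k. \<forall>l\<ge>k. X l = X k"
proof -
  have le: "X k \<subseteq> X l" if "k \<le> l" for k l
    by (rule lift_Suc_mono_le[of X, OF _ that]) (rule mono)
  have "\<Union>(range X) \<in> range X"
  proof (rule ideal_chain_is_trivial)
    show "subset.chain {I. ideal I R} (range X)"
      unfolding pred_on.chain_def
    proof (intro conjI ballI)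
      show "range X \<subseteq> {I. ideal I R}" using I by blast
      fix U V assume "U \<in> range X" "V \<in> range X"
      then obtain k l where "U = X k" "V = X l" by blast
      then show "(\<subset>)\<^sup>=\<^sup>= U V \<or> (\<subset>)\<^sup>=\<^sup>= V U" using le[of k l] le[of l k] nle_le by blast
    qed
  qed simp
  then obtain k where k: "\<Union>(range X) = X k" by blast
  have "X l = X k" if "l \<ge> k" for l using le[OF that] k by blast
  then show ?thesis by blast
qed

lemma (in ring) noetherian_ring_of_acc:
  assumes acc: "\<And>X. \<lbrakk>\<And>k::nat. ideal (X k) R; \<And>k. X k \<subseteq> X (Suc k)\<rbrakk> \<Longrightarrow> \<exists>k. X (Suc k) = X k"
  shows "noetherian_ring R"
proof (rule noetherian_ringI)
  fix I assume I: "ideal I R"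
  have IR: "I \<subseteq> carrier R" using ideal.Icarr[OF I] by blast
  have "\<exists>X. finite X \<and> X \<subseteq> I \<and> Idl X = I"
  proof (rule finitely_generated_of_acc)
    fix X assume X: "X \<subseteq> I"
    then have XR: "X \<subseteq> carrier R" using IR by blast
    show "X \<subseteq> Idl X \<and> Idl X \<subseteq> I"
      using genideal_self[OF XR] genideal_minimal[OF I X] by blast
  next
    fix X :: "nat \<Rightarrow> 'a set" assume X: "\<And>k. finite (X k) \<and> X k \<subseteq> I \<and> X k \<subseteq> X (Suc k)"
    then have XR: "X k \<subseteq> carrier R" for k using IR by blast
    show "\<exists>k. Idl (X (Suc k)) = Idl (X k)"
    proof (rule acc)
      fix k
      show "ideal (Idl (X k)) R" by (rule genideal_ideal[OF XR])
      have "X k \<subseteq> Idl (X (Suc k))" using X[of k] genideal_self[OF XR[of "Suc k"]] by blast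
      then show "Idl (X k) \<subseteq> Idl (X (Suc k))" by (rule genideal_minimal[OF genideal_ideal[OF XR]])
    qed
  qed
  then show "\<exists>A\<subseteq>carrier R. finite A \<and> I = Idl A" using IR by blast
qed

text \<open>The same fact about unions supplies the upper bounds for Zorn's lemma.\<close>

lemma (in noetherian_ring) exists_maximalideal:
  assumes I: "ideal I R" "I \<noteq> carrier R"
  shows "\<exists>M. maximalideal M R \<and> I \<subseteq> M"
proof -
  let ?A = "{L. ideal L R \<and> I \<subseteq> L \<and> L \<noteq> carrier R}"
  have "\<exists>M\<in>?A. \<forall>X\<in>?A. M \<subseteq> X \<longrightarrow> X = M"
  proof (rule subset_Zorn_nonempty)
    show "?A \<noteq> {}" using I by blast
    fix C assume C: "C \<noteq> {}" "subset.chain ?A C"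
    then have "subset.chain {I. ideal I R} C" unfolding pred_on.chain_def by blast
    then have "\<Union>C \<in> C" using ideal_chain_is_trivial C by blast
    then show "\<Union>C \<in> ?A" using C(2) unfolding pred_on.chain_def by blast
  qed
  then obtain M where M: "ideal M R" "I \<subseteq> M" "M \<noteq> carrier R"
    and max: "\<forall>X\<in>?A. M \<subseteq> X \<longrightarrow> X = M" by blast
  have "maximalideal M R"
  proof (rule maximalidealI[OF M(1) M(3)[symmetric]])
    fix L assume L: "ideal L R" "M \<subseteq> L" "L \<subseteq> carrier R"
    show "L = M \<or> L = carrier R"
    proof (cases "L = carrier R")
      case False
      then have "L \<in> ?A" using L(1) order_trans[OF M(2) L(2)] by simp
      then show ?thesis using max L(2) by simp
    qed simp
  qed
  then show ?thesis using M(2) by blast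
qed

text \<open>An element without inverse generates a proper ideal, which lies in a maximal one, hence
  in \<open>\<mm>\<close>.\<close>

lemma local_ring_unit:
  assumes loc: "local_ring R \<mm>" and noeth: "noetherian_ring R" and x: "x \<in> carrier R" "x \<notin> \<mm>"
  shows "\<exists>y\<in>carrier R. y \<otimes>\<^bsub>R\<^esub> x = \<one>\<^bsub>R\<^esub>"
proof (rule ccontr)
  interpret cring R using loc by (simp add: local_ring_def)
  interpret noetherian_ring R by (rule noeth)
  assume neg: "\<not> ?thesis"
  have "\<one>\<^bsub>R\<^esub> \<notin> PIdl\<^bsub>R\<^esub> x" using neg by (auto simp: cgenideal_def)
  then have "PIdl\<^bsub>R\<^esub> x \<noteq> carrier R" using one_closed by metis
  then obtain M where M: "maximalideal M R" "PIdl\<^bsub>R\<^esub> x \<subseteq> M"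
    using exists_maximalideal[OF cgenideal_ideal[OF x(1)]] by blast
  then have "M = \<mm>" using loc by (simp add: local_ring_def)
  then show False using M(2) cgenideal_self[OF x(1)] x(2) by blast
qed

text \<open>The correspondence between ideals of \<open>T\<close> and ideals of \<open>R\<close>
  containing the kernel. It transfers questions about \<open>H^0(A)\<close> and about
  \<open>H^0\<close> of Koszul rings to the one ring A^0.\<close>

locale surj_ring_hom = ring_hom_cring R T h for R (structure) and T (structure) and h +
  assumes surj: "h ` carrier R = carrier T"
begin

abbreviation K where "K \<equiv> a_kernel R T h"

lemma mem_kernel: "x \<in> K \<longleftrightarrow> x \<in> carrier R \<and> h x = \<zero>\<^bsub>T\<^esub>"
  unfolding a_kernel_def' by simp

lemma h_eq_iff:
  assumes "x \<in> carrier R" "y \<in> carrier R"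
  shows "h x = h y \<longleftrightarrow> x \<ominus> y \<in> K"
proof -
  have "h (x \<ominus> y) = h x \<ominus>\<^bsub>T\<^esub> h y"
    unfolding R.minus_eq S.minus_eq using assms by simp
  moreover have "h x \<ominus>\<^bsub>T\<^esub> h y = \<zero>\<^bsub>T\<^esub> \<longleftrightarrow> h x = h y"
  proof
    assume "h x \<ominus>\<^bsub>T\<^esub> h y = \<zero>\<^bsub>T\<^esub>"
    then have "h x \<ominus>\<^bsub>T\<^esub> h y \<oplus>\<^bsub>T\<^esub> h y = h y" using assms by simp
    then show "h x = h y" using assms by (simp add: S.minus_eq S.a_assoc S.l_neg)
  next
    assume "h x = h y"
    then show "h x \<ominus>\<^bsub>T\<^esub> h y = \<zero>\<^bsub>T\<^esub>" using assms by (simp add: S.minus_eq S.r_neg)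
  qed
  moreover have "x \<ominus> y \<in> carrier R" using assms by simp
  ultimately show ?thesis unfolding mem_kernel by metis
qed

lemma image_ideal:
  assumes I: "ideal I R" shows "ideal (h ` I) T"
proof (rule idealI[OF S.ring_axioms])
  have "subgroup I (add_monoid R)"
    using I by (simp add: additive_subgroup.a_subgroup ideal.axioms(1))
  then show "subgroup (h ` I) (add_monoid T)" by (rule ring.img_is_add_subgroup)
  fix a x assume "a \<in> h ` I" "x \<in> carrier T"
  then obtain i r where ir: "a = h i" "i \<in> I" "x = h r" "r \<in> carrier R" using surj by blast
  then have "x \<otimes>\<^bsub>T\<^esub> a = h (r \<otimes> i)" "a \<otimes>\<^bsub>T\<^esub> x = h (i \<otimes> r)" using ideal.Icarr[OF I] by auto
  then show "x \<otimes>\<^bsub>T\<^esub> a \<in> h ` I" "a \<otimes>\<^bsub>T\<^esub> x \<in> h ` I"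
    using ideal.I_l_closed[OF I ir(2,4)] ideal.I_r_closed[OF I ir(2,4)] by auto
qed

lemma image_mem_iff:
  assumes I: "ideal I R" and K: "K \<subseteq> I" and x: "x \<in> carrier R"
  shows "h x \<in> h ` I \<longleftrightarrow> x \<in> I"
proof
  assume "h x \<in> h ` I"
  then obtain i where i: "i \<in> I" "h x = h i" by blast
  then have "x \<ominus> i \<in> I" using h_eq_iff[OF x ideal.Icarr[OF I i(1)]] K by blast
  then have "x \<ominus> i \<oplus> i \<in> I" using additive_subgroup.a_closed[OF ideal.axioms(1)[OF I]] i by blast
  then show "x \<in> I" using x ideal.Icarr[OF I i(1)] by (simp add: R.minus_eq R.a_assoc R.l_neg)
qed simp

lemma image_vimage:
  assumes "L \<subseteq> carrier T" shows "h ` {x \<in> carrier R. h x \<in> L} = L"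
  using assms surj by (auto simp: image_iff)

text \<open>The preimage of an ideal contains the kernel, which is therefore added to the lifted
  generators.\<close>

lemma image_genideal:
  assumes X: "X \<subseteq> carrier R"
  shows "Idl\<^bsub>T\<^esub> (h ` X) = h ` (Idl (K \<union> X))"
proof
  have KX: "K \<union> X \<subseteq> carrier R" using X by (auto simp: mem_kernel)
  have hX: "h ` X \<subseteq> carrier T" using X surj by blast
  have "h ` X \<subseteq> h ` (Idl (K \<union> X))" using R.genideal_self[OF KX] by blast
  then show "Idl\<^bsub>T\<^esub> (h ` X) \<subseteq> h ` (Idl (K \<union> X))"
    by (rule S.genideal_minimal[OF image_ideal[OF R.genideal_ideal[OF KX]]])
  note TI = S.genideal_ideal[OF hX]
  have "K \<union> X \<subseteq> {x \<in> carrier R. h x \<in> Idl\<^bsub>T\<^esub> (h ` X)}"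
    using KX S.genideal_self[OF hX] additive_subgroup.zero_closed[OF ideal.axioms(1)[OF TI]] by (auto simp: mem_kernel)
  then have "Idl (K \<union> X) \<subseteq> {x \<in> carrier R. h x \<in> Idl\<^bsub>T\<^esub> (h ` X)}"
    by (rule R.genideal_minimal[OF ring.ideal_vimage[OF TI]])
  then show "h ` (Idl (K \<union> X)) \<subseteq> Idl\<^bsub>T\<^esub> (h ` X)" by blast
qed

lemma image_eq_iff:
  assumes I: "ideal I R" "K \<subseteq> I" and L: "ideal L R" "K \<subseteq> L"
  shows "h ` I = h ` L \<longleftrightarrow> I = L"
proof
  assume eq: "h ` I = h ` L"
  have "x \<in> L" if x: "x \<in> I" for x
    using image_mem_iff[OF L ideal.Icarr[OF I(1) x]] imageI[OF x, of h] unfolding eq by simp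
  moreover have "x \<in> I" if x: "x \<in> L" for x
    using image_mem_iff[OF I ideal.Icarr[OF L(1) x]] imageI[OF x, of h] unfolding eq by simp
  ultimately show "I = L" by blast
qed simp

lemma noetherian_image:
  assumes acc: "\<And>X. \<lbrakk>\<And>k::nat. ideal (X k) R; \<And>k. K \<subseteq> X k; \<And>k. X k \<subseteq> X (Suc k)\<rbrakk> \<Longrightarrow> \<exists>k. X (Suc k) = X k"
  shows "noetherian_ring T"
proof (rule S.noetherian_ring_of_acc)
  fix X :: "nat \<Rightarrow> _" assume X: "\<And>k. ideal (X k) T" "\<And>k. X k \<subseteq> X (Suc k)"
  let ?Y = "\<lambda>k. {x \<in> carrier R. h x \<in> X k}"
  have "\<exists>k. ?Y (Suc k) = ?Y k"
  proof (rule acc)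
    fix k
    show "ideal (?Y k) R" by (rule ring.ideal_vimage[OF X(1)])
    show "K \<subseteq> ?Y k" using additive_subgroup.zero_closed[OF ideal.axioms(1)[OF X(1)]] by (auto simp: mem_kernel)
    show "?Y k \<subseteq> ?Y (Suc k)" using X(2) by blast
  qed
  then obtain k where "?Y (Suc k) = ?Y k" by blast
  then have eq: "h ` ?Y (Suc k) = h ` ?Y k" by simp
  have "h ` ?Y k = X k" for k
    by (rule image_vimage) (use ideal.Icarr[OF X(1)] in blast)
  then have "X (Suc k) = X k" using eq by simp
  then show "\<exists>k. X (Suc k) = X k" ..
qed

lemma noetherian_acc:
  assumes "noetherian_ring T" and X: "\<And>k::nat. ideal (X k) R" "\<And>k. K \<subseteq> X k" "\<And>k. X k \<subseteq> X (Suc k)"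
  shows "\<exists>k. X (Suc k) = X k"
proof -
  interpret noetherian_ring T by fact
  obtain k where "\<forall>l\<ge>k. h ` X l = h ` X k"
    using ascending_chain[of "\<lambda>k. h ` X k", OF image_ideal[OF X(1)] image_mono[OF X(3)]] ..
  then have "h ` X (Suc k) = h ` X k" by (rule allE[of _ "Suc k"]) simp
  then have "X (Suc k) = X k" by (rule iffD1[OF image_eq_iff[OF X(1,2) X(1,2)]])
  then show ?thesis ..
qed

lemma maximal_vimage:
  assumes M: "maximalideal M T"
  shows "maximalideal {x \<in> carrier R. h x \<in> M} R"
proof -
  interpret M: maximalideal M T by (rule M)
  let ?V = "{x \<in> carrier R. h x \<in> M}"
  have KV: "K \<subseteq> ?V" by (auto simp: mem_kernel)
  show ?thesis
  proof (rule maximalidealI[OF ring.ideal_vimage[OF M.is_ideal]])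
    show "carrier R \<noteq> ?V"
    proof
      assume eq: "carrier R = ?V"
      have "h ` carrier R = M" using image_vimage[OF M.a_subset] unfolding eq[symmetric] .
      then show False using surj M.I_notcarr by simp
    qed
    fix L assume L: "ideal L R" "?V \<subseteq> L" "L \<subseteq> carrier R"
    have KL: "K \<subseteq> L" using KV L by blast
    have "M \<subseteq> h ` L" using image_mono[OF L(2), of h] unfolding image_vimage[OF M.a_subset] .
    then consider "h ` L = M" | "h ` L = carrier T"
      using M.I_maximal[OF image_ideal[OF L(1)]] ideal.Icarr[OF image_ideal[OF L(1)]] by blast
    then show "L = ?V \<or> L = carrier R"
    proof cases
      case 1
      then show ?thesis using L by blast
    next
      case 2
      then have "carrier R \<subseteq> L" using image_mem_iff[OF L(1) KL] surj by blast
      then show ?thesis using L(3) by blast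
    qed
  qed
qed

lemma maximal_image:
  assumes M: "maximalideal M R" and KM: "K \<subseteq> M"
  shows "maximalideal (h ` M) T"
proof -
  interpret M: maximalideal M R by (rule M)
  show ?thesis
  proof (rule maximalidealI[OF image_ideal[OF M.is_ideal]])
    show "carrier T \<noteq> h ` M"
      using image_eq_iff[OF R.oneideal order_trans[OF KM M.a_subset] M.is_ideal KM] M.I_notcarr unfolding surj by simp
    fix L assume L: "ideal L T" "h ` M \<subseteq> L" "L \<subseteq> carrier T"
    let ?V = "{x \<in> carrier R. h x \<in> L}"
    have "M \<subseteq> ?V" using L(2) M.a_subset by blast
    then consider "?V = M" | "?V = carrier R"
      using M.I_maximal[OF ring.ideal_vimage[OF L(1)]] by blast
    then show "L = h ` M \<or> L = carrier T"
    proof cases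
      case 1
      show ?thesis using image_vimage[OF L(3)] unfolding 1 by simp
    next
      case 2
      show ?thesis using image_vimage[OF L(3)] unfolding 2 surj by simp
    qed
  qed
qed

end

section \<open>Finite spans in modules\<close>

definition (in module) finite_span
  where "finite_span C = {(\<Oplus>\<^bsub>M\<^esub> c \<in> C. f c \<odot>\<^bsub>M\<^esub> c) | f. f \<in> C \<rightarrow> carrier R}"

context module
begin

lemma smult_term_closed: "\<lbrakk>f \<in> C \<rightarrow> carrier R; C \<subseteq> carrier M; x \<in> C\<rbrakk> \<Longrightarrow> f x \<odot>\<^bsub>M\<^esub> x \<in> carrier M"
  by (rule smult_closed) auto

lemma finite_spanI: "f \<in> C \<rightarrow> carrier R \<Longrightarrow> (\<Oplus>\<^bsub>M\<^esub> c \<in> C. f c \<odot>\<^bsub>M\<^esub> c) \<in> finite_span C"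
  by (auto simp: finite_span_def)

lemma span_closed:
  assumes "C \<subseteq> carrier M" "x \<in> finite_span C" shows "x \<in> carrier M"
proof -
  obtain f where "f \<in> C \<rightarrow> carrier R" "x = (\<Oplus>\<^bsub>M\<^esub> c \<in> C. f c \<odot>\<^bsub>M\<^esub> c)"
    using assms(2) by (auto simp: finite_span_def)
  then show ?thesis using assms(1) by (auto intro!: M.finsum_closed)
qed

text \<open>Separating the coefficient of one generator gives the recursion for inductions over
  generating sets.\<close>

lemma span_insert:
  assumes "finite C" "c \<notin> C" "insert c C \<subseteq> carrier M"
  shows "x \<in> finite_span (insert c C) \<longleftrightarrow> (\<exists>r\<in>carrier R. \<exists>w\<in>finite_span C. x = r \<odot>\<^bsub>M\<^esub> c \<oplus>\<^bsub>M\<^esub> w)"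
proof
  assume "x \<in> finite_span (insert c C)"
  then obtain f where f: "f \<in> insert c C \<rightarrow> carrier R" "x = (\<Oplus>\<^bsub>M\<^esub> c \<in> insert c C. f c \<odot>\<^bsub>M\<^esub> c)"
    by (auto simp: finite_span_def)
  have "x = f c \<odot>\<^bsub>M\<^esub> c \<oplus>\<^bsub>M\<^esub> (\<Oplus>\<^bsub>M\<^esub> c \<in> C. f c \<odot>\<^bsub>M\<^esub> c)"
    unfolding f(2) by (rule M.finsum_insert) (use assms f(1) in auto)
  moreover have "(\<Oplus>\<^bsub>M\<^esub> c \<in> C. f c \<odot>\<^bsub>M\<^esub> c) \<in> finite_span C" using f(1) by (intro finite_spanI) auto
  ultimately show "\<exists>r\<in>carrier R. \<exists>w\<in>finite_span C. x = r \<odot>\<^bsub>M\<^esub> c \<oplus>\<^bsub>M\<^esub> w" using f(1) by blast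
next
  assume "\<exists>r\<in>carrier R. \<exists>w\<in>finite_span C. x = r \<odot>\<^bsub>M\<^esub> c \<oplus>\<^bsub>M\<^esub> w"
  then obtain r f where f: "r \<in> carrier R" "f \<in> C \<rightarrow> carrier R" "x = r \<odot>\<^bsub>M\<^esub> c \<oplus>\<^bsub>M\<^esub> (\<Oplus>\<^bsub>M\<^esub> c \<in> C. f c \<odot>\<^bsub>M\<^esub> c)"
    by (auto simp: finite_span_def)
  let ?g = "f(c := r)"
  have g: "?g \<in> insert c C \<rightarrow> carrier R" using f by auto
  have gt: "?g x \<odot>\<^bsub>M\<^esub> x \<in> carrier M" if "x \<in> insert c C" for x
    by (rule smult_term_closed[OF g assms(3) that])
  have eq: "(\<Oplus>\<^bsub>M\<^esub> c \<in> C. ?g c \<odot>\<^bsub>M\<^esub> c) = (\<Oplus>\<^bsub>M\<^esub> c \<in> C. f c \<odot>\<^bsub>M\<^esub> c)"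
  proof (rule M.finsum_cong'[OF refl])
    show "(\<lambda>c. f c \<odot>\<^bsub>M\<^esub> c) \<in> C \<rightarrow> carrier M"
      using assms(3) by (intro Pi_I smult_term_closed[OF f(2)]) auto
    show "?g i \<odot>\<^bsub>M\<^esub> i = f i \<odot>\<^bsub>M\<^esub> i" if "i \<in> C" for i using that assms(2) by auto
  qed
  have "(\<Oplus>\<^bsub>M\<^esub> c \<in> insert c C. ?g c \<odot>\<^bsub>M\<^esub> c) = ?g c \<odot>\<^bsub>M\<^esub> c \<oplus>\<^bsub>M\<^esub> (\<Oplus>\<^bsub>M\<^esub> c \<in> C. ?g c \<odot>\<^bsub>M\<^esub> c)"
    by (rule M.finsum_insert[OF assms(1,2)]) (rule Pi_I, rule gt, simp, rule gt, simp)
  also have "\<dots> = x" unfolding eq f(3) by simp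
  finally show "x \<in> finite_span (insert c C)" using finite_spanI[OF g] by simp
qed

lemma span_empty: "finite_span {} = {\<zero>\<^bsub>M\<^esub>}"
  by (auto simp: finite_span_def)

lemma span_submodule:
  assumes "finite C" "C \<subseteq> carrier M"
  shows "\<zero>\<^bsub>M\<^esub> \<in> finite_span C"
    and "\<lbrakk>x \<in> finite_span C; y \<in> finite_span C\<rbrakk> \<Longrightarrow> x \<oplus>\<^bsub>M\<^esub> y \<in> finite_span C"
    and "\<lbrakk>s \<in> carrier R; x \<in> finite_span C\<rbrakk> \<Longrightarrow> s \<odot>\<^bsub>M\<^esub> x \<in> finite_span C"
proof -
  have "\<zero>\<^bsub>M\<^esub> \<in> finite_span C \<and> (\<forall>x\<in>finite_span C. \<forall>y\<in>finite_span C. x \<oplus>\<^bsub>M\<^esub> y \<in> finite_span C) \<and>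
    (\<forall>s\<in>carrier R. \<forall>x\<in>finite_span C. s \<odot>\<^bsub>M\<^esub> x \<in> finite_span C)"
    using assms
  proof (induction C)
    case empty
    then show ?case by (simp add: span_empty smult_r_null)
  next
    case (insert c C)
    have c: "c \<in> carrier M" and C: "C \<subseteq> carrier M" using insert by auto
    note iff = span_insert[OF insert(1,2,4)] and IH = insert.IH[OF C]
    show ?case
    proof (intro conjI ballI)
      show "\<zero>\<^bsub>M\<^esub> \<in> finite_span (insert c C)"
        unfolding iff using IH c by (intro bexI[of _ \<zero>] bexI[of _ "\<zero>\<^bsub>M\<^esub>"]) auto
      fix x assume "x \<in> finite_span (insert c C)"
      then obtain r w where x: "r \<in> carrier R" "w \<in> finite_span C" "x = r \<odot>\<^bsub>M\<^esub> c \<oplus>\<^bsub>M\<^esub> w" unfolding iff by blast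
      note wc = span_closed[OF C x(2)]
      show "x \<oplus>\<^bsub>M\<^esub> y \<in> finite_span (insert c C)" if y: "y \<in> finite_span (insert c C)" for y
      proof -
        obtain r' w' where y: "r' \<in> carrier R" "w' \<in> finite_span C" "y = r' \<odot>\<^bsub>M\<^esub> c \<oplus>\<^bsub>M\<^esub> w'"
          using y unfolding iff by blast
        have "x \<oplus>\<^bsub>M\<^esub> y = (r \<oplus> r') \<odot>\<^bsub>M\<^esub> c \<oplus>\<^bsub>M\<^esub> (w \<oplus>\<^bsub>M\<^esub> w')"
          using x y c wc span_closed[OF C y(2)] by (simp add: smult_l_distr M.a_ac)
        then show ?thesis unfolding iff using x y IH by blast
      qed
      show "s \<odot>\<^bsub>M\<^esub> x \<in> finite_span (insert c C)" if s: "s \<in> carrier R" for s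
      proof -
        have "s \<odot>\<^bsub>M\<^esub> x = (s \<otimes> r) \<odot>\<^bsub>M\<^esub> c \<oplus>\<^bsub>M\<^esub> s \<odot>\<^bsub>M\<^esub> w"
          using x s c wc by (simp add: smult_r_distr smult_assoc1)
        then show ?thesis unfolding iff using x s IH by blast
      qed
    qed
  qed
  then show "\<zero>\<^bsub>M\<^esub> \<in> finite_span C"
    and "\<lbrakk>x \<in> finite_span C; y \<in> finite_span C\<rbrakk> \<Longrightarrow> x \<oplus>\<^bsub>M\<^esub> y \<in> finite_span C"
    and "\<lbrakk>s \<in> carrier R; x \<in> finite_span C\<rbrakk> \<Longrightarrow> s \<odot>\<^bsub>M\<^esub> x \<in> finite_span C" by blast+
qed

lemma span_mono:
  assumes "finite C" "C \<subseteq> carrier M" "D \<subseteq> C" shows "finite_span D \<subseteq> finite_span C"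
proof
  fix x assume "x \<in> finite_span D"
  then obtain f where f: "f \<in> D \<rightarrow> carrier R" "x = (\<Oplus>\<^bsub>M\<^esub> c \<in> D. f c \<odot>\<^bsub>M\<^esub> c)" by (auto simp: finite_span_def)
  let ?g = "\<lambda>c. if c \<in> D then f c else \<zero>"
  have g: "?g \<in> C \<rightarrow> carrier R" using f(1) by auto
  have gt: "?g c \<odot>\<^bsub>M\<^esub> c \<in> carrier M" if "c \<in> C" for c
    by (rule smult_term_closed[OF g assms(2) that])
  have "x = (\<Oplus>\<^bsub>M\<^esub> c \<in> D. ?g c \<odot>\<^bsub>M\<^esub> c)"
    unfolding f(2)
  proof (rule M.finsum_cong'[OF refl])
    show "(\<lambda>c. ?g c \<odot>\<^bsub>M\<^esub> c) \<in> D \<rightarrow> carrier M" using assms(3) by (intro Pi_I gt) auto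
  qed simp
  also have "\<dots> = (\<Oplus>\<^bsub>M\<^esub> c \<in> C. ?g c \<odot>\<^bsub>M\<^esub> c)"
  proof (rule M.finsum_mono_neutral[OF assms(1,3)])
    show "?g c \<odot>\<^bsub>M\<^esub> c = \<zero>\<^bsub>M\<^esub>" if "c \<in> C - D" for c using that assms(2) by auto
    show "(\<lambda>c. ?g c \<odot>\<^bsub>M\<^esub> c) \<in> D \<rightarrow> carrier M" using assms(3) by (intro Pi_I gt) auto
  qed
  finally show "x \<in> finite_span C" using finite_spanI[OF g] by simp
qed

lemma span_self:
  assumes "finite C" "C \<subseteq> carrier M" shows "C \<subseteq> finite_span C"
proof
  fix c assume c: "c \<in> C"
  then have cM: "c \<in> carrier M" using assms by blast
  then have "c = \<one> \<odot>\<^bsub>M\<^esub> c \<oplus>\<^bsub>M\<^esub> \<zero>\<^bsub>M\<^esub>" by simp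
  then have "c \<in> finite_span (insert c {})"
    using span_insert[of "{}" c c] cM R.one_closed unfolding span_empty by blast
  then show "c \<in> finite_span C" using span_mono[OF assms, of "{c}"] c by auto
qed

text \<open>A chain in the span of \<open>insert c C\<close> is controlled by its trace on the span of \<open>C\<close> and by
  the chain of the ideals of coefficients of \<open>c\<close>.\<close>

lemma noetherian_span:
  assumes noeth: "noetherian_ring R" and "finite C" "C \<subseteq> carrier M"
    and "\<And>k::nat. X k \<subseteq> finite_span C" "\<And>k. X k \<subseteq> X (Suc k)" "\<And>k. \<zero>\<^bsub>M\<^esub> \<in> X k"
    and "\<And>k x y. \<lbrakk>x \<in> X k; y \<in> X k\<rbrakk> \<Longrightarrow> x \<oplus>\<^bsub>M\<^esub> y \<in> X k"
    and "\<And>k s x. \<lbrakk>s \<in> carrier R; x \<in> X k\<rbrakk> \<Longrightarrow> s \<odot>\<^bsub>M\<^esub> x \<in> X k"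
  shows "\<exists>k. \<forall>l\<ge>k. X l = X k"
  using assms(2-)
proof (induction C arbitrary: X)
  case empty
  then have "X l = {\<zero>\<^bsub>M\<^esub>}" for l using span_empty by blast
  then show ?case by simp
next
  case (insert c C)
  note sub = insert.prems(2) and mono = insert.prems(3) and zero = insert.prems(4)
    and add = insert.prems(5) and smult = insert.prems(6)
  have c: "c \<in> carrier M" and C: "C \<subseteq> carrier M" using insert.prems(1) by auto
  note S = span_submodule[OF insert.hyps(1) C]
  have neg: "\<ominus>\<^bsub>M\<^esub> x = (\<ominus> \<one>) \<odot>\<^bsub>M\<^esub> x" if "x \<in> carrier M" for x
    using that smult_l_minus[of \<one> x] by simp
  have Xc: "x \<in> carrier M" if "x \<in> X k" for x k
    by (rule span_closed[OF insert.prems(1) subsetD[OF sub that]])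
  define I where "I k = {r \<in> carrier R. \<exists>w\<in>finite_span C. r \<odot>\<^bsub>M\<^esub> c \<oplus>\<^bsub>M\<^esub> w \<in> X k}" for k
  have I: "ideal (I k) R" for k
  proof (rule idealI[OF R.ring_axioms])
    have smI: "s \<otimes> r \<in> I k" if s: "s \<in> carrier R" and rI: "r \<in> I k" for s r
    proof -
      obtain w where w: "r \<in> carrier R" "w \<in> finite_span C" "r \<odot>\<^bsub>M\<^esub> c \<oplus>\<^bsub>M\<^esub> w \<in> X k"
        using rI unfolding I_def by blast
      have "s \<odot>\<^bsub>M\<^esub> (r \<odot>\<^bsub>M\<^esub> c \<oplus>\<^bsub>M\<^esub> w) = (s \<otimes> r) \<odot>\<^bsub>M\<^esub> c \<oplus>\<^bsub>M\<^esub> s \<odot>\<^bsub>M\<^esub> w"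
        using w s c span_closed[OF C w(2)] by (simp add: smult_r_distr smult_assoc1)
      then show ?thesis using smult[OF s w(3)] S(3)[OF s w(2)] w(1) s unfolding I_def by auto
    qed
    show "subgroup (I k) (add_monoid R)"
    proof (rule R.add.subgroupI)
      have "\<zero> \<odot>\<^bsub>M\<^esub> c \<oplus>\<^bsub>M\<^esub> \<zero>\<^bsub>M\<^esub> = \<zero>\<^bsub>M\<^esub>" using c by simp
      then have "\<exists>w\<in>finite_span C. \<zero> \<odot>\<^bsub>M\<^esub> c \<oplus>\<^bsub>M\<^esub> w \<in> X k"
        by (intro bexI[of _ "\<zero>\<^bsub>M\<^esub>"]) (simp_all only: zero S(1))
      then have "\<zero> \<in> I k" unfolding I_def by simp
      then show "I k \<noteq> {}" by blast
      show "\<ominus> r \<in> I k" if "r \<in> I k" for r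
        using smI[of "\<ominus> \<one>" r] that by (simp add: I_def R.l_minus)
      show "r \<oplus> r' \<in> I k" if r: "r \<in> I k" "r' \<in> I k" for r r'
      proof -
        obtain w w' where w: "r \<in> carrier R" "w \<in> finite_span C" "r \<odot>\<^bsub>M\<^esub> c \<oplus>\<^bsub>M\<^esub> w \<in> X k"
          "r' \<in> carrier R" "w' \<in> finite_span C" "r' \<odot>\<^bsub>M\<^esub> c \<oplus>\<^bsub>M\<^esub> w' \<in> X k"
          using r unfolding I_def by blast
        have "(r \<odot>\<^bsub>M\<^esub> c \<oplus>\<^bsub>M\<^esub> w) \<oplus>\<^bsub>M\<^esub> (r' \<odot>\<^bsub>M\<^esub> c \<oplus>\<^bsub>M\<^esub> w') = (r \<oplus> r') \<odot>\<^bsub>M\<^esub> c \<oplus>\<^bsub>M\<^esub> (w \<oplus>\<^bsub>M\<^esub> w')"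
          using w c span_closed[OF C] by (simp add: smult_l_distr M.a_ac)
        then show ?thesis using add[OF w(3,6)] S(2)[OF w(2,5)] w(1,4) unfolding I_def by auto
      qed
    qed (auto simp: I_def)
    fix a x assume a: "a \<in> I k" and x: "x \<in> carrier R"
    show "x \<otimes> a \<in> I k" by (rule smI[OF x a])
    then show "a \<otimes> x \<in> I k" using a x R.m_comm[of a x] by (simp add: I_def)
  qed
  interpret R: noetherian_ring R by (rule noeth)
  have "I k \<subseteq> I (Suc k)" for k using mono[of k] unfolding I_def by blast
  from R.ascending_chain[of I, OF I this] obtain k1 where k1: "\<And>l. l \<ge> k1 \<Longrightarrow> I l = I k1" by blast
  have "\<exists>k. \<forall>l\<ge>k. X l \<inter> finite_span C = X k \<inter> finite_span C"
  proof (rule insert.IH[OF C])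
    fix k
    show "X k \<inter> finite_span C \<subseteq> finite_span C" by (rule Int_lower2)
    show "X k \<inter> finite_span C \<subseteq> X (Suc k) \<inter> finite_span C" by (rule Int_mono[OF mono order_refl])
    show "\<zero>\<^bsub>M\<^esub> \<in> X k \<inter> finite_span C" by (rule IntI[OF zero S(1)])
    fix x assume x: "x \<in> X k \<inter> finite_span C"
    show "x \<oplus>\<^bsub>M\<^esub> y \<in> X k \<inter> finite_span C" if y: "y \<in> X k \<inter> finite_span C" for y
      by (rule IntI[OF add[OF IntD1[OF x] IntD1[OF y]] S(2)[OF IntD2[OF x] IntD2[OF y]]])
    show "s \<odot>\<^bsub>M\<^esub> x \<in> X k \<inter> finite_span C" if s: "s \<in> carrier R" for s
      by (rule IntI[OF smult[OF s IntD1[OF x]] S(3)[OF s IntD2[OF x]]])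
  qed
  then obtain k2 where k2: "\<And>l. l \<ge> k2 \<Longrightarrow> X l \<inter> finite_span C = X k2 \<inter> finite_span C" by blast
  have le: "X k \<subseteq> X l" if "k \<le> l" for k l
    by (rule lift_Suc_mono_le[of X, OF _ that]) (rule mono)
  let ?k = "max k1 k2"
  have main: "X l = X ?k" if l: "l \<ge> ?k" for l
  proof
    have kk: "I l = I ?k" "X l \<inter> finite_span C = X ?k \<inter> finite_span C"
      using k1[of l] k1[of ?k] k2[of l] k2[of ?k] l by auto
    show "X l \<subseteq> X ?k"
    proof
      fix x assume x: "x \<in> X l"
      then obtain r w where r: "r \<in> carrier R" "w \<in> finite_span C" "x = r \<odot>\<^bsub>M\<^esub> c \<oplus>\<^bsub>M\<^esub> w"
        using subsetD[OF sub x] unfolding span_insert[OF insert.hyps insert.prems(1)] by blast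
      then have "r \<in> I ?k" using x kk(1) unfolding I_def by blast
      then obtain w' where w': "w' \<in> finite_span C" "r \<odot>\<^bsub>M\<^esub> c \<oplus>\<^bsub>M\<^esub> w' \<in> X ?k" unfolding I_def by blast
      let ?x' = "r \<odot>\<^bsub>M\<^esub> c \<oplus>\<^bsub>M\<^esub> w'"
      note cl = span_closed[OF C r(2)] span_closed[OF C w'(1)]
      have xl: "?x' \<in> X l" using le[OF l] w'(2) by blast
      have m1: "\<ominus> \<one> \<in> carrier R" by simp
      have rc: "r \<odot>\<^bsub>M\<^esub> c \<in> carrier M" using r(1) c by simp
      \<comment> \<open>Subtracting an element of \<open>X ?k\<close> with the same coefficient of
        \<open>c\<close> leaves an element in the span of \<open>C\<close>, where the chain is
        already stationary. Subtraction is written with the scalar - 1 because the chain is only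
        assumed closed under sums and multiples.\<close>
      let ?d = "w \<oplus>\<^bsub>M\<^esub> (\<ominus> \<one>) \<odot>\<^bsub>M\<^esub> w'"
      have d: "?d = w \<oplus>\<^bsub>M\<^esub> \<ominus>\<^bsub>M\<^esub> w'" using neg[OF cl(2)] by simp
      have "x \<oplus>\<^bsub>M\<^esub> (\<ominus> \<one>) \<odot>\<^bsub>M\<^esub> ?x' \<in> X l" by (rule add[OF x smult[OF m1 xl]])
      also have "(\<ominus> \<one>) \<odot>\<^bsub>M\<^esub> ?x' = \<ominus>\<^bsub>M\<^esub> ?x'" by (rule neg[symmetric]) (use rc cl in simp)
      also have "x \<oplus>\<^bsub>M\<^esub> \<ominus>\<^bsub>M\<^esub> ?x' = ?d"
        unfolding d r(3) using rc cl by (simp add: M.minus_add M.a_ac M.r_neg M.r_neg1 M.r_neg2)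
      finally have "?d \<in> X l \<inter> finite_span C"
        using S(2)[OF r(2) S(3)[OF m1 w'(1)]] by (rule IntI)
      then have "?d \<in> X ?k" unfolding kk(2) by (rule IntD1)
      from add[OF w'(2) this] have "?x' \<oplus>\<^bsub>M\<^esub> ?d \<in> X ?k" .
      also have "?x' \<oplus>\<^bsub>M\<^esub> ?d = x"
      proof -
        have "?x' \<oplus>\<^bsub>M\<^esub> ?d = x \<oplus>\<^bsub>M\<^esub> (w' \<oplus>\<^bsub>M\<^esub> \<ominus>\<^bsub>M\<^esub> w')"
          unfolding d r(3) using rc cl by (simp add: M.a_ac)
        then show ?thesis using rc cl by (simp add: r(3) M.r_neg)
      qed
      finally show "x \<in> X ?k" .
    qed
    show "X ?k \<subseteq> X l" by (rule le[OF l])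
  qed
  show ?case by (intro exI allI impI) (rule main)
qed

end

lemma finitely_generated_module_iff:
  assumes "module R M"
  shows "finitely_generated_module R M \<longleftrightarrow>
    (\<exists>C. finite C \<and> C \<subseteq> carrier M \<and> module.finite_span R M C = carrier M)"
  unfolding finitely_generated_module_def module.finite_span_def[OF assms]
  by (rule iff_exI) blast

section \<open>Cohomology modules\<close>

lemma (in abelian_group) a_inv_zero: "\<ominus> \<zero> = \<zero>"
  by (rule minus_equality) auto

section \<open>The ring \<open>H^0\<close> and representatives of its elements\<close>

lemma H0_eq: "H0 B = degree_zero B Quot coboundaries B 0"
  by (simp add: H0_def degree_zero_def)

definition H0_class :: "'b dg_ring \<Rightarrow> 'b \<Rightarrow> 'b set"
  where "H0_class B s = coboundaries B 0 +>\<^bsub>degree_zero B\<^esub> s"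

context dg_ring
begin

lemma surj_H0: "surj_ring_hom (degree_zero A) (H0 A) (H0_class A)"
proof -
  interpret I: ideal "coboundaries A 0" "degree_zero A" by (rule coboundaries_ideal)
  have "ring_hom_cring (degree_zero A) (H0 A) (H0_class A)"
    unfolding H0_eq H0_class_def[abs_def] by (rule I.rcos_ring_hom_cring[OF Z.is_cring])
  moreover have "H0_class A ` carrier (degree_zero A) = carrier (H0 A)"
    unfolding H0_eq FactRing_def A_RCOSETS_def' H0_class_def by auto
  ultimately show ?thesis
    by (intro surj_ring_hom.intro surj_ring_hom_axioms.intro)
qed

sublocale H0: surj_ring_hom "degree_zero A" "H0 A" "H0_class A"
  by (rule surj_H0)

lemma H0_kernel: "a_kernel (degree_zero A) (H0 A) (H0_class A) = coboundaries A 0"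
proof -
  interpret I: ideal "coboundaries A 0" "degree_zero A" by (rule coboundaries_ideal)
  have z: "\<zero>\<^bsub>H0 A\<^esub> = coboundaries A 0" by (simp add: H0_eq FactRing_def)
  have "H0_class A x = coboundaries A 0 \<longleftrightarrow> x \<in> coboundaries A 0" if x: "x \<in> carrier (degree_zero A)" for x
  proof
    assume "H0_class A x = coboundaries A 0"
    then show "x \<in> coboundaries A 0" using I.a_rcos_self[OF x] unfolding H0_class_def by simp
  next
    assume "x \<in> coboundaries A 0"
    then show "H0_class A x = coboundaries A 0" unfolding H0_class_def by (rule I.a_rcos_const)
  qed
  then show ?thesis unfolding a_kernel_def' z using I.a_subset by auto
qed

text \<open>The definition of regular sequences picks an arbitrary member of a coset; what the proof
  uses of this choice is that it represents the class.\<close>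

lemma H0_lift:
  assumes X: "X \<in> carrier (H0 A)"
  shows "lift X \<in> homog A 0" "H0_class A (lift X) = X" "lift X \<in> X"
proof -
  interpret I: ideal "coboundaries A 0" "degree_zero A" by (rule coboundaries_ideal)
  obtain s where s: "s \<in> carrier (degree_zero A)" "X = H0_class A s" using X H0.surj by blast
  have "s \<in> X" unfolding s(2) H0_class_def by (rule I.a_rcos_self[OF s(1)])
  then show l: "lift X \<in> X" unfolding lift_def by (rule someI)
  then have l': "lift X \<in> coboundaries A 0 +>\<^bsub>degree_zero A\<^esub> s" unfolding s(2) H0_class_def .
  have c: "lift X \<in> carrier (degree_zero A)" by (rule I.a_elemrcos_carrier[OF s(1) l'])
  then show "lift X \<in> homog A 0" by simp
  show "H0_class A (lift X) = X"
    unfolding s(2) H0_class_def by (rule I.a_repr_independence'[OF l' s(1), symmetric, unfolded s(2) H0_class_def])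
qed

lemma H0_class_mem:
  assumes "s \<in> X" and X: "X \<in> carrier (H0 A)"
  shows "s \<in> homog A 0" "H0_class A s = X"
proof -
  interpret I: ideal "coboundaries A 0" "degree_zero A" by (rule coboundaries_ideal)
  obtain t where t: "t \<in> carrier (degree_zero A)" "X = H0_class A t" using X H0.surj by blast
  have s: "s \<in> coboundaries A 0 +>\<^bsub>degree_zero A\<^esub> t" using assms(1) unfolding t(2) H0_class_def .
  show "s \<in> homog A 0" using I.a_elemrcos_carrier[OF t(1) s] by simp
  show "H0_class A s = X"
    unfolding t(2) H0_class_def by (rule I.a_repr_independence'[OF s t(1), symmetric])
qed

end

text \<open>The additional assumption makes the action of the degree zero part of \<open>B\<close>
  descend to \<open>H^0(B)\<close>, so that \<open>cohomology M n\<close> becomes a module over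
  it.\<close>

locale cohomology_action = B: dg_ring B + C: scalar_complex "degree_zero B" M "act M"
  for B :: "'b dg_ring" and M :: "('b, 'm) dg_module" +
  assumes ann: "b \<in> coboundaries B 0 \<Longrightarrow> C.annihilates b"
begin

definition cl :: "int \<Rightarrow> 'm \<Rightarrow> 'm set" where "cl n z = coboundaries M n +>\<^bsub>M\<^esub> z"

lemma coboundaries_subgroup: "abelian_subgroup (coboundaries M n) M"
proof (rule abelian_subgroupI3[OF additive_subgroupI C.M.abelian_group_axioms], rule C.M.add.subgroupI)
  show "coboundaries M n \<subseteq> carrier M"
    using C.coboundaries_cocycles C.cocycles_homog C.homog_carrier by blast
  show "coboundaries M n \<noteq> {}" using C.coboundaries_zero by blast
qed (auto intro: C.coboundaries_minus C.coboundaries_add)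

lemma cocycles_carrier: "z \<in> cocycles M n \<Longrightarrow> z \<in> carrier M"
  using C.cocycles_homog C.homog_carrier by blast

lemma cl_self: "z \<in> cocycles M n \<Longrightarrow> z \<in> cl n z"
  unfolding cl_def by (rule abelian_subgroup.a_rcos_self[OF coboundaries_subgroup cocycles_carrier])

lemma mem_cl_iff:
  assumes "z \<in> carrier M" "w \<in> cocycles M n"
  shows "z \<in> cl n w \<longleftrightarrow> z \<oplus>\<^bsub>M\<^esub> \<ominus>\<^bsub>M\<^esub> w \<in> coboundaries M n"
  unfolding cl_def by (rule abelian_subgroup.a_rcos_module[OF coboundaries_subgroup cocycles_carrier[OF assms(2)] assms(1)])

lemma cl_eqI: "\<lbrakk>z \<in> cl n w; w \<in> cocycles M n\<rbrakk> \<Longrightarrow> cl n z = cl n w"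
  unfolding cl_def
  by (rule abelian_subgroup.a_repr_independence'[OF coboundaries_subgroup, symmetric]) (auto intro: cocycles_carrier)

lemma mem_cl_cocycle:
  assumes "z \<in> cl n w" "w \<in> cocycles M n"
  shows "z \<in> cocycles M n"
proof -
  obtain b where "b \<in> coboundaries M n" "z = b \<oplus>\<^bsub>M\<^esub> w"
    using assms(1) unfolding cl_def a_r_coset_def' by blast
  then show ?thesis using C.cocycles_add C.coboundaries_cocycles assms(2) by blast
qed

lemma cl_eq_iff:
  assumes z: "z \<in> cocycles M n" and w: "w \<in> cocycles M n"
  shows "cl n z = cl n w \<longleftrightarrow> z \<oplus>\<^bsub>M\<^esub> \<ominus>\<^bsub>M\<^esub> w \<in> coboundaries M n"
proof
  assume "cl n z = cl n w"
  then have "z \<in> cl n w" using cl_self[OF z] by simp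
  then show "z \<oplus>\<^bsub>M\<^esub> \<ominus>\<^bsub>M\<^esub> w \<in> coboundaries M n" using mem_cl_iff[OF cocycles_carrier[OF z] w] by simp
next
  assume "z \<oplus>\<^bsub>M\<^esub> \<ominus>\<^bsub>M\<^esub> w \<in> coboundaries M n"
  then have "z \<in> cl n w" using mem_cl_iff[OF cocycles_carrier[OF z] w] by simp
  then show "cl n z = cl n w" by (rule cl_eqI[OF _ w])
qed

lemma cl_add_coboundary:
  assumes b: "b \<in> coboundaries M n" and z: "z \<in> cocycles M n"
  shows "cl n (b \<oplus>\<^bsub>M\<^esub> z) = cl n z"
  using b by (intro cl_eqI[OF _ z]) (auto simp: cl_def a_r_coset_def')

lemma cl_add:
  "\<lbrakk>z \<in> cocycles M n; w \<in> cocycles M n\<rbrakk> \<Longrightarrow> cl n z <+>\<^bsub>M\<^esub> cl n w = cl n (z \<oplus>\<^bsub>M\<^esub> w)"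
  unfolding cl_def
  by (rule abelian_subgroup.a_rcos_sum[OF coboundaries_subgroup cocycles_carrier cocycles_carrier])

lemma cl_zero: "cl n \<zero>\<^bsub>M\<^esub> = coboundaries M n"
  unfolding cl_def by (rule abelian_subgroup.a_rcos_const[OF coboundaries_subgroup C.coboundaries_zero])

lemma zero_cocycle: "\<zero>\<^bsub>M\<^esub> \<in> cocycles M n"
  using C.coboundaries_zero C.coboundaries_cocycles by blast

lemma cl_eq_zero_iff: "z \<in> cocycles M n \<Longrightarrow> cl n z = coboundaries M n \<longleftrightarrow> z \<in> coboundaries M n"
  using cl_eq_iff[OF _ zero_cocycle, of z n] unfolding cl_zero by (simp add: cocycles_carrier C.M.a_inv_zero)

lemma cohomology_simps:
  "carrier (cohomology M n) = cl n ` cocycles M n" "\<zero>\<^bsub>cohomology M n\<^esub> = coboundaries M n"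
  "X \<oplus>\<^bsub>cohomology M n\<^esub> Y = X <+>\<^bsub>M\<^esub> Y"
  by (simp_all add: cohomology_def cl_def[abs_def])

text \<open>By definition the product is a union over all representatives. A change of
  representatives alters the result by a coboundary, so all members of the union are one and the
  same class.\<close>

lemma cohomology_smult:
  assumes a: "a \<in> homog B 0" and z: "z \<in> cocycles M n"
  shows "H0_class B a \<odot>\<^bsub>cohomology M n\<^esub> cl n z = cl n (act M a z)"
proof -
  have *: "cl n (act M a' z') = cl n (act M a z)" if a': "a' \<in> H0_class B a" and z': "z' \<in> cl n z" for a' z'
  proof -
    obtain b where b: "b \<in> coboundaries B 0" "a' = b \<oplus>\<^bsub>B\<^esub> a"
      using a' unfolding H0_class_def a_r_coset_def' by auto
    obtain y where y: "y \<in> coboundaries M n" "z' = y \<oplus>\<^bsub>M\<^esub> z"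
      using z' unfolding cl_def a_r_coset_def' by auto
    have bh: "b \<in> carrier (degree_zero B)" using ideal.Icarr[OF B.coboundaries_ideal b(1)] .
    have ah: "a \<in> carrier (degree_zero B)" using a by simp
    have zc: "z' \<in> cocycles M n" by (rule mem_cl_cocycle[OF z' z])
    note zh = C.cocycles_homog[OF zc] and z0 = C.cocycles_homog[OF z]
    have yh: "y \<in> homog M n" using C.cocycles_homog C.coboundaries_cocycles y(1) by blast
    have "act M a' z' = act M b z' \<oplus>\<^bsub>M\<^esub> act M a z'"
      using C.add_act[OF bh ah zh] b(2) by simp
    also have "act M a z' = act M a y \<oplus>\<^bsub>M\<^esub> act M a z"
      unfolding y(2) by (rule C.act_add[OF ah yh z0])
    finally have eq: "act M a' z' = act M b z' \<oplus>\<^bsub>M\<^esub> (act M a y \<oplus>\<^bsub>M\<^esub> act M a z)" .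
    have "act M b z' \<in> coboundaries M n" using ann[OF b(1)] zc unfolding C.annihilates_def by blast
    then show ?thesis
      unfolding eq using C.coboundaries_act[OF ah y(1)] C.cocycles_act[OF ah z]
      by (simp add: cl_add_coboundary C.cocycles_add subsetD[OF C.coboundaries_cocycles])
  qed
  have 1: "a \<in> H0_class B a"
    using abelian_subgroup.a_rcos_self[OF ideal.axioms(1)[OF B.coboundaries_ideal, THEN abelian_subgroupI3, OF B.Z.abelian_group_axioms], of a] a
    by (simp add: H0_class_def)
  have 2: "z \<in> cl n z" by (rule cl_self[OF z])
  have "H0_class B a \<odot>\<^bsub>cohomology M n\<^esub> cl n z = (\<Union>a'\<in>H0_class B a. \<Union>z'\<in>cl n z. cl n (act M a' z'))"
    by (simp add: cohomology_def cl_def[abs_def])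
  also have "\<dots> = (\<Union>a'\<in>H0_class B a. \<Union>z'\<in>cl n z. cl n (act M a z))"
    by (intro SUP_cong refl *)
  also have "\<dots> = cl n (act M a z)" using 1 2 by blast
  finally show ?thesis .
qed

lemma cohomology_module: "module (H0 B) (cohomology M n)"
proof (rule moduleI)
  note cs = cohomology_simps
  show "cring (H0 B)" by (rule B.H0.S.is_cring)
  show "abelian_group (cohomology M n)"
  proof (rule abelian_groupI)
    fix X assume "X \<in> carrier (cohomology M n)"
    then obtain z where z: "z \<in> cocycles M n" "X = cl n z" unfolding cs by blast
    note zc = cocycles_carrier[OF z(1)]
    show "\<zero>\<^bsub>cohomology M n\<^esub> \<oplus>\<^bsub>cohomology M n\<^esub> X = X"
      unfolding cs z(2) cl_zero[symmetric] cl_add[OF zero_cocycle z(1)] using zc by simp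
    have "cl n (\<ominus>\<^bsub>M\<^esub> z) \<oplus>\<^bsub>cohomology M n\<^esub> X = \<zero>\<^bsub>cohomology M n\<^esub>"
      unfolding cs z(2) cl_zero[symmetric] cl_add[OF C.cocycles_minus[OF z(1)] z(1)] using zc by (simp add: C.M.l_neg)
    then show "\<exists>Y\<in>carrier (cohomology M n). Y \<oplus>\<^bsub>cohomology M n\<^esub> X = \<zero>\<^bsub>cohomology M n\<^esub>"
      unfolding cs(1) using C.cocycles_minus[OF z(1)] by blast
    fix Y assume "Y \<in> carrier (cohomology M n)"
    then obtain w where w: "w \<in> cocycles M n" "Y = cl n w" unfolding cs by blast
    note wc = cocycles_carrier[OF w(1)]
    show "X \<oplus>\<^bsub>cohomology M n\<^esub> Y \<in> carrier (cohomology M n)"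
      unfolding cs z(2) w(2) cl_add[OF z(1) w(1)] by (rule imageI[OF C.cocycles_add[OF z(1) w(1)]])
    show "X \<oplus>\<^bsub>cohomology M n\<^esub> Y = Y \<oplus>\<^bsub>cohomology M n\<^esub> X"
      unfolding cs z(2) w(2) cl_add[OF z(1) w(1)] cl_add[OF w(1) z(1)] C.M.a_comm[OF zc wc] ..
    fix V assume "V \<in> carrier (cohomology M n)"
    then obtain v where v: "v \<in> cocycles M n" "V = cl n v" unfolding cs by blast
    note vc = cocycles_carrier[OF v(1)]
    show "(X \<oplus>\<^bsub>cohomology M n\<^esub> Y) \<oplus>\<^bsub>cohomology M n\<^esub> V = X \<oplus>\<^bsub>cohomology M n\<^esub> (Y \<oplus>\<^bsub>cohomology M n\<^esub> V)"
      unfolding cs z(2) w(2) v(2) cl_add[OF z(1) w(1)] cl_add[OF w(1) v(1)]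
        cl_add[OF C.cocycles_add[OF z(1) w(1)] v(1)] cl_add[OF z(1) C.cocycles_add[OF w(1) v(1)]]
        C.M.a_assoc[OF zc wc vc] ..
  next
    show "\<zero>\<^bsub>cohomology M n\<^esub> \<in> carrier (cohomology M n)"
      unfolding cs cl_zero[symmetric] by (rule imageI[OF zero_cocycle])
  qed
  show "\<one>\<^bsub>H0 B\<^esub> \<odot>\<^bsub>cohomology M n\<^esub> X = X" if X: "X \<in> carrier (cohomology M n)" for X
  proof -
    obtain z where z: "z \<in> cocycles M n" "X = cl n z" using X unfolding cs by blast
    show ?thesis
      using cohomology_smult[OF B.one_homog z(1)] C.one_act[OF C.cocycles_homog[OF z(1)]] B.H0.hom_one z(2) by simp
  qed
  fix r X assume "r \<in> carrier (H0 B)" "X \<in> carrier (cohomology M n)"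
  then obtain a z where a: "a \<in> homog B 0" "r = H0_class B a" and z: "z \<in> cocycles M n" "X = cl n z"
    unfolding cs B.H0.surj[symmetric] by auto
  have ah: "a \<in> carrier (degree_zero B)" using a by simp
  note za = C.cocycles_act[OF ah z(1)]
  show "r \<odot>\<^bsub>cohomology M n\<^esub> X \<in> carrier (cohomology M n)"
    unfolding a(2) z(2) cohomology_smult[OF a(1) z(1)] cs by (rule imageI[OF za])
  { fix Y assume "Y \<in> carrier (cohomology M n)"
    then obtain w where w: "w \<in> cocycles M n" "Y = cl n w" unfolding cs by blast
    show "r \<odot>\<^bsub>cohomology M n\<^esub> (X \<oplus>\<^bsub>cohomology M n\<^esub> Y) =
        r \<odot>\<^bsub>cohomology M n\<^esub> X \<oplus>\<^bsub>cohomology M n\<^esub> r \<odot>\<^bsub>cohomology M n\<^esub> Y"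
      unfolding a(2) z(2) w(2) cs(3) cl_add[OF z(1) w(1)] cohomology_smult[OF a(1) z(1)] cohomology_smult[OF a(1) w(1)]
        cohomology_smult[OF a(1) C.cocycles_add[OF z(1) w(1)]] cl_add[OF za C.cocycles_act[OF ah w(1)]]
        C.act_add[OF ah C.cocycles_homog[OF z(1)] C.cocycles_homog[OF w(1)]] .. }
  fix t assume "t \<in> carrier (H0 B)"
  then obtain b where b: "b \<in> homog B 0" "t = H0_class B b" unfolding B.H0.surj[symmetric] by auto
  have bh: "b \<in> carrier (degree_zero B)" using b by simp
  have rt: "r \<oplus>\<^bsub>H0 B\<^esub> t = H0_class B (a \<oplus>\<^bsub>B\<^esub> b)" "r \<otimes>\<^bsub>H0 B\<^esub> t = H0_class B (a \<otimes>\<^bsub>B\<^esub> b)"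
    using B.H0.hom_add[OF ah bh] B.H0.hom_mult[OF ah bh] a b by simp_all
  have ab: "a \<oplus>\<^bsub>B\<^esub> b \<in> homog B 0" "a \<otimes>\<^bsub>B\<^esub> b \<in> homog B 0"
    using a b by (simp_all add: B.mult_mem_homog)
  note zb = C.cocycles_act[OF bh z(1)]
  show "(r \<oplus>\<^bsub>H0 B\<^esub> t) \<odot>\<^bsub>cohomology M n\<^esub> X = r \<odot>\<^bsub>cohomology M n\<^esub> X \<oplus>\<^bsub>cohomology M n\<^esub> t \<odot>\<^bsub>cohomology M n\<^esub> X"
    unfolding rt cs(3) unfolding a(2) b(2) z(2) cohomology_smult[OF ab(1) z(1)] cohomology_smult[OF a(1) z(1)]
      cohomology_smult[OF b(1) z(1)] cl_add[OF za zb]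
    using C.add_act[OF ah bh C.cocycles_homog[OF z(1)]] by simp
  show "(r \<otimes>\<^bsub>H0 B\<^esub> t) \<odot>\<^bsub>cohomology M n\<^esub> X = r \<odot>\<^bsub>cohomology M n\<^esub> (t \<odot>\<^bsub>cohomology M n\<^esub> X)"
    unfolding rt unfolding a(2) b(2) z(2) cohomology_smult[OF ab(2) z(1)] cohomology_smult[OF b(1) z(1)]
      cohomology_smult[OF a(1) zb]
    using C.mult_act[OF ah bh C.cocycles_homog[OF z(1)]] by simp
qed

lemma cohomology_vanishes_iff: "cohomology_vanishes M n \<longleftrightarrow> cocycles M n \<subseteq> coboundaries M n"
proof -
  have "coboundaries M n \<in> cl n ` cocycles M n" using zero_cocycle unfolding cl_zero[symmetric] by (rule imageI)
  then have "cohomology_vanishes M n \<longleftrightarrow> (\<forall>z\<in>cocycles M n. cl n z = coboundaries M n)"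
    unfolding cohomology_vanishes_def cohomology_simps by auto
  also have "\<dots> \<longleftrightarrow> cocycles M n \<subseteq> coboundaries M n" using cl_eq_zero_iff by blast
  finally show ?thesis .
qed

lemma dg_inf_eq: "dg_inf M = complex_inf M"
  by (simp add: dg_inf_def complex_inf_def cohomology_vanishes_iff)

text \<open>An additive map is injective if its kernel is trivial, and by
  \<open>cohomology_smult\<close> the representative \<open>lift x\<close> may act in place of the
  coset \<open>x\<close>.\<close>

lemma regular_element_iff:
  assumes x: "x \<in> carrier (H0 B)"
  shows "regular_element \<mm> M x \<longleftrightarrow> x \<in> \<mm> \<and> C.regular_at (lift x) (complex_inf M)"
proof -
  let ?n = "complex_inf M"
  note l = B.H0_lift[OF x]
  have lh: "lift x \<in> carrier (degree_zero B)" using l(1) by simp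
  have sm: "x \<odot>\<^bsub>cohomology M ?n\<^esub> cl ?n z = cl ?n (act M (lift x) z)" if "z \<in> cocycles M ?n" for z
    using cohomology_smult[OF l(1) that] unfolding l(2) .
  interpret H: module "H0 B" "cohomology M ?n" by (rule cohomology_module)
  have "inj_on (\<lambda>z. x \<odot>\<^bsub>cohomology M ?n\<^esub> z) (carrier (cohomology M ?n)) \<longleftrightarrow> C.regular_at (lift x) ?n"
  proof
    assume inj: "inj_on (\<lambda>z. x \<odot>\<^bsub>cohomology M ?n\<^esub> z) (carrier (cohomology M ?n))"
    show "C.regular_at (lift x) ?n"
      unfolding C.regular_at_def
    proof (intro ballI impI)
      fix z assume z: "z \<in> cocycles M ?n" "act M (lift x) z \<in> coboundaries M ?n"
      have "x \<odot>\<^bsub>cohomology M ?n\<^esub> cl ?n z = coboundaries M ?n"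
        unfolding sm[OF z(1)] using cl_eq_zero_iff[OF C.cocycles_act[OF lh z(1)]] z(2) by simp
      moreover have "x \<odot>\<^bsub>cohomology M ?n\<^esub> cl ?n \<zero>\<^bsub>M\<^esub> = coboundaries M ?n"
        unfolding sm[OF zero_cocycle] C.act_zero[OF lh] by (rule cl_zero)
      ultimately have "cl ?n z = cl ?n \<zero>\<^bsub>M\<^esub>"
        using inj_onD[OF inj, of "cl ?n z" "cl ?n \<zero>\<^bsub>M\<^esub>"] z(1) zero_cocycle unfolding cohomology_simps by simp
      then show "z \<in> coboundaries M ?n" using cl_eq_zero_iff[OF z(1)] unfolding cl_zero by simp
    qed
  next
    assume reg: "C.regular_at (lift x) ?n"
    show "inj_on (\<lambda>z. x \<odot>\<^bsub>cohomology M ?n\<^esub> z) (carrier (cohomology M ?n))"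
    proof (rule inj_onI)
      fix X Y assume "X \<in> carrier (cohomology M ?n)" "Y \<in> carrier (cohomology M ?n)"
        and eq: "x \<odot>\<^bsub>cohomology M ?n\<^esub> X = x \<odot>\<^bsub>cohomology M ?n\<^esub> Y"
      then obtain z w where z: "z \<in> cocycles M ?n" "X = cl ?n z" and w: "w \<in> cocycles M ?n" "Y = cl ?n w"
        unfolding cohomology_simps by blast
      note mw = C.cocycles_minus[OF w(1)]
      have "act M (lift x) (z \<oplus>\<^bsub>M\<^esub> \<ominus>\<^bsub>M\<^esub> w) = act M (lift x) z \<oplus>\<^bsub>M\<^esub> \<ominus>\<^bsub>M\<^esub> act M (lift x) w"
        using C.act_add[OF lh C.cocycles_homog[OF z(1)] C.cocycles_homog[OF mw]] C.act_minus[OF lh C.cocycles_homog[OF w(1)]] by simp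
      also have "\<dots> \<in> coboundaries M ?n"
        using eq unfolding z(2) w(2) sm[OF z(1)] sm[OF w(1)]
          cl_eq_iff[OF C.cocycles_act[OF lh z(1)] C.cocycles_act[OF lh w(1)]] .
      finally have "z \<oplus>\<^bsub>M\<^esub> \<ominus>\<^bsub>M\<^esub> w \<in> coboundaries M ?n"
        using reg C.cocycles_add[OF z(1) mw] unfolding C.regular_at_def by blast
      then show "X = Y" unfolding z(2) w(2) cl_eq_iff[OF z(1) w(1)] .
    qed
  qed
  then show ?thesis unfolding regular_element_def dg_inf_eq by simp
qed

text \<open>A submodule given by cocycles contains all coboundaries, so it is a union of
  classes.\<close>

lemma between_classes:
  assumes X: "C.between n X" and z: "z \<in> cocycles M n" "cl n z \<in> cl n ` X" shows "z \<in> X"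
proof -
  obtain w where w: "w \<in> X" "cl n z = cl n w" using z(2) by blast
  have wc: "w \<in> cocycles M n" using w(1) X unfolding C.between_def by blast
  have b: "z \<oplus>\<^bsub>M\<^esub> \<ominus>\<^bsub>M\<^esub> w \<in> X" using w(2) cl_eq_iff[OF z(1) wc] X unfolding C.between_def by blast
  have "z = (z \<oplus>\<^bsub>M\<^esub> \<ominus>\<^bsub>M\<^esub> w) \<oplus>\<^bsub>M\<^esub> w"
    using cocycles_carrier[OF z(1)] cocycles_carrier[OF wc] by (simp add: C.M.a_assoc C.M.l_neg)
  then show ?thesis using b w(1) X unfolding C.between_def by metis
qed

text \<open>Passing to classes turns a chain of cocycle submodules into a chain inside a finite
  span, where \<open>noetherian_span\<close> applies; \<open>between_classes\<close> returns
  stationarity to the cocycles.\<close>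

lemma noetherian_cohomology_of_finitely_generated:
  assumes noeth: "noetherian_ring (H0 B)" and fg: "finitely_generated_module (H0 B) (cohomology M n)"
  shows "C.noetherian_cohomology n"
  unfolding C.noetherian_cohomology_def
proof (intro allI impI)
  interpret H: module "H0 B" "cohomology M n" by (rule cohomology_module)
  obtain D where D: "finite D" "D \<subseteq> carrier (cohomology M n)" "H.finite_span D = carrier (cohomology M n)"
    using fg unfolding finitely_generated_module_iff[OF cohomology_module] by blast
  fix X :: "nat \<Rightarrow> 'm set" assume "\<forall>k. C.between n (X k) \<and> X k \<subseteq> X (Suc k)"
  then have X: "C.between n (X k)" "X k \<subseteq> X (Suc k)" for k by simp_all
  have Xc: "X k \<subseteq> cocycles M n" for k using X(1)[of k] unfolding C.between_def by simp
  have "\<exists>k. \<forall>l\<ge>k. cl n ` X l = cl n ` X k"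
  proof (rule H.noetherian_span[OF noeth D(1,2)])
    fix k
    show "cl n ` X k \<subseteq> H.finite_span D" unfolding D(3) cohomology_simps by (rule image_mono[OF Xc])
    show "cl n ` X k \<subseteq> cl n ` X (Suc k)" by (rule image_mono[OF X(2)])
    have "\<zero>\<^bsub>M\<^esub> \<in> X k" using X(1)[of k] C.coboundaries_zero unfolding C.between_def by blast
    then show "\<zero>\<^bsub>cohomology M n\<^esub> \<in> cl n ` X k" unfolding cohomology_simps cl_zero[symmetric] by (rule imageI)
    fix x assume "x \<in> cl n ` X k"
    then obtain z where z: "z \<in> X k" "x = cl n z" by blast
    have zc: "z \<in> cocycles M n" by (rule subsetD[OF Xc z(1)])
    show "x \<oplus>\<^bsub>cohomology M n\<^esub> y \<in> cl n ` X k" if y: "y \<in> cl n ` X k" for y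
    proof -
      obtain w where w: "w \<in> X k" "y = cl n w" using y by blast
      have wc: "w \<in> cocycles M n" by (rule subsetD[OF Xc w(1)])
      have "z \<oplus>\<^bsub>M\<^esub> w \<in> X k" using X(1)[of k] z(1) w(1) unfolding C.between_def by blast
      then show ?thesis unfolding cohomology_simps z(2) w(2) cl_add[OF zc wc] by (rule imageI)
    qed
    show "s \<odot>\<^bsub>cohomology M n\<^esub> x \<in> cl n ` X k" if s: "s \<in> carrier (H0 B)" for s
    proof -
      obtain a where a: "a \<in> homog B 0" "s = H0_class B a" using s unfolding B.H0.surj[symmetric] by auto
      have "act M a z \<in> X k" using X(1)[of k] z(1) a(1) unfolding C.between_def by simp
      then show ?thesis unfolding a(2) z(2) cohomology_smult[OF a(1) zc] by (rule imageI)
    qed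
  qed
  then obtain k where k: "\<forall>l\<ge>k. cl n ` X l = cl n ` X k" by (rule exE)
  have sub: "X i \<subseteq> X j" if eq: "cl n ` X i = cl n ` X j" for i j
  proof
    fix z assume z: "z \<in> X i"
    have "cl n z \<in> cl n ` X j" unfolding eq[symmetric] by (rule imageI[OF z])
    then show "z \<in> X j" by (rule between_classes[OF X(1) subsetD[OF Xc z]])
  qed
  show "\<exists>k. \<forall>l\<ge>k. X l = X k"
  proof (rule exI[of _ k], intro allI impI)
    fix l assume l: "k \<le> l"
    note eq = k[rule_format, OF l]
    show "X l = X k" by (rule equalityI[OF sub[OF eq] sub[OF eq[symmetric]]])
  qed
qed

text \<open>The preimages in the cocycles of the spans of growing finite sets form a chain as in
  \<open>noetherian_cohomology\<close>, so \<open>finitely_generated_of_acc\<close> applies to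
  spans.\<close>

lemma finitely_generated_of_noetherian_cohomology:
  assumes noeth: "C.noetherian_cohomology n"
  shows "finitely_generated_module (H0 B) (cohomology M n)"
  unfolding finitely_generated_module_iff[OF cohomology_module]
proof (rule finitely_generated_of_acc)
  interpret H: module "H0 B" "cohomology M n" by (rule cohomology_module)
  show "D \<subseteq> H.finite_span D \<and> H.finite_span D \<subseteq> carrier (cohomology M n)"
    if D: "finite D" "D \<subseteq> carrier (cohomology M n)" for D
    using H.span_self[OF D] H.span_closed[OF D(2)] by blast
  fix D :: "nat \<Rightarrow> 'm set set"
  assume "\<And>k. finite (D k) \<and> D k \<subseteq> carrier (cohomology M n) \<and> D k \<subseteq> D (Suc k)"
  then have D: "finite (D k)" "D k \<subseteq> carrier (cohomology M n)" "D k \<subseteq> D (Suc k)" for k by simp_all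
  define X where "X k = {z \<in> cocycles M n. cl n z \<in> H.finite_span (D k)}" for k
  have sp: "H.finite_span (D k) = cl n ` X k" for k
  proof
    show "H.finite_span (D k) \<subseteq> cl n ` X k"
    proof
      fix x assume x: "x \<in> H.finite_span (D k)"
      then obtain z where "z \<in> cocycles M n" "x = cl n z"
        using H.span_closed[OF D(2) x] unfolding cohomology_simps by blast
      then show "x \<in> cl n ` X k" using x unfolding X_def by blast
    qed
  qed (auto simp: X_def)
  have betw: "C.between n (X k)" for k
    unfolding C.between_def
  proof (intro conjI ballI subsetI)
    note S = H.span_submodule[OF D(1,2)]
    fix b assume b: "b \<in> coboundaries M n"
    then have bc: "b \<in> cocycles M n" by (rule subsetD[OF C.coboundaries_cocycles])
    then have "cl n b = \<zero>\<^bsub>cohomology M n\<^esub>" unfolding cohomology_simps using cl_eq_zero_iff b by simp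
    then show "b \<in> X k" using S(1) bc unfolding X_def by simp
  next
    fix z assume z: "z \<in> X k"
    then show "z \<in> cocycles M n" unfolding X_def by simp
  next
    note S = H.span_submodule[OF D(1,2)]
    fix z w assume z: "z \<in> X k" and w: "w \<in> X k"
    have zc: "z \<in> cocycles M n" "w \<in> cocycles M n" using z w unfolding X_def by simp_all
    have "cl n z \<oplus>\<^bsub>cohomology M n\<^esub> cl n w \<in> H.finite_span (D k)" using S(2) z w unfolding X_def by simp
    then show "z \<oplus>\<^bsub>M\<^esub> w \<in> X k"
      unfolding X_def cohomology_simps cl_add[OF zc] using C.cocycles_add[OF zc] by simp
  next
    note S = H.span_submodule[OF D(1,2)]
    fix s z assume s: "s \<in> carrier (degree_zero B)" and z: "z \<in> X k"
    have zc: "z \<in> cocycles M n" using z unfolding X_def by simp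
    have sh: "s \<in> homog B 0" using s by simp
    have "H0_class B s \<odot>\<^bsub>cohomology M n\<^esub> cl n z \<in> H.finite_span (D k)"
      using S(3)[OF B.H0.hom_closed[OF s]] z unfolding X_def by simp
    then show "act M s z \<in> X k"
      unfolding X_def cohomology_smult[OF sh zc] using C.cocycles_act[OF s zc] by simp
  qed
  have mono: "X k \<subseteq> X (Suc k)" for k
  proof -
    have "H.finite_span (D k) \<subseteq> H.finite_span (D (Suc k))"
      by (rule H.span_mono[OF D(1)[of "Suc k"] D(2)[of "Suc k"] D(3)])
    then show ?thesis unfolding X_def by blast
  qed
  have "\<exists>k. \<forall>l\<ge>k. X l = X k"
    by (rule noeth[unfolded C.noetherian_cohomology_def, rule_format]) (rule conjI[OF betw mono])
  then obtain k where k: "\<forall>l\<ge>k. X l = X k" ..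
  have "X (Suc k) = X k" using k[rule_format, of "Suc k"] by simp
  then have "H.finite_span (D (Suc k)) = H.finite_span (D k)" unfolding sp by (rule arg_cong)
  then show "\<exists>k. H.finite_span (D (Suc k)) = H.finite_span (D k)" ..
qed

end

section \<open>Koszul models\<close>

context complex_iso
begin

text \<open>A left inverse suffices, since surjectivity in each degree makes it two-sided.\<close>

lemma inverse:
  assumes g: "\<And>n x. x \<in> homog M n \<Longrightarrow> g (f x) = x"
  shows "complex_iso S N \<beta> M \<alpha> g"
proof (intro complex_iso.intro complex_iso_axioms.intro N.scalar_complex_axioms M.scalar_complex_axioms)
  fix n
  show "bij_betw g (homog N n) (homog M n)"
  proof (rule bij_betw_byWitness[of _ f])
    show "\<forall>y\<in>homog N n. f (g y) = y"
    proof
      fix y assume "y \<in> homog N n"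
      then obtain x where "x \<in> homog M n" "y = f x" by (rule f_surj)
      then show "f (g y) = y" using g by simp
    qed
    show "g ` homog N n \<subseteq> homog M n"
    proof
      fix x assume "x \<in> g ` homog N n"
      then obtain y where y: "y \<in> homog N n" "x = g y" by blast
      obtain z where "z \<in> homog M n" "y = f z" using y(1) by (rule f_surj)
      then show "x \<in> homog M n" using g y(2) by simp
    qed
    show "f ` homog M n \<subseteq> homog N n" using f_homog by blast
  qed (use g in blast)
  fix y assume "y \<in> homog N n"
  then obtain x where x: "x \<in> homog M n" "y = f x" by (rule f_surj)
  show "g (diff N y) = diff M (g y)"
    unfolding x(2) f_diff[OF x(1), symmetric] g[OF x(1)] by (rule g[OF M.diff_homog[OF x(1)]])
  show "g (\<beta> s y) = \<alpha> s (g y)" if s: "s \<in> carrier S" for s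
    unfolding x(2) f_act[OF s x(1), symmetric] g[OF x(1)] by (rule g[OF M.act_homog[OF s x(1)]])
  fix w assume "w \<in> homog N n"
  then obtain z where z: "z \<in> homog M n" "w = f z" by (rule f_surj)
  show "g (y \<oplus>\<^bsub>N\<^esub> w) = g y \<oplus>\<^bsub>M\<^esub> g w"
    unfolding x(2) z(2) f_add[OF x(1) z(1), symmetric] g[OF x(1)] g[OF z(1)]
    by (rule g[OF M.homog_add[OF x(1) z(1)]])
qed

lemma annihilates_vimage:
  assumes s: "s \<in> carrier S" and N: "N.annihilates s"
  shows "M.annihilates s"
  unfolding M.annihilates_def
proof (intro allI ballI)
  fix n z assume z: "z \<in> cocycles M n"
  note zh = M.cocycles_homog[OF z]
  have "f z \<in> cocycles N n" using cocycles_iff[OF zh] z by simp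
  then have "f (\<alpha> s z) \<in> coboundaries N n"
    unfolding f_act[OF s zh] using N unfolding N.annihilates_def by blast
  then show "\<alpha> s z \<in> coboundaries M n" using coboundaries_iff[OF M.act_homog[OF s zh]] by simp
qed

lemma between_image:
  assumes X: "M.between n X" shows "N.between n (f ` X)"
proof -
  have Xc: "X \<subseteq> cocycles M n" and Xb: "coboundaries M n \<subseteq> X" using X by (simp_all add: M.between_def)
  have Xh: "x \<in> homog M n" if x: "x \<in> X" for x by (rule M.cocycles_homog[OF subsetD[OF Xc x]])
  show ?thesis
    unfolding N.between_def
  proof (intro conjI ballI subsetI)
    fix y assume y: "y \<in> coboundaries N n"
    obtain x where x: "x \<in> homog M n" "y = f x"
      using N.cocycles_homog[OF subsetD[OF N.coboundaries_cocycles y]] by (rule f_surj)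
    have "x \<in> coboundaries M n" using coboundaries_iff[OF x(1)] y unfolding x(2) by simp
    then show "y \<in> f ` X" unfolding x(2) by (rule imageI[OF subsetD[OF Xb]])
  next
    fix y assume "y \<in> f ` X"
    then obtain x where x: "x \<in> X" "y = f x" by blast
    show "y \<in> cocycles N n" unfolding x(2) using cocycles_iff[OF Xh[OF x(1)]] subsetD[OF Xc x(1)] by simp
  next
    fix y w assume "y \<in> f ` X" "w \<in> f ` X"
    then obtain a b where a: "a \<in> X" "y = f a" and b: "b \<in> X" "w = f b" by blast
    have "a \<oplus>\<^bsub>M\<^esub> b \<in> X" using X a(1) b(1) by (simp add: M.between_def)
    then show "y \<oplus>\<^bsub>N\<^esub> w \<in> f ` X"
      unfolding a(2) b(2) f_add[OF Xh[OF a(1)] Xh[OF b(1)], symmetric] by (rule imageI)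
  next
    fix s y assume s: "s \<in> carrier S" and "y \<in> f ` X"
    then obtain x where x: "x \<in> X" "y = f x" by blast
    have "\<alpha> s x \<in> X" using X x(1) s by (simp add: M.between_def)
    then show "\<beta> s y \<in> f ` X"
      unfolding x(2) f_act[OF s Xh[OF x(1)], symmetric] by (rule imageI)
  qed
qed

lemma noetherian_cohomology_vimage:
  assumes N: "N.noetherian_cohomology n" shows "M.noetherian_cohomology n"
  unfolding M.noetherian_cohomology_def
proof (intro allI impI)
  fix X :: "nat \<Rightarrow> _" assume "\<forall>k. M.between n (X k) \<and> X k \<subseteq> X (Suc k)"
  then have X: "M.between n (X k)" "X k \<subseteq> X (Suc k)" for k by simp_all
  have Xh: "x \<in> homog M n" if x: "x \<in> X k" for x k
    using X(1)[of k] subsetD[of "X k" "cocycles M n", OF _ x] M.cocycles_homog by (simp add: M.between_def)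
  have "\<exists>k. \<forall>l\<ge>k. f ` X l = f ` X k"
    by (rule N[unfolded N.noetherian_cohomology_def, rule_format, of "\<lambda>k. f ` X k"])
      (rule conjI[OF between_image[OF X(1)] image_mono[OF X(2)]])
  then obtain k where k: "\<forall>l\<ge>k. f ` X l = f ` X k" by (rule exE)
  have sub: "X i \<subseteq> X j" if eq: "f ` X i = f ` X j" for i j
  proof
    fix x assume x: "x \<in> X i"
    have "f x \<in> f ` X j" unfolding eq[symmetric] by (rule imageI[OF x])
    then obtain y where y: "f x = f y" "y \<in> X j" by (rule imageE)
    have "x = y" using f_eq_iff[OF Xh[OF x] Xh[OF y(2)]] y(1) by (rule iffD1)
    then show "x \<in> X j" using y(2) by simp
  qed
  show "\<exists>k. \<forall>l\<ge>k. X l = X k"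
  proof (rule exI[of _ k], intro allI impI)
    fix l assume l: "k \<le> l"
    note eq = k[rule_format, OF l]
    show "X l = X k" by (rule equalityI[OF sub[OF eq] sub[OF eq[symmetric]]])
  qed
qed

lemma complex_inf_eq: "complex_inf M = complex_inf N"
  using acyclic_at_iff unfolding M.acyclic_at_def N.acyclic_at_def complex_inf_def by simp

end

text \<open>Elements of \<open>T\<close> are images of elements of \<open>S\<close>, so the laws
  transfer and both rings have the same submodules. This exchanges A^0 for the degree zero part of
  another ring.\<close>

lemma scalar_complex_surj:
  assumes M: "scalar_complex S M (\<lambda>s. \<beta> (\<sigma> s))" and T: "cring T"
    and hom: "\<sigma> \<in> ring_hom S T" and surj: "\<sigma> ` carrier S = carrier T"
  shows "scalar_complex T M \<beta>"
    and "scalar_complex.noetherian_cohomology T M \<beta> n \<longleftrightarrow>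
      scalar_complex.noetherian_cohomology S M (\<lambda>s. \<beta> (\<sigma> s)) n"
proof -
  interpret M: scalar_complex S M "\<lambda>s. \<beta> (\<sigma> s)" by (rule M)
  show sc: "scalar_complex T M \<beta>"
  proof (intro scalar_complex.intro scalar_complex_axioms.intro T M.M.abelian_group_axioms M.homog_subgroup M.diff_homog)
    fix n x assume x: "x \<in> homog M n"
    show "diff M (diff M x) = \<zero>\<^bsub>M\<^esub>" by (rule M.diff_diff[OF x])
    show "\<beta> \<one>\<^bsub>T\<^esub> x = x" using M.one_act[OF x] unfolding ring_hom_one[OF hom] .
    show "diff M (x \<oplus>\<^bsub>M\<^esub> y) = diff M x \<oplus>\<^bsub>M\<^esub> diff M y" if "y \<in> homog M n" for y by (rule M.diff_add[OF x that])
    fix a assume "a \<in> carrier T"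
    then obtain s where s: "s \<in> carrier S" "a = \<sigma> s" using surj by blast
    show "\<beta> a x \<in> homog M n" unfolding s(2) by (rule M.act_homog[OF s(1) x])
    show "diff M (\<beta> a x) = \<beta> a (diff M x)" unfolding s(2) by (rule M.diff_act[OF s(1) x])
    show "\<beta> a (x \<oplus>\<^bsub>M\<^esub> y) = \<beta> a x \<oplus>\<^bsub>M\<^esub> \<beta> a y" if "y \<in> homog M n" for y
      unfolding s(2) by (rule M.act_add[OF s(1) x that])
    fix b assume "b \<in> carrier T"
    then obtain t where t: "t \<in> carrier S" "b = \<sigma> t" using surj by blast
    show "\<beta> (a \<oplus>\<^bsub>T\<^esub> b) x = \<beta> a x \<oplus>\<^bsub>M\<^esub> \<beta> b x"
      using M.add_act[OF s(1) t(1) x] unfolding s(2) t(2) ring_hom_add[OF hom s(1) t(1)] .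
    show "\<beta> (a \<otimes>\<^bsub>T\<^esub> b) x = \<beta> a (\<beta> b x)"
      using M.mult_act[OF s(1) t(1) x] unfolding s(2) t(2) ring_hom_mult[OF hom s(1) t(1)] .
  qed
  interpret T: scalar_complex T M \<beta> by (rule sc)
  have "T.between n X \<longleftrightarrow> M.between n X" for X
    unfolding T.between_def M.between_def surj[symmetric] by (simp only: ball_simps)
  then show "T.noetherian_cohomology n \<longleftrightarrow> M.noetherian_cohomology n"
    unfolding T.noetherian_cohomology_def M.noetherian_cohomology_def by simp
qed

section \<open>Copies of complexes in the type of iterated Koszul complexes\<close>

lemma transport_simps:
  assumes f: "inj f"
  shows "carrier (transport f M) = f ` carrier M" "\<zero>\<^bsub>transport f M\<^esub> = f \<zero>\<^bsub>M\<^esub>"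
    "homog (transport f M) n = f ` homog M n" "f x \<oplus>\<^bsub>transport f M\<^esub> f y = f (x \<oplus>\<^bsub>M\<^esub> y)"
    "diff (transport f M) (f x) = f (diff M x)" "act (transport f M) a (f x) = f (act M a x)"
  using f by (simp_all add: transport_def Let_def)

lemma complex_iso_transport:
  assumes M: "scalar_complex S M (\<lambda>s. act M (\<sigma> s))" and f: "inj f"
  shows "complex_iso S M (\<lambda>s. act M (\<sigma> s)) (transport f M) (\<lambda>s. act (transport f M) (\<sigma> s)) f"
proof -
  interpret M: scalar_complex S M "\<lambda>s. act M (\<sigma> s)" by (rule M)
  note ts = transport_simps[OF f]
  let ?N = "transport f M"
  have ag: "abelian_group ?N"
  proof (rule abelian_groupI)
    show "\<zero>\<^bsub>?N\<^esub> \<in> carrier ?N" unfolding ts by simp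
    fix X assume "X \<in> carrier ?N"
    then obtain x where x: "x \<in> carrier M" "X = f x" unfolding ts by blast
    show "\<zero>\<^bsub>?N\<^esub> \<oplus>\<^bsub>?N\<^esub> X = X" unfolding x(2) ts using x(1) by simp
    have "f (\<ominus>\<^bsub>M\<^esub> x) \<oplus>\<^bsub>?N\<^esub> X = \<zero>\<^bsub>?N\<^esub>" unfolding x(2) ts using x(1) by (simp add: M.M.l_neg)
    then show "\<exists>Y\<in>carrier ?N. Y \<oplus>\<^bsub>?N\<^esub> X = \<zero>\<^bsub>?N\<^esub>" unfolding ts(1) using x(1) by blast
    fix Y assume "Y \<in> carrier ?N"
    then obtain y where y: "y \<in> carrier M" "Y = f y" unfolding ts by blast
    show "X \<oplus>\<^bsub>?N\<^esub> Y \<in> carrier ?N" unfolding x(2) y(2) ts using x(1) y(1) by simp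
    show "X \<oplus>\<^bsub>?N\<^esub> Y = Y \<oplus>\<^bsub>?N\<^esub> X" unfolding x(2) y(2) ts M.M.a_comm[OF x(1) y(1)] ..
    fix Z assume "Z \<in> carrier ?N"
    then obtain z where z: "z \<in> carrier M" "Z = f z" unfolding ts by blast
    show "X \<oplus>\<^bsub>?N\<^esub> Y \<oplus>\<^bsub>?N\<^esub> Z = X \<oplus>\<^bsub>?N\<^esub> (Y \<oplus>\<^bsub>?N\<^esub> Z)"
      unfolding x(2) y(2) z(2) ts M.M.a_assoc[OF x(1) y(1) z(1)] ..
  qed
  have neg: "\<ominus>\<^bsub>?N\<^esub> f x = f (\<ominus>\<^bsub>M\<^esub> x)" if x: "x \<in> carrier M" for x
    by (rule abelian_group.minus_equality[OF ag]) (use x in \<open>simp_all add: ts M.M.l_neg\<close>)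
  have "scalar_complex S ?N (\<lambda>s. act ?N (\<sigma> s))"
  proof (intro scalar_complex.intro scalar_complex_axioms.intro M.S.is_cring ag)
    fix n
    show "additive_subgroup (homog ?N n) ?N"
    proof (intro additive_subgroupI group.subgroupI[OF abelian_group.a_group[OF ag]])
      show "homog ?N n \<subseteq> carrier (add_monoid ?N)" unfolding ts using M.homog_carrier by (auto simp: ts)
      show "homog ?N n \<noteq> {}" unfolding ts using M.homog_zero[of n] by blast
      fix X assume "X \<in> homog ?N n"
      then obtain x where x: "x \<in> homog M n" "X = f x" unfolding ts by blast
      show "inv\<^bsub>add_monoid ?N\<^esub> X \<in> homog ?N n"
        using neg[OF M.homog_carrier[OF x(1)]] M.homog_minus[OF x(1)] unfolding x(2) ts a_inv_def by simp
      fix Y assume "Y \<in> homog ?N n"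
      then obtain y where y: "y \<in> homog M n" "Y = f y" unfolding ts by blast
      show "X \<otimes>\<^bsub>add_monoid ?N\<^esub> Y \<in> homog ?N n"
        using M.homog_add[OF x(1) y(1)] unfolding x(2) y(2) by (simp add: ts)
    qed
    fix X assume "X \<in> homog ?N n"
    then obtain x where x: "x \<in> homog M n" "X = f x" unfolding ts by blast
    show "diff ?N X \<in> homog ?N (n + 1)" unfolding x(2) ts by (rule imageI[OF M.diff_homog[OF x(1)]])
    show "diff ?N (diff ?N X) = \<zero>\<^bsub>?N\<^esub>" unfolding x(2) ts M.diff_diff[OF x(1)] ..
    show "act ?N (\<sigma> \<one>\<^bsub>S\<^esub>) X = X" unfolding x(2) ts M.one_act[OF x(1)] ..
    { fix Y assume "Y \<in> homog ?N n"
      then obtain y where y: "y \<in> homog M n" "Y = f y" unfolding ts by blast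
      show "diff ?N (X \<oplus>\<^bsub>?N\<^esub> Y) = diff ?N X \<oplus>\<^bsub>?N\<^esub> diff ?N Y"
        unfolding x(2) y(2) ts M.diff_add[OF x(1) y(1)] ..
      show "act ?N (\<sigma> s) (X \<oplus>\<^bsub>?N\<^esub> Y) = act ?N (\<sigma> s) X \<oplus>\<^bsub>?N\<^esub> act ?N (\<sigma> s) Y" if s: "s \<in> carrier S" for s
        unfolding x(2) y(2) ts M.act_add[OF s x(1) y(1)] .. }
    fix s assume s: "s \<in> carrier S"
    show "act ?N (\<sigma> s) X \<in> homog ?N n" unfolding x(2) ts by (rule imageI[OF M.act_homog[OF s x(1)]])
    show "diff ?N (act ?N (\<sigma> s) X) = act ?N (\<sigma> s) (diff ?N X)" unfolding x(2) ts M.diff_act[OF s x(1)] ..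
    fix t assume t: "t \<in> carrier S"
    show "act ?N (\<sigma> (s \<oplus>\<^bsub>S\<^esub> t)) X = act ?N (\<sigma> s) X \<oplus>\<^bsub>?N\<^esub> act ?N (\<sigma> t) X"
      unfolding x(2) ts M.add_act[OF s t x(1)] ..
    show "act ?N (\<sigma> (s \<otimes>\<^bsub>S\<^esub> t)) X = act ?N (\<sigma> s) (act ?N (\<sigma> t) X)"
      unfolding x(2) ts M.mult_act[OF s t x(1)] ..
  qed
  moreover have "bij_betw f (homog M n) (homog ?N n)" for n
    unfolding ts bij_betw_def using inj_on_subset[OF f] by blast
  ultimately show ?thesis
    by (intro complex_iso.intro complex_iso_axioms.intro M.scalar_complex_axioms) (simp_all add: ts)
qed

definition node_at :: "nat set \<Rightarrow> 'm koszul_iter \<Rightarrow> 'm koszul_iter"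
  where "node_at I z = (case z of Node F \<Rightarrow> F I)"

definition node_pair :: "'m koszul_iter \<Rightarrow> 'm koszul_iter \<Rightarrow> 'm koszul_iter"
  where "node_pair u v = Node (\<lambda>I\<in>{{}, {0}}. if I = {} then u else v)"

lemma node_at_Node [simp]: "node_at I (Node F) = F I"
  by (simp add: node_at_def)

lemma koszul_single_simps:
  "carrier (koszul_module B M [b]) = {{}, {0}} \<rightarrow>\<^sub>E carrier M"
  "homog (koszul_module B M [b]) n = {F \<in> {{}, {0}} \<rightarrow>\<^sub>E carrier M. F {} \<in> homog M n \<and> F {0} \<in> homog M (n + 1)}"
  "\<zero>\<^bsub>koszul_module B M [b]\<^esub> = (\<lambda>I\<in>{{}, {0}}. \<zero>\<^bsub>M\<^esub>)"
  "F \<oplus>\<^bsub>koszul_module B M [b]\<^esub> G = (\<lambda>I\<in>{{}, {0}}. F I \<oplus>\<^bsub>M\<^esub> G I)"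
  "act (koszul_module B M [b]) c F = (\<lambda>I\<in>{{}, {0}}. act M (twist B (int (card I)) c) (F I))"
proof -
  have P: "Pow {..<length [b]} = {{}, {0}}" by (auto simp: lessThan_Suc)
  show "carrier (koszul_module B M [b]) = {{}, {0}} \<rightarrow>\<^sub>E carrier M"
    "homog (koszul_module B M [b]) n = {F \<in> {{}, {0}} \<rightarrow>\<^sub>E carrier M. F {} \<in> homog M n \<and> F {0} \<in> homog M (n + 1)}"
    "\<zero>\<^bsub>koszul_module B M [b]\<^esub> = (\<lambda>I\<in>{{}, {0}}. \<zero>\<^bsub>M\<^esub>)"
    "F \<oplus>\<^bsub>koszul_module B M [b]\<^esub> G = (\<lambda>I\<in>{{}, {0}}. F I \<oplus>\<^bsub>M\<^esub> G I)"
    "act (koszul_module B M [b]) c F = (\<lambda>I\<in>{{}, {0}}. act M (twist B (int (card I)) c) (F I))"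
    unfolding koszul_module_def Let_def P by simp_all
qed

lemma koszul_single_diff:
  assumes M: "abelian_group M" and c: "diff M (F {}) \<in> carrier M" "diff M (F {0}) \<in> carrier M" "act M b (F {0}) \<in> carrier M"
  shows "diff (koszul_module B M [b]) F \<in> {{}, {0}} \<rightarrow>\<^sub>E carrier M"
    "diff (koszul_module B M [b]) F {} = diff M (F {}) \<oplus>\<^bsub>M\<^esub> act M b (F {0})"
    "diff (koszul_module B M [b]) F {0} = \<ominus>\<^bsub>M\<^esub> diff M (F {0})"
proof -
  interpret M: abelian_group M by (rule M)
  have P: "Pow {..<length [b]} = {{}, {0}}" by (auto simp: lessThan_Suc)
  have d: "diff (koszul_module B M [b]) F = (\<lambda>I\<in>{{}, {0}}. sgn_pow M (int (card I)) (diff M (F I)) \<oplus>\<^bsub>M\<^esub>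
       (\<Oplus>\<^bsub>M\<^esub> i \<in> {..<length [b]} - I.
          sgn_pow M (int (card {j \<in> I. j < i})) (act M ([b] ! i) (F (insert i I)))))"
    unfolding koszul_module_def Let_def P by simp
  have e: "{..<length [b]} - {} = {0}" "{..<length [b]} - {0} = {}" by (auto simp: lessThan_Suc)
  show 1: "diff (koszul_module B M [b]) F {} = diff M (F {}) \<oplus>\<^bsub>M\<^esub> act M b (F {0})"
    unfolding d using c by (simp add: e[simplified] sgn_pow_def)
  show 2: "diff (koszul_module B M [b]) F {0} = \<ominus>\<^bsub>M\<^esub> diff M (F {0})"
    unfolding d using c by (simp add: e[simplified] sgn_pow_def)
  have "diff (koszul_module B M [b]) F \<in> extensional {{}, {0}}" unfolding d by simp
  then show "diff (koszul_module B M [b]) F \<in> {{}, {0}} \<rightarrow>\<^sub>E carrier M"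
    using 1 2 c by (auto simp: PiE_def)
qed

text \<open>One step of the recursion in \<open>regular_sequence_iter\<close> is a cone of the same
  kind as appending a term to a Koszul ring. The twist in the action disappears because the scalars
  have degree 0.\<close>

lemma koszul_node_cone:
  assumes B: "dg_ring B" and M: "scalar_complex S M (\<lambda>s. act M (\<sigma> s))"
    and \<sigma>: "\<And>s. s \<in> carrier S \<Longrightarrow> \<sigma> s \<in> homog B 0" and t: "t \<in> carrier S"
  defines "N \<equiv> transport Node (koszul_module B M [\<sigma> t])"
  shows "complex_cone S M (\<lambda>s. act M (\<sigma> s)) N (node_at {}) (node_at {0}) node_pair (\<lambda>s. act N (\<sigma> s)) t"
proof -
  interpret B: dg_ring B by (rule B)
  interpret M: scalar_complex S M "\<lambda>s. act M (\<sigma> s)" by (rule M)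
  have inj: "inj Node" by (rule injI) simp
  let ?K = "koszul_module B M [\<sigma> t]"
  note ks = koszul_single_simps[of B M "\<sigma> t"]
  note ts = transport_simps[OF inj, of ?K, folded N_def]
  have Nc: "\<exists>F. z = Node F \<and> F \<in> {{}, {0}} \<rightarrow>\<^sub>E carrier M \<and> F {} \<in> carrier M \<and> F {0} \<in> carrier M"
    if "z \<in> carrier N" for z using that unfolding ts ks by auto
  have Nh: "\<exists>F. z = Node F \<and> F \<in> {{}, {0}} \<rightarrow>\<^sub>E carrier M \<and> F {} \<in> homog M n \<and> F {0} \<in> homog M (n + 1)"
    if "z \<in> homog N n" for z n using that unfolding ts ks by auto
  have restr: "(\<lambda>I\<in>{{}, {0}}. G I) \<in> {{}, {0}} \<rightarrow>\<^sub>E carrier M" if "G {} \<in> carrier M" "G {0} \<in> carrier M"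
    for G :: "nat set \<Rightarrow> _" unfolding restrict_PiE_iff using that by simp
  have ext: "F = (\<lambda>I\<in>{{}, {0}}. if I = {} then F {} else F {0})" if "F \<in> {{}, {0}} \<rightarrow>\<^sub>E carrier M" for F
    using that by (intro ext) (auto simp: PiE_def extensional_def)
  show ?thesis
  proof (intro complex_cone.intro complex_cone_axioms.intro pair_group.intro pair_group_axioms.intro
      M.scalar_complex_axioms M.M.abelian_group_axioms t)
    show "\<zero>\<^bsub>N\<^esub> \<in> carrier N" "node_at {} \<zero>\<^bsub>N\<^esub> = \<zero>\<^bsub>M\<^esub>" "node_at {0} \<zero>\<^bsub>N\<^esub> = \<zero>\<^bsub>M\<^esub>"
      unfolding ts ks by auto
    show "node_pair u w \<in> carrier N" "node_at {} (node_pair u w) = u" "node_at {0} (node_pair u w) = w"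
      if "u \<in> carrier M" "w \<in> carrier M" for u w
      using that unfolding node_pair_def ts ks by auto
    { fix z assume "z \<in> carrier N"
      then obtain F where F: "z = Node F" "F \<in> {{}, {0}} \<rightarrow>\<^sub>E carrier M" "F {} \<in> carrier M" "F {0} \<in> carrier M"
        using Nc by blast
      show "node_at {} z \<in> carrier M" "node_at {0} z \<in> carrier M" using F by simp_all
      show "node_pair (node_at {} z) (node_at {0} z) = z"
        unfolding F(1) node_at_Node node_pair_def by (rule arg_cong[where f = Node]) (rule ext[OF F(2), symmetric])
      fix w assume "w \<in> carrier N"
      then obtain G where G: "w = Node G" "G \<in> {{}, {0}} \<rightarrow>\<^sub>E carrier M" "G {} \<in> carrier M" "G {0} \<in> carrier M"
        using Nc by blast
      have zw: "z \<oplus>\<^bsub>N\<^esub> w = Node (\<lambda>I\<in>{{}, {0}}. F I \<oplus>\<^bsub>M\<^esub> G I)" unfolding F(1) G(1) ts(4) ks(4) ..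
      show "z \<oplus>\<^bsub>N\<^esub> w \<in> carrier N" unfolding zw ts(1) ks(1) by (rule imageI[OF restr]) (use F(3,4) G(3,4) in simp_all)
      show "node_at {} (z \<oplus>\<^bsub>N\<^esub> w) = node_at {} z \<oplus>\<^bsub>M\<^esub> node_at {} w"
        "node_at {0} (z \<oplus>\<^bsub>N\<^esub> w) = node_at {0} z \<oplus>\<^bsub>M\<^esub> node_at {0} w" unfolding F(1) G(1) ts(4) ks(4) by simp_all }
    show "homog N n = {z \<in> carrier N. node_at {} z \<in> homog M n \<and> node_at {0} z \<in> homog M (n + 1)}" for n
    proof (rule Set.set_eqI, rule iffI)
      fix z assume "z \<in> homog N n"
      then obtain F where F: "z = Node F" "F \<in> {{}, {0}} \<rightarrow>\<^sub>E carrier M" "F {} \<in> homog M n" "F {0} \<in> homog M (n + 1)"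
        using Nh by blast
      have "Node F \<in> carrier N" unfolding ts(1) ks(1) by (rule imageI[OF F(2)])
      then show "z \<in> {z \<in> carrier N. node_at {} z \<in> homog M n \<and> node_at {0} z \<in> homog M (n + 1)}"
        unfolding F(1) using F(3,4) by simp
    next
      fix z assume z: "z \<in> {z \<in> carrier N. node_at {} z \<in> homog M n \<and> node_at {0} z \<in> homog M (n + 1)}"
      then obtain F where F: "z = Node F" "F \<in> {{}, {0}} \<rightarrow>\<^sub>E carrier M" using Nc by blast
      have "F {} \<in> homog M n" "F {0} \<in> homog M (n + 1)" using z unfolding F(1) by simp_all
      then show "z \<in> homog N n" unfolding F(1) ts(3) ks(2) using F(2) by (intro imageI) simp
    qed
    fix n z assume "z \<in> homog N n"
    then obtain F where F: "z = Node F" "F \<in> {{}, {0}} \<rightarrow>\<^sub>E carrier M" "F {} \<in> homog M n" "F {0} \<in> homog M (n + 1)"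
      using Nh by blast
    have Fd: "diff M (F {}) \<in> carrier M" "diff M (F {0}) \<in> carrier M" "act M (\<sigma> t) (F {0}) \<in> carrier M"
      using M.diff_homog[OF F(3)] M.diff_homog[OF F(4)] M.act_homog[OF t F(4)] M.homog_carrier by blast+
    note D = koszul_single_diff[where B = B, OF M.M.abelian_group_axioms Fd]
    have dz: "diff N z = Node (diff ?K F)" unfolding F(1) ts(5) ..
    show "diff N z \<in> carrier N" unfolding dz ts(1) ks(1) by (rule imageI[OF D(1)])
    show "node_at {} (diff N z) = diff M (node_at {} z) \<oplus>\<^bsub>M\<^esub> act M (\<sigma> t) (node_at {0} z)"
      "node_at {0} (diff N z) = \<ominus>\<^bsub>M\<^esub> diff M (node_at {0} z)"
      unfolding dz unfolding F(1) node_at_Node by (rule D(2), rule D(3))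
    fix s assume s: "s \<in> carrier S"
    have tw: "twist B k (\<sigma> s) = \<sigma> s" for k
      using B.twist_homog[OF \<sigma>[OF s], of k] by (simp add: sgn_pow_def)
    have az: "act N (\<sigma> s) z = Node (\<lambda>I\<in>{{}, {0}}. act M (\<sigma> s) (F I))" unfolding F(1) ts(6) ks(5) tw ..
    show "act N (\<sigma> s) z \<in> carrier N"
      unfolding az ts(1) ks(1)
      by (rule imageI[OF restr[OF M.homog_carrier[OF M.act_homog[OF s F(3)]] M.homog_carrier[OF M.act_homog[OF s F(4)]]]])
    show "node_at {} (act N (\<sigma> s) z) = act M (\<sigma> s) (node_at {} z)"
      "node_at {0} (act N (\<sigma> s) z) = act M (\<sigma> s) (node_at {0} z)"
      unfolding az unfolding F(1) by simp_all
  qed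
qed

lemma abelian_group_self_module:
  assumes "abelian_group A" shows "abelian_group (self_module A)"
proof -
  interpret abelian_group A by (rule assms)
  show ?thesis
  proof (rule abelian_groupI)
    fix x assume "x \<in> carrier (self_module A)"
    then show "\<exists>y\<in>carrier (self_module A). y \<oplus>\<^bsub>self_module A\<^esub> x = \<zero>\<^bsub>self_module A\<^esub>"
      by (intro bexI[of _ "\<ominus>\<^bsub>A\<^esub> x"]) (auto simp: l_neg)
  qed (auto simp: a_ac)
qed

lemma additive_subgroup_self_module: "additive_subgroup H A \<Longrightarrow> additive_subgroup H (self_module A)"
  unfolding additive_subgroup_def subgroup_def a_inv_def[symmetric] by (simp add: a_inv_self_module)

lemma (in dg_ring) dg_module_self: "dg_module A (self_module A)"
proof (intro dg_module.intro dg_module_axioms.intro dg_ring_axioms)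
  show "dg_group (self_module A)"
  proof (intro dg_group.intro dg_group_axioms.intro abelian_group_self_module[OF abelian_group_axioms])
    show "additive_subgroup (homog (self_module A) n) (self_module A)" for n
      by (simp add: additive_subgroup_self_module homog_subgroup)
    have hp: "homog_parts (self_module A) x f \<longleftrightarrow> homog_parts A x f" for x f
      by (simp add: homog_parts_def finsum_self_module)
    show "\<exists>!f. homog_parts (self_module A) x f" if "x \<in> carrier (self_module A)" for x
      unfolding hp using direct_sum that by simp
  qed (simp_all add: diff_homog diff_add diff_diff)
qed (auto simp: l_distr r_distr m_assoc mult_homog leibniz sgn_pow_self_module)

lemma scalar_complex_self_module:
  assumes "scalar_complex S A \<alpha>" shows "scalar_complex S (self_module A) \<alpha>"
proof -
  interpret A: scalar_complex S A \<alpha> by (rule assms)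
  show ?thesis
    by (intro scalar_complex.intro scalar_complex_axioms.intro A.S.is_cring
        abelian_group_self_module[OF A.M.abelian_group_axioms])
      (simp_all add: additive_subgroup_self_module A.homog_subgroup A.diff_homog A.diff_add A.diff_diff
        A.act_homog A.act_add A.add_act A.mult_act A.one_act A.diff_act)
qed

lemma complex_iso_trans:
  assumes "complex_iso S L \<gamma> M \<alpha> f" "complex_iso S M \<alpha> N \<beta> g"
  shows "complex_iso S L \<gamma> N \<beta> (g \<circ> f)"
proof -
  interpret f: complex_iso S L \<gamma> M \<alpha> f by (rule assms)
  interpret g: complex_iso S M \<alpha> N \<beta> g by (rule assms)
  show ?thesis
  proof (intro complex_iso.intro complex_iso_axioms.intro f.M.scalar_complex_axioms g.N.scalar_complex_axioms)
    show "bij_betw (g \<circ> f) (homog L n) (homog N n)" for n by (rule bij_betw_trans[OF f.bij g.bij])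
    fix n x assume x: "x \<in> homog L n"
    show "(g \<circ> f) (diff L x) = diff N ((g \<circ> f) x)"
      using g.f_diff[OF f.f_homog[OF x]] f.f_diff[OF x] by simp
    show "(g \<circ> f) (x \<oplus>\<^bsub>L\<^esub> y) = (g \<circ> f) x \<oplus>\<^bsub>N\<^esub> (g \<circ> f) y" if y: "y \<in> homog L n" for y
      using g.f_add[OF f.f_homog[OF x] f.f_homog[OF y]] f.f_add[OF x y] by simp
    show "(g \<circ> f) (\<gamma> s x) = \<beta> s ((g \<circ> f) x)" if s: "s \<in> carrier S" for s
      using g.f_act[OF s f.f_homog[OF x]] f.f_act[OF s x] by simp
  qed
qed

text \<open>Both \<open>A\<close> itself, with \<open>cs = []\<close>, and \<open>koszul_ring A cs\<close> are models \<open>B\<close>. Regularity over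
  either ring is thereby expressed by the numbers \<open>v\<close> of sequences in \<open>A\<^sup>0\<close>.\<close>

locale koszul_model = local_dg_ring A m + B: dg_ring B
  for A :: "'a dg_ring" (structure) and m and B :: "'b dg_ring" +
  fixes \<sigma> :: "'a \<Rightarrow> 'b" and cs :: "'a list" and \<phi> :: "'b \<Rightarrow> nat set \<Rightarrow> 'a"
  assumes cs: "set cs \<subseteq> m"
    and \<sigma>_hom: "\<sigma> \<in> ring_hom (degree_zero A) (degree_zero B)"
    and \<sigma>_surj: "\<sigma> ` homog A 0 = homog B 0"
    and \<sigma>_coboundaries: "s \<in> homog A 0 \<Longrightarrow> \<sigma> s \<in> coboundaries B 0 \<longleftrightarrow> s \<in> koszul_ideal cs"
    and iso: "complex_iso (degree_zero A) B (\<lambda>s x. \<sigma> s \<otimes>\<^bsub>B\<^esub> x) (koszul_ring A cs) (koszul_act cs) \<phi>"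
begin

lemma J_eq: "set xs \<subseteq> m \<Longrightarrow> depth.J xs = koszul_ideal xs"
  using koszul_ideal_eq[OF m_homog_list] by (simp add: depth.J_def)

lemma \<sigma>_homog: "s \<in> homog A 0 \<Longrightarrow> \<sigma> s \<in> homog B 0"
  using \<sigma>_surj by blast

definition h :: "'a \<Rightarrow> 'b set" where "h s = H0_class B (\<sigma> s)"

sublocale h: surj_ring_hom "degree_zero A" "H0 B" h
proof (intro surj_ring_hom.intro surj_ring_hom_axioms.intro ring_hom_cring.intro ring_hom_cring_axioms.intro
    Z.is_cring B.H0.S.is_cring)
  have "h = H0_class B \<circ> \<sigma>" by (simp add: h_def fun_eq_iff)
  then show "h \<in> ring_hom (degree_zero A) (H0 B)"
    using ring_hom_trans[OF \<sigma>_hom B.H0.homh] by simp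
  show "h ` carrier (degree_zero A) = carrier (H0 B)"
    unfolding B.H0.surj[symmetric] by (simp add: h_def[abs_def] image_image flip: \<sigma>_surj)
qed

lemma h_kernel: "a_kernel (degree_zero A) (H0 B) h = depth.J cs"
proof -
  have "h s = \<zero>\<^bsub>H0 B\<^esub> \<longleftrightarrow> s \<in> koszul_ideal cs" if s: "s \<in> homog A 0" for s
    using B.H0.mem_kernel[of "\<sigma> s"] \<sigma>_coboundaries[OF s] \<sigma>_homog[OF s] unfolding B.H0_kernel by (simp add: h_def)
  moreover have "koszul_ideal cs \<subseteq> homog A 0" by (auto simp: koszul_ideal_def)
  ultimately show ?thesis unfolding J_eq[OF cs] a_kernel_def' by auto
qed

definition \<nn> :: "'b set set" where "\<nn> = h ` m"

lemma kernel_m: "depth.J cs \<subseteq> m"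
  by (rule depth.J_m[OF cs])

text \<open>The kernel of \<open>h\<close> is \<open>J cs\<close>, so generating sequences of ideals
  in \<open>H^0(B)\<close> correspond to continuations of \<open>cs\<close> in A^0.\<close>

lemma Idl_image:
  assumes "set ts \<subseteq> m"
  shows "Idl\<^bsub>H0 B\<^esub> (set (map h ts)) = h ` depth.J (cs @ ts)"
proof -
  have c: "set cs \<subseteq> carrier (degree_zero A)" "set ts \<subseteq> carrier (degree_zero A)"
    "set (cs @ ts) \<subseteq> carrier (degree_zero A)" using assms cs m_homog by auto
  have "Idl\<^bsub>degree_zero A\<^esub> (depth.J cs \<union> set ts) = depth.J (cs @ ts)"
  proof
    show "Idl\<^bsub>degree_zero A\<^esub> (depth.J cs \<union> set ts) \<subseteq> depth.J (cs @ ts)"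
      using depth.J_mono[OF c(3), of cs] depth.J_set[OF c(3)]
      by (intro Z.genideal_minimal[OF depth.J_ideal[OF c(3)]]) auto
    have sub: "depth.J cs \<union> set ts \<subseteq> carrier (degree_zero A)"
      using c ideal.Icarr[OF depth.J_ideal[OF c(1)]] by blast
    show "depth.J (cs @ ts) \<subseteq> Idl\<^bsub>degree_zero A\<^esub> (depth.J cs \<union> set ts)"
      using Z.genideal_self[OF sub] depth.J_N[OF c(1)] depth.J_set[OF c(1)]
      by (intro depth.J_leI[OF Z.genideal_ideal[OF sub]]) auto
  qed
  then show ?thesis using h.image_genideal[OF c(2)] unfolding h_kernel by simp
qed

lemma Idl_eq_iff:
  assumes "set ts \<subseteq> m"
  shows "Idl\<^bsub>H0 B\<^esub> (set (map h ts)) = \<nn> \<longleftrightarrow> depth.J (cs @ ts) = m"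
proof -
  have c: "set (cs @ ts) \<subseteq> carrier (degree_zero A)" using assms cs m_homog by auto
  show ?thesis
    unfolding Idl_image[OF assms] \<nn>_def
    by (rule h.image_eq_iff[OF depth.J_ideal[OF c] _ m_ideal]) (use h_kernel kernel_m depth.J_mono[OF c, of cs] in auto)
qed

text \<open>The comparison is made over A^0 only, through \<sigma>, and thereby survives the change
  of type in each step of the recursion.\<close>

definition models :: "('b, 'k) dg_module \<Rightarrow> 'a list \<Rightarrow> bool" where
  "models M xs \<longleftrightarrow> (\<exists>g. complex_iso (degree_zero A) M (\<lambda>s. act M (\<sigma> s)) (koszul_ring A xs) (koszul_act xs) g)"

lemma models_self: "models (self_module B) cs"
proof -
  interpret \<phi>: complex_iso "degree_zero A" B "\<lambda>s x. \<sigma> s \<otimes>\<^bsub>B\<^esub> x" "koszul_ring A cs" "koszul_act cs" \<phi>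
    by (rule iso)
  have "complex_iso (degree_zero A) (self_module B) (\<lambda>s x. \<sigma> s \<otimes>\<^bsub>B\<^esub> x) (koszul_ring A cs) (koszul_act cs) \<phi>"
    by (intro complex_iso.intro complex_iso_axioms.intro \<phi>.N.scalar_complex_axioms
        scalar_complex_self_module[OF \<phi>.M.scalar_complex_axioms])
      (use \<phi>.bij \<phi>.f_add \<phi>.f_diff \<phi>.f_act in simp_all)
  then show ?thesis unfolding models_def by (intro exI) simp
qed

lemma models_transport:
  assumes M: "models M xs" and f: "inj f" shows "models (transport f M) xs"
proof -
  obtain g where g: "complex_iso (degree_zero A) M (\<lambda>s. act M (\<sigma> s)) (koszul_ring A xs) (koszul_act xs) g"
    using M unfolding models_def by (rule exE)
  interpret g: complex_iso "degree_zero A" M "\<lambda>s. act M (\<sigma> s)" "koszul_ring A xs" "koszul_act xs" g by (rule g)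
  have "complex_iso (degree_zero A) (transport f M) (\<lambda>s. act (transport f M) (\<sigma> s)) M (\<lambda>s. act M (\<sigma> s)) (inv_into UNIV f)"
    by (rule complex_iso.inverse[OF complex_iso_transport[OF g.M.scalar_complex_axioms f]]) (rule inv_f_f[OF f])
  then show ?thesis unfolding models_def using g by (intro exI) (rule complex_iso_trans)
qed

text \<open>Both sides are cones on the same scalar \<open>t\<close>, so the comparison extends by
  functoriality.\<close>

lemma models_node:
  assumes M: "models M xs" and xs: "set xs \<subseteq> m" and t: "t \<in> m"
  shows "models (transport Node (koszul_module B M [\<sigma> t])) (xs @ [t])"
proof -
  obtain g where g: "complex_iso (degree_zero A) M (\<lambda>s. act M (\<sigma> s)) (koszul_ring A xs) (koszul_act xs) g"
    using M unfolding models_def by (rule exE)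
  interpret g: complex_iso "degree_zero A" M "\<lambda>s. act M (\<sigma> s)" "koszul_ring A xs" "koszul_act xs" g by (rule g)
  have x: "set (xs @ [t]) \<subseteq> homog A 0" using m_homog_list[of "xs @ [t]"] xs t by simp
  have t': "t \<in> carrier (degree_zero A)" using x by simp
  have "complex_cone (degree_zero A) M (\<lambda>s. act M (\<sigma> s)) (transport Node (koszul_module B M [\<sigma> t]))
      (node_at {}) (node_at {0}) node_pair (\<lambda>s. act (transport Node (koszul_module B M [\<sigma> t])) (\<sigma> s)) t"
    by (rule koszul_node_cone[OF B.dg_ring_axioms g.M.scalar_complex_axioms _ t']) (simp add: \<sigma>_homog)
  note iso = complex_iso_cone[OF g this koszul_cone[OF x]]
  show ?thesis unfolding models_def by (intro exI) (rule iso)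
qed

context
  fixes M :: "('b, 'k) dg_module" and xs :: "'a list"
  assumes M: "models M xs" and xs: "set xs \<subseteq> m"
begin

lemma models_complex: "scalar_complex (degree_zero B) M (act M)"
proof -
  obtain g where g: "complex_iso (degree_zero A) M (\<lambda>s. act M (\<sigma> s)) (koszul_ring A xs) (koszul_act xs) g"
    using M unfolding models_def by (rule exE)
  interpret g: complex_iso "degree_zero A" M "\<lambda>s. act M (\<sigma> s)" "koszul_ring A xs" "koszul_act xs" g by (rule g)
  show ?thesis
    by (rule scalar_complex_surj(1)[OF g.M.scalar_complex_axioms B.Z.is_cring \<sigma>_hom]) (simp add: \<sigma>_surj)
qed

lemma models_noetherian: "scalar_complex.noetherian_cohomology (degree_zero B) M (act M) n"
proof -
  obtain g where g: "complex_iso (degree_zero A) M (\<lambda>s. act M (\<sigma> s)) (koszul_ring A xs) (koszul_act xs) g"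
    using M unfolding models_def by (rule exE)
  interpret g: complex_iso "degree_zero A" M "\<lambda>s. act M (\<sigma> s)" "koszul_ring A xs" "koszul_act xs" g by (rule g)
  have "g.M.noetherian_cohomology n" by (rule g.noetherian_cohomology_vimage[OF noetherian_koszul[OF xs]])
  then show ?thesis
    using scalar_complex_surj(2)[OF g.M.scalar_complex_axioms B.Z.is_cring \<sigma>_hom] by (simp add: \<sigma>_surj)
qed

lemma models_inf: "complex_inf M = v xs"
  and models_acyclic: "cocycles M n \<subseteq> coboundaries M n \<longleftrightarrow> cocycles (koszul_ring A xs) n \<subseteq> coboundaries (koszul_ring A xs) n"
  and models_regular: "s \<in> homog A 0 \<Longrightarrow> scalar_complex.regular_at M (act M) (\<sigma> s) (v xs) \<longleftrightarrow> reg xs s"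
proof -
  obtain g where g: "complex_iso (degree_zero A) M (\<lambda>s. act M (\<sigma> s)) (koszul_ring A xs) (koszul_act xs) g"
    using M unfolding models_def by (rule exE)
  interpret g: complex_iso "degree_zero A" M "\<lambda>s. act M (\<sigma> s)" "koszul_ring A xs" "koszul_act xs" g by (rule g)
  interpret C: scalar_complex "degree_zero B" M "act M" by (rule models_complex)
  show "complex_inf M = v xs" unfolding v_def by (rule g.complex_inf_eq)
  show "cocycles M n \<subseteq> coboundaries M n \<longleftrightarrow> cocycles (koszul_ring A xs) n \<subseteq> coboundaries (koszul_ring A xs) n"
    using g.acyclic_at_iff unfolding g.M.acyclic_at_def g.N.acyclic_at_def .
  show "C.regular_at (\<sigma> s) (v xs) \<longleftrightarrow> reg xs s" if "s \<in> homog A 0"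
    using g.regular_at_iff[of s "v xs"] that unfolding reg_def C.regular_at_def g.M.regular_at_def by simp
qed

text \<open>A coboundary of \<open>B\<close> in degree 0 comes from an element of
  \<open>J cs\<close>, which is contained in \<open>J xs\<close> and so annihilates the cohomology
  of the Koszul complex on \<open>xs\<close>.\<close>

lemma models_action:
  assumes "set cs \<subseteq> set xs" shows "cohomology_action B M"
proof (intro cohomology_action.intro cohomology_action_axioms.intro B.dg_ring_axioms models_complex)
  obtain g where g: "complex_iso (degree_zero A) M (\<lambda>s. act M (\<sigma> s)) (koszul_ring A xs) (koszul_act xs) g"
    using M unfolding models_def by (rule exE)
  interpret g: complex_iso "degree_zero A" M "\<lambda>s. act M (\<sigma> s)" "koszul_ring A xs" "koszul_act xs" g by (rule g)
  interpret C: scalar_complex "degree_zero B" M "act M" by (rule models_complex)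
  fix b assume b: "b \<in> coboundaries B 0"
  have "b \<in> homog B 0" using ideal.Icarr[OF B.coboundaries_ideal b] by simp
  then obtain s where s: "s \<in> homog A 0" "b = \<sigma> s" using \<sigma>_surj by blast
  have "s \<in> depth.J cs" using \<sigma>_coboundaries[OF s(1)] b unfolding s(2) J_eq[OF cs] by simp
  then have "s \<in> koszul_ideal xs"
    using depth.J_mono[of xs cs] m_homog_list[OF xs] assms unfolding J_eq[OF xs, symmetric] by auto
  then have "g.N.annihilates s" by (rule koszul_ideal_annihilates[OF m_homog_list[OF xs]])
  then have "g.M.annihilates s" using s(1) by (intro g.annihilates_vimage) simp_all
  then show "C.annihilates b" unfolding s(2) C.annihilates_def g.M.annihilates_def .
qed

end

text \<open>A preimage in A^0 of the very representative \<open>lift x\<close> that the recursion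
  uses, so that the two cones are formed with the same scalar.\<close>

definition sect :: "'b set \<Rightarrow> 'a"
  where "sect x = (SOME s. s \<in> homog A 0 \<and> \<sigma> s = lift x)"

lemma sect:
  assumes x: "x \<in> carrier (H0 B)"
  shows "sect x \<in> homog A 0" "\<sigma> (sect x) = lift x" "h (sect x) = x"
proof -
  have "lift x \<in> \<sigma> ` homog A 0" unfolding \<sigma>_surj by (rule B.H0_lift(1)[OF x])
  then have "\<exists>s. s \<in> homog A 0 \<and> \<sigma> s = lift x" by (metis imageE)
  then have *: "sect x \<in> homog A 0 \<and> \<sigma> (sect x) = lift x" unfolding sect_def by (rule someI_ex)
  then show "sect x \<in> homog A 0" "\<sigma> (sect x) = lift x" by simp_all
  then show "h (sect x) = x" using B.H0_lift(2)[OF x] by (simp add: h_def)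
qed

lemma max_carrier: "\<nn> \<subseteq> carrier (H0 B)"
  unfolding \<nn>_def using m_homog h.hom_closed by auto

lemma sect_m:
  assumes x: "x \<in> \<nn>" shows "sect x \<in> m"
proof -
  note c = sect[OF subsetD[OF max_carrier x]]
  have "h (sect x) \<in> h ` m" using x unfolding c(3) \<nn>_def .
  then show ?thesis using h.image_mem_iff[OF m_ideal] kernel_m c(1) unfolding h_kernel by simp
qed

text \<open>Each step of the recursion compares two consecutive values of \<open>v\<close>. As
  \<open>v\<close> can only decrease along a sequence, equality of the first and the last value
  means equality throughout.\<close>

lemma regular_sequence_iter_iff:
  assumes "models M ys" "set ys \<subseteq> m" "set cs \<subseteq> set ys" "set xs \<subseteq> \<nn>"
  shows "regular_sequence_iter B \<nn> M xs \<longleftrightarrow> v (ys @ map sect xs) = v ys"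
  using assms
proof (induction xs arbitrary: M ys)
  case (Cons x xs)
  have x: "x \<in> \<nn>" using Cons.prems by simp
  have xc: "x \<in> carrier (H0 B)" by (rule subsetD[OF max_carrier x])
  note sx = sect[OF xc] and sm = sect_m[OF x]
  have smap: "set (map sect xs) \<subseteq> m" using Cons.prems(4) sect_m by auto
  interpret C: cohomology_action B M by (rule models_action[OF Cons.prems(1,2,3)])
  have "regular_element \<nn> M x \<longleftrightarrow> reg ys (sect x)"
    using C.regular_element_iff[OF xc, of \<nn>] models_regular[OF Cons.prems(1,2) sx(1)] x
    unfolding models_inf[OF Cons.prems(1,2)] sx(2) by simp
  also have "\<dots> \<longleftrightarrow> v (ys @ [sect x]) = v ys" by (rule depth.reg_iff[OF Cons.prems(2) sm])
  finally have 1: "regular_element \<nn> M x \<longleftrightarrow> v (ys @ [sect x]) = v ys" .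
  have "regular_sequence_iter B \<nn> (transport Node (koszul_module B M [lift x])) xs \<longleftrightarrow>
      v ((ys @ [sect x]) @ map sect xs) = v (ys @ [sect x])"
    by (rule Cons.IH[OF models_node[OF Cons.prems(1,2) sm, unfolded sx(2)]]) (use Cons.prems sm in auto)
  moreover have "v ((ys @ [sect x]) @ map sect xs) \<le> v (ys @ [sect x])" "v (ys @ [sect x]) \<le> v ys"
    using depth.v_append_le[of "ys @ [sect x]" "map sect xs"] depth.v_append_le[of ys "[sect x]"]
      Cons.prems(2) sm smap by simp_all
  ultimately show ?case using 1 by auto
qed simp

lemma regular_sequence_iter_mem: "regular_sequence_iter C \<mm> M xs \<Longrightarrow> set xs \<subseteq> \<mm>"
  by (induction xs arbitrary: M) (auto simp: regular_element_def)

text \<open>An ideal of A^0 that contains the coboundaries and some element outside \<open>m\<close>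
  is the whole ring. So \<open>m\<close> is the only maximal ideal above the kernel of
  \<open>h\<close>, and maximal ideals correspond along \<open>h\<close>.\<close>

lemma local_H0: "local_ring (H0 B) \<nn>"
proof -
  have unit_ideal: "\<one> \<in> I" if I: "ideal I (degree_zero A)" "coboundaries A 0 \<subseteq> I" and s: "s \<in> I" "s \<notin> m" for I s
  proof -
    have sh: "s \<in> homog A 0" using ideal.Icarr[OF I(1) s(1)] by simp
    obtain e where e: "e \<in> homog A 0" "e \<otimes> s \<ominus> \<one> \<in> coboundaries A 0" using unit[OF sh s(2)] by blast
    have es: "e \<otimes> s \<in> I" using ideal.I_l_closed[OF I(1) s(1), of e] e(1) by simp
    have esh: "e \<otimes> s \<in> homog A 0" using ideal.Icarr[OF I(1) es] by simp
    have "e \<otimes> s \<ominus>\<^bsub>degree_zero A\<^esub> (e \<otimes> s \<ominus>\<^bsub>degree_zero A\<^esub> \<one>) \<in> I"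
      using depth.ideal_minus[OF I(1) es subsetD[OF I(2) e(2)]] esh one_homog by simp
    moreover have "e \<otimes> s \<ominus>\<^bsub>degree_zero A\<^esub> (e \<otimes> s \<ominus>\<^bsub>degree_zero A\<^esub> \<one>) = \<one>"
      using esh one_homog homog_carrier[OF esh]
      by (simp add: minus_eq minus_add r_neg1 r_neg2 a_assoc[symmetric] r_neg)
    ultimately show ?thesis by simp
  qed
  have max: "maximalideal m (degree_zero A)"
  proof (intro maximalidealI m_ideal)
    show "carrier (degree_zero A) \<noteq> m" using one_m one_homog by auto
    fix J assume J: "ideal J (degree_zero A)" "m \<subseteq> J" "J \<subseteq> carrier (degree_zero A)"
    show "J = m \<or> J = carrier (degree_zero A)"
    proof (cases "J \<subseteq> m")
      case False
      then obtain s where "s \<in> J" "s \<notin> m" by blast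
      then have "\<one> \<in> J" using unit_ideal[OF J(1)] coboundaries_m J(2) by blast
      then show ?thesis using ideal.one_imp_carrier[OF J(1)] by simp
    qed (use J in blast)
  qed
  have uniq: "J = \<nn>" if J: "maximalideal J (H0 B)" for J
  proof -
    let ?V = "{s \<in> carrier (degree_zero A). h s \<in> J}"
    interpret V: maximalideal ?V "degree_zero A" by (rule h.maximal_vimage[OF J])
    have "depth.J cs \<subseteq> ?V"
    proof
      fix s assume "s \<in> depth.J cs"
      then have s: "s \<in> carrier (degree_zero A)" "h s = \<zero>\<^bsub>H0 B\<^esub>"
        unfolding h_kernel[symmetric] h.mem_kernel by simp_all
      have "\<zero>\<^bsub>H0 B\<^esub> \<in> J" by (rule additive_subgroup.zero_closed[OF ideal.axioms(1)[OF maximalideal.axioms(1)[OF J]]])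
      then show "s \<in> ?V" using s by simp
    qed
    moreover have "coboundaries A 0 \<subseteq> depth.J cs" by (rule depth.J_N) (use m_homog_list[OF cs] in simp)
    ultimately have nb: "coboundaries A 0 \<subseteq> ?V" by simp
    have "?V \<subseteq> m"
    proof
      fix s assume s: "s \<in> ?V"
      show "s \<in> m"
      proof (rule ccontr)
        assume "s \<notin> m"
        then have "\<one> \<in> ?V" by (rule unit_ideal[OF V.is_ideal nb s])
        then have "?V = carrier (degree_zero A)" using V.one_imp_carrier by simp
        then show False using V.I_notcarr by simp
      qed
    qed
    then have "m = ?V"
      using V.I_maximal[OF m_ideal] m_homog one_m one_homog by auto
    then have "h ` m = h ` ?V" by (rule arg_cong)
    also have "\<dots> = J"
      by (rule h.image_vimage) (use ideal.Icarr[OF maximalideal.axioms(1)[OF J]] in blast)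
    finally show ?thesis unfolding \<nn>_def by (rule sym)
  qed
  have "maximalideal \<nn> (H0 B)" unfolding \<nn>_def by (rule h.maximal_image[OF max]) (use kernel_m h_kernel in simp)
  then show ?thesis unfolding local_ring_def using uniq B.H0.S.is_cring by blast
qed

text \<open>The chain condition obtained from the cones is turned back into finite generation, now
  over \<open>H^0(B)\<close>.\<close>

lemma noetherian_local: "noetherian_local_dg_ring B \<nn>"
proof -
  interpret C: cohomology_action B "self_module B" by (rule models_action[OF models_self cs subset_refl])
  have "coboundaries A 0 \<subseteq> depth.J cs" by (rule depth.J_N) (use m_homog_list[OF cs] in simp)
  then have "noetherian_ring (H0 B)"
    by (intro h.noetherian_image acc) (auto simp: h_kernel)
  moreover have "finitely_generated_module (H0 B) (cohomology (self_module B) i)" for i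
    by (rule C.finitely_generated_of_noetherian_cohomology[OF models_noetherian[OF models_self cs]])
  ultimately show ?thesis
    using local_H0 B.dg_ring_axioms by (simp add: noetherian_local_dg_ring_def noetherian_dg_ring_def)
qed

lemma bounded: "bounded_cohomology B"
proof -
  interpret C: cohomology_action B "self_module B" by (rule models_action[OF models_self cs subset_refl])
  show ?thesis
    unfolding bounded_cohomology_def bounded_below_def C.cohomology_vanishes_iff models_acyclic[OF models_self cs]
    using has_inf[OF cs] unfolding has_inf_def by blast
qed

lemma regular_sequence_iff:
  "regular_sequence B \<nn> (self_module B) xs \<longleftrightarrow> set xs \<subseteq> \<nn> \<and> v (cs @ map sect xs) = v cs"
proof -
  have "inj Base" by (rule injI) simp
  then have "models (transport Base (self_module B)) cs" by (rule models_transport[OF models_self])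
  then have "regular_sequence_iter B \<nn> (transport Base (self_module B)) xs \<longleftrightarrow>
      set xs \<subseteq> \<nn> \<and> v (cs @ map sect xs) = v cs"
    using regular_sequence_iter_iff[OF _ cs subset_refl] regular_sequence_iter_mem by metis
  then show ?thesis
    using noetherian_local bounded B.dg_module_self by (simp add: regular_sequence_def bounded_cohomology_def)
qed

text \<open>A regular generating sequence of \<open>\<nn>\<close> lifts to a continuation
  \<open>ts\<close> of \<open>cs\<close>. In the converse direction the preimages chosen by
  \<open>sect\<close> may differ from the given \<open>ts\<close>, but they generate the same ideal
  together with \<open>cs\<close> and have the same number, so \<open>v_ideal\<close> gives the same
  \<open>v\<close>.\<close>

theorem sequence_regular_iff:
  "sequence_regular B \<pp> \<longleftrightarrow>
    \<pp> = \<nn> \<and> (\<exists>ts. set ts \<subseteq> m \<and> depth.J (cs @ ts) = m \<and> v (cs @ ts) = v cs)"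
proof -
  have sect_list: "set (map sect xs) \<subseteq> m" "map h (map sect xs) = xs" if "set xs \<subseteq> \<nn>" for xs
    using that sect_m sect(3) max_carrier by (auto intro!: map_idI)
  have "(\<exists>xs. regular_sequence B \<nn> (self_module B) xs \<and> Idl\<^bsub>H0 B\<^esub> (set xs) = \<nn>) \<longleftrightarrow>
      (\<exists>ts. set ts \<subseteq> m \<and> depth.J (cs @ ts) = m \<and> v (cs @ ts) = v cs)"
  proof
    assume "\<exists>xs. regular_sequence B \<nn> (self_module B) xs \<and> Idl\<^bsub>H0 B\<^esub> (set xs) = \<nn>"
    then obtain xs where xs: "set xs \<subseteq> \<nn>" "v (cs @ map sect xs) = v cs" "Idl\<^bsub>H0 B\<^esub> (set xs) = \<nn>"
      unfolding regular_sequence_iff by blast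
    have "depth.J (cs @ map sect xs) = m"
      using Idl_eq_iff[OF sect_list(1)[OF xs(1)]] xs(3) unfolding sect_list(2)[OF xs(1)] by simp
    then show "\<exists>ts. set ts \<subseteq> m \<and> depth.J (cs @ ts) = m \<and> v (cs @ ts) = v cs"
      using xs(2) sect_list(1)[OF xs(1)] by blast
  next
    assume "\<exists>ts. set ts \<subseteq> m \<and> depth.J (cs @ ts) = m \<and> v (cs @ ts) = v cs"
    then obtain ts where ts: "set ts \<subseteq> m" "depth.J (cs @ ts) = m" "v (cs @ ts) = v cs" by blast
    let ?xs = "map h ts"
    have xs: "set ?xs \<subseteq> \<nn>" using ts(1) unfolding \<nn>_def by auto
    have gen: "Idl\<^bsub>H0 B\<^esub> (set ?xs) = \<nn>" using Idl_eq_iff[OF ts(1)] ts(2) by blast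
    then have J: "depth.J (cs @ map sect ?xs) = m"
      using Idl_eq_iff[OF sect_list(1)[OF xs]] unfolding sect_list(2)[OF xs] by blast
    have "v (cs @ map sect ?xs) = v cs"
      using depth.v_ideal[of "cs @ map sect ?xs" "cs @ ts"] sect_list(1)[OF xs] cs ts J by simp
    then show "\<exists>xs. regular_sequence B \<nn> (self_module B) xs \<and> Idl\<^bsub>H0 B\<^esub> (set xs) = \<nn>"
      unfolding regular_sequence_iff using xs gen by blast
  qed
  then have eq: "sequence_regular B \<nn> \<longleftrightarrow> (\<exists>ts. set ts \<subseteq> m \<and> depth.J (cs @ ts) = m \<and> v (cs @ ts) = v cs)"
    using noetherian_local bounded by (simp add: sequence_regular_def)
  have "sequence_regular B \<pp> \<Longrightarrow> \<pp> = \<nn>"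
    using local_H0 unfolding sequence_regular_def noetherian_local_dg_ring_def local_ring_def by simp
  then show ?thesis using eq by metis
qed

end

context koszul_model
begin

lemma Idl_eq_Idl_iff:
  assumes "set ts \<subseteq> m" "set us \<subseteq> m"
  shows "Idl\<^bsub>H0 B\<^esub> (set (map h ts)) = Idl\<^bsub>H0 B\<^esub> (set (map h us)) \<longleftrightarrow> depth.J (cs @ ts) = depth.J (cs @ us)"
proof -
  have c: "set (cs @ ts) \<subseteq> carrier (degree_zero A)" "set (cs @ us) \<subseteq> carrier (degree_zero A)"
    using assms cs m_homog by auto
  show ?thesis
    unfolding Idl_image[OF assms(1)] Idl_image[OF assms(2)]
    by (rule h.image_eq_iff[OF depth.J_ideal[OF c(1)] _ depth.J_ideal[OF c(2)]])
      (use h_kernel depth.J_mono[OF c(1), of cs] depth.J_mono[OF c(2), of cs] in auto)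
qed

lemma sect_list:
  assumes "set xs \<subseteq> \<nn>"
  shows "set (map sect xs) \<subseteq> m" "map h (map sect xs) = xs"
  using assms sect_m sect(3) max_carrier by (auto intro!: map_idI)

lemma regular_system_of_parameters_iff:
  assumes ys: "set ys \<subseteq> m"
  shows "regular_system_of_parameters B \<nn> (map h ys) \<longleftrightarrow> sequence_regular B \<nn> \<and> depth.J (cs @ ys) = m \<and>
    (\<forall>i<length ys. depth.J (cs @ take i ys @ drop (Suc i) ys) \<noteq> m)"
proof -
  have "Idl\<^bsub>H0 B\<^esub> (set (take i (map h ys) @ drop (Suc i) (map h ys))) = \<nn> \<longleftrightarrow>
      depth.J (cs @ take i ys @ drop (Suc i) ys) = m" for i
  proof -
    have "set (take i ys @ drop (Suc i) ys) \<subseteq> m"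
      using ys set_take_subset[of i ys] set_drop_subset[of "Suc i" ys] by auto
    from Idl_eq_iff[OF this] show ?thesis by (simp add: take_map drop_map)
  qed
  moreover have "set (map h ys) \<subseteq> \<nn>" using ys unfolding \<nn>_def by auto
  ultimately show ?thesis
    using Idl_eq_iff[OF ys] by (simp add: regular_system_of_parameters_def)
qed

end

section \<open>From the assumptions on \<open>A\<close> to the local setting\<close>

context dg_ring
begin

lemma complex_degree_zero: "scalar_complex (degree_zero A) A (\<lambda>s x. s \<otimes> x)"
  by (rule scalar_complexI[OF cring_degree_zero]) auto

lemma complex_iso_koszul_Nil:
  "complex_iso (degree_zero A) A (\<lambda>s x. s \<otimes> x) (koszul_ring A []) (koszul_act []) (koszul_const A 0)"
proof -
  have Nil: "set [] \<subseteq> homog A 0" by simp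
  interpret A: scalar_complex "degree_zero A" A "\<lambda>s x. s \<otimes> x" by (rule complex_degree_zero)
  interpret K: scalar_complex "degree_zero A" "koszul_ring A []" "koszul_act []" by (rule koszul_complex[OF Nil])
  have kc: "koszul_const A 0 x = (\<lambda>I\<in>{{}}. x)" for x
    by (simp add: koszul_const_def fun_eq_iff restrict_def)
  have mem: "(\<lambda>I\<in>{{}}. x) \<in> {{}} \<rightarrow>\<^sub>E carrier A" if "x \<in> carrier A" for x
    using that by simp
  show ?thesis
  proof (intro complex_iso.intro complex_iso_axioms.intro A.scalar_complex_axioms K.scalar_complex_axioms)
    show "bij_betw (koszul_const A 0) (homog A n) (homog (koszul_ring A []) n)" for n
    proof (rule bij_betw_byWitness[of _ "\<lambda>F. F {}"])
      show "\<forall>F\<in>homog (koszul_ring A []) n. koszul_const A 0 (F {}) = F"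
        by (auto simp: kc koszul_Nil_simps fun_eq_iff PiE_def extensional_def)
      show "koszul_const A 0 ` homog A n \<subseteq> homog (koszul_ring A []) n"
        using koszul_const_homog[of _ n "[]"] by auto
    qed (auto simp: koszul_Nil_simps)
    fix n x assume x: "x \<in> homog A n"
    show "koszul_const A 0 (x \<oplus> y) = koszul_const A 0 x \<oplus>\<^bsub>koszul_ring A []\<^esub> koszul_const A 0 y" for y
      unfolding kc koszul_Nil_simps by (rule restrict_cong) auto
    show "koszul_const A 0 (diff A x) = diff (koszul_ring A []) (koszul_const A 0 x)"
      unfolding kc koszul_Nil_simps(7)[OF mem[OF homog_carrier[OF x]]] by (rule restrict_cong) auto
    fix s assume "s \<in> carrier (degree_zero A)"
    then have s: "s \<in> carrier A" using homog_carrier by simp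
    show "koszul_const A 0 (s \<otimes> x) = koszul_act [] s (koszul_const A 0 x)"
      unfolding koszul_act_def list.size(3) kc koszul_Nil_simps(6)[OF mem[OF s] mem[OF homog_carrier[OF x]]]
      by (rule restrict_cong) auto
  qed
qed

lemma action_self_module: "cohomology_action A (self_module A)"
proof (intro cohomology_action.intro cohomology_action_axioms.intro dg_ring_axioms)
  show sc: "scalar_complex (degree_zero A) (self_module A) (act (self_module A))"
    using scalar_complex_self_module[OF complex_degree_zero] by simp
  interpret C: scalar_complex "degree_zero A" "self_module A" "act (self_module A)" by (rule sc)
  show "C.annihilates b" if "b \<in> coboundaries A 0" for b
    unfolding C.annihilates_def using coboundaries_annihilate[OF that] by (simp add: cocycles_def coboundaries_def)
qed

text \<open>The definition of a noetherian DG-ring speaks of negative degrees. The remaining ones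
  are supplied here and in the next lemma: positive cohomology vanishes, and \<open>H^0\<close> is
  generated by the class of 1.\<close>

lemma finitely_generated_cohomology_positive:
  assumes n: "n > 0" shows "finitely_generated_module (H0 A) (cohomology (self_module A) n)"
proof -
  interpret C: cohomology_action A "self_module A" by (rule action_self_module)
  interpret H: module "H0 A" "cohomology (self_module A) n" by (rule C.cohomology_module)
  have "x = \<zero>\<^bsub>cohomology (self_module A) n\<^esub>" if x: "x \<in> carrier (cohomology (self_module A) n)" for x
  proof -
    obtain z where z: "z \<in> cocycles (self_module A) n" "x = C.cl n z" using x unfolding C.cohomology_simps(1) by blast
    have "z = \<zero>" using z(1) nonpositive[OF n] by (simp add: cocycles_def)
    then have "C.cl n z = coboundaries (self_module A) n" using C.cl_zero[of n] by simp
    then show ?thesis unfolding z(2) C.cohomology_simps(2) .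
  qed
  then have "H.finite_span {} = carrier (cohomology (self_module A) n)"
    unfolding H.span_empty using H.M.zero_closed by blast
  then show ?thesis
    unfolding finitely_generated_module_iff[OF C.cohomology_module] by (intro exI[of _ "{}"]) simp
qed

lemma finitely_generated_cohomology_zero:
  "finitely_generated_module (H0 A) (cohomology (self_module A) 0)"
proof -
  interpret C: cohomology_action A "self_module A" by (rule action_self_module)
  interpret H: module "H0 A" "cohomology (self_module A) 0" by (rule C.cohomology_module)
  define c where "c = C.cl 0 \<one>"
  have c1: "\<one> \<in> cocycles (self_module A) 0"
    using one_homog diff_degree_zero[OF one_homog] by (simp add: cocycles_def)
  have c: "{c} \<subseteq> carrier (cohomology (self_module A) 0)"
    unfolding C.cohomology_simps(1) c_def using c1 by blast
  have "x \<in> H.finite_span {c}" if xc: "x \<in> carrier (cohomology (self_module A) 0)" for x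
  proof -
    obtain z where z: "z \<in> cocycles (self_module A) 0" "x = C.cl 0 z"
      using xc unfolding C.cohomology_simps(1) by blast
    have zh: "z \<in> homog A 0" using z(1) by (simp add: cocycles_def)
    have x: "H0_class A z \<odot>\<^bsub>cohomology (self_module A) 0\<^esub> c = x"
      using C.cohomology_smult[OF zh c1] homog_carrier[OF zh] unfolding c_def z(2) by simp
    have r: "H0_class A z \<in> carrier (H0 A)" using H0.hom_closed[of z] zh by simp
    have "(\<Oplus>\<^bsub>cohomology (self_module A) 0\<^esub> d \<in> {c}. H0_class A z \<odot>\<^bsub>cohomology (self_module A) 0\<^esub> d) \<in> H.finite_span {c}"
      by (rule H.finite_spanI) (use r in simp)
    moreover have "(\<Oplus>\<^bsub>cohomology (self_module A) 0\<^esub> d \<in> {c}. H0_class A z \<odot>\<^bsub>cohomology (self_module A) 0\<^esub> d) = x"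
      using xc by (simp add: x)
    ultimately show ?thesis by simp
  qed
  then have "H.finite_span {c} = carrier (cohomology (self_module A) 0)"
    using H.span_closed[OF c] by blast
  then show ?thesis
    unfolding finitely_generated_module_iff[OF C.cohomology_module] using c by (intro exI[of _ "{c}"]) simp
qed

definition max_lift :: "'a set set \<Rightarrow> 'a set"
  where "max_lift \<mm> = {s \<in> homog A 0. H0_class A s \<in> \<mm>}"

text \<open>The maximal ideal, the inverses of elements outside it and the chain condition are
  pulled back along the surjection from A^0 to \<open>H^0(A)\<close>. The conditions on cohomology
  pass to \<open>koszul_ring A []\<close> through its isomorphism with \<open>A\<close>.\<close>

lemma local_dg_ring_max_lift:
  assumes loc: "noetherian_local_dg_ring A \<mm>" and bdd: "bounded_cohomology A"
  shows "local_dg_ring A (max_lift \<mm>)"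
proof (intro local_dg_ring.intro local_dg_ring_axioms.intro dg_ring_axioms)
  have noeth: "noetherian_ring (H0 A)" and local: "local_ring (H0 A) \<mm>"
    and fg: "\<And>i. i < 0 \<Longrightarrow> finitely_generated_module (H0 A) (cohomology (self_module A) i)"
    using loc by (simp_all add: noetherian_local_dg_ring_def noetherian_dg_ring_def)
  have max: "maximalideal \<mm> (H0 A)" using local by (simp add: local_ring_def)
  have V: "maximalideal (max_lift \<mm>) (degree_zero A)"
    using H0.maximal_vimage[OF max] by (simp add: max_lift_def)
  interpret V: maximalideal "max_lift \<mm>" "degree_zero A" by (rule V)
  show "ideal (max_lift \<mm>) (degree_zero A)" by (rule V.is_ideal)
  show "\<one> \<notin> max_lift \<mm>" using V.I_notcarr V.one_imp_carrier by auto
  show "coboundaries A 0 \<subseteq> max_lift \<mm>"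
  proof
    fix b assume "b \<in> coboundaries A 0"
    then have b: "b \<in> homog A 0" "H0_class A b = \<zero>\<^bsub>H0 A\<^esub>" using H0.mem_kernel[of b] unfolding H0_kernel by simp_all
    have "\<zero>\<^bsub>H0 A\<^esub> \<in> \<mm>" by (rule additive_subgroup.zero_closed[OF ideal.axioms(1)[OF maximalideal.axioms(1)[OF max]]])
    then show "b \<in> max_lift \<mm>" using b by (simp add: max_lift_def)
  qed
  show "\<exists>e\<in>homog A 0. e \<otimes> s \<ominus> \<one> \<in> coboundaries A 0" if s: "s \<in> homog A 0" "s \<notin> max_lift \<mm>" for s
  proof -
    have sc: "s \<in> carrier (degree_zero A)" using s(1) by simp
    have "H0_class A s \<notin> \<mm>" using s by (simp add: max_lift_def)
    then obtain y where y: "y \<in> carrier (H0 A)" "y \<otimes>\<^bsub>H0 A\<^esub> H0_class A s = \<one>\<^bsub>H0 A\<^esub>"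
      using local_ring_unit[OF local noeth H0.hom_closed[OF sc]] by blast
    note e = H0_lift(1,2)[OF y(1)]
    have ec: "lift y \<in> carrier (degree_zero A)" using e(1) by simp
    have es: "lift y \<otimes> s \<in> homog A 0" using e(1) s(1) by (simp add: mult_mem_homog)
    have "H0_class A (lift y \<otimes> s) = H0_class A \<one>"
      using H0.hom_mult[OF ec sc] H0.hom_one y(2) e(2) by simp
    then show ?thesis
      using H0.h_eq_iff[of "lift y \<otimes> s" \<one>] es one_homog e(1) unfolding H0_kernel by auto
  qed
  show "\<exists>k. X (Suc k) = X k" if "\<And>k::nat. ideal (X k) (degree_zero A)" "\<And>k. coboundaries A 0 \<subseteq> X k"
    "\<And>k. X k \<subseteq> X (Suc k)" for X
    by (rule H0.noetherian_acc[OF noeth]) (use that in \<open>simp_all add: H0_kernel\<close>)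
  interpret C: cohomology_action A "self_module A" by (rule action_self_module)
  interpret A: complex_iso "degree_zero A" A "\<lambda>s x. s \<otimes> x" "koszul_ring A []" "koszul_act []" "koszul_const A 0"
    by (rule complex_iso_koszul_Nil)
  interpret K: complex_iso "degree_zero A" "koszul_ring A []" "koszul_act []" A "\<lambda>s x. s \<otimes> x" "\<lambda>F. F {}"
    by (rule A.inverse) simp
  have sc: "scalar_complex (degree_zero A) (self_module A) (\<lambda>s x. s \<otimes> x)"
    by (rule scalar_complex_self_module[OF complex_degree_zero])
  interpret K': complex_iso "degree_zero A" "koszul_ring A []" "koszul_act []" "self_module A" "\<lambda>s x. s \<otimes> x" "\<lambda>F. F {}"
    by (intro complex_iso.intro complex_iso_axioms.intro sc A.N.scalar_complex_axioms)
      (use K.bij K.f_add K.f_diff K.f_act in simp_all)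
  have "finitely_generated_module (H0 A) (cohomology (self_module A) n)" for n
    using fg[of n] finitely_generated_cohomology_positive[of n] finitely_generated_cohomology_zero
    by (cases n "0::int" rule: linorder_cases) auto
  then have "K'.N.noetherian_cohomology n" for n
    using C.noetherian_cohomology_of_finitely_generated[OF noeth] by simp
  then show "scalar_complex.noetherian_cohomology (degree_zero A) (koszul_ring A []) (koszul_act []) n" for n
    by (rule K'.noetherian_cohomology_vimage)
  show "\<exists>b. \<forall>n<b. cocycles (koszul_ring A []) n \<subseteq> coboundaries (koszul_ring A []) n"
    using bdd K'.acyclic_at_iff
    unfolding bounded_cohomology_def bounded_below_def C.cohomology_vanishes_iff A.N.acyclic_at_def K'.N.acyclic_at_def
    by simp
qed

end

context local_dg_ring
begin

text \<open>With the empty sequence, the model turns sequence-regularity of \<open>A\<close> into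
  the existence of generators \<open>xs\<close> of \<open>m\<close> with
  \<open>v xs = v []\<close>.\<close>

lemma koszul_model_self: "koszul_model A m A id [] (koszul_const A 0)"
proof (intro koszul_model.intro koszul_model_axioms.intro local_dg_ring_axioms dg_ring_axioms)
  have "koszul_ideal [] = coboundaries A 0"
    using koszul_ideal_eq[of "[]"] Z.genideal_self[of "coboundaries A 0"] ideal.Icarr[OF coboundaries_ideal]
      Z.genideal_minimal[OF coboundaries_ideal subset_refl] by auto
  then show "id s \<in> coboundaries A 0 \<longleftrightarrow> s \<in> koszul_ideal []" for s by simp
  show "complex_iso (degree_zero A) A (\<lambda>s x. id s \<otimes> x) (koszul_ring A []) (koszul_act []) (koszul_const A 0)"
    using complex_iso_koszul_Nil by simp
qed (auto intro!: ring_hom_memI)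

text \<open>The degree zero part of the Koszul ring is a copy of A^0, and its coboundaries pull back
  to \<open>koszul_ideal as\<close> by definition; the identity serves as isomorphism.\<close>

lemma koszul_model_koszul_ring:
  assumes as: "set as \<subseteq> m"
  shows "koszul_model A m (koszul_ring A as) (koszul_const A (length as)) as id"
proof -
  note ah = m_homog_list[OF as]
  interpret K: scalar_complex "degree_zero A" "koszul_ring A as" "koszul_act as" by (rule koszul_complex[OF ah])
  show ?thesis
  proof (intro koszul_model.intro koszul_model_axioms.intro local_dg_ring_axioms dg_ring_koszul[OF ah] as)
    show "koszul_const A (length as) \<in> ring_hom (degree_zero A) (degree_zero (koszul_ring A as))"
      by (auto intro!: ring_hom_memI simp: koszul_const_homog koszul_const_add koszul_const_times koszul_const_one)
    show "koszul_const A (length as) ` homog A 0 = homog (koszul_ring A as) 0"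
    proof
      show "koszul_const A (length as) ` homog A 0 \<subseteq> homog (koszul_ring A as) 0"
        using koszul_const_homog by blast
      show "homog (koszul_ring A as) 0 \<subseteq> koszul_const A (length as) ` homog A 0"
        using koszul_degree_zero_eq by blast
    qed
    show "koszul_const A (length as) s \<in> coboundaries (koszul_ring A as) 0 \<longleftrightarrow> s \<in> koszul_ideal as"
      if "s \<in> homog A 0" for s using that by (simp add: koszul_ideal_def)
    have "(\<lambda>s x. koszul_const A (length as) s \<otimes>\<^bsub>koszul_ring A as\<^esub> x) = koszul_act as"
      by (simp add: koszul_act_def fun_eq_iff)
    then show "complex_iso (degree_zero A) (koszul_ring A as)
        (\<lambda>s x. koszul_const A (length as) s \<otimes>\<^bsub>koszul_ring A as\<^esub> x) (koszul_ring A as) (koszul_act as) id"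
      by (simp add: complex_iso_def complex_iso_axioms_def K.scalar_complex_axioms)
  qed
qed

end

text \<open>The list \<open>as\<close> consists of lifts of the classes in \<open>abar\<close>. Both
  sides are translated into statements about sequences in \<open>m\<close>, the left one by the
  model \<open>koszul_ring A as\<close> and the right one by the model \<open>A\<close>.\<close>

theorem theorem4p6:
  fixes A :: "'a dg_ring"
    and \<mm> :: "'a set set"
    and abar :: "'a set list"
    and as :: "'a list"
  assumes "sequence_regular A \<mm>"
    and "set abar \<subseteq> \<mm>"
    and "list_all2 (\<lambda>a x. a \<in> x) as abar"
  shows "(\<exists>\<nn>. sequence_regular (koszul_ring A as) \<nn>) \<longleftrightarrow>
    (\<exists>xs S. regular_system_of_parameters A \<mm> xs \<and> S \<subseteq> set xs \<and>
      Idl\<^bsub>H0 A\<^esub> S = Idl\<^bsub>H0 A\<^esub> (set abar))"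
proof -
  have loc: "noetherian_local_dg_ring A \<mm>" "bounded_cohomology A"
    using assms(1) by (simp_all add: sequence_regular_def)
  interpret dg_ring A using loc by (simp add: noetherian_local_dg_ring_def noetherian_dg_ring_def)
  define m where "m = max_lift \<mm>"
  interpret L: local_dg_ring A m unfolding m_def by (rule local_dg_ring_max_lift[OF loc])
  interpret M: koszul_model A m A id "[]" "koszul_const A 0" by (rule L.koszul_model_self)
  \<comment> \<open>Sequence-regularity of \<open>A\<close>, read in the model with
    \<open>cs = []\<close>, identifies the maximal ideal and provides regular generators of
    \<open>m\<close> in A^0.\<close>
  have \<mm>: "\<mm> = M.\<nn>" and "\<exists>xs. set xs \<subseteq> m \<and> L.depth.J xs = m \<and> L.v xs = L.v []"
    using assms(1) unfolding M.sequence_regular_iff by simp_all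
  then obtain xs where xs: "set xs \<subseteq> m" "L.depth.J xs = m" "L.v xs = L.v []" by blast
  have mc: "\<mm> \<subseteq> carrier (H0 A)" unfolding \<mm> by (rule M.max_carrier)
  have len: "length as = length abar" and nth: "\<And>i. i < length as \<Longrightarrow> as ! i \<in> abar ! i"
    using assms(3) by (simp_all add: list_all2_conv_all_nth)
  have nth': "as ! i \<in> homog A 0" "H0_class A (as ! i) = abar ! i" "abar ! i \<in> \<mm>" if i: "i < length as" for i
  proof -
    show "abar ! i \<in> \<mm>" using assms(2) i len by auto
    then have "abar ! i \<in> carrier (H0 A)" using mc by blast
    then show "as ! i \<in> homog A 0" "H0_class A (as ! i) = abar ! i" using H0_class_mem[OF nth[OF i]] by simp_all
  qed
  \<comment> \<open>The classes of the lifts are the given elements, so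
    \<open>Idl_eq_Idl_iff\<close> can compare the ideal of \<open>abar\<close> with
    \<open>J as\<close>.\<close>
  have abar: "map M.h as = abar"
    by (rule nth_equalityI) (use nth' len in \<open>simp_all add: M.h_def\<close>)
  have as: "set as \<subseteq> m"
  proof
    fix a assume "a \<in> set as"
    then obtain i where "i < length as" "a = as ! i" by (auto simp: in_set_conv_nth)
    then show "a \<in> m" using nth' by (simp add: m_def max_lift_def)
  qed
  interpret K: koszul_model A m "koszul_ring A as" "koszul_const A (length as)" as id
    by (rule L.koszul_model_koszul_ring[OF as])
  have lhs: "(\<exists>\<nn>. sequence_regular (koszul_ring A as) \<nn>) \<longleftrightarrow>
      (\<exists>ts. set ts \<subseteq> m \<and> L.depth.J (as @ ts) = m \<and> L.v (as @ ts) = L.v as)"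
    unfolding K.sequence_regular_iff by simp
  have rsp: "regular_system_of_parameters A \<mm> (map M.h ys) \<longleftrightarrow> L.depth.J ys = m \<and> L.depth.irredundant ys"
    if "set ys \<subseteq> m" for ys
    using M.regular_system_of_parameters_iff[OF that] assms(1) unfolding \<mm> L.depth.irredundant_def by simp
  have rhs: "(\<exists>xs S. regular_system_of_parameters A \<mm> xs \<and> S \<subseteq> set xs \<and> Idl\<^bsub>H0 A\<^esub> S = Idl\<^bsub>H0 A\<^esub> (set abar)) \<longleftrightarrow>
      (\<exists>ys zs. set ys \<subseteq> m \<and> L.depth.J ys = m \<and> L.depth.irredundant ys \<and> set zs \<subseteq> set ys \<and> L.depth.J zs = L.depth.J as)"
    (is "?L \<longleftrightarrow> ?R")
  proof
    assume ?R
    then obtain ys zs where ys: "set ys \<subseteq> m" "L.depth.J ys = m" "L.depth.irredundant ys"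
      and zs: "set zs \<subseteq> set ys" "L.depth.J zs = L.depth.J as" by blast
    have "set zs \<subseteq> m" using ys zs by blast
    then have "Idl\<^bsub>H0 A\<^esub> (set (map M.h zs)) = Idl\<^bsub>H0 A\<^esub> (set abar)"
      using M.Idl_eq_Idl_iff[OF _ as, of zs] zs(2) unfolding abar by simp
    moreover have "set (map M.h zs) \<subseteq> set (map M.h ys)" using zs(1) by auto
    ultimately show ?L using rsp[OF ys(1)] ys by blast
  next
    assume ?L
    then obtain us S where us: "regular_system_of_parameters A \<mm> us" and S: "S \<subseteq> set us"
      "Idl\<^bsub>H0 A\<^esub> S = Idl\<^bsub>H0 A\<^esub> (set abar)" by blast
    have usm: "set us \<subseteq> M.\<nn>" using us unfolding regular_system_of_parameters_def \<mm> by simp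
    note ys = M.sect_list[OF usm]
    \<comment> \<open>A subset carries no order, so \<open>S\<close> is listed in the order of
      \<open>us\<close>; its chosen preimages are then among those of \<open>us\<close>.\<close>
    let ?ss = "filter (\<lambda>x. x \<in> S) us"
    have ss: "set ?ss = S" "set ?ss \<subseteq> M.\<nn>" using S(1) usm by auto
    note zs = M.sect_list[OF ss(2)]
    have "set (map M.sect ?ss) \<subseteq> set (map M.sect us)" by auto
    moreover have "L.depth.J (map M.sect ?ss) = L.depth.J as"
      using M.Idl_eq_Idl_iff[OF zs(1) as] S(2) unfolding zs(2) abar ss(1) by simp
    ultimately show ?R using rsp[OF ys(1)] us ys(1) unfolding ys(2) by blast
  qed
  show ?thesis
    unfolding lhs rhs
  proof
    assume "\<exists>ts. set ts \<subseteq> m \<and> L.depth.J (as @ ts) = m \<and> L.v (as @ ts) = L.v as"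
    then show "\<exists>ys zs. set ys \<subseteq> m \<and> L.depth.J ys = m \<and> L.depth.irredundant ys \<and> set zs \<subseteq> set ys \<and> L.depth.J zs = L.depth.J as"
      using L.depth.regular_quotient_imp[OF xs as] by blast
  next
    assume "\<exists>ys zs. set ys \<subseteq> m \<and> L.depth.J ys = m \<and> L.depth.irredundant ys \<and> set zs \<subseteq> set ys \<and> L.depth.J zs = L.depth.J as"
    then show "\<exists>ts. set ts \<subseteq> m \<and> L.depth.J (as @ ts) = m \<and> L.v (as @ ts) = L.v as"
      using L.depth.regular_quotient_if[OF xs as] by blast
  qed
qed

end
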